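(* For any $n$, block size $b$, $k$ and $\epsilon\in(0,1)$, there is a distribution over binary matrices $A$ with $O(\frac{1}{\epsilon^2}k+\frac{k}{\epsilon^5b}\log n)$ rows and a recovery algorithm running in $O(k+\frac{n}{\epsilon^2b}\log n)$ time such that for any $x\in\mathbb{R}^n$ the algorithm recovers from $Ax$ a $(k,b)$-block-sparse $x'$ with \[ \|x'-x\|_2\le(1+\epsilon)\,\mathrm{Err}_2^{k,b}(x) \] with probability at least $1-\frac{1}{k^{\Omega(1)}}$.
   Context: $[n]$ is partitioned into $n/b$ consecutive blocks $T_i=\{(i-1)b+1,\dots,ib\}$ (assume $b$ divides $n$ and $k$). A vector is $(k,b)$-block-sparse if its support is contained in the union of at most $k/b$ blocks. $\mathrm{Err}_2^{k,b}(x)=\min_{\hat x\ (k,b)\text{-block-sparse}}\|x-\hat x\|_2$. Binary means all entries are in $\{0,1\}$. *)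

theory Defs
  imports
    "HOL-Probability.Probability_Mass_Function"
    "Jordan_Normal_Form.Matrix"
begin

unbundle no vec_syntax

section \<open>Block sparsity\<close>

text \<open>Coordinates and blocks are numbered from 0, so block \<open>i\<close> is the paper's \<open>T_{i+1}\<close>.\<close>

definition block :: "nat \<Rightarrow> nat \<Rightarrow> nat set" where
  "block b i = {i * b..<(i + 1) * b}"

definition block_sparse :: "nat \<Rightarrow> nat \<Rightarrow> nat \<Rightarrow> real vec \<Rightarrow> bool" where
  "block_sparse n k b v \<longleftrightarrow> v \<in> carrier_vec n \<and>
     (\<exists>S \<subseteq> {..<n div b}. card S \<le> k div b \<and> {j. j < n \<and> v $ j \<noteq> 0} \<subseteq> (\<Union>i\<in>S. block b i))"

definition l2norm :: "real vec \<Rightarrow> real" where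
  "l2norm v = L2_set (\<lambda>j. v $ j) {..<dim_vec v}"

text \<open>The infimum is a minimum, see \<open>block_err_attained\<close> and \<open>block_err_le\<close>.\<close>

definition block_err :: "nat \<Rightarrow> nat \<Rightarrow> nat \<Rightarrow> real vec \<Rightarrow> real" where
  "block_err n k b x = Inf {l2norm (x - z) | z. block_sparse n k b z}"

definition binary_mat :: "real mat \<Rightarrow> bool" where
  "binary_mat A \<longleftrightarrow> elements_mat A \<subseteq> {0, 1}"

lemma l2norm_nonneg: "0 \<le> l2norm v"
  by (simp add: l2norm_def)

lemma block_sparse_zero: "block_sparse n k b (0\<^sub>v n)"
  unfolding block_sparse_def by (auto intro!: exI[of _ "{}"])

lemma block_err_le:
  assumes "block_sparse n k b z"
  shows "block_err n k b x \<le> l2norm (x - z)"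
  unfolding block_err_def
  by (rule cInf_lower) (use assms l2norm_nonneg in \<open>auto intro!: bdd_belowI[of _ 0]\<close>)

lemma block_err_attained:
  assumes x: "x \<in> carrier_vec n"
  shows "\<exists>z. block_sparse n k b z \<and> block_err n k b x = l2norm (x - z)"
proof -
  define I where "I = {S. S \<subseteq> {..<n div b} \<and> card S \<le> k div b}"
  define r where "r S = vec n (\<lambda>j. if j \<in> (\<Union>i\<in>S. block b i) then x $ j else 0)" for S
  define F where "F = (\<lambda>S. l2norm (x - r S)) ` I"
  have "finite I" unfolding I_def by (rule finite_subset[of _ "Pow {..<n div b}"]) auto
  hence fin: "finite F" by (simp add: F_def)
  have "{} \<in> I" by (simp add: I_def)
  hence ne: "F \<noteq> {}" by (auto simp: F_def)
  have rs: "block_sparse n k b (r S)" if "S \<in> I" for S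
    unfolding block_sparse_def using that
    by (intro conjI exI[of _ S]) (auto simp: I_def r_def split: if_splits)
  have below: "\<exists>S\<in>I. l2norm (x - r S) \<le> l2norm (x - z)" if z: "block_sparse n k b z" for z
  proof -
    from z obtain S where S: "S \<in> I" and zc: "z \<in> carrier_vec n"
      and supp: "{j. j < n \<and> z $ j \<noteq> 0} \<subseteq> (\<Union>i\<in>S. block b i)"
      by (auto simp: block_sparse_def I_def)
    have "l2norm (x - r S) \<le> l2norm (x - z)"
      unfolding l2norm_def L2_set_def
    proof (rule real_sqrt_le_mono)
      have d: "dim_vec (x - r S) = n" "dim_vec (x - z) = n" "dim_vec x = n" "dim_vec z = n"
        using zc x by (auto simp: r_def)
      show "(\<Sum>j<dim_vec (x - r S). ((x - r S) $ j)\<^sup>2) \<le> (\<Sum>j<dim_vec (x - z). ((x - z) $ j)\<^sup>2)"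
        unfolding d
      proof (rule sum_mono)
        fix j assume "j \<in> {..<n}"
        then have j: "j < n" by simp
        show "((x - r S) $ j)\<^sup>2 \<le> ((x - z) $ j)\<^sup>2"
        proof (cases "j \<in> (\<Union>i\<in>S. block b i)")
          case True
          then have "(x - r S) $ j = 0" using j d by (simp add: r_def)
          then show ?thesis by simp
        next
          case False
          then have "z $ j = 0" using supp j by blast
          then show ?thesis using False j d by (simp add: r_def)
        qed
      qed
    qed
    then show ?thesis using S by blast
  qed
  have "Min F \<in> F" using fin ne by simp
  then obtain S where S: "S \<in> I" "Min F = l2norm (x - r S)" by (auto simp: F_def)
  have "block_err n k b x = l2norm (x - r S)"
  proof (rule antisym)
    show "block_err n k b x \<le> l2norm (x - r S)" by (rule block_err_le[OF rs[OF S(1)]])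
    show "l2norm (x - r S) \<le> block_err n k b x"
      unfolding block_err_def
    proof (rule cInf_greatest)
      show "{l2norm (x - z) |z. block_sparse n k b z} \<noteq> {}" using block_sparse_zero by blast
      fix y assume "y \<in> {l2norm (x - z) |z. block_sparse n k b z}"
      then obtain z where y: "y = l2norm (x - z)" and z: "block_sparse n k b z" by blast
      from below[OF z] obtain S' where "S' \<in> I" "l2norm (x - r S') \<le> y" using y by blast
      moreover have "Min F \<le> l2norm (x - r S')"
        using fin \<open>S' \<in> I\<close> by (intro Min_le) (auto simp: F_def)
      ultimately show "l2norm (x - r S) \<le> y" using S by simp
    qed
  qed
  then show ?thesis using rs[OF S(1)] by blast
qed


section \<open>The machine model: a word RAM with real registers\<close>

text \<open>
  A program is a fixed piece of syntax working on named arrays of integers and of reals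
  (cell 0 of an array serves as a scalar variable).  A program mentions only finitely many array
  names, so its arrays can be interleaved in one random access memory.  The read-only input
  consists of the parameters, the binary matrix in sparse column format (for each column the
  increasing list of the rows where it has a 1), and the measurement vector.  The only real
  numbers available initially are the measurements, \<open>\<epsilon>\<close> and integers; there is no
  rounding from reals to integers.  Out-of-range reads return 0.
\<close>

record input =
  in_n :: nat
  in_k :: nat
  in_b :: nat
  in_eps :: real
  in_mat :: "real mat"
  in_meas :: "real vec"

definition col_ones :: "real mat \<Rightarrow> nat \<Rightarrow> nat list" where
  "col_ones A j =
     (if j < dim_col A then sorted_list_of_set {i. i < dim_row A \<and> A $$ (i, j) = 1} else [])"

datatype iexp =
    IConst int
  | ParN | ParK | ParB
  | ParRows              (* number of measurements *)
  | ColDeg iexp          (* number of ones in a column *)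
  | ColOne iexp iexp     (* row of the t-th one (from 0) of column j *)
  | ILoad nat iexp       (* array name, index *)
  | IAdd iexp iexp | ISub iexp iexp | IMul iexp iexp | IDiv iexp iexp | IMod iexp iexp

datatype rexp =
    ROfInt iexp
  | ParEps
  | Meas iexp            (* coordinate of the measurement vector *)
  | RLoad nat iexp
  | RAdd rexp rexp | RSub rexp rexp | RMul rexp rexp | RDiv rexp rexp

datatype bexp =
    ILess iexp iexp | RLess rexp rexp | BNot bexp | BAnd bexp bexp

datatype com =
    Skip
  | IStore nat iexp iexp (* array name, index, value *)
  | RStore nat iexp rexp
  | Output iexp rexp     (* coordinate of the result, value *)
  | Seq com com
  | Cond bexp com com
  | While bexp com

text \<open>The result is in sparse form: coordinates never written by \<open>Output\<close> are 0.\<close>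

record state =
  imem :: "nat \<Rightarrow> int \<Rightarrow> int"
  rmem :: "nat \<Rightarrow> int \<Rightarrow> real"
  outp :: "int \<Rightarrow> real"

definition init_state :: state where
  "init_state = \<lparr>imem = (\<lambda>_ _. 0), rmem = (\<lambda>_ _. 0), outp = (\<lambda>_. 0)\<rparr>"

fun ival :: "input \<Rightarrow> state \<Rightarrow> iexp \<Rightarrow> int" where
  "ival I s (IConst c) = c"
| "ival I s ParN = int (in_n I)"
| "ival I s ParK = int (in_k I)"
| "ival I s ParB = int (in_b I)"
| "ival I s ParRows = int (dim_vec (in_meas I))"
| "ival I s (ColDeg e) =
     (let j = ival I s e in if 0 \<le> j then int (length (col_ones (in_mat I) (nat j))) else 0)"
| "ival I s (ColOne e f) =
     (let j = ival I s e; t = ival I s f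
      in if 0 \<le> j \<and> 0 \<le> t \<and> nat t < length (col_ones (in_mat I) (nat j))
         then int (col_ones (in_mat I) (nat j) ! nat t) else 0)"
| "ival I s (ILoad a e) = imem s a (ival I s e)"
| "ival I s (IAdd e f) = ival I s e + ival I s f"
| "ival I s (ISub e f) = ival I s e - ival I s f"
| "ival I s (IMul e f) = ival I s e * ival I s f"
| "ival I s (IDiv e f) = ival I s e div ival I s f"
| "ival I s (IMod e f) = ival I s e mod ival I s f"

fun rval :: "input \<Rightarrow> state \<Rightarrow> rexp \<Rightarrow> real" where
  "rval I s (ROfInt e) = real_of_int (ival I s e)"
| "rval I s ParEps = in_eps I"
| "rval I s (Meas e) =
     (let i = ival I s e in if 0 \<le> i \<and> nat i < dim_vec (in_meas I) then in_meas I $ nat i else 0)"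
| "rval I s (RLoad a e) = rmem s a (ival I s e)"
| "rval I s (RAdd e f) = rval I s e + rval I s f"
| "rval I s (RSub e f) = rval I s e - rval I s f"
| "rval I s (RMul e f) = rval I s e * rval I s f"
| "rval I s (RDiv e f) = rval I s e / rval I s f"

fun bval :: "input \<Rightarrow> state \<Rightarrow> bexp \<Rightarrow> bool" where
  "bval I s (ILess e f) \<longleftrightarrow> ival I s e < ival I s f"
| "bval I s (RLess e f) \<longleftrightarrow> rval I s e < rval I s f"
| "bval I s (BNot p) \<longleftrightarrow> \<not> bval I s p"
| "bval I s (BAnd p q) \<longleftrightarrow> bval I s p \<and> bval I s q"

text \<open>
  \<open>exec I W P s t s'\<close>: on input \<open>I\<close>, program \<open>P\<close> takes state \<open>s\<close> to
  \<open>s'\<close> in \<open>t\<close> steps.  Each elementary command and each evaluation of a test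
  is one step; for a fixed program this differs from counting the operations inside the
  expressions by a constant factor only.  An integer can be stored, and a cell be written, only
  if value and index are at most \<open>W\<close> in absolute value: integer words have
  \<open>O(log W)\<close> bits.  A program violating this has no execution.
\<close>

inductive exec :: "input \<Rightarrow> real \<Rightarrow> com \<Rightarrow> state \<Rightarrow> nat \<Rightarrow> state \<Rightarrow> bool"
  for I :: input and W :: real where
  Skip: "exec I W Skip s 1 s"
| IStore: "\<lbrakk>j = ival I s e; v = ival I s f; \<bar>real_of_int j\<bar> \<le> W; \<bar>real_of_int v\<bar> \<le> W\<rbrakk>
    \<Longrightarrow> exec I W (IStore a e f) s 1 (s\<lparr>imem := (imem s)(a := (imem s a)(j := v))\<rparr>)"
| RStore: "\<lbrakk>j = ival I s e; v = rval I s f; \<bar>real_of_int j\<bar> \<le> W\<rbrakk>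
    \<Longrightarrow> exec I W (RStore a e f) s 1 (s\<lparr>rmem := (rmem s)(a := (rmem s a)(j := v))\<rparr>)"
| Output: "\<lbrakk>j = ival I s e; v = rval I s f; \<bar>real_of_int j\<bar> \<le> W\<rbrakk>
    \<Longrightarrow> exec I W (Output e f) s 1 (s\<lparr>outp := (outp s)(j := v)\<rparr>)"
| Seq: "\<lbrakk>exec I W P s t s'; exec I W Q s' u s''\<rbrakk> \<Longrightarrow> exec I W (Seq P Q) s (t + u) s''"
| CondTrue: "\<lbrakk>bval I s p; exec I W P s t s'\<rbrakk> \<Longrightarrow> exec I W (Cond p P Q) s (1 + t) s'"
| CondFalse: "\<lbrakk>\<not> bval I s p; exec I W Q s t s'\<rbrakk> \<Longrightarrow> exec I W (Cond p P Q) s (1 + t) s'"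
| WhileFalse: "\<not> bval I s p \<Longrightarrow> exec I W (While p P) s 1 s"
| WhileTrue: "\<lbrakk>bval I s p; exec I W P s t s'; exec I W (While p P) s' u s''\<rbrakk>
    \<Longrightarrow> exec I W (While p P) s (1 + t + u) s''"

inductive_cases exec_elims:
  "exec I W Skip s t s'" "exec I W (IStore a e f) s t s'" "exec I W (RStore a e g) s t s'"
  "exec I W (Output e g) s t s'" "exec I W (Seq P Q) s t s'" "exec I W (Cond p P Q) s t s'"

inductive_cases exec_WhileE: "exec I W (While p P) s t s'"

lemma exec_deterministic:
  "exec I W P s t s' \<Longrightarrow> exec I W P s u s'' \<Longrightarrow> u = t \<and> s'' = s'"
proof (induction arbitrary: u s'' rule: exec.induct)
  case (WhileTrue s p P t s1 t2 s2)
  from WhileTrue.prems obtain t' s1' t2' where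
    eq: "u = Suc (t' + t2')" and 1: "exec I W P s t' s1'" and 2: "exec I W (While p P) s1' t2' s''"
    by (rule exec_WhileE) (simp_all add: WhileTrue.hyps)
  from WhileTrue.IH(1)[OF 1] 2 have "exec I W (While p P) s1 t2' s''" by simp
  from WhileTrue.IH(2)[OF this] WhileTrue.IH(1)[OF 1] eq show ?case by simp
next
  case (WhileFalse s p P)
  from WhileFalse.prems show ?case by (rule exec_WhileE) (simp_all add: WhileFalse.hyps)
next
  case (Seq P s t s1 Q t2 s2)
  from Seq.prems obtain t' s1' t2' where
    eq: "u = t' + t2'" and 1: "exec I W P s t' s1'" and 2: "exec I W Q s1' t2' s''"
    by (rule exec_elims) simp_all
  from Seq.IH(1)[OF 1] 2 have "exec I W Q s1 t2' s''" by simp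
  from Seq.IH(2)[OF this] Seq.IH(1)[OF 1] eq show ?case by simp
next
  case (CondTrue s p P t s1 Q)
  from CondTrue.prems obtain t' where eq: "u = Suc t'" and 1: "exec I W P s t' s''"
    by (rule exec_elims) (simp_all add: CondTrue.hyps)
  from CondTrue.IH[OF 1] eq show ?case by simp
next
  case (CondFalse s p Q t s1 P)
  from CondFalse.prems obtain t' where eq: "u = Suc t'" and 1: "exec I W Q s t' s''"
    by (rule exec_elims) (simp_all add: CondFalse.hyps)
  from CondFalse.IH[OF 1] eq show ?case by simp
qed (erule exec_elims; simp)+

text \<open>\<open>recovers P W n k b \<epsilon> A y t x'\<close>: given \<open>A\<close> and the
  measurements \<open>y\<close>, program \<open>P\<close> halts after exactly \<open>t\<close> steps with
  result \<open>x'\<close>.\<close>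

definition recovers ::
  "com \<Rightarrow> real \<Rightarrow> nat \<Rightarrow> nat \<Rightarrow> nat \<Rightarrow> real \<Rightarrow> real mat \<Rightarrow> real vec \<Rightarrow> nat \<Rightarrow> real vec \<Rightarrow> bool" where
  "recovers P W n k b \<epsilon> A y t x' \<longleftrightarrow>
     (\<exists>s. exec \<lparr>in_n = n, in_k = k, in_b = b, in_eps = \<epsilon>, in_mat = A, in_meas = y\<rparr> W P
            init_state t s \<and>
          x' = vec n (\<lambda>j. outp s (int j)))"

end

theory Submission imports Defs "HOL-Probability.Product_PMF" begin

text \<open>
  The measurements combine two sketches. In \<open>L = O(log n)\<close> repetitions the \<open>N = n/b\<close> blocks are hashed
  to \<open>O(K/\<epsilon>)\<close> buckets, \<open>K = k/b\<close>, and every bucket stores \<open>s = O(1/\<epsilon>\<^sup>2)\<close> random sign sums; the median over the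
  repetitions of the energy of the bucket of a block estimates the energy of the block with relative error
  \<open>\<epsilon>/16\<close> and additive error \<open>(\<epsilon>/16) Err\<^sup>2/K\<close>, so the \<open>K\<close> blocks with the largest estimates leave a tail
  of energy at most \<open>(1 + \<epsilon>/2) Err\<^sup>2\<close>. Five further rows hash the coordinates to \<open>O(k/\<epsilon>\<^sup>2)\<close> signed buckets.
  The coordinates of the selected blocks are read off these rows by peeling: a coordinate alone in at least
  three of its five buckets is set to the median of three of its residuals and subtracted. Every set of
  coordinates that blocks peeling is so rich in collisions that one exists only with probability
  \<open>k\<^bsup>-\<Omega>(1)\<^esup>\<close>; errors propagate only within connected components of the collision graph and grow
  exponentially in their size, and exponential moments of the component sizes are bounded.
  A random sign is encoded in a binary matrix by splitting every row into a positive and a negative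
  one, so that the measurements occur in pairs to be subtracted.
  When \<open>k \<ge> n\<close> the identity matrix is used.
\<close>

section \<open>Finite expectations and product distributions\<close>

text \<open>Markov's inequality on the noise met by the queried coordinates would give only constant
  failure probability. With \<kappa> the eighth root of \<open>k\<close>, a tail coordinate is heavy
  if its square exceeds \<open>\<epsilon>\<^sup>2 / \<kappa>\<^sup>2\<close> times the tail energy.
  Heavy ones are so few that a queried coordinate is unlikely to meet them in two of its rows, and a
  median of three tolerates one spoiled row; light ones have small fourth powers, so Chebyshev
  applies. The component sizes need second moments for the same reason. The selected set is a
  function of the energy sketches, hence independent of the query rows, and may be treated as fixed
  there. The program cannot round reals and is told neither \<open>L\<close> nor \<open>s\<close>.
  Every column has \<open>L * s + 5\<close> ones, and zero rows pad the matrix until the number of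
  rows is \<open>s\<close> modulo that degree, so integer arithmetic recovers both. The time bound
  puts no logarithm on \<open>k\<close>, so peeling keeps just a count and an index sum per
  bucket.\<close>

abbreviation expect :: "'a pmf \<Rightarrow> ('a \<Rightarrow> real) \<Rightarrow> real" where
  "expect p f \<equiv> measure_pmf.expectation p f"

text \<open>Every distribution used below has finite support, which disposes of integrability once
  and for all.\<close>

lemma finite_integrable:
  fixes f :: "'a \<Rightarrow> real"
  assumes "finite (set_pmf p)" shows "integrable (measure_pmf p) f"
  using assms by (rule integrable_measure_pmf_finite)

lemma expect_add:
  fixes f g :: "'a \<Rightarrow> real"
  assumes "finite (set_pmf p)"
  shows "expect p (\<lambda>x. f x + g x) = expect p f + expect p g"
  by (intro Bochner_Integration.integral_add finite_integrable assms)

lemma expect_diff: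
  fixes f g :: "'a \<Rightarrow> real"
  assumes "finite (set_pmf p)"
  shows "expect p (\<lambda>x. f x - g x) = expect p f - expect p g"
  by (intro Bochner_Integration.integral_diff finite_integrable assms)

lemma expect_sum:
  fixes f :: "'i \<Rightarrow> 'a \<Rightarrow> real"
  assumes "finite (set_pmf p)"
  shows "expect p (\<lambda>x. \<Sum>i\<in>I. f i x) = (\<Sum>i\<in>I. expect p (f i))"
  by (intro Bochner_Integration.integral_sum finite_integrable assms)

lemma expect_mono:
  fixes f g :: "'a \<Rightarrow> real"
  assumes "finite (set_pmf p)" "\<And>x. x \<in> set_pmf p \<Longrightarrow> f x \<le> g x"
  shows "expect p f \<le> expect p g"
  by (rule integral_mono_AE) (auto intro!: finite_integrable assms simp: AE_measure_pmf_iff)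

lemma expect_cong:
  fixes f g :: "'a \<Rightarrow> real"
  assumes "\<And>x. x \<in> set_pmf p \<Longrightarrow> f x = g x"
  shows "expect p f = expect p g"
  by (rule integral_cong_AE) (auto intro!: assms simp: AE_measure_pmf_iff)

lemma prob_eq_expect: "measure_pmf.prob p {x. P x} = expect p (\<lambda>x. of_bool (P x))"
proof -
  have "expect p (\<lambda>x. of_bool (P x)) = expect p (indicat_real {x. P x})"
    by (rule expect_cong) (simp add: indicator_def)
  then show ?thesis by simp
qed

lemma prob_le_expect:
  assumes "finite (set_pmf p)" "\<And>x. x \<in> set_pmf p \<Longrightarrow> 0 \<le> f x" "\<And>x. x \<in> set_pmf p \<Longrightarrow> P x \<Longrightarrow> 1 \<le> f x"
  shows "measure_pmf.prob p {x. P x} \<le> expect p f"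
  unfolding prob_eq_expect by (rule expect_mono) (use assms in auto)

text \<open>Events may be intersected with the support, so the premise is asked only there. This is
  how facts such as the range of hash values become available inside probability estimates.\<close>

lemma prob_union_bound:
  assumes "finite I" "\<And>x. x \<in> set_pmf p \<Longrightarrow> P x \<Longrightarrow> \<exists>i\<in>I. Q i x"
  shows "measure_pmf.prob p {x. P x} \<le> (\<Sum>i\<in>I. measure_pmf.prob p {x. Q i x})"
proof -
  have "measure_pmf.prob p {x. P x} = measure_pmf.prob p ({x. P x} \<inter> set_pmf p)"
    by (simp add: measure_Int_set_pmf)
  also have "\<dots> \<le> measure_pmf.prob p (\<Union>i\<in>I. {x. Q i x})"
    using assms(2) by (intro measure_pmf.finite_measure_mono) auto
  also have "\<dots> \<le> (\<Sum>i\<in>I. measure_pmf.prob p {x. Q i x})"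
    using assms(1) by (intro measure_pmf.finite_measure_subadditive_finite) auto
  finally show ?thesis .
qed

lemma prob_mono:
  assumes "\<And>x. x \<in> set_pmf p \<Longrightarrow> P x \<Longrightarrow> Q x"
  shows "measure_pmf.prob p {x. P x} \<le> measure_pmf.prob p {x. Q x}"
  using prob_union_bound[of "{()}" p P "\<lambda>_. Q"] assms by auto

lemma prob_disj:
  assumes "\<And>x. x \<in> set_pmf p \<Longrightarrow> P x \<Longrightarrow> Q x \<or> R x"
  shows "measure_pmf.prob p {x. P x} \<le> measure_pmf.prob p {x. Q x} + measure_pmf.prob p {x. R x}"
proof -
  have "measure_pmf.prob p {x. P x} \<le> (\<Sum>i\<in>UNIV. measure_pmf.prob p {x. (if i then Q x else R x)})"
    by (rule prob_union_bound) (use assms in auto)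
  then show ?thesis by (simp add: UNIV_bool add.commute)
qed

lemma prob_markov:
  assumes "finite (set_pmf p)" "\<And>x. x \<in> set_pmf p \<Longrightarrow> 0 \<le> f x" "0 < t"
  shows "measure_pmf.prob p {x. t \<le> f x} \<le> expect p f / t"
proof -
  have "measure_pmf.prob p {x. t \<le> f x} \<le> expect p (\<lambda>x. f x / t)"
    by (rule prob_le_expect) (use assms in auto)
  then show ?thesis by simp
qed

text \<open>The variance enters as second moment minus squared mean because the inductions below
  bound exactly that difference.\<close>

lemma prob_chebyshev:
  assumes "finite (set_pmf p)" "0 < t"
    and v: "expect p (\<lambda>x. (f x)\<^sup>2) - (expect p f)\<^sup>2 \<le> v"
  shows "measure_pmf.prob p {x. t \<le> \<bar>f x - expect p f\<bar>} \<le> v / t\<^sup>2"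
proof -
  define m where "m = expect p f"
  have "expect p (\<lambda>x. (f x - m)\<^sup>2) = expect p (\<lambda>x. (f x)\<^sup>2 + (m\<^sup>2 - 2 * m * f x))"
    by (rule expect_cong) (simp add: power2_eq_square algebra_simps)
  also have "\<dots> = expect p (\<lambda>x. (f x)\<^sup>2) - m\<^sup>2"
    by (simp add: expect_add expect_diff assms(1) m_def power2_eq_square)
  finally have e: "expect p (\<lambda>x. (f x - m)\<^sup>2) \<le> v" using v by (simp add: m_def)
  have "measure_pmf.prob p {x. t \<le> \<bar>f x - m\<bar>} \<le> measure_pmf.prob p {x. t\<^sup>2 \<le> (f x - m)\<^sup>2}"
    by (rule prob_mono) (use assms(2) in \<open>metis abs_le_square_iff abs_of_pos\<close>)
  also have "\<dots> \<le> expect p (\<lambda>x. (f x - m)\<^sup>2) / t\<^sup>2"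
    by (rule prob_markov) (use assms in auto)
  also have "\<dots> \<le> v / t\<^sup>2" using e by (simp add: divide_right_mono)
  finally show ?thesis by (simp add: m_def)
qed

section \<open>Expectations under pairs and product distributions\<close>

lemma expect_pair:
  fixes f :: "'a \<times> 'b \<Rightarrow> real"
  assumes "finite (set_pmf p)" "finite (set_pmf q)"
  shows "expect (pair_pmf p q) f = expect p (\<lambda>x. expect q (\<lambda>y. f (x, y)))"
proof -
  have "expect (pair_pmf p q) f =
      (\<Sum>x\<in>set_pmf p. pmf p x *\<^sub>R expect (q \<bind> (\<lambda>y. return_pmf (x, y))) f)"
    unfolding pair_pmf_def by (rule pmf_expectation_bind) (use assms in auto)
  also have "\<dots> = (\<Sum>x\<in>set_pmf p. pmf p x *\<^sub>R expect q (\<lambda>y. f (x, y)))"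
    by (simp add: map_pmf_def[symmetric])
  also have "\<dots> = expect p (\<lambda>x. expect q (\<lambda>y. f (x, y)))"
    by (subst integral_measure_pmf[of "set_pmf p"]) (use assms in \<open>auto simp: mult.commute\<close>)
  finally show ?thesis .
qed

lemma finite_set_Pi_pmf:
  assumes "finite A" "\<And>x. x \<in> A \<Longrightarrow> finite (set_pmf (p x))"
  shows "finite (set_pmf (Pi_pmf A d p))"
  using assms by (simp add: set_Pi_pmf finite_PiE_dflt)

text \<open>The fresh coordinate is averaged innermost while the others stay fixed, the shape needed
  for inductions that add one coordinate at a time.\<close>

lemma expect_Pi_insert:
  fixes f :: "_ \<Rightarrow> real"
  assumes "finite A" "x \<notin> A" "\<And>y. y \<in> insert x A \<Longrightarrow> finite (set_pmf (p y))"
  shows "expect (Pi_pmf (insert x A) d p) f =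
    expect (Pi_pmf A d p) (\<lambda>g. expect (p x) (\<lambda>v. f (g(x := v))))"
proof -
  have "Pi_pmf (insert x A) d p = map_pmf (\<lambda>(f, y). f(x := y)) (pair_pmf (Pi_pmf A d p) (p x))"
    using assms by (subst Pi_pmf_insert) (auto simp: pair_commute_pmf[of "p x"] pmf.map_comp o_def case_prod_unfold intro!: map_pmf_cong)
  then show ?thesis
    by (simp add: expect_pair finite_set_Pi_pmf assms case_prod_unfold)
qed

lemma expect_Pi_union:
  fixes f :: "_ \<Rightarrow> real"
  assumes "finite A" "finite B" "A \<inter> B = {}" "\<And>y. y \<in> A \<union> B \<Longrightarrow> finite (set_pmf (p y))"
  shows "expect (Pi_pmf (A \<union> B) d p) f =
    expect (Pi_pmf A d p) (\<lambda>g. expect (Pi_pmf B d p) (\<lambda>h. f (\<lambda>x. if x \<in> A then g x else h x)))"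
proof -
  have "Pi_pmf (A \<union> B) d p = map_pmf (\<lambda>z x. if x \<in> A then fst z x else snd z x)
      (pair_pmf (Pi_pmf A d p) (Pi_pmf B d p))"
    using assms(1-3) by (subst Pi_pmf_union) (auto simp: case_prod_unfold)
  then show ?thesis using assms by (simp add: expect_pair finite_set_Pi_pmf cong: if_cong)
qed

lemma expect_Pi_component:
  fixes f :: "_ \<Rightarrow> real"
  assumes "finite A" "x \<in> A"
  shows "expect (Pi_pmf A d p) (\<lambda>g. f (g x)) = expect (p x) f"
proof -
  have "p x = map_pmf (\<lambda>g. g x) (Pi_pmf A d p)" using assms by (simp add: Pi_pmf_component)
  then show ?thesis by simp
qed

text \<open>Coordinates on which \<open>f\<close> does not depend integrate out. Later this
  restricts an event about few elements to the hashes of these elements alone.\<close>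

lemma expect_Pi_subset:
  fixes f :: "_ \<Rightarrow> real"
  assumes "finite A" "B \<subseteq> A" and dep: "\<And>g h. (\<And>x. x \<in> B \<Longrightarrow> g x = h x) \<Longrightarrow> f g = f h"
  shows "expect (Pi_pmf A d p) f = expect (Pi_pmf B d p) f"
proof -
  have "Pi_pmf B d p = map_pmf (\<lambda>f x. if x \<in> B then f x else d) (Pi_pmf A d p)"
    using assms by (intro Pi_pmf_subset) auto
  then show ?thesis by (auto intro!: expect_cong dep)
qed

text \<open>
  Adding one coordinate \<open>j\<close> changes \<open>X\<close> by \<open>2 x\<^sub>j Lin + x\<^sub>j\<^sup>2 A\<close>, where \<open>Lin\<close> is linear in the
  fresh vector; the moment conditions say that \<open>Lin\<close> is centred and uncorrelated with \<open>A\<close>, which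
  makes the variance additive.
\<close>

locale quadratic_sketch =
  fixes V :: "'v pmf" and c :: "'v \<Rightarrow> 'b \<Rightarrow> real" and \<Gamma> :: "'b set" and \<omega> :: "'b \<Rightarrow> real"
    and \<rho> q :: real and d :: 'v and x :: "'j \<Rightarrow> real"
  assumes fin: "finite \<Gamma>" and finV: "finite (set_pmf V)"
    and m1: "\<beta> \<in> \<Gamma> \<Longrightarrow> expect V (\<lambda>v. c v \<beta>) = 0"
    and m2: "\<beta> \<in> \<Gamma> \<Longrightarrow> \<gamma> \<in> \<Gamma> \<Longrightarrow> expect V (\<lambda>v. c v \<beta> * c v \<gamma>) = (if \<beta> = \<gamma> then \<rho> else 0)"
    and m3: "\<beta> \<in> \<Gamma> \<Longrightarrow> expect V (\<lambda>v. c v \<beta> * (\<Sum>\<gamma>\<in>\<Gamma>. \<omega> \<gamma> * (c v \<gamma>)\<^sup>2)) = 0"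
    and m4: "expect V (\<lambda>v. (\<Sum>\<gamma>\<in>\<Gamma>. \<omega> \<gamma> * (c v \<gamma>)\<^sup>2)\<^sup>2) - (\<rho> * sum \<omega> \<Gamma>)\<^sup>2 \<le> q"
begin

definition N :: "'j set \<Rightarrow> ('j \<Rightarrow> 'v) \<Rightarrow> 'b \<Rightarrow> real" where
  "N J f \<beta> = (\<Sum>j\<in>J. x j * c (f j) \<beta>)"

definition X :: "'j set \<Rightarrow> ('j \<Rightarrow> 'v) \<Rightarrow> real" where
  "X J f = (\<Sum>\<beta>\<in>\<Gamma>. \<omega> \<beta> * (N J f \<beta>)\<^sup>2)"

definition A :: "'v \<Rightarrow> real" where "A v = (\<Sum>\<gamma>\<in>\<Gamma>. \<omega> \<gamma> * (c v \<gamma>)\<^sup>2)"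

lemmas lin = expect_add expect_sum expect_diff

lemma N_insert: "finite J \<Longrightarrow> j \<notin> J \<Longrightarrow> N (insert j J) (f(j := v)) \<beta> = N J f \<beta> + x j * c v \<beta>"
proof -
  assume a: "finite J" "j \<notin> J"
  then have "(\<Sum>i\<in>J. x i * c ((f(j := v)) i) \<beta>) = (\<Sum>i\<in>J. x i * c (f i) \<beta>)"
    by (intro sum.cong) auto
  then show ?thesis using a by (simp add: N_def)
qed

lemma X_insert:
  assumes "finite J" "j \<notin> J"
  shows "X (insert j J) (f(j := v)) =
    X J f + (2 * x j * (\<Sum>\<beta>\<in>\<Gamma>. \<omega> \<beta> * N J f \<beta> * c v \<beta>) + (x j)\<^sup>2 * A v)"
  unfolding X_def A_def N_insert[OF assms]
  by (simp add: power2_eq_square algebra_simps sum.distrib sum_distrib_left)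

lemma expect_A: "expect V A = \<rho> * sum \<omega> \<Gamma>"
proof -
  have "expect V A = (\<Sum>\<gamma>\<in>\<Gamma>. \<omega> \<gamma> * expect V (\<lambda>v. c v \<gamma> * c v \<gamma>))"
    unfolding A_def by (simp add: lin finV power2_eq_square)
  also have "\<dots> = (\<Sum>\<gamma>\<in>\<Gamma>. \<omega> \<gamma> * \<rho>)" by (rule sum.cong) (simp_all add: m2)
  finally show ?thesis by (simp add: sum_distrib_left mult.commute)
qed

lemma expect_lin: "expect V (\<lambda>v. \<Sum>\<beta>\<in>\<Gamma>. a \<beta> * c v \<beta>) = 0"
  by (simp add: lin finV m1)

lemma expect_lin_A: "expect V (\<lambda>v. (\<Sum>\<beta>\<in>\<Gamma>. a \<beta> * c v \<beta>) * A v) = 0"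
proof -
  have "expect V (\<lambda>v. (\<Sum>\<beta>\<in>\<Gamma>. a \<beta> * c v \<beta>) * A v) = expect V (\<lambda>v. \<Sum>\<beta>\<in>\<Gamma>. a \<beta> * (c v \<beta> * A v))"
    by (rule expect_cong) (simp add: sum_distrib_right mult.assoc)
  also have "\<dots> = 0" unfolding A_def by (simp add: expect_sum[OF finV] m3)
  finally show ?thesis .
qed

lemma expect_lin_sq: "expect V (\<lambda>v. (\<Sum>\<beta>\<in>\<Gamma>. a \<beta> * c v \<beta>)\<^sup>2) = \<rho> * (\<Sum>\<beta>\<in>\<Gamma>. (a \<beta>)\<^sup>2)"
proof -
  have "expect V (\<lambda>v. (\<Sum>\<beta>\<in>\<Gamma>. a \<beta> * c v \<beta>)\<^sup>2) =
      expect V (\<lambda>v. \<Sum>\<beta>\<in>\<Gamma>. \<Sum>\<gamma>\<in>\<Gamma>. (a \<beta> * a \<gamma>) * (c v \<beta> * c v \<gamma>))"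
    by (rule expect_cong) (simp add: power2_eq_square sum_product mult_ac)
  also have "\<dots> = (\<Sum>\<beta>\<in>\<Gamma>. \<Sum>\<gamma>\<in>\<Gamma>. (a \<beta> * a \<gamma>) * (if \<beta> = \<gamma> then \<rho> else 0))"
    by (simp add: expect_sum[OF finV] m2)
  also have "\<dots> = (\<Sum>\<beta>\<in>\<Gamma>. \<rho> * (a \<beta>)\<^sup>2)"
    using fin by (intro sum.cong) (simp_all add: power2_eq_square if_distrib cong: if_cong)
  finally show ?thesis by (simp add: sum_distrib_left)
qed

abbreviation PJ :: "'j set \<Rightarrow> ('j \<Rightarrow> 'v) pmf" where "PJ J \<equiv> Pi_pmf J d (\<lambda>_. V)"

lemma finPJ: "finite J \<Longrightarrow> finite (set_pmf (PJ J))"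
  by (rule finite_set_Pi_pmf) (auto simp: finV)

lemma expect_N_sq:
  assumes "finite J" "\<beta> \<in> \<Gamma>" shows "expect (PJ J) (\<lambda>f. (N J f \<beta>)\<^sup>2) = \<rho> * (\<Sum>j\<in>J. (x j)\<^sup>2)"
  using assms(1)
proof (induction rule: finite_induct)
  case empty show ?case by (simp add: N_def)
next
  case (insert j J)
  have "expect (PJ (insert j J)) (\<lambda>f. (N (insert j J) f \<beta>)\<^sup>2)
     = expect (PJ J) (\<lambda>f. expect V (\<lambda>v. (N (insert j J) (f(j := v)) \<beta>)\<^sup>2))"
    using insert by (subst expect_Pi_insert) (auto simp: finV)
  also have "\<dots> = expect (PJ J) (\<lambda>f. expect V (\<lambda>v. (N J f \<beta>)\<^sup>2 + (2 * x j * N J f \<beta> * c v \<beta> + (x j)\<^sup>2 * (c v \<beta> * c v \<beta>))))"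
    using insert by (simp add: N_insert power2_eq_square algebra_simps)
  also have "\<dots> = expect (PJ J) (\<lambda>f. (N J f \<beta>)\<^sup>2 + (x j)\<^sup>2 * \<rho>)"
    using assms(2) by (simp add: lin finV m1 m2)
  also have "\<dots> = \<rho> * (\<Sum>j\<in>insert j J. (x j)\<^sup>2)"
    using insert by (simp add: lin finPJ algebra_simps)
  finally show ?case .
qed

lemma expect_X:
  assumes "finite J" shows "expect (PJ J) (X J) = \<rho> * sum \<omega> \<Gamma> * (\<Sum>j\<in>J. (x j)\<^sup>2)"
proof -
  have "expect (PJ J) (X J) = (\<Sum>\<beta>\<in>\<Gamma>. \<omega> \<beta> * (\<rho> * (\<Sum>j\<in>J. (x j)\<^sup>2)))"
    unfolding X_def using assms by (simp add: expect_sum finPJ expect_N_sq)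
  also have "\<dots> = sum \<omega> \<Gamma> * (\<rho> * (\<Sum>j\<in>J. (x j)\<^sup>2))" by (rule sum_distrib_right[symmetric])
  finally show ?thesis by (simp add: mult_ac)
qed

text \<open>Induction on \<open>J\<close>. With energy \<open>s2\<close> collected so far, a new
  coordinate of value \<open>a\<close> raises the variance by
  \<open>4 * \<rho>\<^sup>2 * W * a\<^sup>2 * s2\<close> plus at most \<open>q * a ^ 4\<close>. The
  first amount is covered by the growth of \<open>2 * \<rho>\<^sup>2 * W * s2\<^sup>2\<close>, since
  \<open>(a\<^sup>2 + s2)\<^sup>2\<close> exceeds \<open>s2\<^sup>2\<close> by
  \<open>2 * a\<^sup>2 * s2 + a ^ 4\<close>.\<close>

lemma expect_X_sq:
  assumes "finite J"
  shows "expect (PJ J) (\<lambda>f. (X J f)\<^sup>2) - (expect (PJ J) (X J))\<^sup>2 \<le>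
    q * (\<Sum>j\<in>J. (x j) ^ 4) + 2 * \<rho>\<^sup>2 * (\<Sum>\<beta>\<in>\<Gamma>. (\<omega> \<beta>)\<^sup>2) * (\<Sum>j\<in>J. (x j)\<^sup>2)\<^sup>2"
  using assms
proof (induction rule: finite_induct)
  case empty show ?case by (simp add: X_def N_def)
next
  case (insert j J)
  define \<mu> where "\<mu> = \<rho> * sum \<omega> \<Gamma>"
  define s2 where "s2 = (\<Sum>j\<in>J. (x j)\<^sup>2)"
  define W where "W = (\<Sum>\<beta>\<in>\<Gamma>. (\<omega> \<beta>)\<^sup>2)"
  define a where "a = x j"
  have EX: "expect (PJ J) (X J) = \<mu> * s2" "expect (PJ (insert j J)) (X (insert j J)) = \<mu> * (a\<^sup>2 + s2)"
    using insert by (simp_all add: expect_X \<mu>_def s2_def a_def)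
  have "expect (PJ (insert j J)) (\<lambda>f. (X (insert j J) f)\<^sup>2)
     = expect (PJ J) (\<lambda>f. expect V (\<lambda>v. (X (insert j J) (f(j := v)))\<^sup>2))"
    using insert by (subst expect_Pi_insert) (auto simp: finV)
  also have "\<dots> = expect (PJ J) (\<lambda>f. (X J f)\<^sup>2 + (4 * a\<^sup>2 * \<rho> * (\<Sum>\<beta>\<in>\<Gamma>. (\<omega> \<beta>)\<^sup>2 * (N J f \<beta>)\<^sup>2)
       + (a^4 * expect V (\<lambda>v. (A v)\<^sup>2) + 2 * a\<^sup>2 * \<mu> * X J f)))"
  proof (rule expect_cong)
    fix f
    let ?L = "\<lambda>v. \<Sum>\<beta>\<in>\<Gamma>. \<omega> \<beta> * N J f \<beta> * c v \<beta>"
    \<comment> \<open>The last two summands are odd in the linear part \<open>?L\<close> and average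
      to zero by \<open>expect_lin\<close> and \<open>expect_lin_A\<close>.\<close>
    have "expect V (\<lambda>v. (X (insert j J) (f(j := v)))\<^sup>2) = expect V (\<lambda>v. (X J f)\<^sup>2 + (4 * a\<^sup>2 * (?L v)\<^sup>2
        + (a^4 * (A v)\<^sup>2 + (2 * a\<^sup>2 * X J f * A v + (4 * a * X J f * ?L v + 4 * a^3 * (?L v * A v))))))"
      by (rule expect_cong)
        (simp only: X_insert[OF insert.hyps] a_def[symmetric], simp only: power2_eq_square power3_eq_cube power4_eq_xxxx algebra_simps)
    also have "\<dots> = (X J f)\<^sup>2 + (4 * a\<^sup>2 * \<rho> * (\<Sum>\<beta>\<in>\<Gamma>. (\<omega> \<beta>)\<^sup>2 * (N J f \<beta>)\<^sup>2)
       + (a^4 * expect V (\<lambda>v. (A v)\<^sup>2) + 2 * a\<^sup>2 * \<mu> * X J f))"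
      by (simp add: expect_add[OF finV] expect_lin expect_lin_A expect_lin_sq expect_A \<mu>_def[symmetric] power_mult_distrib)
    finally show "expect V (\<lambda>v. (X (insert j J) (f(j := v)))\<^sup>2) = \<dots>" .
  qed
  also have "\<dots> = expect (PJ J) (\<lambda>f. (X J f)\<^sup>2) + (4 * a\<^sup>2 * \<rho> * (\<rho> * s2 * W)
       + (a^4 * expect V (\<lambda>v. (A v)\<^sup>2) + 2 * a\<^sup>2 * \<mu> * (\<mu> * s2)))"
    using insert.hyps EX(1)
    by (simp add: lin finPJ expect_N_sq W_def s2_def sum_distrib_left[symmetric] sum_distrib_right[symmetric] mult_ac)
  finally have e: "expect (PJ (insert j J)) (\<lambda>f. (X (insert j J) f)\<^sup>2) - (\<mu> * (a\<^sup>2 + s2))\<^sup>2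
     = (expect (PJ J) (\<lambda>f. (X J f)\<^sup>2) - (\<mu> * s2)\<^sup>2) + 4 * \<rho>\<^sup>2 * a\<^sup>2 * s2 * W + a^4 * (expect V (\<lambda>v. (A v)\<^sup>2) - \<mu>\<^sup>2)"
    by (simp add: power2_eq_square power4_eq_xxxx algebra_simps)
  have "a^4 * (expect V (\<lambda>v. (A v)\<^sup>2) - \<mu>\<^sup>2) \<le> a^4 * q"
    using m4 by (intro mult_left_mono) (auto simp: A_def \<mu>_def)
  moreover have "expect (PJ J) (\<lambda>f. (X J f)\<^sup>2) - (\<mu> * s2)\<^sup>2 \<le> q * (\<Sum>j\<in>J. (x j) ^ 4) + 2 * \<rho>\<^sup>2 * W * s2\<^sup>2"
    using insert.IH by (simp add: EX W_def s2_def)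
  \<comment> \<open>This is the \<open>a ^ 4\<close> term of the squared energy; it is pure slack in
    the claimed bound.\<close>
  moreover have "0 \<le> \<rho>\<^sup>2 * W * (a\<^sup>2)\<^sup>2" by (intro mult_nonneg_nonneg) (auto simp: W_def intro: sum_nonneg)
  ultimately have "expect (PJ (insert j J)) (\<lambda>f. (X (insert j J) f)\<^sup>2) - (\<mu> * (a\<^sup>2 + s2))\<^sup>2
     \<le> q * (a^4 + (\<Sum>j\<in>J. (x j) ^ 4)) + 2 * \<rho>\<^sup>2 * W * (a\<^sup>2 + s2)\<^sup>2"
    unfolding e by (simp add: power2_eq_square algebra_simps)
  then show ?case using insert.hyps by (simp add: EX W_def s2_def a_def)
qed

end

section \<open>Stopping sets and components of bucket hypergraphs\<close>

definition collide :: "(nat \<Rightarrow> nat \<Rightarrow> nat) \<Rightarrow> nat \<Rightarrow> nat \<Rightarrow> bool" where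
  "collide bk e f \<longleftrightarrow> (\<exists>r<5. bk r e = bk r f)"

text \<open>Connectedness of the collision graph on \<open>U\<close>, phrased by cuts. This form
  lets a set grow one neighbour at a time without any mention of paths.\<close>

definition linked :: "(nat \<Rightarrow> nat \<Rightarrow> nat) \<Rightarrow> nat set \<Rightarrow> bool" where
  "linked bk U \<longleftrightarrow> U \<noteq> {} \<and> (\<forall>A. A \<subset> U \<longrightarrow> A \<noteq> {} \<longrightarrow> (\<exists>a\<in>A. \<exists>b\<in>U - A. collide bk a b))"

definition isolated :: "(nat \<Rightarrow> nat \<Rightarrow> nat) \<Rightarrow> nat set \<Rightarrow> nat \<Rightarrow> nat set" where
  "isolated bk U e = {r. r < 5 \<and> (\<forall>f\<in>U. bk r f = bk r e \<longrightarrow> f = e)}"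

text \<open>The threshold is three because a peeled value is a median of three residuals, each from
  a row in which the element is alone.\<close>

definition stopping :: "(nat \<Rightarrow> nat \<Rightarrow> nat) \<Rightarrow> nat set \<Rightarrow> bool" where
  "stopping bk U \<longleftrightarrow> U \<noteq> {} \<and> (\<forall>e\<in>U. card (isolated bk U e) < 3)"

text \<open>Each collision is charged to the later element. If hashes are revealed in increasing
  order of the elements, such a pair asks a fresh bucket to hit one of at most \<open>card U\<close>
  occupied ones, which makes these pairs easy to bound in probability.\<close>

definition nonfirst :: "(nat \<Rightarrow> nat \<Rightarrow> nat) \<Rightarrow> nat set \<Rightarrow> (nat \<times> nat) set" where
  "nonfirst bk U = {(e, r). e \<in> U \<and> r < 5 \<and> (\<exists>e'\<in>U. e' < e \<and> bk r e' = bk r e)}"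

text \<open>The elements that come first in their bucket correspond one to one to the occupied
  buckets.\<close>

lemma card_later:
  fixes U :: "nat set"
  assumes "finite U"
  shows "card {e\<in>U. \<exists>e'\<in>U. e' < e \<and> h e' = h e} + card (h ` U) = card U"
proof -
  let ?L = "{e\<in>U. \<exists>e'\<in>U. e' < e \<and> h e' = h e}" and ?F = "{e\<in>U. \<forall>e'\<in>U. e' < e \<longrightarrow> h e' \<noteq> h e}"
  have "bij_betw h ?F (h ` U)"
    unfolding bij_betw_def
  proof
    show "inj_on h ?F"
    proof (rule inj_onI)
      fix a b assume ab: "a \<in> ?F" "b \<in> ?F" "h a = h b"
      show "a = b" by (rule linorder_cases[of a b]) (use ab in auto)
    qed
    show "h ` ?F = h ` U"
    proof
      show "h ` U \<subseteq> h ` ?F"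
      proof
        fix y assume "y \<in> h ` U"
        then obtain e where e: "e \<in> U" "h e = y" by auto
        let ?P = "\<lambda>e. e \<in> U \<and> h e = y"
        have "?P (LEAST e. ?P e)" by (rule LeastI) (use e in auto)
        moreover have "\<forall>e'\<in>U. e' < (LEAST e. ?P e) \<longrightarrow> h e' \<noteq> y"
          using not_less_Least by blast
        ultimately show "y \<in> h ` ?F"
          by (intro image_eqI[of _ _ "LEAST e. ?P e"]) auto
      qed
    qed auto
  qed
  then have "card (h ` U) = card ?F" by (simp add: bij_betw_same_card)
  moreover have "card U = card ?L + card ?F"
    using assms by (subst card_Un_disjoint[symmetric]) (auto intro: arg_cong[where f=card])
  ultimately show ?thesis by simp
qed

lemma card_nonfirst_eq:
  assumes "finite U"
  shows "card (nonfirst bk U) + (\<Sum>r<5. card (bk r ` U)) = 5 * card U"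
proof -
  have "nonfirst bk U = (\<lambda>(r, e). (e, r)) ` (SIGMA r:{..<5}. {e\<in>U. \<exists>e'\<in>U. e' < e \<and> bk r e' = bk r e})"
    by (auto simp: nonfirst_def image_iff)
  then have "card (nonfirst bk U) = card (SIGMA r:{..<5::nat}. {e\<in>U. \<exists>e'\<in>U. e' < e \<and> bk r e' = bk r e})"
    by (simp add: card_image inj_on_def case_prod_unfold prod_eq_iff)
  also have "\<dots> = (\<Sum>r<5. card {e\<in>U. \<exists>e'\<in>U. e' < e \<and> bk r e' = bk r e})"
    using assms by (subst card_SigmaI) auto
  finally have "card (nonfirst bk U) + (\<Sum>r<5. card (bk r ` U)) =
      (\<Sum>r<5. card {e\<in>U. \<exists>e'\<in>U. e' < e \<and> bk r e' = bk r e} + card (bk r ` U))"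
    by (simp only: sum.distrib)
  also have "\<dots> = 5 * card U" using assms by (simp add: card_later)
  finally show ?thesis .
qed

text \<open>Grow a set from one element along collisions, as in a spanning tree. A new element falls
  into an occupied bucket in some row, so the occupied buckets over the five rows increase by at
  most four while \<open>5 * card\<close> increases by five; by \<open>card_nonfirst_eq\<close>
  every step adds a nonfirst pair.\<close>

lemma linked_nonfirst:
  assumes "finite U" "linked bk U"
  shows "card U \<le> card (nonfirst bk U) + 1"
proof -
  have "\<exists>A\<subseteq>U. card A = Suc i \<and> i \<le> card (nonfirst bk A)" if "Suc i \<le> card U" for i
    using that
  proof (induction i)
    case 0
    from assms obtain a where "a \<in> U" by (auto simp: linked_def)
    then show ?case by (intro exI[of _ "{a}"]) auto
  next
    case (Suc i)
    then obtain A where A: "A \<subseteq> U" "card A = Suc i" "i \<le> card (nonfirst bk A)" by auto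
    have finA: "finite A" using A assms finite_subset by blast
    have "A \<subset> U" "A \<noteq> {}" using A Suc.prems by auto
    then obtain a b r where ab: "a \<in> A" "b \<in> U - A" "r < 5" "bk r a = bk r b"
      using assms(2) unfolding linked_def collide_def by blast
    have "(\<Sum>r<5. card (bk r ` insert b A)) \<le> (\<Sum>q<5. (if q = r then 0 else 1) + card (bk q ` A))"
    proof (rule sum_mono)
      fix q assume "q \<in> {..<5::nat}"
      show "card (bk q ` insert b A) \<le> (if q = r then 0 else 1) + card (bk q ` A)"
      proof (cases "q = r")
        case True
        then have "bk q b \<in> bk q ` A" using ab by (metis imageI)
        then show ?thesis using True by (simp add: insert_absorb)
      next
        case False
        then show ?thesis using card_insert_le_m1[of "Suc (card (bk q ` A))" "bk q ` A" "bk q b"] by simp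
      qed
    qed
    also have "\<dots> = (\<Sum>q<5. if q = r then 0 else 1) + (\<Sum>q<5. card (bk q ` A))" by (simp add: sum.distrib)
    also have "(\<Sum>q<5. if q = r then 0 else 1) = (4::nat)"
    proof -
      have "r = 0 \<or> r = 1 \<or> r = 2 \<or> r = 3 \<or> r = 4" using ab(3) by linarith
      then show ?thesis by (elim disjE) (simp_all add: lessThan_nat_numeral)
    qed
    finally have "(\<Sum>r<5. card (bk r ` insert b A)) \<le> 4 + (\<Sum>q<5. card (bk q ` A))" .
    with card_nonfirst_eq[of A bk] card_nonfirst_eq[of "insert b A" bk] finA ab A
    have "Suc i \<le> card (nonfirst bk (insert b A))" by simp
    then show ?case using A ab finA by (intro exI[of _ "insert b A"]) auto
  qed
  from this[of "card U - 1"] assms obtain A where "A \<subseteq> U" "card A = card U" "card U - 1 \<le> card (nonfirst bk A)"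
    by (auto simp: linked_def card_gt_0_iff)
  then have "A = U" using assms(1) by (simp add: card_subset_eq)
  with \<open>card U - 1 \<le> card (nonfirst bk A)\<close> show ?thesis by simp
qed

text \<open>In a bucket with \<open>c \<ge> 2\<close> elements all but the first are later ones, and
  \<open>c \<le> 2 * (c - 1)\<close>. The proof maps the first element of each crowded bucket
  injectively to a later companion.\<close>

lemma card_crowded:
  fixes U :: "nat set"
  assumes "finite U"
  shows "card {e\<in>U. \<exists>f\<in>U. f \<noteq> e \<and> h f = h e} \<le> 2 * card {e\<in>U. \<exists>e'\<in>U. e' < e \<and> h e' = h e}"
    (is "card ?C \<le> 2 * card ?L")
proof -
  let ?F = "{e\<in>?C. \<forall>e'\<in>U. e' < e \<longrightarrow> h e' \<noteq> h e}"
  have "\<forall>e\<in>?F. \<exists>f. f \<in> ?L \<and> h f = h e"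
  proof
    fix e assume e: "e \<in> ?F"
    then obtain f where f: "f \<in> U" "f \<noteq> e" "h f = h e" by auto
    from e have "\<forall>e'\<in>U. e' < e \<longrightarrow> h e' \<noteq> h e" by simp
    with f have "\<not> f < e" by metis
    then have "e < f" using f(2) by simp
    moreover have "e \<in> U" using e by simp
    ultimately have "e \<in> U \<and> e < f \<and> h e = h f" using f(3) by simp
    with f(1) have "f \<in> ?L" by (intro CollectI conjI bexI[of _ e]) simp_all
    then show "\<exists>f. f \<in> ?L \<and> h f = h e" using f(3) by (intro exI conjI)
  qed
  then obtain p where "\<forall>e\<in>?F. p e \<in> ?L \<and> h (p e) = h e" by (rule bchoice[THEN exE]) blast
  then have p: "\<And>e. e \<in> ?F \<Longrightarrow> p e \<in> ?L \<and> h (p e) = h e" by (rule bspec)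
  have "inj_on p ?F"
  proof (rule inj_onI)
    fix a b assume ab: "a \<in> ?F" "b \<in> ?F" "p a = p b"
    then have "h a = h b" using p[OF ab(1)] p[OF ab(2)] by simp
    moreover have "a \<in> U" "b \<in> U" "\<forall>e'\<in>U. e' < a \<longrightarrow> h e' \<noteq> h a" "\<forall>e'\<in>U. e' < b \<longrightarrow> h e' \<noteq> h b"
      using ab by simp_all
    ultimately show "a = b" by (metis linorder_neqE_nat)
  qed
  moreover have "p ` ?F \<subseteq> ?L" by (rule image_subsetI) (rule conjunct1[OF p])
  moreover have "finite ?L" using assms by simp
  ultimately have "card ?F \<le> card ?L" by (rule card_inj_on_le)
  moreover have "card ?C \<le> card (?F \<union> ?L)" using assms by (intro card_mono) auto
  moreover have "card (?F \<union> ?L) \<le> card ?F + card ?L" by (rule card_Un_le)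
  ultimately show ?thesis by simp
qed

text \<open>Every element of a stopping set is crowded in at least three rows; counting these
  incidences row by row, at least half of them are nonfirst. So a stopping set has more than
  \<open>card U\<close> nonfirst pairs, whereas being linked forces only \<open>card U - 1\<close>;
  this gap is what makes stopping sets rare.\<close>

lemma stopping_nonfirst:
  assumes "finite U" "stopping bk U"
  shows "3 * card U \<le> 2 * card (nonfirst bk U)"
proof -
  let ?C = "\<lambda>r. {e\<in>U. \<exists>f\<in>U. f \<noteq> e \<and> bk r f = bk r e}"
  let ?L = "\<lambda>r. {e\<in>U. \<exists>e'\<in>U. e' < e \<and> bk r e' = bk r e}"
  have "3 * card U = (\<Sum>e\<in>U. 3)" by simp
  also have "\<dots> \<le> (\<Sum>e\<in>U. card {r\<in>{..<5}. e \<in> ?C r})"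
  proof (rule sum_mono)
    fix e assume e: "e \<in> U"
    have "isolated bk U e \<subseteq> {..<5}" by (auto simp: isolated_def)
    moreover have "{r\<in>{..<5}. e \<in> ?C r} = {..<5} - isolated bk U e"
      using e by (auto simp: isolated_def)
    moreover have "card (isolated bk U e) < 3" using assms e by (auto simp: stopping_def)
    ultimately show "3 \<le> card {r\<in>{..<5}. e \<in> ?C r}"
      by (simp only: card_Diff_subset[OF finite_subset[OF _ finite_lessThan]] card_lessThan)
  qed
  also have "\<dots> = (\<Sum>r<5. card {e\<in>U. e \<in> ?C r})"
  proof -
    have "(\<Sum>e\<in>U. card {r\<in>{..<5}. e \<in> ?C r}) = (\<Sum>e\<in>U. \<Sum>r<5. of_bool (e \<in> ?C r))"
      by (intro sum.cong) (simp_all add: sum.If_cases of_bool_def Int_def)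
    also have "\<dots> = (\<Sum>r<5. \<Sum>e\<in>U. of_bool (e \<in> ?C r))" by (rule sum.swap)
    also have "\<dots> = (\<Sum>r<5. card {e\<in>U. e \<in> ?C r})"
      using assms(1) by (intro sum.cong) (simp_all add: sum.If_cases of_bool_def Int_def)
    finally show ?thesis .
  qed
  also have "\<dots> \<le> (\<Sum>r<5. 2 * card (?L r))"
  proof (rule sum_mono)
    fix r assume "r \<in> {..<5::nat}"
    have "{e\<in>U. e \<in> ?C r} = ?C r" by auto
    then show "card {e\<in>U. e \<in> ?C r} \<le> 2 * card (?L r)" using card_crowded[OF assms(1), of "bk r"] by simp
  qed
  also have "\<dots> = 2 * ((\<Sum>r<5. card (?L r) + card (bk r ` U)) - (\<Sum>r<5. card (bk r ` U)))"
    by (simp add: sum_distrib_left sum.distrib)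
  also have "(\<Sum>r<5. card (?L r) + card (bk r ` U)) = 5 * card U"
    using assms(1) by (simp add: card_later)
  also have "5 * card U - (\<Sum>r<5. card (bk r ` U)) = card (nonfirst bk U)"
    using card_nonfirst_eq[OF assms(1), of bk] by simp
  finally show ?thesis .
qed

text \<open>A cut of the union induces a proper cut of \<open>U\<close> or of \<open>V\<close>,
  unless it contains or avoids each of them entirely; the common element excludes containing one and
  avoiding the other.\<close>

lemma linked_Un:
  assumes "linked bk U" "linked bk V" "U \<inter> V \<noteq> {}"
  shows "linked bk (U \<union> V)"
  unfolding linked_def
proof (intro conjI allI impI)
  show "U \<union> V \<noteq> {}" using assms by auto
  fix A assume A: "A \<subset> U \<union> V" "A \<noteq> {}"
  obtain c where c: "c \<in> U" "c \<in> V" using assms by auto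
  show "\<exists>a\<in>A. \<exists>b\<in>U \<union> V - A. collide bk a b"
  proof (cases "(A \<inter> U \<noteq> {} \<and> A \<inter> U \<subset> U) \<or> (A \<inter> V \<noteq> {} \<and> A \<inter> V \<subset> V)")
    case True
    then obtain Z where Z: "Z = U \<or> Z = V" "A \<inter> Z \<noteq> {}" "A \<inter> Z \<subset> Z" by metis
    then have "linked bk Z" using assms by metis
    then have "\<exists>a\<in>A \<inter> Z. \<exists>b\<in>Z - (A \<inter> Z). collide bk a b" using Z unfolding linked_def by blast
    then show ?thesis using Z by blast
  next
    case False
    then have "A \<inter> U = {} \<or> U \<subseteq> A" "A \<inter> V = {} \<or> V \<subseteq> A" by auto
    then have "A = {} \<or> U \<union> V \<subseteq> A" using A c by blast
    then show ?thesis using A by auto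
  qed
qed

definition component :: "(nat \<Rightarrow> nat \<Rightarrow> nat) \<Rightarrow> nat set \<Rightarrow> nat \<Rightarrow> nat set" where
  "component bk S e = {f. (e, f) \<in> {(a, b). a \<in> S \<and> b \<in> S \<and> collide bk a b}\<^sup>*}"

lemma collide_sym: "collide bk a b \<Longrightarrow> collide bk b a"
  unfolding collide_def by metis

lemma component_subset: "e \<in> S \<Longrightarrow> component bk S e \<subseteq> S"
proof
  fix f assume "e \<in> S" "f \<in> component bk S e"
  then have "(e, f) \<in> {(a, b). a \<in> S \<and> b \<in> S \<and> collide bk a b}\<^sup>*" by (simp add: component_def)
  then show "f \<in> S" by (induction rule: rtrancl_induct) (use \<open>e \<in> S\<close> in auto)
qed

lemma component_refl: "e \<in> component bk S e"
  by (simp add: component_def)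

lemma component_step:
  "f \<in> component bk S e \<Longrightarrow> f \<in> S \<Longrightarrow> g \<in> S \<Longrightarrow> collide bk f g \<Longrightarrow> g \<in> component bk S e"
  unfolding component_def mem_Collect_eq by (erule rtrancl_into_rtrancl) simp

lemma component_eq:
  assumes "f \<in> component bk S e" shows "component bk S f = component bk S e"
proof -
  let ?R = "{(a, b). a \<in> S \<and> b \<in> S \<and> collide bk a b}"
  have "sym (?R\<^sup>*)" by (rule sym_rtrancl) (auto simp: sym_def collide_sym)
  moreover have "(e, f) \<in> ?R\<^sup>*" using assms by (simp add: component_def)
  ultimately have "(f, e) \<in> ?R\<^sup>*" by (rule symD)
  with \<open>(e, f) \<in> ?R\<^sup>*\<close> have "(f, g) \<in> ?R\<^sup>* \<longleftrightarrow> (e, g) \<in> ?R\<^sup>*" for g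
    by (meson rtrancl_trans)
  then show ?thesis unfolding component_def by simp
qed

text \<open>A nonempty part of the component that no collision leaves would be closed under steps
  and hence contain the whole component of any of its elements.\<close>

lemma linked_component:
  assumes "e \<in> S" shows "linked bk (component bk S e)"
  unfolding linked_def
proof (intro conjI allI impI)
  show "component bk S e \<noteq> {}" using component_refl by blast
  fix A assume A: "A \<subset> component bk S e" "A \<noteq> {}"
  show "\<exists>a\<in>A. \<exists>b\<in>component bk S e - A. collide bk a b"
  proof (rule ccontr)
    assume no: "\<not> ?thesis"
    from A obtain a where a: "a \<in> A" by auto
    have "component bk S a \<subseteq> A"
    proof
      fix f assume "f \<in> component bk S a"
      then have "(a, f) \<in> {(a, b). a \<in> S \<and> b \<in> S \<and> collide bk a b}\<^sup>*" by (simp add: component_def)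
      then show "f \<in> A"
      proof (induction rule: rtrancl_induct)
        case (step y z)
        then have "y \<in> component bk S e" "z \<in> S" "y \<in> S" "collide bk y z" using A by auto
        then have "z \<in> component bk S e" using component_step by blast
        then show ?case using no step by auto
      qed (fact a)
    qed
    moreover have "component bk S a = component bk S e" using a A component_eq by blast
    ultimately show False using A by auto
  qed
qed

section \<open>Random buckets and the probability of many collisions\<close>

definition row_hash :: "nat \<Rightarrow> (nat \<Rightarrow> nat \<times> bool) pmf" where
  "row_hash B = Pi_pmf {..<5} (0, False) (\<lambda>_. pmf_of_set ({..<B} \<times> UNIV))"

abbreviation buckets :: "(nat \<Rightarrow> nat \<Rightarrow> nat \<times> bool) \<Rightarrow> nat \<Rightarrow> nat \<Rightarrow> nat" where
  "buckets \<omega> r e \<equiv> fst (\<omega> e r)"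

abbreviation hashes :: "nat \<Rightarrow> nat set \<Rightarrow> (nat \<Rightarrow> nat \<Rightarrow> nat \<times> bool) pmf" where
  "hashes B U \<equiv> Pi_pmf U (\<lambda>_. (0, False)) (\<lambda>_. row_hash B)"

lemma finite_row_hash: "B > 0 \<Longrightarrow> finite (set_pmf (row_hash B))"
  unfolding row_hash_def by (rule finite_set_Pi_pmf, simp, subst set_pmf_of_set) auto

lemma finite_hashes: "B > 0 \<Longrightarrow> finite U \<Longrightarrow> finite (set_pmf (hashes B U))"
  by (rule finite_set_Pi_pmf) (auto simp: finite_row_hash)

lemma prob_bucket:
  fixes B :: nat
  assumes "B > 0" "finite T"
  shows "measure_pmf.prob (pmf_of_set ({..<B} \<times> (UNIV :: bool set))) {z. fst z \<in> T} \<le> real (card T) / real B"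
proof -
  have "({..<B} \<times> (UNIV :: bool set)) \<inter> {z. fst z \<in> T} = ({..<B} \<inter> T) \<times> UNIV" by auto
  then have "measure_pmf.prob (pmf_of_set ({..<B} \<times> (UNIV :: bool set))) {z. fst z \<in> T}
     = real (2 * card ({..<B} \<inter> T)) / real (2 * B)"
    using assms by (subst measure_pmf_of_set) (auto simp: card_cartesian_product lessThan_empty_iff)
  also have "\<dots> \<le> real (card T) / real B"
    using assms card_mono[of T "{..<B} \<inter> T"] by (simp add: field_simps)
  finally show ?thesis .
qed

lemma prob_row_hash:
  fixes B M :: nat
  assumes "B > 0" "\<rho> \<subseteq> {..<5}" "\<And>r. r \<in> \<rho> \<Longrightarrow> finite (T r) \<and> card (T r) \<le> M"
  shows "measure_pmf.prob (row_hash B) {v. \<forall>r\<in>\<rho>. fst (v r) \<in> T r} \<le> (real M / real B) ^ card \<rho>"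
proof -
  have "{v :: nat \<Rightarrow> nat \<times> bool. \<forall>r\<in>\<rho>. fst (v r) \<in> T r} = Pi {..<5} (\<lambda>r. if r \<in> \<rho> then {z. fst z \<in> T r} else UNIV)"
    using assms(2) by (auto simp: Pi_def split: if_splits)
  then have "measure_pmf.prob (row_hash B) {v. \<forall>r\<in>\<rho>. fst (v r) \<in> T r}
     = (\<Prod>r<5. measure_pmf.prob (pmf_of_set ({..<B} \<times> (UNIV :: bool set))) (if r \<in> \<rho> then {z. fst z \<in> T r} else UNIV))"
    unfolding row_hash_def by (simp only: measure_Pi_pmf_Pi[OF finite_lessThan])
  also have "\<dots> \<le> (\<Prod>r<5. if r \<in> \<rho> then real M / real B else 1)"
  proof (rule prod_mono)
    fix r assume "r \<in> {..<5::nat}"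
    have "measure_pmf.prob (pmf_of_set ({..<B} \<times> (UNIV::bool set))) {z. fst z \<in> T r} \<le> real M / real B" if "r \<in> \<rho>"
    proof -
      have "card (T r) / real B \<le> real M / real B" using assms(3)[OF that] by (simp add: divide_right_mono)
      with prob_bucket[OF assms(1), of "T r"] assms(3)[OF that] show ?thesis by linarith
    qed
    then show "0 \<le> measure_pmf.prob (pmf_of_set ({..<B} \<times> (UNIV::bool set))) (if r \<in> \<rho> then {z. fst z \<in> T r} else UNIV) \<and>
      measure_pmf.prob (pmf_of_set ({..<B} \<times> (UNIV::bool set))) (if r \<in> \<rho> then {z. fst z \<in> T r} else UNIV) \<le> (if r \<in> \<rho> then real M / real B else 1)"
      by simp
  qed
  also have "\<dots> = (real M / real B) ^ card \<rho>"
    using assms(2) by (simp add: prod.If_cases Int_absorb1)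
  finally show ?thesis .
qed

text \<open>The largest element is hashed last. Whether its pairs are nonfirst depends only on the
  buckets occupied by the smaller ones, at most \<open>M\<close> per row, so each prescribed pair
  costs a factor \<open>M / B\<close>; the pairs of smaller elements are unaffected by it.
  \<open>M\<close> is kept apart from \<open>card U\<close> so that the bound survives the
  induction.\<close>

lemma prob_nonfirst_subset:
  fixes B M :: nat
  assumes "B > 0" "finite U" "card U \<le> M" "D \<subseteq> U \<times> {..<5}"
  shows "measure_pmf.prob (hashes B U) {\<omega>. D \<subseteq> nonfirst (buckets \<omega>) U} \<le> (real M / real B) ^ card D"
  using assms(2-)
proof (induction U arbitrary: D rule: finite_linorder_max_induct)
  case empty
  then show ?case by simp
next
  case (insert m A)
  define DA where "DA = D \<inter> (A \<times> {..<5})"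
  define \<rho> where "\<rho> = {r. (m, r) \<in> D}"
  have mA: "m \<notin> A" using insert.hyps by auto
  have D: "D = DA \<union> Pair m ` \<rho>" using insert.prems by (auto simp: DA_def \<rho>_def)
  have \<rho>: "\<rho> \<subseteq> {..<5}" using insert.prems by (auto simp: \<rho>_def)
  have fin: "finite DA" "finite \<rho>"
    using insert.hyps \<rho> finite_subset by (auto simp: DA_def)
  have cD: "card D = card DA + card \<rho>"
    unfolding D using fin mA by (subst card_Un_disjoint) (auto simp: DA_def card_image inj_on_def)
  have ev: "D \<subseteq> nonfirst (buckets (g(m := v))) (insert m A) \<longleftrightarrow>
      DA \<subseteq> nonfirst (buckets g) A \<and> (\<forall>r\<in>\<rho>. fst (v r) \<in> buckets g r ` A)" for g v
  proof -
    have 1: "(e, r) \<in> nonfirst (buckets (g(m := v))) (insert m A) \<longleftrightarrow> (e, r) \<in> nonfirst (buckets g) A" if "e \<in> A" for e r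
    proof -
      have "e < m" "e \<noteq> m" using insert.hyps that by auto
      then show ?thesis using mA that unfolding nonfirst_def by auto
    qed
    have 2: "(m, r) \<in> nonfirst (buckets (g(m := v))) (insert m A) \<longleftrightarrow> r < 5 \<and> fst (v r) \<in> buckets g r ` A" for r
    proof -
      have "(\<exists>e'\<in>insert m A. e' < m \<and> buckets (g(m := v)) r e' = fst (v r)) \<longleftrightarrow> (\<exists>e'\<in>A. buckets g r e' = fst (v r))"
        using mA insert.hyps by auto
      moreover have "(\<exists>e'\<in>A. buckets g r e' = fst (v r)) \<longleftrightarrow> fst (v r) \<in> buckets g r ` A"
        unfolding image_iff by metis
      ultimately show ?thesis by (simp add: nonfirst_def)
    qed
    have "D \<subseteq> nonfirst (buckets (g(m := v))) (insert m A) \<longleftrightarrow>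
       (\<forall>z\<in>DA. z \<in> nonfirst (buckets (g(m := v))) (insert m A)) \<and> (\<forall>r\<in>\<rho>. (m, r) \<in> nonfirst (buckets (g(m := v))) (insert m A))"
      unfolding D by auto
    also have "(\<forall>z\<in>DA. z \<in> nonfirst (buckets (g(m := v))) (insert m A)) \<longleftrightarrow> DA \<subseteq> nonfirst (buckets g) A"
      using 1 by (auto simp: DA_def)
    also have "(\<forall>r\<in>\<rho>. (m, r) \<in> nonfirst (buckets (g(m := v))) (insert m A)) \<longleftrightarrow> (\<forall>r\<in>\<rho>. fst (v r) \<in> buckets g r ` A)"
      using 2 \<rho> by auto
    finally show ?thesis .
  qed
  have "measure_pmf.prob (hashes B (insert m A)) {\<omega>. D \<subseteq> nonfirst (buckets \<omega>) (insert m A)}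
     = expect (hashes B A) (\<lambda>g. expect (row_hash B) (\<lambda>v. of_bool (DA \<subseteq> nonfirst (buckets g) A \<and> (\<forall>r\<in>\<rho>. fst (v r) \<in> buckets g r ` A))))"
    unfolding prob_eq_expect using mA insert.hyps assms(1)
    by (subst expect_Pi_insert) (simp_all only: finite_row_hash ev not_False_eq_True)
  also have "\<dots> = expect (hashes B A) (\<lambda>g. of_bool (DA \<subseteq> nonfirst (buckets g) A) *
      measure_pmf.prob (row_hash B) {v. \<forall>r\<in>\<rho>. fst (v r) \<in> buckets g r ` A})"
    unfolding prob_eq_expect by (rule expect_cong) auto
  also have "\<dots> \<le> expect (hashes B A) (\<lambda>g. of_bool (DA \<subseteq> nonfirst (buckets g) A) * (real M / real B) ^ card \<rho>)"
  proof (intro expect_mono mult_left_mono finite_hashes)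
    fix g
    have "card (buckets g r ` A) \<le> M" for r
      using card_image_le[OF insert.hyps(1), of "buckets g r"] insert.prems card_insert_le[of A m] by linarith
    then show "measure_pmf.prob (row_hash B) {v. \<forall>r\<in>\<rho>. fst (v r) \<in> buckets g r ` A} \<le> (real M / real B) ^ card \<rho>"
      using insert.hyps \<rho> assms(1) by (intro prob_row_hash) auto
  qed (use assms insert.hyps in auto)
  also have "\<dots> = measure_pmf.prob (hashes B A) {g. DA \<subseteq> nonfirst (buckets g) A} * (real M / real B) ^ card \<rho>"
    unfolding prob_eq_expect by simp
  also have "\<dots> \<le> (real M / real B) ^ card DA * (real M / real B) ^ card \<rho>"
  proof (rule mult_right_mono)
    show "measure_pmf.prob (hashes B A) {g. DA \<subseteq> nonfirst (buckets g) A} \<le> (real M / real B) ^ card DA"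
      using insert.prems mA insert.hyps by (intro insert.IH) (auto simp: DA_def)
  qed simp
  also have "\<dots> = (real M / real B) ^ card D" by (simp add: cD power_add)
  finally show ?case .
qed

text \<open>Union bound over the possible sets of \<rho> nonfirst pairs; there are at most
  \<open>2 ^ (5 * card U)\<close>, which is the factor \<open>32 ^ card U\<close>.\<close>

lemma prob_card_nonfirst:
  fixes B :: nat
  assumes "B > 0" "finite U"
  shows "measure_pmf.prob (hashes B U) {\<omega>. \<rho> \<le> card (nonfirst (buckets \<omega>) U)} \<le> 32 ^ card U * (real (card U) / real B) ^ \<rho>"
proof -
  let ?I = "{D. D \<subseteq> U \<times> {..<5::nat} \<and> card D = \<rho>}"
  have fin: "finite ?I" using assms by (auto intro: finite_subset[of _ "Pow (U \<times> {..<5})"])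
  have "measure_pmf.prob (hashes B U) {\<omega>. \<rho> \<le> card (nonfirst (buckets \<omega>) U)}
     \<le> (\<Sum>D\<in>?I. measure_pmf.prob (hashes B U) {\<omega>. D \<subseteq> nonfirst (buckets \<omega>) U})"
  proof (rule prob_union_bound[OF fin])
    fix \<omega> assume "\<rho> \<le> card (nonfirst (buckets \<omega>) U)"
    then obtain D where "D \<subseteq> nonfirst (buckets \<omega>) U" "card D = \<rho>" by (meson obtain_subset_with_card_n)
    then show "\<exists>D\<in>?I. D \<subseteq> nonfirst (buckets \<omega>) U" by (intro bexI[of _ D]) (auto simp: nonfirst_def)
  qed
  also have "\<dots> \<le> (\<Sum>D\<in>?I. (real (card U) / real B) ^ \<rho>)"
  proof (rule sum_mono)
    fix D assume D: "D \<in> ?I"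
    then show "measure_pmf.prob (hashes B U) {\<omega>. D \<subseteq> nonfirst (buckets \<omega>) U} \<le> (real (card U) / real B) ^ \<rho>"
      using prob_nonfirst_subset[OF assms(1,2) order_refl, of D] by auto
  qed
  also have "\<dots> = card ?I * (real (card U) / real B) ^ \<rho>" by simp
  also have "\<dots> \<le> 32 ^ card U * (real (card U) / real B) ^ \<rho>"
  proof (rule mult_right_mono)
    have "card ?I \<le> card (Pow (U \<times> {..<5::nat}))" using assms by (intro card_mono) auto
    also have "\<dots> = 32 ^ card U" using assms by (simp add: card_Pow card_cartesian_product mult.commute[of _ 5] power_mult)
    finally have "real (card ?I) \<le> real (32 ^ card U)" by (simp only: of_nat_le_iff)
    then show "real (card ?I) \<le> 32 ^ card U" by simp
  qed simp
  finally show ?thesis .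
qed

text \<open>The quotient \<open>v ^ v / fact v\<close> is a single term of the series of
  \<open>exp v\<close>, and \<open>exp 1 \<le> 3\<close>.\<close>

lemma power_le_fact: "real v ^ v \<le> 3 ^ v * fact v"
proof -
  have "(\<Sum>i\<in>{v}. real v ^ i /\<^sub>R fact i) \<le> (\<Sum>i. real v ^ i /\<^sub>R fact i)"
    using exp_converges[of "real v"] by (intro sum_le_suminf) (auto dest: sums_summable)
  then have "real v ^ v / fact v \<le> exp (real v)"
    using exp_converges[of "real v"] by (simp add: sums_iff divide_inverse mult.commute)
  also have "\<dots> = exp 1 ^ v" by (simp add: exp_of_nat_mult[symmetric])
  also have "\<dots> \<le> 3 ^ v" by (intro power_mono exp_le) simp
  finally show ?thesis by (simp add: field_simps)
qed

lemma sum_Pow_card: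
  fixes F :: "nat \<Rightarrow> real"
  assumes "finite S"
  shows "(\<Sum>U\<in>Pow S. F (card U)) = (\<Sum>v\<le>card S. real (card S choose v) * F v)"
proof -
  have "(\<Sum>U\<in>Pow S. F (card U)) = (\<Sum>v\<le>card S. \<Sum>U\<in>{U\<in>Pow S. card U = v}. F (card U))"
    using assms by (intro sum.group[symmetric]) (auto intro: card_mono)
  also have "\<dots> = (\<Sum>v\<le>card S. real (card S choose v) * F v)"
    using assms by (intro sum.cong) (auto simp: n_subsets)
  finally show ?thesis .
qed

lemma binomial_power_le: "real (k choose v) * real v ^ v \<le> (3 * real k) ^ v"
proof -
  have "(k choose v) * fact v \<le> k ^ v" by (rule binomial_fact_pow)
  then have 1: "real (k choose v) * real (fact v) \<le> real k ^ v" by (metis of_nat_le_iff of_nat_mult of_nat_power)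
  have "real (k choose v) * real v ^ v \<le> real (k choose v) * (3 ^ v * fact v)"
    by (intro mult_left_mono power_le_fact) simp
  also have "\<dots> \<le> 3 ^ v * real k ^ v" using 1 by (simp add: mult_ac)
  finally show ?thesis by (simp add: power_mult_distrib)
qed

text \<open>A linked set of size \<open>v\<close> has \<open>v - 1\<close> nonfirst pairs. With the
  \<open>k choose v\<close> sets of that size its contribution is at most
  \<open>96 * y * k * (96 * y * k / B) ^ (v - 1)\<close>, where 96 is 32 from
  \<open>prob_card_nonfirst\<close> times 3 from \<open>binomial_power_le\<close>. The premise makes
  the ratio at most 1/2, and the geometric series costs a factor 2.\<close>

lemma sum_linked_bound:
  fixes y :: real and B :: nat
  assumes "B > 0" "finite S" "y \<ge> 0" "192 * y * real (card S) \<le> real B" 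
  shows "(\<Sum>U\<in>Pow S - {{}}. y ^ card U * measure_pmf.prob (hashes B U) {\<omega>. linked (buckets \<omega>) U}) \<le> 192 * y * real (card S)"
proof -
  let ?k = "card S"
  define F where "F v = (if v = 0 then 0 else y ^ v * (32 ^ v * (real v / real B) ^ (v - 1)))" for v
  have "(\<Sum>U\<in>Pow S - {{}}. y ^ card U * measure_pmf.prob (hashes B U) {\<omega>. linked (buckets \<omega>) U})
      \<le> (\<Sum>U\<in>Pow S - {{}}. F (card U))"
  proof (rule sum_mono)
    fix U assume U: "U \<in> Pow S - {{}}"
    then have finU: "finite U" using assms finite_subset by auto
    have "measure_pmf.prob (hashes B U) {\<omega>. linked (buckets \<omega>) U}
       \<le> measure_pmf.prob (hashes B U) {\<omega>. card U - 1 \<le> card (nonfirst (buckets \<omega>) U)}"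
      by (rule prob_mono) (use linked_nonfirst[OF finU] in force)
    also have "\<dots> \<le> 32 ^ card U * (real (card U) / real B) ^ (card U - 1)"
      by (rule prob_card_nonfirst) (use assms finU in auto)
    finally show "y ^ card U * measure_pmf.prob (hashes B U) {\<omega>. linked (buckets \<omega>) U} \<le> F (card U)"
      using U finU assms by (auto simp: F_def intro!: mult_left_mono)
  qed
  also have "\<dots> \<le> (\<Sum>U\<in>Pow S. F (card U))"
    by (rule sum_mono2) (use assms in \<open>auto simp: F_def\<close>)
  also have "\<dots> = (\<Sum>v\<le>?k. real (?k choose v) * F v)" by (rule sum_Pow_card) fact
  also have "\<dots> \<le> (\<Sum>v\<le>?k. 96 * y * real ?k * (if v = 0 then 0 else (1/2) ^ (v - 1)))"
  proof (rule sum_mono)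
    fix v
    show "real (?k choose v) * F v \<le> 96 * y * real ?k * (if v = 0 then 0 else (1/2) ^ (v - 1))"
    proof (cases v)
      case (Suc w)
      \<comment> \<open>Raising the exponent from \<open>w = v - 1\<close> to \<open>v\<close>
        wastes a factor \<open>v\<close> but makes \<open>binomial_power_le\<close>
        applicable.\<close>
      have "real (?k choose v) * real v ^ w \<le> real (?k choose v) * real v ^ v"
        using Suc by (intro mult_left_mono power_increasing) auto
      also have "\<dots> \<le> (3 * real ?k) ^ v" by (rule binomial_power_le)
      finally have a: "real (?k choose v) * real v ^ w \<le> (3 * real ?k) ^ v" .
      have "real (?k choose v) * F v = (32 * y) ^ v * (real (?k choose v) * real v ^ w) / real B ^ w"
        using Suc by (simp add: F_def power_divide power_mult_distrib)
      also have "\<dots> \<le> (32 * y) ^ v * (3 * real ?k) ^ v / real B ^ w"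
        using a assms by (intro divide_right_mono mult_left_mono) auto
      also have "\<dots> = 96 * y * real ?k * (96 * y * real ?k / real B) ^ w"
      proof -
        have eq: "96 * y * real ?k = (32 * y) * (3 * real ?k)" by simp
        show ?thesis unfolding eq power_divide power_mult_distrib Suc power_Suc by simp
      qed
      also have "\<dots> \<le> 96 * y * real ?k * (1/2) ^ w"
        using assms by (intro mult_left_mono power_mono) (auto simp: field_simps)
      finally show ?thesis using Suc by simp
    qed (simp add: F_def)
  qed
  also have "\<dots> = 96 * y * real ?k * (\<Sum>v<?k. (1/2) ^ v)"
    unfolding sum_distrib_left[symmetric] sum.atMost_shift by simp
  also have "\<dots> \<le> 96 * y * real ?k * 2"
  proof (rule mult_left_mono)
    have "(\<Sum>v<?k. (1/2::real) ^ v) = 2 * (1 - (1/2) ^ ?k)" by (simp add: sum_gp_strict)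
    also have "\<dots> \<le> 2" by simp
    finally show "(\<Sum>v<?k. (1/2::real) ^ v) \<le> 2" .
  qed (use assms in auto)
  finally show ?thesis by simp
qed

text \<open>A stopping set of size \<open>v\<close> has at least \<open>v + 1\<close> nonfirst
  pairs, two more than a linked set needs. The surplus over \<open>v\<close> leaves a factor
  \<open>1 / B\<close> in front of a geometric series.\<close>

lemma prob_stopping:
  fixes B :: nat
  assumes "B > 0" "finite S" "400 * real (card S) \<le> real B"
  shows "measure_pmf.prob (hashes B S) {\<omega>. \<exists>U\<subseteq>S. stopping (buckets \<omega>) U} \<le> 2 / real B"
proof -
  let ?k = "card S"
  have dep: "measure_pmf.prob (hashes B S) {\<omega>. \<rho> \<le> card (nonfirst (buckets \<omega>) U)}
      = measure_pmf.prob (hashes B U) {\<omega>. \<rho> \<le> card (nonfirst (buckets \<omega>) U)}" if "U \<subseteq> S" for U \<rho>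
    unfolding prob_eq_expect
  proof (rule expect_Pi_subset[OF assms(2) that])
    fix g h :: "nat \<Rightarrow> nat \<Rightarrow> nat \<times> bool" assume "\<And>x. x \<in> U \<Longrightarrow> g x = h x"
    then have "nonfirst (buckets g) U = nonfirst (buckets h) U" unfolding nonfirst_def by auto
    then show "of_bool (\<rho> \<le> card (nonfirst (buckets g) U)) = (of_bool (\<rho> \<le> card (nonfirst (buckets h) U)) :: real)"
      by simp
  qed
  define F where "F v = (if v = 0 then 0 else 32 ^ v * (real v / real B) ^ (v + 1))" for v
  have "measure_pmf.prob (hashes B S) {\<omega>. \<exists>U\<subseteq>S. stopping (buckets \<omega>) U}
     \<le> (\<Sum>U\<in>Pow S - {{}}. measure_pmf.prob (hashes B S) {\<omega>. card U + 1 \<le> card (nonfirst (buckets \<omega>) U)})"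
  proof (rule prob_union_bound)
    fix \<omega> assume "\<exists>U\<subseteq>S. stopping (buckets \<omega>) U"
    then obtain U where U: "U \<subseteq> S" "stopping (buckets \<omega>) U" by auto
    have "finite U" using U assms finite_subset by auto
    then have "3 * card U \<le> 2 * card (nonfirst (buckets \<omega>) U)" using U(2) by (rule stopping_nonfirst)
    moreover have "card U > 0" using U \<open>finite U\<close> by (auto simp: stopping_def card_gt_0_iff)
    ultimately show "\<exists>U\<in>Pow S - {{}}. card U + 1 \<le> card (nonfirst (buckets \<omega>) U)"
      using U by (intro bexI[of _ U]) (auto simp: stopping_def)
  qed (use assms in auto)
  also have "\<dots> \<le> (\<Sum>U\<in>Pow S - {{}}. F (card U))"
  proof (rule sum_mono)
    fix U assume U: "U \<in> Pow S - {{}}"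
    then have finU: "finite U" using assms finite_subset by auto
    then show "measure_pmf.prob (hashes B S) {\<omega>. card U + 1 \<le> card (nonfirst (buckets \<omega>) U)} \<le> F (card U)"
      using prob_card_nonfirst[OF assms(1) finU, of "card U + 1"] U dep[of U "card U + 1"] by (auto simp: F_def)
  qed
  also have "\<dots> \<le> (\<Sum>U\<in>Pow S. F (card U))"
    by (rule sum_mono2) (use assms in \<open>auto simp: F_def\<close>)
  also have "\<dots> = (\<Sum>v\<le>?k. real (?k choose v) * F v)" by (rule sum_Pow_card) fact
  also have "\<dots> \<le> (\<Sum>v\<le>?k. 1 / real B * (1/2) ^ v)"
  proof (rule sum_mono)
    fix v
    show "real (?k choose v) * F v \<le> 1 / real B * (1/2) ^ v"
    proof (cases "v = 0")
      case False
      \<comment> \<open>The surplus factor \<open>v\<close> goes into the base of the geometric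
        series, which turns 96 into 192 and is why the premise asks for 400.\<close>
      have v2: "real v \<le> 2 ^ v" by (metis less_exp less_imp_le of_nat_le_iff of_nat_numeral of_nat_power)
      have "real (?k choose v) * F v = 32 ^ v * (real (?k choose v) * real v ^ v) * real v / real B ^ (v + 1)"
        using False by (simp add: F_def power_divide)
      also have "\<dots> \<le> 32 ^ v * (3 * real ?k) ^ v * 2 ^ v / real B ^ (v + 1)"
        using v2 by (intro divide_right_mono mult_mono mult_left_mono binomial_power_le) auto
      also have "\<dots> = 1 / real B * (192 * real ?k / real B) ^ v"
      proof -
        have eq: "192 * real ?k = 32 * (3 * real ?k) * 2" by simp
        show ?thesis unfolding eq power_divide power_mult_distrib by simp
      qed
      also have "\<dots> \<le> 1 / real B * (1/2) ^ v"
        using assms by (intro mult_left_mono power_mono) (auto simp: field_simps)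
      finally show ?thesis .
    qed (simp add: F_def)
  qed
  also have "\<dots> = 1 / real B * (\<Sum>v<Suc ?k. (1/2) ^ v)" by (simp add: sum_distrib_left lessThan_Suc_atMost)
  also have "\<dots> \<le> 1 / real B * 2"
  proof (rule mult_left_mono)
    have "(\<Sum>v<Suc ?k. (1/2::real) ^ v) = 2 * (1 - (1/2) ^ Suc ?k)" by (simp only: sum_gp_strict) simp
    also have "\<dots> \<le> 2" by simp
    finally show "(\<Sum>v<Suc ?k. (1/2::real) ^ v) \<le> 2" .
  qed simp
  finally show ?thesis by simp
qed

section \<open>Moments of the weighted count of linked sets\<close>

lemma expect_Pi_indep:
  fixes f g :: "('a \<Rightarrow> 'b) \<Rightarrow> real"
  assumes "finite S" "U \<subseteq> S" "V \<subseteq> S" "U \<inter> V = {}" "finite (set_pmf p)"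
    and f: "\<And>\<omega> \<omega>'. (\<And>e. e \<in> U \<Longrightarrow> \<omega> e = \<omega>' e) \<Longrightarrow> f \<omega> = f \<omega>'"
    and g: "\<And>\<omega> \<omega>'. (\<And>e. e \<in> V \<Longrightarrow> \<omega> e = \<omega>' e) \<Longrightarrow> g \<omega> = g \<omega>'"
  shows "expect (Pi_pmf S d (\<lambda>_. p)) (\<lambda>\<omega>. f \<omega> * g \<omega>) = expect (Pi_pmf U d (\<lambda>_. p)) f * expect (Pi_pmf V d (\<lambda>_. p)) g"
proof -
  have fin: "finite U" "finite V" using finite_subset[OF assms(2,1)] finite_subset[OF assms(3,1)] .
  have "expect (Pi_pmf S d (\<lambda>_. p)) (\<lambda>\<omega>. f \<omega> * g \<omega>) = expect (Pi_pmf (U \<union> V) d (\<lambda>_. p)) (\<lambda>\<omega>. f \<omega> * g \<omega>)"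
  proof (rule expect_Pi_subset)
    fix \<omega> \<omega>' :: "'a \<Rightarrow> 'b" assume "\<And>x. x \<in> U \<union> V \<Longrightarrow> \<omega> x = \<omega>' x"
    then show "f \<omega> * g \<omega> = f \<omega>' * g \<omega>'" using f[of \<omega> \<omega>'] g[of \<omega> \<omega>'] by simp
  qed (use assms in auto)
  also have "\<dots> = expect (Pi_pmf U d (\<lambda>_. p)) (\<lambda>\<omega>. expect (Pi_pmf V d (\<lambda>_. p)) (\<lambda>\<omega>'. f \<omega> * g \<omega>'))"
  proof (subst expect_Pi_union)
    have "f (\<lambda>x. if x \<in> U then \<omega> x else \<omega>' x) = f \<omega>" "g (\<lambda>x. if x \<in> U then \<omega> x else \<omega>' x) = g \<omega>'" for \<omega> \<omega>'
      using assms(4) by (intro f g; auto)+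
    then show "expect (Pi_pmf U d (\<lambda>_. p)) (\<lambda>\<omega>. expect (Pi_pmf V d (\<lambda>_. p))
        (\<lambda>\<omega>'. f (\<lambda>x. if x \<in> U then \<omega> x else \<omega>' x) * g (\<lambda>x. if x \<in> U then \<omega> x else \<omega>' x))) = 
      expect (Pi_pmf U d (\<lambda>_. p)) (\<lambda>\<omega>. expect (Pi_pmf V d (\<lambda>_. p)) (\<lambda>\<omega>'. f \<omega> * g \<omega>'))" by simp
  qed (use assms fin in auto)
  finally show ?thesis by simp
qed

lemma linked_cong:
  assumes "\<And>e. e \<in> U \<Longrightarrow> \<omega> e = \<omega>' e"
  shows "linked (buckets \<omega>) U = linked (buckets \<omega>') U"
proof -
  have "collide (buckets \<omega>) a b = collide (buckets \<omega>') a b" if "a \<in> U" "b \<in> U" for a b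
    using assms that by (simp add: collide_def)
  then have "(\<exists>a\<in>A. \<exists>b\<in>U - A. collide (buckets \<omega>) a b) = (\<exists>a\<in>A. \<exists>b\<in>U - A. collide (buckets \<omega>') a b)" if "A \<subset> U" for A
    using that by (intro bex_cong refl) auto
  then show ?thesis unfolding linked_def by simp
qed

lemma sum_Pow_power:
  fixes y :: real
  assumes "finite V" shows "(\<Sum>U\<in>Pow V. y ^ card U) = (1 + y) ^ card V"
  using binomial_ring[of y 1 "card V"] sum_Pow_card[OF assms, of "\<lambda>v. y ^ v"] by (simp add: add.commute)

text \<open>Exponential moments of component sizes are awkward to average directly. This sum over
  all linked subsets dominates them, as \<open>component_le_linked_sum\<close> shows, and is linear
  in indicator variables, so that its mean and variance can be computed.\<close>

definition linked_sum :: "real \<Rightarrow> nat set \<Rightarrow> (nat \<Rightarrow> nat \<Rightarrow> nat \<times> bool) \<Rightarrow> real" where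
  "linked_sum y S \<omega> = (\<Sum>U\<in>Pow S - {{}}. y ^ card U * of_bool (linked (buckets \<omega>) U))"

abbreviation linked_prob :: "nat \<Rightarrow> nat set \<Rightarrow> real" where
  "linked_prob B U \<equiv> measure_pmf.prob (hashes B U) {\<omega>. linked (buckets \<omega>) U}"

lemma expect_linked:
  assumes "finite S" "U \<subseteq> S"
  shows "expect (hashes B S) (\<lambda>\<omega>. of_bool (linked (buckets \<omega>) U)) = linked_prob B U"
  unfolding prob_eq_expect
proof (rule expect_Pi_subset[OF assms])
  fix g h :: "nat \<Rightarrow> nat \<Rightarrow> nat \<times> bool" assume "\<And>x. x \<in> U \<Longrightarrow> g x = h x"
  then have "linked (buckets g) U = linked (buckets h) U" by (rule linked_cong)
  then show "of_bool (linked (buckets g) U) = (of_bool (linked (buckets h) U) :: real)" by simp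
qed

lemma expect_linked_sum:
  assumes "B > 0" "finite S"
  shows "expect (hashes B S) (linked_sum y S) = (\<Sum>U\<in>Pow S - {{}}. y ^ card U * linked_prob B U)"
proof -
  have "expect (hashes B S) (linked_sum y S) =
      (\<Sum>U\<in>Pow S - {{}}. expect (hashes B S) (\<lambda>\<omega>. y ^ card U * of_bool (linked (buckets \<omega>) U)))"
    unfolding linked_sum_def by (rule expect_sum[OF finite_hashes[OF assms]])
  also have "\<dots> = (\<Sum>U\<in>Pow S - {{}}. y ^ card U * linked_prob B U)"
    by (rule sum.cong) (simp_all add: expect_linked[OF assms(2)])
  finally show ?thesis .
qed

lemma expect_linked_sum_le:
  assumes "B > 0" "finite S" "y \<ge> 0" "192 * y * real (card S) \<le> real B"
  shows "expect (hashes B S) (linked_sum y S) \<le> 192 * y * real (card S)"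
  using sum_linked_bound[OF assms] expect_linked_sum[OF assms(1,2)] by simp

text \<open>
  Disjoint sets are linked independently; the union of two intersecting linked sets is again
  linked, so the remaining covariance is controlled by \<open>sum_linked_bound\<close> with a larger \<open>y\<close>.
\<close>

lemma variance_linked_sum:
  assumes B: "B > 0" and S: "finite S" and y: "y \<ge> 0" and le: "192 * (1 + y)\<^sup>2 * real (card S) \<le> real B"
  shows "expect (hashes B S) (\<lambda>\<omega>. (linked_sum y S \<omega>)\<^sup>2) - (expect (hashes B S) (linked_sum y S))\<^sup>2
    \<le> 192 * (1 + y)\<^sup>2 * real (card S)"
proof -
  let ?P = "Pow S - {{}}"
  let ?J = "\<lambda>U V. expect (hashes B S) (\<lambda>\<omega>. of_bool (linked (buckets \<omega>) U) * of_bool (linked (buckets \<omega>) V))"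
  define I where "I = {(U, V). U \<in> ?P \<and> V \<in> ?P \<and> U \<inter> V \<noteq> {}}"
  have finI: "finite I" "I \<subseteq> ?P \<times> ?P" unfolding I_def using S by (auto intro: finite_subset[of _ "?P \<times> ?P"])
  have fin: "finite (set_pmf (hashes B S))" using B S by (rule finite_hashes)
  have "expect (hashes B S) (\<lambda>\<omega>. (linked_sum y S \<omega>)\<^sup>2) =
    expect (hashes B S) (\<lambda>\<omega>. \<Sum>U\<in>?P. \<Sum>V\<in>?P. y ^ card U * y ^ card V * (of_bool (linked (buckets \<omega>) U) * of_bool (linked (buckets \<omega>) V)))"
    unfolding linked_sum_def power2_eq_square sum_product by (simp only: mult_ac)
  also have "\<dots> = (\<Sum>U\<in>?P. \<Sum>V\<in>?P. y ^ card U * y ^ card V * ?J U V)"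
    by (simp only: expect_sum[OF fin] integral_mult_right_zero)
  finally have 1: "expect (hashes B S) (\<lambda>\<omega>. (linked_sum y S \<omega>)\<^sup>2) = \<dots>" .
  have 2: "(expect (hashes B S) (linked_sum y S))\<^sup>2 = (\<Sum>U\<in>?P. \<Sum>V\<in>?P. y ^ card U * y ^ card V * (linked_prob B U * linked_prob B V))"
    unfolding expect_linked_sum[OF B S] power2_eq_square sum_product by (simp only: mult_ac)
  have "expect (hashes B S) (\<lambda>\<omega>. (linked_sum y S \<omega>)\<^sup>2) - (expect (hashes B S) (linked_sum y S))\<^sup>2
    = (\<Sum>(U, V)\<in>?P \<times> ?P. y ^ card U * y ^ card V * (?J U V - linked_prob B U * linked_prob B V))"
    unfolding 1 2 sum_subtractf[symmetric] right_diff_distrib[symmetric] by (simp only: sum.cartesian_product)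
  also have "\<dots> = (\<Sum>(U, V)\<in>I. y ^ card U * y ^ card V * (?J U V - linked_prob B U * linked_prob B V))"
  proof (rule sum.mono_neutral_right)
    have "?J U V = linked_prob B U * linked_prob B V" if "U \<subseteq> S" "V \<subseteq> S" "U \<inter> V = {}" for U V
      unfolding prob_eq_expect
    proof (rule expect_Pi_indep[OF S that finite_row_hash[OF B]])
      show "of_bool (linked (buckets \<omega>) U) = (of_bool (linked (buckets \<omega>') U) :: real)"
        if "\<And>e. e \<in> U \<Longrightarrow> \<omega> e = \<omega>' e" for \<omega> \<omega>' using linked_cong[OF that] by simp
      show "of_bool (linked (buckets \<omega>) V) = (of_bool (linked (buckets \<omega>') V) :: real)"
        if "\<And>e. e \<in> V \<Longrightarrow> \<omega> e = \<omega>' e" for \<omega> \<omega>' using linked_cong[OF that] by simp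
    qed
    then show "\<forall>i\<in>?P \<times> ?P - I. (case i of (U, V) \<Rightarrow> y ^ card U * y ^ card V * (?J U V - linked_prob B U * linked_prob B V)) = 0"
      by (auto simp: I_def)
  qed (use S finI in auto)
  \<comment> \<open>The product of the two separate probabilities is nonnegative and is
    dropped.\<close>
  also have "\<dots> \<le> (\<Sum>(U, V)\<in>I. y ^ card U * y ^ card V * linked_prob B (U \<union> V))"
  proof (rule sum_mono)
    fix i assume "i \<in> I"
    then obtain U V where i: "i = (U, V)" and UV: "U \<subseteq> S" "V \<subseteq> S" "U \<inter> V \<noteq> {}" by (auto simp: I_def)
    have "?J U V \<le> expect (hashes B S) (\<lambda>\<omega>. of_bool (linked (buckets \<omega>) (U \<union> V)))"
      by (rule expect_mono[OF fin]) (use UV in \<open>auto dest: linked_Un\<close>)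
    also have "\<dots> = linked_prob B (U \<union> V)" using UV S by (intro expect_linked) auto
    finally have "?J U V \<le> linked_prob B (U \<union> V)" .
    moreover have "0 \<le> linked_prob B U * linked_prob B V" by simp
    ultimately have "?J U V - linked_prob B U * linked_prob B V \<le> linked_prob B (U \<union> V)" by linarith
    then show "(case i of (U, V) \<Rightarrow> y ^ card U * y ^ card V * (?J U V - linked_prob B U * linked_prob B V))
       \<le> (case i of (U, V) \<Rightarrow> y ^ card U * y ^ card V * linked_prob B (U \<union> V))"
      unfolding i prod.case using y by (intro mult_left_mono) simp_all
  qed
  \<comment> \<open>Pairs are grouped by their union \<open>Z\<close>. All pairs of subsets of
    \<open>Z\<close> together weigh \<open>(1 + y) ^ (2 * card Z)\<close>, the origin of the
    parameter \<open>(1 + y)\<^sup>2\<close>.\<close>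
  also have "\<dots> = (\<Sum>Z\<in>?P. \<Sum>i\<in>{i\<in>I. (case i of (U, V) \<Rightarrow> U \<union> V) = Z}. (case i of (U, V) \<Rightarrow> y ^ card U * y ^ card V * linked_prob B (U \<union> V)))"
    by (rule sum.group[symmetric]) (use S finI in \<open>auto simp: I_def\<close>)
  also have "\<dots> \<le> (\<Sum>Z\<in>?P. ((1 + y)\<^sup>2) ^ card Z * linked_prob B Z)"
  proof (rule sum_mono)
    fix Z assume Z: "Z \<in> ?P"
    then have finZ: "finite Z" using S finite_subset by auto
    have "(\<Sum>i\<in>{i\<in>I. (case i of (U, V) \<Rightarrow> U \<union> V) = Z}. (case i of (U, V) \<Rightarrow> y ^ card U * y ^ card V * linked_prob B (U \<union> V)))
      = (\<Sum>i\<in>{i\<in>I. (case i of (U, V) \<Rightarrow> U \<union> V) = Z}. (case i of (U, V) \<Rightarrow> y ^ card U * y ^ card V) * linked_prob B Z)"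
      by (rule sum.cong) auto
    also have "\<dots> \<le> (\<Sum>i\<in>Pow Z \<times> Pow Z. (case i of (U, V) \<Rightarrow> y ^ card U * y ^ card V) * linked_prob B Z)"
      by (rule sum_mono2) (use finZ y in auto)
    also have "\<dots> = (\<Sum>(U, V)\<in>Pow Z \<times> Pow Z. y ^ card U * y ^ card V) * linked_prob B Z"
      by (rule sum_distrib_right[symmetric])
    also have "(\<Sum>(U, V)\<in>Pow Z \<times> Pow Z. y ^ card U * y ^ card V) = (\<Sum>U\<in>Pow Z. y ^ card U) * (\<Sum>V\<in>Pow Z. y ^ card V)"
      unfolding sum_product by (rule sum.cartesian_product[symmetric])
    also have "(\<Sum>U\<in>Pow Z. y ^ card U) * (\<Sum>V\<in>Pow Z. y ^ card V) = ((1 + y)\<^sup>2) ^ card Z"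
      by (simp add: sum_Pow_power finZ power2_eq_square power_mult_distrib)
    finally show "(\<Sum>i\<in>{i\<in>I. (case i of (U, V) \<Rightarrow> U \<union> V) = Z}. (case i of (U, V) \<Rightarrow> y ^ card U * y ^ card V * linked_prob B (U \<union> V)))
      \<le> ((1 + y)\<^sup>2) ^ card Z * linked_prob B Z" .
  qed
  also have "\<dots> \<le> 192 * (1 + y)\<^sup>2 * real (card S)"
    by (rule sum_linked_bound)  (use assms in auto)
  finally show ?thesis .
qed

text \<open>The component of \<open>f\<close> is one of the linked sets containing \<open>f\<close>.
  Summing over \<open>f\<close> counts a linked set \<open>U\<close> exactly
  \<open>card U \<le> 2 ^ card U\<close> times, which doubles the base.\<close>

lemma component_le_linked_sum:
  assumes "finite S" "y \<ge> 0"
  shows "(\<Sum>f\<in>S. y ^ card (component (buckets \<omega>) S f)) \<le> linked_sum (2 * y) S \<omega>"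
proof -
  let ?P = "Pow S - {{}}"
  have "(\<Sum>f\<in>S. y ^ card (component (buckets \<omega>) S f)) \<le> (\<Sum>f\<in>S. \<Sum>U\<in>?P. of_bool (f \<in> U) * (y ^ card U * of_bool (linked (buckets \<omega>) U)))"
  proof (rule sum_mono)
    fix f assume f: "f \<in> S"
    let ?C = "component (buckets \<omega>) S f"
    have "y ^ card ?C = (\<Sum>U\<in>{?C}. of_bool (f \<in> U) * (y ^ card U * of_bool (linked (buckets \<omega>) U)))"
      using f by (simp add: component_refl linked_component)
    also have "\<dots> \<le> (\<Sum>U\<in>?P. of_bool (f \<in> U) * (y ^ card U * of_bool (linked (buckets \<omega>) U)))"
      using assms component_subset[OF f, of "buckets \<omega>"] component_refl[of f "buckets \<omega>" S] by (intro sum_mono2) auto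
    finally show "y ^ card ?C \<le> \<dots>" .
  qed
  also have "\<dots> = (\<Sum>U\<in>?P. \<Sum>f\<in>S. of_bool (f \<in> U) * (y ^ card U * of_bool (linked (buckets \<omega>) U)))" by (rule sum.swap)
  also have "\<dots> \<le> (\<Sum>U\<in>?P. (2 * y) ^ card U * of_bool (linked (buckets \<omega>) U))"
  proof (rule sum_mono)
    fix U assume U: "U \<in> ?P"
    have "(\<Sum>f\<in>S. of_bool (f \<in> U) * (y ^ card U * of_bool (linked (buckets \<omega>) U))) = real (card U) * y ^ card U * of_bool (linked (buckets \<omega>) U)"
      using U assms by (simp add: sum_distrib_right[symmetric] of_bool_def sum.If_cases Int_absorb1)
    also have "\<dots> \<le> 2 ^ card U * y ^ card U * of_bool (linked (buckets \<omega>) U)"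
    proof -
      have "real (card U) \<le> 2 ^ card U" by (metis less_exp less_imp_le of_nat_le_iff of_nat_numeral of_nat_power)
      then show ?thesis using assms(2) by (intro mult_right_mono) auto
    qed
    finally show "(\<Sum>f\<in>S. of_bool (f \<in> U) * (y ^ card U * of_bool (linked (buckets \<omega>) U))) \<le> (2 * y) ^ card U * of_bool (linked (buckets \<omega>) U)"
      by (simp add: power_mult_distrib)
  qed
  finally show ?thesis by (simp add: linked_sum_def)
qed

section \<open>Noise in the set query rows\<close>

text \<open>\<open>True\<close> stands for minus so that the same bit can later select the second,
  subtracted row of a pair in the binary matrix.\<close>

definition sgn_bit :: "bool \<Rightarrow> real" where
  "sgn_bit s = (if s then -1 else 1)"

definition noise :: "(nat \<Rightarrow> real) \<Rightarrow> nat set \<Rightarrow> (nat \<Rightarrow> nat \<Rightarrow> nat \<times> bool) \<Rightarrow> nat \<Rightarrow> nat \<Rightarrow> real" where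
  "noise x L \<omega> r \<beta> = (\<Sum>j\<in>L. x j * (if fst (\<omega> j r) = \<beta> then sgn_bit (snd (\<omega> j r)) else 0))"

lemma expect_row_hash:
  fixes F :: "nat \<times> bool \<Rightarrow> real"
  assumes "B > 0" "r < 5"
  shows "expect (row_hash B) (\<lambda>v. F (v r)) = (\<Sum>\<beta><B. F (\<beta>, False) + F (\<beta>, True)) / (2 * real B)"
proof -
  have "expect (row_hash B) (\<lambda>v. F (v r)) = expect (pmf_of_set ({..<B} \<times> UNIV)) F"
    unfolding row_hash_def using assms by (intro expect_Pi_component) auto
  also have "\<dots> = sum F ({..<B} \<times> UNIV) / card ({..<B} \<times> (UNIV :: bool set))"
    using assms by (intro integral_pmf_of_set) (auto simp: lessThan_empty_iff)
  also have "sum F ({..<B} \<times> UNIV) = (\<Sum>\<beta><B. F (\<beta>, False) + F (\<beta>, True))"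
    unfolding sum.cartesian_product' by (simp add: UNIV_bool)
  finally show ?thesis by (simp add: card_cartesian_product mult.commute)
qed

text \<open>A coordinate touches a single bucket, so products of different coefficients vanish and
  \<rho> is the hit probability \<open>1 / B\<close>. The diagonal term is the weight of the bucket
  hit and does not see the sign, so the mixed third moment cancels; its second moment is the mean of
  the squared weights, and the subtracted square is discarded.\<close>

lemma row_quadratic_sketch:
  assumes B: "B > 0" and r: "r < 5"
  shows "quadratic_sketch (row_hash B) (\<lambda>v \<beta>. if fst (v r) = \<beta> then sgn_bit (snd (v r)) else 0) {..<B} \<omega>
     (1 / real B) ((\<Sum>\<beta><B. (\<omega> \<beta>)\<^sup>2) / real B)"
proof -
  let ?c = "\<lambda>z \<beta>. if fst z = \<beta> then sgn_bit (snd z) else 0 :: real"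
  have A: "(\<Sum>\<gamma><B. \<omega> \<gamma> * (?c (\<beta>, s) \<gamma>)\<^sup>2) = \<omega> \<beta>" if "\<beta> < B" for \<beta> s
  proof -
    have "(\<Sum>\<gamma><B. \<omega> \<gamma> * (?c (\<beta>, s) \<gamma>)\<^sup>2) = (\<Sum>\<gamma><B. if \<beta> = \<gamma> then \<omega> \<gamma> else 0)"
      by (intro sum.cong) (auto simp: sgn_bit_def)
    then show ?thesis using that by simp
  qed
  show ?thesis
  proof
    show "finite {..<B}" "finite (set_pmf (row_hash B))" using finite_row_hash[OF B] by auto
    fix \<beta> \<gamma> assume "\<beta> \<in> {..<B}" "\<gamma> \<in> {..<B}"
    then have bg: "\<beta> < B" "\<gamma> < B" by auto
    have "expect (row_hash B) (\<lambda>v. ?c (v r) \<beta> * ?c (v r) \<gamma>) = (\<Sum>\<delta><B. if \<beta> = \<delta> \<and> \<gamma> = \<delta> then 2 else 0) / (2 * real B)"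
      by (subst expect_row_hash[OF B r]) (auto intro!: sum.cong arg_cong2[where f="(/)"] simp: sgn_bit_def)
    also have "\<dots> = (if \<beta> = \<gamma> then 1 / real B else 0)"
    proof (cases "\<beta> = \<gamma>")
      case False
      then have "(\<Sum>\<delta><B. if \<beta> = \<delta> \<and> \<gamma> = \<delta> then 2 else 0 :: real) = 0" by (intro sum.neutral) auto
      then show ?thesis using False by simp
    qed (use bg in simp)
    finally show "expect (row_hash B) (\<lambda>v. ?c (v r) \<beta> * ?c (v r) \<gamma>) = (if \<beta> = \<gamma> then 1 / real B else 0)" .
  next
    fix \<beta> assume "\<beta> \<in> {..<B}"
    show "expect (row_hash B) (\<lambda>v. ?c (v r) \<beta>) = 0"
      by (subst expect_row_hash[OF B r]) (auto intro!: sum.neutral simp: sgn_bit_def)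
    show "expect (row_hash B) (\<lambda>v. ?c (v r) \<beta> * (\<Sum>\<gamma><B. \<omega> \<gamma> * (?c (v r) \<gamma>)\<^sup>2)) = 0"
    proof (subst expect_row_hash[OF B r])
      have "(\<Sum>\<delta><B. ?c (\<delta>, False) \<beta> * (\<Sum>\<gamma><B. \<omega> \<gamma> * (?c (\<delta>, False) \<gamma>)\<^sup>2) + ?c (\<delta>, True) \<beta> * (\<Sum>\<gamma><B. \<omega> \<gamma> * (?c (\<delta>, True) \<gamma>)\<^sup>2)) = 0"
      proof (intro sum.neutral ballI)
        fix \<delta> assume "\<delta> \<in> {..<B}"
        then have "\<delta> < B" by simp
        show "?c (\<delta>, False) \<beta> * (\<Sum>\<gamma><B. \<omega> \<gamma> * (?c (\<delta>, False) \<gamma>)\<^sup>2) + ?c (\<delta>, True) \<beta> * (\<Sum>\<gamma><B. \<omega> \<gamma> * (?c (\<delta>, True) \<gamma>)\<^sup>2) = 0"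
          unfolding A[OF \<open>\<delta> < B\<close>] by (simp add: sgn_bit_def)
      qed
      then show "(\<Sum>\<delta><B. ?c (\<delta>, False) \<beta> * (\<Sum>\<gamma><B. \<omega> \<gamma> * (?c (\<delta>, False) \<gamma>)\<^sup>2) + ?c (\<delta>, True) \<beta> * (\<Sum>\<gamma><B. \<omega> \<gamma> * (?c (\<delta>, True) \<gamma>)\<^sup>2)) / (2 * real B) = 0"
        by simp
    qed
  next
    have "expect (row_hash B) (\<lambda>v. (\<Sum>\<gamma><B. \<omega> \<gamma> * (?c (v r) \<gamma>)\<^sup>2)\<^sup>2) = (\<Sum>\<beta><B. (\<omega> \<beta>)\<^sup>2) / real B"
    proof (subst expect_row_hash[OF B r])
      have "(\<Sum>\<delta><B. (\<Sum>\<gamma><B. \<omega> \<gamma> * (?c (\<delta>, False) \<gamma>)\<^sup>2)\<^sup>2 + (\<Sum>\<gamma><B. \<omega> \<gamma> * (?c (\<delta>, True) \<gamma>)\<^sup>2)\<^sup>2) = (\<Sum>\<delta><B. 2 * (\<omega> \<delta>)\<^sup>2)"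
      proof (intro sum.cong refl)
        fix \<delta> assume "\<delta> \<in> {..<B}"
        then have "\<delta> < B" by simp
        show "(\<Sum>\<gamma><B. \<omega> \<gamma> * (?c (\<delta>, False) \<gamma>)\<^sup>2)\<^sup>2 + (\<Sum>\<gamma><B. \<omega> \<gamma> * (?c (\<delta>, True) \<gamma>)\<^sup>2)\<^sup>2 = 2 * (\<omega> \<delta>)\<^sup>2"
          unfolding A[OF \<open>\<delta> < B\<close>] by simp
      qed
      then show "(\<Sum>\<delta><B. (\<Sum>\<gamma><B. \<omega> \<gamma> * (?c (\<delta>, False) \<gamma>)\<^sup>2)\<^sup>2 + (\<Sum>\<gamma><B. \<omega> \<gamma> * (?c (\<delta>, True) \<gamma>)\<^sup>2)\<^sup>2) / (2 * real B) = (\<Sum>\<beta><B. (\<omega> \<beta>)\<^sup>2) / real B"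
        by (simp add: sum_distrib_left[symmetric])
    qed
    moreover have "0 \<le> (1 / real B * sum \<omega> {..<B})\<^sup>2" by simp
    ultimately show "expect (row_hash B) (\<lambda>v. (\<Sum>\<gamma><B. \<omega> \<gamma> * (?c (v r) \<gamma>)\<^sup>2)\<^sup>2) - (1 / real B * sum \<omega> {..<B})\<^sup>2 \<le> (\<Sum>\<beta><B. (\<omega> \<beta>)\<^sup>2) / real B"
      by linarith
  qed
qed

text \<open>Chebyshev for the weighted bucket energy. Lightness is what tames the fourth powers:
  \<open>(x j) ^ 4 \<le> h * (x j)\<^sup>2\<close>. The weights enter only through the bounds
  \<open>M1\<close> on their sum and \<open>M2\<close> on the sum of their squares.\<close>

lemma prob_noise:
  fixes x :: "nat \<Rightarrow> real" and \<omega> :: "nat \<Rightarrow> real"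
  assumes B: "B > 0" and r: "r < 5" and L: "finite L"
    and M1: "sum \<omega> {..<B} \<le> M1" and M2: "(\<Sum>\<beta><B. (\<omega> \<beta>)\<^sup>2) \<le> M2"
    and \<tau>: "(\<Sum>j\<in>L. (x j)\<^sup>2) \<le> \<tau>" and light: "\<And>j. j \<in> L \<Longrightarrow> (x j)\<^sup>2 \<le> h" and h: "0 \<le> h" and t: "t > 0"
    and M1': "0 \<le> M1"
  shows "measure_pmf.prob (hashes B L) {\<psi>. M1 * \<tau> / real B + t \<le> (\<Sum>\<beta><B. \<omega> \<beta> * (noise x L \<psi> r \<beta>)\<^sup>2)}
    \<le> (M2 / real B * (h * \<tau>) + 2 * M2 * \<tau>\<^sup>2 / (real B)\<^sup>2) / t\<^sup>2"
proof -
  interpret quadratic_sketch "row_hash B" "\<lambda>v \<beta>. if fst (v r) = \<beta> then sgn_bit (snd (v r)) else 0" "{..<B}" \<omega>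
     "1 / real B" "(\<Sum>\<beta><B. (\<omega> \<beta>)\<^sup>2) / real B" "\<lambda>_. (0, False)" x
    by (rule row_quadratic_sketch[OF B r])
  have X: "X L \<psi> = (\<Sum>\<beta><B. \<omega> \<beta> * (noise x L \<psi> r \<beta>)\<^sup>2)" for \<psi> by (simp add: X_def N_def noise_def)
  define s2 where "s2 = (\<Sum>j\<in>L. (x j)\<^sup>2)"
  have s2: "0 \<le> s2" "s2 \<le> \<tau>" using \<tau> by (auto simp: s2_def intro: sum_nonneg)
  have M2': "0 \<le> (\<Sum>\<beta><B. (\<omega> \<beta>)\<^sup>2)" by (intro sum_nonneg) simp
  have "(\<Sum>j\<in>L. (x j) ^ 4) \<le> (\<Sum>j\<in>L. h * (x j)\<^sup>2)"
  proof (rule sum_mono)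
    fix j assume "j \<in> L"
    then have "(x j)\<^sup>2 * (x j)\<^sup>2 \<le> h * (x j)\<^sup>2" using light by (intro mult_right_mono) auto
    then show "(x j) ^ 4 \<le> h * (x j)\<^sup>2" by (simp add: power2_eq_square power4_eq_xxxx mult.assoc)
  qed
  also have "\<dots> = h * s2" by (simp add: s2_def sum_distrib_left)
  also have "\<dots> \<le> h * \<tau>" using s2 h by (intro mult_left_mono)
  finally have x4: "(\<Sum>j\<in>L. (x j) ^ 4) \<le> h * \<tau>" .
  have v: "expect (hashes B L) (\<lambda>f. (X L f)\<^sup>2) - (expect (hashes B L) (X L))\<^sup>2
     \<le> M2 / real B * (h * \<tau>) + 2 * M2 * \<tau>\<^sup>2 / (real B)\<^sup>2"
  proof -
    have "(\<Sum>\<beta><B. (\<omega> \<beta>)\<^sup>2) / real B * (\<Sum>j\<in>L. (x j) ^ 4) \<le> M2 / real B * (h * \<tau>)"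
      using M2 M2' x4 by (intro mult_mono divide_right_mono divide_nonneg_nonneg) (auto intro: sum_nonneg)
    moreover have "2 * (1 / real B)\<^sup>2 * (\<Sum>\<beta><B. (\<omega> \<beta>)\<^sup>2) * s2\<^sup>2 \<le> 2 * (1 / real B)\<^sup>2 * M2 * \<tau>\<^sup>2"
      using M2 M2' s2 by (intro mult_mono power_mono mult_left_mono mult_nonneg_nonneg) auto
    ultimately show ?thesis using expect_X_sq[OF L] by (simp add: s2_def power_divide)
  qed
  have m: "expect (hashes B L) (X L) \<le> M1 * \<tau> / real B"
  proof -
    have "sum \<omega> {..<B} * s2 \<le> M1 * \<tau>" using M1 M1' s2 by (intro mult_mono) auto
    then show ?thesis using expect_X[OF L] by (simp add: s2_def divide_right_mono)
  qed
  have "measure_pmf.prob (hashes B L) {\<psi>. M1 * \<tau> / real B + t \<le> (\<Sum>\<beta><B. \<omega> \<beta> * (noise x L \<psi> r \<beta>)\<^sup>2)}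
     \<le> measure_pmf.prob (hashes B L) {\<psi>. t \<le> \<bar>X L \<psi> - expect (hashes B L) (X L)\<bar>}"
    by (rule prob_mono) (use m in \<open>unfold X, linarith\<close>)
  also have "\<dots> \<le> (M2 / real B * (h * \<tau>) + 2 * M2 * \<tau>\<^sup>2 / (real B)\<^sup>2) / t\<^sup>2"
    by (rule prob_chebyshev[OF finite_hashes[OF B L] t v])
  finally show ?thesis .
qed

text \<open>Two independent draws are involved in either case: different rows of one coordinate, or
  different coordinates.\<close>

lemma prob_heavy_pair:
  assumes B: "B > 0" and r: "r < 5" "r' < 5" "r \<noteq> r'" and T: "finite T" "j \<in> T" "j' \<in> T"
  shows "measure_pmf.prob (hashes B T) {\<psi>. buckets \<psi> r j = \<beta> \<and> buckets \<psi> r' j' = \<beta>'} \<le> (1 / real B)\<^sup>2"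
proof -
  have one: "measure_pmf.prob (row_hash B) {v. fst (v q) = \<gamma>} \<le> 1 / real B" if "q < 5" for q \<gamma>
    using prob_row_hash[OF B, of "{q}" "\<lambda>_. {\<gamma>}" 1] that by simp
  show ?thesis
  proof (cases "j = j'")
    case True
    have "measure_pmf.prob (hashes B T) {\<psi>. buckets \<psi> r j = \<beta> \<and> buckets \<psi> r' j' = \<beta>'}
       = measure_pmf.prob (row_hash B) {v. fst (v r) = \<beta> \<and> fst (v r') = \<beta>'}"
      unfolding prob_eq_expect True
      using expect_Pi_component[OF T(1,3), of "\<lambda>_. (0, False)" "\<lambda>_. row_hash B" "\<lambda>v. of_bool (fst (v r) = \<beta> \<and> fst (v r') = \<beta>')"] by simp
    also have "\<dots> \<le> (real 1 / real B) ^ card {r, r'}"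
      using prob_row_hash[OF B, of "{r, r'}" "\<lambda>q. if q = r then {\<beta>} else {\<beta>'}" 1] r by (simp add: eq_commute)
    finally show ?thesis using r by (simp add: power2_eq_square)
  next
    case False
    have "measure_pmf.prob (hashes B T) {\<psi>. buckets \<psi> r j = \<beta> \<and> buckets \<psi> r' j' = \<beta>'}
       = expect (hashes B T) (\<lambda>\<psi>. of_bool (buckets \<psi> r j = \<beta>) * of_bool (buckets \<psi> r' j' = \<beta>'))"
      unfolding prob_eq_expect by (simp add: of_bool_conj)
    also have "\<dots> = expect (hashes B {j}) (\<lambda>\<psi>. of_bool (buckets \<psi> r j = \<beta>)) * expect (hashes B {j'}) (\<lambda>\<psi>. of_bool (buckets \<psi> r' j' = \<beta>'))"
      by (rule expect_Pi_indep) (use T False finite_row_hash[OF B] in auto)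
    also have "\<dots> = measure_pmf.prob (row_hash B) {v. fst (v r) = \<beta>} * measure_pmf.prob (row_hash B) {v. fst (v r') = \<beta>'}"
      unfolding prob_eq_expect
      using expect_Pi_component[of "{j}" j "\<lambda>_. (0, False)" "\<lambda>_. row_hash B" "\<lambda>v. of_bool (fst (v r) = \<beta>)"]
        expect_Pi_component[of "{j'}" j' "\<lambda>_. (0, False)" "\<lambda>_. row_hash B" "\<lambda>v. of_bool (fst (v r') = \<beta>')"] by simp
    also have "\<dots> \<le> 1 / real B * (1 / real B)" using r by (intro mult_mono one) auto
    finally show ?thesis by (simp add: power2_eq_square)
  qed
qed

definition heavy_hit :: "nat set \<Rightarrow> (nat \<Rightarrow> nat \<Rightarrow> nat) \<Rightarrow> nat \<Rightarrow> nat \<Rightarrow> bool" where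
  "heavy_hit H bk e r \<longleftrightarrow> (\<exists>j\<in>H. bk r j = bk r e)"

text \<open>The buckets of the queried elements enter as a fixed \<beta>, since their hashes are
  drawn independently of the tail. The union bound runs over at most 25 pairs of rows and all pairs
  of heavy coordinates.\<close>

lemma prob_heavy:
  fixes \<beta> :: "nat \<Rightarrow> nat \<Rightarrow> nat"
  assumes B: "B > 0" and T: "finite T" "H \<subseteq> T" and S: "finite S"
  shows "measure_pmf.prob (hashes B T) {\<psi>. \<exists>f\<in>S. \<exists>r<5. \<exists>r'<5. r \<noteq> r' \<and> (\<exists>j\<in>H. buckets \<psi> r j = \<beta> r f) \<and> (\<exists>j\<in>H. buckets \<psi> r' j = \<beta> r' f)}
    \<le> 25 * real (card S) * (real (card H) / real B)\<^sup>2"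
proof -
  let ?R = "{(r, r'). r < 5 \<and> r' < 5 \<and> r \<noteq> (r'::nat)}"
  let ?I = "S \<times> ?R \<times> H \<times> H"
  have finH: "finite H" using T finite_subset by blast
  have R: "?R \<subseteq> {..<5} \<times> {..<5}" by auto
  have finR: "finite ?R" by (rule finite_subset[OF R]) simp
  have "card ?R \<le> card ({..<5::nat} \<times> {..<5::nat})" using R by (intro card_mono) auto
  then have cR: "card ?R \<le> 25" by simp
  have "measure_pmf.prob (hashes B T) {\<psi>. \<exists>f\<in>S. \<exists>r<5. \<exists>r'<5. r \<noteq> r' \<and> (\<exists>j\<in>H. buckets \<psi> r j = \<beta> r f) \<and> (\<exists>j\<in>H. buckets \<psi> r' j = \<beta> r' f)}
    \<le> (\<Sum>i\<in>?I. measure_pmf.prob (hashes B T) {\<psi>. case i of (f, (r, r'), j, j') \<Rightarrow> buckets \<psi> r j = \<beta> r f \<and> buckets \<psi> r' j' = \<beta> r' f})"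
  proof (rule prob_union_bound)
    show "finite ?I" using S finR finH by simp
    fix \<psi> assume "\<exists>f\<in>S. \<exists>r<5. \<exists>r'<5. r \<noteq> r' \<and> (\<exists>j\<in>H. buckets \<psi> r j = \<beta> r f) \<and> (\<exists>j\<in>H. buckets \<psi> r' j = \<beta> r' f)"
    then obtain f r r' j j' where "f \<in> S" "r < 5" "r' < 5" "r \<noteq> r'" "j \<in> H" "j' \<in> H" "buckets \<psi> r j = \<beta> r f" "buckets \<psi> r' j' = \<beta> r' f"
      by blast
    then show "\<exists>i\<in>?I. case i of (f, (r, r'), j, j') \<Rightarrow> buckets \<psi> r j = \<beta> r f \<and> buckets \<psi> r' j' = \<beta> r' f"
      by (intro bexI[of _ "(f, (r, r'), j, j')"]) auto
  qed
  also have "\<dots> \<le> (\<Sum>i\<in>?I. (1 / real B)\<^sup>2)"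
  proof (rule sum_mono)
    fix i assume "i \<in> ?I"
    then obtain f r r' j j' where i: "i = (f, (r, r'), j, j')" "r < 5" "r' < 5" "r \<noteq> r'" "j \<in> H" "j' \<in> H" by auto
    show "measure_pmf.prob (hashes B T) {\<psi>. case i of (f, (r, r'), j, j') \<Rightarrow> buckets \<psi> r j = \<beta> r f \<and> buckets \<psi> r' j' = \<beta> r' f} \<le> (1 / real B)\<^sup>2"
      unfolding i(1) prod.case using i T by (intro prob_heavy_pair[OF B]) auto
  qed
  also have "\<dots> = real (card S * card ?R * card H * card H) * (1 / real B)\<^sup>2"
    by (simp add: card_cartesian_product mult.assoc)
  also have "\<dots> \<le> real (card S * 25 * card H * card H) * (1 / real B)\<^sup>2"
    using cR by (intro mult_right_mono of_nat_mono mult_mono) auto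
  finally show ?thesis by (simp add: power2_eq_square mult_ac)
qed

section \<open>Peeling\<close>

definition med3 :: "real \<Rightarrow> real \<Rightarrow> real \<Rightarrow> real" where
  "med3 a b c = max (min a b) (min (max a b) c)"

lemma med3_close:
  assumes "\<bar>a - x\<bar> \<le> t \<and> \<bar>b - x\<bar> \<le> t \<or> \<bar>a - x\<bar> \<le> t \<and> \<bar>c - x\<bar> \<le> t \<or> \<bar>b - x\<bar> \<le> t \<and> \<bar>c - x\<bar> \<le> t"
  shows "\<bar>med3 a b c - x\<bar> \<le> t"
  using assms unfolding med3_def max_def min_def by (auto simp: abs_le_iff)

abbreviation hsign :: "(nat \<Rightarrow> nat \<Rightarrow> nat \<times> bool) \<Rightarrow> nat \<Rightarrow> nat \<Rightarrow> real" where
  "hsign \<omega> r e \<equiv> sgn_bit (snd (\<omega> e r))"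

text \<open>The content of the bucket of \<open>e\<close> after removal of the recovered
  coordinates, multiplied by the sign of \<open>e\<close> so that it estimates \<open>x e\<close>
  itself.\<close>

definition residual :: "nat \<Rightarrow> (nat \<Rightarrow> real) \<Rightarrow> (nat \<Rightarrow> nat \<Rightarrow> nat \<times> bool) \<Rightarrow> nat set \<Rightarrow> (nat \<Rightarrow> real) \<Rightarrow> nat \<Rightarrow> nat \<Rightarrow> real" where
  "residual n x \<omega> D est r e = hsign \<omega> r e *
     ((\<Sum>j | j < n \<and> buckets \<omega> r j = buckets \<omega> r e. hsign \<omega> r j * x j) -
      (\<Sum>f | f \<in> D \<and> buckets \<omega> r f = buckets \<omega> r e. hsign \<omega> r f * est f))"

text \<open>The order of the elements and the choice among the isolated rows are left open, so the
  error analysis applies to whatever order a queue happens to produce.\<close>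

inductive peel :: "nat \<Rightarrow> (nat \<Rightarrow> real) \<Rightarrow> (nat \<Rightarrow> nat \<Rightarrow> nat \<times> bool) \<Rightarrow> nat set \<Rightarrow> nat set \<Rightarrow> (nat \<Rightarrow> real) \<Rightarrow> bool"
  for n x \<omega> S where
  peel_start: "peel n x \<omega> S {} (\<lambda>_. 0)"
| peel_step: "\<lbrakk>peel n x \<omega> S D est; e \<in> S - D; r\<^sub>1 \<in> isolated (buckets \<omega>) (S - D) e;
     r\<^sub>2 \<in> isolated (buckets \<omega>) (S - D) e; r\<^sub>3 \<in> isolated (buckets \<omega>) (S - D) e;
     r\<^sub>1 \<noteq> r\<^sub>2; r\<^sub>1 \<noteq> r\<^sub>3; r\<^sub>2 \<noteq> r\<^sub>3;
     v = med3 (residual n x \<omega> D est r\<^sub>1 e) (residual n x \<omega> D est r\<^sub>2 e) (residual n x \<omega> D est r\<^sub>3 e)\<rbrakk>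
   \<Longrightarrow> peel n x \<omega> S (insert e D) (est(e := v))"

lemma noise_abs_cong: "(\<Sum>j | j \<in> L \<and> fst (\<omega> j r) = \<beta>. sgn_bit (snd (\<omega> j r)) * x j) = noise x L \<omega> r \<beta>"
  if "finite L"
proof -
  have "noise x L \<omega> r \<beta> = (\<Sum>j\<in>L. if fst (\<omega> j r) = \<beta> then sgn_bit (snd (\<omega> j r)) * x j else 0)"
    unfolding noise_def by (intro sum.cong) auto
  also have "\<dots> = (\<Sum>j\<in>L \<inter> {j. fst (\<omega> j r) = \<beta>}. sgn_bit (snd (\<omega> j r)) * x j)"
    using that by (simp add: sum.If_cases)
  finally show ?thesis by (simp add: Int_def)
qed

lemma abs_sgn_bit [simp]: "\<bar>sgn_bit s\<bar> = 1" "sgn_bit s * sgn_bit s = 1"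
  by (simp_all add: sgn_bit_def)

text \<open>Since the row is isolated, the bucket of \<open>e\<close> contains besides
  \<open>e\<close> only tail coordinates, which form the noise, and recovered ones. The latter
  collide with \<open>e\<close>, so their errors come from the component of \<open>e\<close>
  only.\<close>

lemma residual_error:
  assumes S: "S \<subseteq> {..<n}" and D: "D \<subseteq> S" and e: "e \<in> S - D" and r: "r \<in> isolated (buckets \<omega>) (S - D) e"
  shows "\<bar>residual n x \<omega> D est r e - x e\<bar> \<le> \<bar>noise x ({..<n} - S) \<omega> r (buckets \<omega> r e)\<bar>
     + (\<Sum>f\<in>D \<inter> component (buckets \<omega>) S e. \<bar>est f - x f\<bar>)"
proof -
  let ?b = "\<lambda>f. buckets \<omega> r f = buckets \<omega> r e" and ?s = "\<lambda>f. hsign \<omega> r f"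
  have finD: "finite D" "finite S" using S D finite_subset[OF S] finite_subset[OF D] by auto
  have iso: "f = e" if "f \<in> S - D" "?b f" for f using r that by (auto simp: isolated_def)
  have "{j. j < n \<and> ?b j} = {j. j \<in> {..<n} - S \<and> ?b j} \<union> ({j. j \<in> D \<and> ?b j} \<union> {e})"
    using S D e iso by auto
  then have "(\<Sum>j | j < n \<and> ?b j. ?s j * x j) =
    (\<Sum>j | j \<in> {..<n} - S \<and> ?b j. ?s j * x j) + ((\<Sum>j | j \<in> D \<and> ?b j. ?s j * x j) + ?s e * x e)"
    using finD D e by (simp only:) (subst sum.union_disjoint; auto)+
  also have "(\<Sum>j | j \<in> {..<n} - S \<and> ?b j. ?s j * x j) = noise x ({..<n} - S) \<omega> r (buckets \<omega> r e)"
    by (rule noise_abs_cong) simp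
  finally have "residual n x \<omega> D est r e - x e = ?s e * (noise x ({..<n} - S) \<omega> r (buckets \<omega> r e)
     - ((\<Sum>f | f \<in> D \<and> ?b f. ?s f * est f) - (\<Sum>j | j \<in> D \<and> ?b j. ?s j * x j)))"
    unfolding residual_def by (simp add: algebra_simps flip: mult.assoc)
  also have "(\<Sum>f | f \<in> D \<and> ?b f. ?s f * est f) - (\<Sum>j | j \<in> D \<and> ?b j. ?s j * x j) = (\<Sum>f | f \<in> D \<and> ?b f. ?s f * (est f - x f))"
    by (simp add: sum_subtractf right_diff_distrib)
  finally have "\<bar>residual n x \<omega> D est r e - x e\<bar> \<le> \<bar>noise x ({..<n} - S) \<omega> r (buckets \<omega> r e)\<bar> + \<bar>\<Sum>f | f \<in> D \<and> ?b f. ?s f * (est f - x f)\<bar>"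
    by (simp add: abs_mult)
  also have "\<bar>\<Sum>f | f \<in> D \<and> ?b f. ?s f * (est f - x f)\<bar> \<le> (\<Sum>f | f \<in> D \<and> ?b f. \<bar>est f - x f\<bar>)"
    by (rule order_trans[OF sum_abs]) (simp add: abs_mult)
  also have "\<dots> \<le> (\<Sum>f\<in>D \<inter> component (buckets \<omega>) S e. \<bar>est f - x f\<bar>)"
  proof (rule sum_mono2)
    show "{f. f \<in> D \<and> ?b f} \<subseteq> D \<inter> component (buckets \<omega>) S e"
    proof clarsimp
      fix f assume f: "f \<in> D" "?b f"
      have "r < 5" using r by (simp add: isolated_def)
      then have "collide (buckets \<omega>) e f" unfolding collide_def using f(2) by metis
      then show "f \<in> component (buckets \<omega>) S e"
        using component_step[OF component_refl, of e S f] f D e by auto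
    qed
  qed (use finD in auto)
  finally show ?thesis by simp
qed

text \<open>The sum over all five rows bounds the noise in any of them, so the analysis need not
  record which rows a peeling step used.\<close>

definition light_error :: "(nat \<Rightarrow> real) \<Rightarrow> nat set \<Rightarrow> (nat \<Rightarrow> nat \<Rightarrow> nat \<times> bool) \<Rightarrow> nat \<Rightarrow> real" where
  "light_error x L \<omega> f = (\<Sum>r<5. \<bar>noise x L \<omega> r (buckets \<omega> r f)\<bar>)"

lemma light_error_nonneg: "0 \<le> light_error x L \<omega> f"
  unfolding light_error_def by (intro sum_nonneg) simp

lemma noise_no_heavy:
  assumes "H \<subseteq> T" "finite T" "\<not> heavy_hit H (buckets \<omega>) e r"
  shows "noise x T \<omega> r (buckets \<omega> r e) = noise x (T - H) \<omega> r (buckets \<omega> r e)"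
  unfolding noise_def
  by (rule sum.mono_neutral_right) (use assms in \<open>auto simp: heavy_hit_def\<close>)

text \<open>At most one of the rows of \<open>e\<close> meets a heavy coordinate, so at least two of
  the three residuals obey the light bound, and these two already confine the median.\<close>

lemma peel_step_error:
  assumes S: "S \<subseteq> {..<n}" and D: "D \<subseteq> S" and e: "e \<in> S - D" and H: "H \<subseteq> {..<n} - S"
    and one: "\<And>r r'. r < 5 \<Longrightarrow> r' < 5 \<Longrightarrow> r \<noteq> r' \<Longrightarrow> heavy_hit H (buckets \<omega>) e r \<Longrightarrow> \<not> heavy_hit H (buckets \<omega>) e r'"
    and iso: "r\<^sub>1 \<in> isolated (buckets \<omega>) (S - D) e" "r\<^sub>2 \<in> isolated (buckets \<omega>) (S - D) e" "r\<^sub>3 \<in> isolated (buckets \<omega>) (S - D) e"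
    and dist: "r\<^sub>1 \<noteq> r\<^sub>2" "r\<^sub>1 \<noteq> r\<^sub>3" "r\<^sub>2 \<noteq> r\<^sub>3"
  shows "\<bar>med3 (residual n x \<omega> D est r\<^sub>1 e) (residual n x \<omega> D est r\<^sub>2 e) (residual n x \<omega> D est r\<^sub>3 e) - x e\<bar>
    \<le> light_error x ({..<n} - S - H) \<omega> e + (\<Sum>f\<in>D \<inter> component (buckets \<omega>) S e. \<bar>est f - x f\<bar>)"
proof -
  let ?t = "light_error x ({..<n} - S - H) \<omega> e + (\<Sum>f\<in>D \<inter> component (buckets \<omega>) S e. \<bar>est f - x f\<bar>)"
  have ok: "\<bar>residual n x \<omega> D est r e - x e\<bar> \<le> ?t"
    if "r \<in> isolated (buckets \<omega>) (S - D) e" "\<not> heavy_hit H (buckets \<omega>) e r" for r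
  proof -
    have "r < 5" using that by (simp add: isolated_def)
    have "\<bar>noise x ({..<n} - S) \<omega> r (buckets \<omega> r e)\<bar> \<le> light_error x ({..<n} - S - H) \<omega> e"
      unfolding light_error_def noise_no_heavy[OF H finite_Diff[OF finite_lessThan] that(2)]
      using \<open>r < 5\<close> by (intro member_le_sum) auto
    with residual_error[OF S D e that(1), of x est] show ?thesis by linarith
  qed
  have "r\<^sub>1 < 5" "r\<^sub>2 < 5" "r\<^sub>3 < 5" using iso by (auto simp: isolated_def)
  then have "(\<not> heavy_hit H (buckets \<omega>) e r\<^sub>1 \<and> \<not> heavy_hit H (buckets \<omega>) e r\<^sub>2) \<or>
     (\<not> heavy_hit H (buckets \<omega>) e r\<^sub>1 \<and> \<not> heavy_hit H (buckets \<omega>) e r\<^sub>3) \<or>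
     (\<not> heavy_hit H (buckets \<omega>) e r\<^sub>2 \<and> \<not> heavy_hit H (buckets \<omega>) e r\<^sub>3)"
    using one dist by metis
  then show ?thesis using ok iso by (intro med3_close) blast
qed

lemma peel_subset: "peel n x \<omega> S D est \<Longrightarrow> D \<subseteq> S"
  by (induction rule: peel.induct) auto

text \<open>Let \<open>s\<close> be the error accumulated in the component and \<open>N\<close> its
  total light error. A new element errs by at most \<open>N + s\<close>, so the accumulated error
  becomes at most \<open>N + 2 * s\<close>; this recursion solves to \<open>(2 ^ m - 1) * N\<close>
  after \<open>m\<close> elements.\<close>

lemma peel_error:
  assumes S: "S \<subseteq> {..<n}" and H: "H \<subseteq> {..<n} - S"
    and one: "\<And>e r r'. e \<in> S \<Longrightarrow> r < 5 \<Longrightarrow> r' < 5 \<Longrightarrow> r \<noteq> r' \<Longrightarrow> heavy_hit H (buckets \<omega>) e r \<Longrightarrow> \<not> heavy_hit H (buckets \<omega>) e r'"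
    and p: "peel n x \<omega> S D est" and a: "a \<in> S"
  shows "(\<Sum>f\<in>D \<inter> component (buckets \<omega>) S a. \<bar>est f - x f\<bar>)
    \<le> (2 ^ card (D \<inter> component (buckets \<omega>) S a) - 1) * (\<Sum>f\<in>component (buckets \<omega>) S a. light_error x ({..<n} - S - H) \<omega> f)"
  using p
proof (induction rule: peel.induct)
  case peel_start
  then show ?case by simp
next
  case (peel_step D est e r\<^sub>1 r\<^sub>2 r\<^sub>3 v)
  let ?C = "component (buckets \<omega>) S" and ?L = "{..<n} - S - H"
  have D: "D \<subseteq> S" using peel_step.hyps by (intro peel_subset)
  have fin: "finite S" "finite D" using S D finite_subset[OF S] finite_subset[OF D] by auto
  have finC: "finite (?C a)" using component_subset[OF a] fin finite_subset by metis
  show ?case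
  proof (cases "e \<in> ?C a")
    case False
    then have "insert e D \<inter> ?C a = D \<inter> ?C a" by auto
    moreover have "(\<Sum>f\<in>D \<inter> ?C a. \<bar>(est(e := v)) f - x f\<bar>) = (\<Sum>f\<in>D \<inter> ?C a. \<bar>est f - x f\<bar>)"
      using peel_step.hyps by (intro sum.cong) auto
    ultimately show ?thesis using peel_step.IH by simp
  next
    case True
    have Ceq: "?C e = ?C a" by (rule component_eq[OF True])
    let ?s = "\<Sum>f\<in>D \<inter> ?C a. \<bar>est f - x f\<bar>" and ?N = "\<Sum>f\<in>?C a. light_error x ?L \<omega> f"
    have one': "\<not> heavy_hit H (buckets \<omega>) e r'" if "r < 5" "r' < 5" "r \<noteq> r'" "heavy_hit H (buckets \<omega>) e r" for r r'
      using one[of e r r'] that peel_step.hyps(2) by auto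
    have "\<bar>v - x e\<bar> \<le> light_error x ?L \<omega> e + ?s"
      unfolding peel_step.hyps(9) Ceq[symmetric]
      by (rule peel_step_error[OF S D peel_step.hyps(2) H one' peel_step.hyps(3-8)])
    also have "light_error x ?L \<omega> e \<le> ?N"
      using True finC by (intro member_le_sum light_error_nonneg)
    finally have v: "\<bar>v - x e\<bar> \<le> ?N + ?s" by simp
    have ins: "insert e D \<inter> ?C a = insert e (D \<inter> ?C a)" "e \<notin> D \<inter> ?C a" using True peel_step.hyps by auto
    have "(\<Sum>f\<in>insert e D \<inter> ?C a. \<bar>(est(e := v)) f - x f\<bar>) = \<bar>v - x e\<bar> + (\<Sum>f\<in>D \<inter> ?C a. \<bar>(est(e := v)) f - x f\<bar>)"
      unfolding ins(1) using ins(2) fin by (subst sum.insert) auto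
    also have "(\<Sum>f\<in>D \<inter> ?C a. \<bar>(est(e := v)) f - x f\<bar>) = ?s"
      using ins(2) by (intro sum.cong) auto
    also have "\<bar>v - x e\<bar> + ?s \<le> ?N + 2 * ?s" using v by simp
    also have "\<dots> \<le> ?N + 2 * ((2 ^ card (D \<inter> ?C a) - 1) * ?N)" using peel_step.IH by simp
    also have "\<dots> = (2 ^ card (insert e D \<inter> ?C a) - 1) * ?N"
      unfolding ins(1) using ins(2) fin by (simp add: algebra_simps)
    finally show ?thesis .
  qed
qed

lemma card_le_power2: "real m \<le> 2 ^ m"
  by (metis less_exp less_imp_le of_nat_le_iff of_nat_numeral of_nat_power)

text \<open>For a component of size \<open>c\<close>, squaring the factor \<open>2 ^ c\<close> gives
  \<open>4 ^ c\<close>, Cauchy-Schwarz over the component costs \<open>c \<le> 2 ^ c\<close>, and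
  charging the errors of all \<open>c\<close> elements to each source costs another
  \<open>2 ^ c\<close>, altogether \<open>16 ^ c\<close>. The leading 5 is Cauchy-Schwarz over the
  rows.\<close>

lemma peel_total_error:
  assumes S: "S \<subseteq> {..<n}" and H: "H \<subseteq> {..<n} - S"
    and one: "\<And>e r r'. e \<in> S \<Longrightarrow> r < 5 \<Longrightarrow> r' < 5 \<Longrightarrow> r \<noteq> r' \<Longrightarrow> heavy_hit H (buckets \<omega>) e r \<Longrightarrow> \<not> heavy_hit H (buckets \<omega>) e r'"
    and p: "peel n x \<omega> S S est"
  shows "(\<Sum>e\<in>S. (est e - x e)\<^sup>2) \<le>
    5 * (\<Sum>r<5. \<Sum>f\<in>S. 16 ^ card (component (buckets \<omega>) S f) * (noise x ({..<n} - S - H) \<omega> r (buckets \<omega> r f))\<^sup>2)"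
proof -
  let ?C = "component (buckets \<omega>) S" and ?L = "{..<n} - S - H"
  let ?l = "light_error x ?L \<omega>"
  have fin: "finite S" using finite_subset[OF S] by auto
  have finC: "finite (?C e)" "?C e \<subseteq> S" if "e \<in> S" for e using component_subset[OF that] finite_subset[OF component_subset[OF that] fin] by auto
  have one_e: "(est e - x e)\<^sup>2 \<le> (\<Sum>f\<in>?C e. 8 ^ card (?C f) * (?l f)\<^sup>2)" if e: "e \<in> S" for e
  proof -
    have SC: "S \<inter> ?C e = ?C e" using finC[OF e] by auto
    have "\<bar>est e - x e\<bar> \<le> (\<Sum>f\<in>S \<inter> ?C e. \<bar>est f - x f\<bar>)"
      unfolding SC using finC[OF e] component_refl by (intro member_le_sum) auto
    also have "\<dots> \<le> (2 ^ card (?C e) - 1) * (\<Sum>f\<in>?C e. ?l f)"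
      using peel_error[OF S H one p e] unfolding SC by simp
    also have "\<dots> \<le> 2 ^ card (?C e) * (\<Sum>f\<in>?C e. ?l f)"
      by (intro mult_right_mono sum_nonneg light_error_nonneg) auto
    finally have "\<bar>est e - x e\<bar>\<^sup>2 \<le> (2 ^ card (?C e) * (\<Sum>f\<in>?C e. ?l f))\<^sup>2" by (intro power_mono) auto
    also have "\<dots> = 4 ^ card (?C e) * (\<Sum>f\<in>?C e. ?l f)\<^sup>2"
      by (simp add: power_mult_distrib power2_eq_square flip: power_mult_distrib)
    also have "\<dots> \<le> 4 ^ card (?C e) * ((\<Sum>f\<in>?C e. (?l f)\<^sup>2) * card (?C e))"
      by (intro mult_left_mono sum_squared_le_sum_of_squares) auto
    also have "\<dots> \<le> 4 ^ card (?C e) * ((\<Sum>f\<in>?C e. (?l f)\<^sup>2) * 2 ^ card (?C e))"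
      by (intro mult_left_mono card_le_power2 sum_nonneg) auto
    also have "\<dots> = (4 * 2) ^ card (?C e) * (\<Sum>f\<in>?C e. (?l f)\<^sup>2)" unfolding power_mult_distrib by simp
    also have "\<dots> = (\<Sum>f\<in>?C e. 8 ^ card (?C f) * (?l f)\<^sup>2)"
      unfolding sum_distrib_left by (rule sum.cong) (auto dest: component_eq)
    finally show ?thesis by simp
  qed
  have "(\<Sum>e\<in>S. (est e - x e)\<^sup>2) \<le> (\<Sum>e\<in>S. \<Sum>f\<in>?C e. 8 ^ card (?C f) * (?l f)\<^sup>2)"
    by (rule sum_mono) (rule one_e)
  also have "\<dots> = (\<Sum>e\<in>S. \<Sum>f\<in>S. if f \<in> ?C e then 8 ^ card (?C f) * (?l f)\<^sup>2 else 0)"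
  proof (rule sum.cong[OF refl])
    fix e assume "e \<in> S"
    then have "S \<inter> {f. f \<in> ?C e} = ?C e" using finC by auto
    then show "(\<Sum>f\<in>?C e. 8 ^ card (?C f) * (?l f)\<^sup>2) = (\<Sum>f\<in>S. if f \<in> ?C e then 8 ^ card (?C f) * (?l f)\<^sup>2 else 0)"
      using fin by (simp add: sum.If_cases)
  qed
  also have "\<dots> = (\<Sum>f\<in>S. \<Sum>e\<in>S. if f \<in> ?C e then 8 ^ card (?C f) * (?l f)\<^sup>2 else 0)" by (rule sum.swap)
  also have "\<dots> \<le> (\<Sum>f\<in>S. 16 ^ card (?C f) * (?l f)\<^sup>2)"
  proof (rule sum_mono)
    fix f assume f: "f \<in> S"
    \<comment> \<open>Membership in a component is symmetric, so \<open>f\<close> is counted once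
      for each element of its own component.\<close>
    have "S \<inter> {e. f \<in> ?C e} = ?C f"
      using finC[OF f] component_eq component_refl by fast
    then have "(\<Sum>e\<in>S. if f \<in> ?C e then 8 ^ card (?C f) * (?l f)\<^sup>2 else 0) = card (?C f) * (8 ^ card (?C f) * (?l f)\<^sup>2)"
      using fin by (simp add: sum.If_cases)
    also have "\<dots> \<le> 2 ^ card (?C f) * (8 ^ card (?C f) * (?l f)\<^sup>2)"
      by (intro mult_right_mono card_le_power2) auto
    also have "\<dots> = (2 * 8) ^ card (?C f) * (?l f)\<^sup>2" unfolding power_mult_distrib by simp
    finally show "(\<Sum>e\<in>S. if f \<in> ?C e then 8 ^ card (?C f) * (?l f)\<^sup>2 else 0) \<le> 16 ^ card (?C f) * (?l f)\<^sup>2" by simp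
  qed
  also have "\<dots> \<le> (\<Sum>f\<in>S. 16 ^ card (?C f) * (5 * (\<Sum>r<5. (noise x ?L \<omega> r (buckets \<omega> r f))\<^sup>2)))"
  proof (intro sum_mono mult_left_mono)
    fix f
    have "(?l f)\<^sup>2 \<le> (\<Sum>r<5. \<bar>noise x ?L \<omega> r (buckets \<omega> r f)\<bar>\<^sup>2) * card {..<5::nat}"
      unfolding light_error_def by (rule sum_squared_le_sum_of_squares)
    then show "(?l f)\<^sup>2 \<le> 5 * (\<Sum>r<5. (noise x ?L \<omega> r (buckets \<omega> r f))\<^sup>2)" by simp
  qed simp
  also have "\<dots> = (\<Sum>f\<in>S. \<Sum>r<5. 5 * (16 ^ card (?C f) * (noise x ?L \<omega> r (buckets \<omega> r f))\<^sup>2))"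
    by (simp add: sum_distrib_left mult_ac)
  also have "\<dots> = (\<Sum>r<5. \<Sum>f\<in>S. 5 * (16 ^ card (?C f) * (noise x ?L \<omega> r (buckets \<omega> r f))\<^sup>2))" by (rule sum.swap)
  finally show ?thesis by (simp add: sum_distrib_left)
qed

text \<open>The elements left over when no step is possible would form a stopping set.\<close>

lemma peel_complete:
  assumes "peel n x \<omega> S D est" "\<And>e. e \<in> S - D \<Longrightarrow> card (isolated (buckets \<omega>) (S - D) e) < 3"
    and "\<not> (\<exists>U\<subseteq>S. stopping (buckets \<omega>) U)"
  shows "D = S"
proof (rule ccontr)
  assume "D \<noteq> S"
  then have "S - D \<noteq> {}" using peel_subset[OF assms(1)] by auto
  then have "stopping (buckets \<omega>) (S - D)" using assms(2) by (auto simp: stopping_def)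
  then show False using assms(3) by blast
qed

section \<open>Failure probability of a set query\<close>

lemma component_cong:
  assumes "\<And>e r. e \<in> S \<Longrightarrow> bk r e = bk' r e"
  shows "component bk S e = component bk' S e"
proof -
  have "{(a, b). a \<in> S \<and> b \<in> S \<and> collide bk a b} = {(a, b). a \<in> S \<and> b \<in> S \<and> collide bk' a b}"
    using assms by (auto simp: collide_def)
  then show ?thesis by (simp add: component_def)
qed

lemma stopping_cong:
  assumes "\<And>e r. e \<in> U \<Longrightarrow> bk r e = bk' r e"
  shows "stopping bk U = stopping bk' U"
proof -
  have "isolated bk U e = isolated bk' U e" if "e \<in> U" for e
    using assms that by (auto simp: isolated_def)
  then show ?thesis by (simp add: stopping_def)
qed

text \<open>This turns the weighted error over queried elements into a weighted energy over buckets,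
  the form to which \<open>prob_noise\<close> applies.\<close>

lemma sum_over_buckets:
  fixes W :: "nat \<Rightarrow> real" and h :: "nat \<Rightarrow> nat" and B :: nat
  assumes "finite S" "\<And>f. f \<in> S \<Longrightarrow> h f < B"
  shows "(\<Sum>f\<in>S. W f * G (h f)) = (\<Sum>\<beta><B. (\<Sum>f | f \<in> S \<and> h f = \<beta>. W f) * G \<beta>)"
proof -
  have "(\<Sum>f\<in>S. W f * G (h f)) = (\<Sum>\<beta><B. \<Sum>f | f \<in> S \<and> h f = \<beta>. W f * G (h f))"
    using assms by (intro sum.group[symmetric]) auto
  also have "\<dots> = (\<Sum>\<beta><B. (\<Sum>f | f \<in> S \<and> h f = \<beta>. W f) * G \<beta>)"
    unfolding sum_distrib_right by (intro sum.cong) auto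
  finally show ?thesis .
qed

text \<open>Elements of one bucket lie in one component, so there are at most \<open>c\<close> of
  them, all of weight \<open>16 ^ c\<close>. The squared sum is at most
  \<open>(2 ^ c * 16 ^ c)\<^sup>2 = 1024 ^ c\<close>, charged to a single element of the
  bucket.\<close>

lemma bucket_weight_sq:
  fixes g :: "nat \<Rightarrow> nat \<Rightarrow> nat \<times> bool" and B :: nat
  assumes S: "finite S" and B: "\<And>f. f \<in> S \<Longrightarrow> buckets g r f < B" and r: "r < 5"
  defines "c \<equiv> \<lambda>f. card (component (buckets g) S f)"
  shows "(\<Sum>\<beta><B. (\<Sum>f | f \<in> S \<and> buckets g r f = \<beta>. 16 ^ c f)\<^sup>2) \<le> (\<Sum>f\<in>S. (1024::real) ^ c f)"
proof -
  have "(\<Sum>f | f \<in> S \<and> buckets g r f = \<beta>. 16 ^ c f)\<^sup>2 \<le> (\<Sum>f | f \<in> S \<and> buckets g r f = \<beta>. (1024::real) ^ c f)" for \<beta>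
  proof (cases "{f. f \<in> S \<and> buckets g r f = \<beta>} = {}")
    case False
    then obtain a where a: "a \<in> S" "buckets g r a = \<beta>" by auto
    let ?bin = "{f. f \<in> S \<and> buckets g r f = \<beta>}"
    have sub: "?bin \<subseteq> component (buckets g) S a"
    proof clarsimp
      fix f assume "f \<in> S" "\<beta> = buckets g r f"
      then have "collide (buckets g) a f" using a r unfolding collide_def by metis
      then show "f \<in> component (buckets g) S a" using component_step[OF component_refl] a \<open>f \<in> S\<close> by metis
    qed
    have ceq: "c f = c a" if "f \<in> ?bin" for f
      unfolding c_def using component_eq[of f "buckets g" S a] sub that by auto
    have "card ?bin \<le> c a"
      unfolding c_def using sub finite_subset[OF component_subset[OF a(1)] S] by (intro card_mono)
    then have "(\<Sum>f\<in>?bin. (16::real) ^ c f) \<le> real (c a) * 16 ^ c a"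
      using ceq by (simp add: mult_right_mono)
    also have "\<dots> \<le> 2 ^ c a * 16 ^ c a" by (intro mult_right_mono card_le_power2) simp
    finally have "(\<Sum>f\<in>?bin. (16::real) ^ c f)\<^sup>2 \<le> (2 ^ c a * 16 ^ c a)\<^sup>2" by (intro power_mono sum_nonneg) auto
    also have "\<dots> = (2 * 16 * (2 * 16)) ^ c a" unfolding power_mult_distrib power2_eq_square by simp
    also have "\<dots> = (\<Sum>f\<in>{a}. 1024 ^ c f)" by simp
    also have "\<dots> \<le> (\<Sum>f\<in>?bin. 1024 ^ c f)" using a S by (intro sum_mono2) auto
    finally show ?thesis .
  next
    case True
    show ?thesis unfolding True by simp
  qed
  then have "(\<Sum>\<beta><B. (\<Sum>f | f \<in> S \<and> buckets g r f = \<beta>. (16::real) ^ c f)\<^sup>2) \<le> (\<Sum>\<beta><B. \<Sum>f | f \<in> S \<and> buckets g r f = \<beta>. (1024::real) ^ c f)"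
    by (intro sum_mono)
  also have "\<dots> = (\<Sum>f\<in>S. (1024::real) ^ c f)"
    by (rule sum.group) (use S B in auto)
  finally show ?thesis .
qed

definition set_query_good :: "nat \<Rightarrow> (nat \<Rightarrow> real) \<Rightarrow> nat set \<Rightarrow> real \<Rightarrow> (nat \<Rightarrow> nat \<Rightarrow> nat \<times> bool) \<Rightarrow> bool" where
  "set_query_good n x S \<delta> \<omega> \<longleftrightarrow> (\<forall>D est. peel n x \<omega> S D est \<longrightarrow>
     (\<forall>e\<in>S - D. card (isolated (buckets \<omega>) (S - D) e) < 3) \<longrightarrow>
     D = S \<and> (\<Sum>e\<in>S. (est e - x e)\<^sup>2) \<le> \<delta> * (\<Sum>j\<in>{..<n} - S. (x j)\<^sup>2))"

text \<open>\<open>g\<close> hashes the queried set, \<open>h\<close> the tail; the two are independent.\<close>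

definition bad_query :: "real \<Rightarrow> nat set \<Rightarrow> (nat \<Rightarrow> nat \<Rightarrow> nat \<times> bool) \<Rightarrow> bool" where
  "bad_query \<kappa> S g \<longleftrightarrow> (\<exists>U\<subseteq>S. stopping (buckets g) U) \<or> 12288 * real (card S) \<le> linked_sum 32 S g
     \<or> 6291456 * real (card S) * \<kappa> \<le> linked_sum 2048 S g"

text \<open>The total factor with which \<open>peel_total_error\<close> multiplies the squared noise
  of a bucket.\<close>

definition query_weight :: "nat set \<Rightarrow> (nat \<Rightarrow> nat \<Rightarrow> nat \<times> bool) \<Rightarrow> nat \<Rightarrow> nat \<Rightarrow> real" where
  "query_weight S g r \<beta> = (\<Sum>f | f \<in> S \<and> buckets g r f = \<beta>. 16 ^ card (component (buckets g) S f))"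

definition bad_tail where
  "bad_tail B x S H L g a h \<longleftrightarrow>
     (\<exists>f\<in>S. \<exists>r<5. \<exists>r'<5. r \<noteq> r' \<and> (\<exists>j\<in>H. buckets h r j = buckets g r f) \<and> (\<exists>j\<in>H. buckets h r' j = buckets g r' f))
     \<or> (\<exists>r<5. a < (\<Sum>\<beta><B. query_weight S g r \<beta> * (noise x L h r \<beta>)\<^sup>2))"

text \<open>The parameters 32 and 2048 are twice the bases 16 and 1024 of the weights and their
  squares. The first sum governs the mean of the noise and must stay linear in \<open>k\<close>, so
  it is held to twice its mean bound \<open>192 * 32 * k\<close> by Chebyshev. The second governs
  only the variance, where a factor \<kappa> is affordable: Markov at \<open>16 * \<kappa>\<close>
  times the mean bound \<open>192 * 2048 * k\<close> suffices.\<close>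

lemma prob_bad_query:
  fixes B :: nat
  assumes B: "B > 0" and S: "finite S" "card S > 0" and \<kappa>: "\<kappa> \<ge> 1" "\<kappa> \<le> real (card S)"
    and le: "2 ^ 30 * real (card S) \<le> real B"
  shows "measure_pmf.prob (hashes B S) {g. bad_query \<kappa> S g} \<le> 1 / (8 * \<kappa>)"
proof -
  let ?k = "real (card S)" and ?P = "measure_pmf.prob (hashes B S)"
  have k: "?k > 0" using S by simp
  have fin: "finite (set_pmf (hashes B S))" by (rule finite_hashes[OF B S(1)])
  have "?P {g. bad_query \<kappa> S g} \<le> ?P {g. \<exists>U\<subseteq>S. stopping (buckets g) U} +
      ?P {g. 12288 * ?k \<le> linked_sum 32 S g \<or> 6291456 * ?k * \<kappa> \<le> linked_sum 2048 S g}"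
    by (rule prob_disj) (auto simp: bad_query_def)
  also have "\<dots> \<le> ?P {g. \<exists>U\<subseteq>S. stopping (buckets g) U} +
      (?P {g. 12288 * ?k \<le> linked_sum 32 S g} + ?P {g. 6291456 * ?k * \<kappa> \<le> linked_sum 2048 S g})"
    by (intro add_left_mono prob_disj)
  also have "?P {g. \<exists>U\<subseteq>S. stopping (buckets g) U} \<le> 1 / (64 * \<kappa>)"
  proof -
    have "?P {g. \<exists>U\<subseteq>S. stopping (buckets g) U} \<le> 2 / real B"
      using le k by (intro prob_stopping B S) auto
    also have "\<dots> \<le> 2 / (2 ^ 30 * \<kappa>)"
      using le \<kappa> B by (intro divide_left_mono) auto
    also have "\<dots> \<le> 1 / (64 * \<kappa>)" using \<kappa> by (simp add: field_simps)
    finally show ?thesis .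
  qed
  also have "?P {g. 12288 * ?k \<le> linked_sum 32 S g} \<le> 1 / (64 * \<kappa>)"
  proof -
    have e: "expect (hashes B S) (linked_sum 32 S) \<le> 192 * 32 * ?k"
      using le k by (intro expect_linked_sum_le B S) auto
    have "?P {g. 12288 * ?k \<le> linked_sum 32 S g} \<le> ?P {g. 6144 * ?k \<le> \<bar>linked_sum 32 S g - expect (hashes B S) (linked_sum 32 S)\<bar>}"
      by (rule prob_mono) (use e in auto)
    also have "\<dots> \<le> (192 * (1 + 32)\<^sup>2 * ?k) / (6144 * ?k)\<^sup>2"
      using le k by (intro prob_chebyshev fin variance_linked_sum B S) auto
    also have "\<dots> \<le> 1 / (64 * ?k)" using k by (simp add: power2_eq_square field_simps)
    also have "\<dots> \<le> 1 / (64 * \<kappa>)" using \<kappa> k by (intro divide_left_mono) auto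
    finally show ?thesis .
  qed
  also have "?P {g. 6291456 * ?k * \<kappa> \<le> linked_sum 2048 S g} \<le> 1 / (16 * \<kappa>)"
  proof -
    have e: "expect (hashes B S) (linked_sum 2048 S) \<le> 192 * 2048 * ?k"
      using le k by (intro expect_linked_sum_le B S) auto
    have "?P {g. 6291456 * ?k * \<kappa> \<le> linked_sum 2048 S g} \<le> expect (hashes B S) (linked_sum 2048 S) / (6291456 * ?k * \<kappa>)"
      using k \<kappa> by (intro prob_markov fin) (auto simp: linked_sum_def intro!: sum_nonneg)
    also have "\<dots> \<le> (192 * 2048 * ?k) / (6291456 * ?k * \<kappa>)" using e k \<kappa> by (intro divide_right_mono) auto
    also have "\<dots> = 1 / (16 * \<kappa>)" using k \<kappa> by (simp add: field_simps)
    finally show ?thesis .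
  qed
  finally show ?thesis using \<kappa> by (simp add: field_simps)
qed

lemma hashes_bucket_less:
  assumes "B > 0" "finite S" "g \<in> set_pmf (hashes B S)" "f \<in> S" "r < 5"
  shows "buckets g r f < B"
proof -
  have "g f \<in> set_pmf (row_hash B)" using assms by (auto simp: set_Pi_pmf PiE_dflt_def)
  then have "g f r \<in> set_pmf (pmf_of_set ({..<B} \<times> UNIV))"
    using assms by (auto simp: row_hash_def set_Pi_pmf PiE_dflt_def)
  then show ?thesis using assms by (subst (asm) set_pmf_of_set) (auto simp: lessThan_empty_iff)
qed

text \<open>The heaviness threshold balances two errors. There are at most
  \<open>\<kappa>\<^sup>2 / \<epsilon>\<^sup>2\<close> heavy coordinates, so double hits have
  probability of order \<open>\<kappa> ^ 4 / k\<close>, which is \<open>1 / \<kappa> ^ 4\<close>.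
  For the light ones the dominant relative variance is of order \<open>\<kappa>\<close> from the
  squared weights times \<open>1 / \<kappa>\<^sup>2\<close> from the threshold, that is
  \<open>1 / \<kappa>\<close>.\<close>

lemma prob_bad_tail:
  fixes B :: nat and x :: "nat \<Rightarrow> real"
  assumes B: "B > 0" and S: "finite S" "card S > 0" and \<kappa>: "\<kappa> \<ge> 1" "\<kappa> ^ 8 = real (card S)"
    and \<epsilon>: "0 < \<epsilon>" "\<epsilon> < 1" and le: "2 ^ 48 * real (card S) \<le> \<epsilon>\<^sup>2 * real B"
    and g: "g \<in> set_pmf (hashes B S)" "\<not> bad_query \<kappa> S g"
    and T: "finite T" and \<tau>: "\<tau> = (\<Sum>j\<in>T. (x j)\<^sup>2)"
    and H: "H = {j\<in>T. \<epsilon>\<^sup>2 / \<kappa>\<^sup>2 * \<tau> < (x j)\<^sup>2}"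
  shows "measure_pmf.prob (hashes B T) {h. bad_tail B x S H (T - H) g (\<epsilon>\<^sup>2 / 100 * \<tau>) h} \<le> 1 / (8 * \<kappa>)"
proof -
  let ?k = "real (card S)" and ?L = "T - H" and ?P = "measure_pmf.prob (hashes B T)"
  let ?\<theta> = "\<epsilon>\<^sup>2 / \<kappa>\<^sup>2"
  have k: "?k > 0" using S by simp
  have \<tau>0: "\<tau> \<ge> 0" unfolding \<tau> by (intro sum_nonneg) auto
  have HT: "H \<subseteq> T" using H by auto
  have finH: "finite H" using T HT finite_subset by auto
  have \<theta>: "?\<theta> > 0" using \<epsilon> \<kappa> by simp
  have cH: "real (card H) \<le> 1 / ?\<theta>"
  proof (cases "\<tau> = 0")
    case True
    then have "(x j)\<^sup>2 = 0" if "j \<in> T" for j using \<tau> T that by (simp add: sum_nonneg_eq_0_iff)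
    then have "H = {}" unfolding H using True by auto
    then show ?thesis using \<theta> by simp
  next
    case False
    have "real (card H) * (?\<theta> * \<tau>) = (\<Sum>j\<in>H. ?\<theta> * \<tau>)" by simp
    also have "\<dots> \<le> (\<Sum>j\<in>H. (x j)\<^sup>2)" by (intro sum_mono) (auto simp: H)
    also have "\<dots> \<le> 1 * \<tau>" unfolding \<tau> using T HT by (simp add: sum_mono2)
    finally have "(real (card H) * ?\<theta>) * \<tau> \<le> 1 * \<tau>" by (simp only: mult.assoc)
    then have "real (card H) * ?\<theta> \<le> 1" by (rule mult_right_le_imp_le) (use False \<tau>0 in simp)
    then show ?thesis by (rule pos_le_divide_eq[OF \<theta>, THEN iffD2])
  qed
  have B\<epsilon>: "real B \<ge> 2 ^ 48 * ?k / \<epsilon>\<^sup>2" using le \<epsilon> by (simp add: field_simps)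
  have heavy: "?P {h. \<exists>f\<in>S. \<exists>r<5. \<exists>r'<5. r \<noteq> r' \<and> (\<exists>j\<in>H. buckets h r j = buckets g r f) \<and> (\<exists>j\<in>H. buckets h r' j = buckets g r' f)} \<le> 1 / (16 * \<kappa>)"
  proof -
    have "?P {h. \<exists>f\<in>S. \<exists>r<5. \<exists>r'<5. r \<noteq> r' \<and> (\<exists>j\<in>H. buckets h r j = buckets g r f) \<and> (\<exists>j\<in>H. buckets h r' j = buckets g r' f)}
      \<le> 25 * ?k * (real (card H) / real B)\<^sup>2"
      by (rule prob_heavy[OF B T HT S(1)])
    also have "\<dots> \<le> 25 * ?k * (1 / ?\<theta> / (2 ^ 48 * ?k / \<epsilon>\<^sup>2))\<^sup>2"
      using cH B\<epsilon> k \<epsilon> by (intro mult_left_mono power_mono frac_le) auto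
    also have "1 / ?\<theta> / (2 ^ 48 * ?k / \<epsilon>\<^sup>2) = \<kappa>\<^sup>2 / (2 ^ 48 * ?k)" using \<epsilon> by simp
    also have "25 * ?k * (\<kappa>\<^sup>2 / (2 ^ 48 * ?k))\<^sup>2 = 25 * \<kappa> ^ 4 / (2 ^ 96 * ?k)"
      using k by (simp add: power2_eq_square power4_eq_xxxx field_simps)
    also have "\<dots> = 25 / (2 ^ 96 * \<kappa> ^ 4)"
    proof -
      have "\<kappa> ^ 8 = \<kappa> ^ 4 * \<kappa> ^ 4" by (simp flip: power_add)
      then have k4: "?k = \<kappa> ^ 4 * \<kappa> ^ 4" using \<kappa>(2) by simp
      define y where "y = \<kappa> ^ 4"
      have "y > 0" using \<kappa>(1) by (simp add: y_def)
      then show ?thesis unfolding k4 y_def[symmetric] by simp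
    qed
    also have "\<dots> \<le> 25 / (2 ^ 96 * \<kappa>)"
      using \<kappa> power_increasing[of 1 4 \<kappa>] by (intro divide_left_mono mult_left_mono) auto
    also have "\<dots> \<le> 1 / (16 * \<kappa>)" using \<kappa> by (simp add: field_simps)
    finally show ?thesis .
  qed
  have light: "?P {h. \<epsilon>\<^sup>2 / 100 * \<tau> < (\<Sum>\<beta><B. query_weight S g r \<beta> * (noise x ?L h r \<beta>)\<^sup>2)} \<le> 1 / (80 * \<kappa>)" if r: "r < 5" for r
  \<comment> \<open>Without tail energy the permitted deviation is zero and Chebyshev is not
    applicable, but then there is no noise either.\<close>
  proof (cases "\<tau> = 0")
    case True
    then have "x j = 0" if "j \<in> T" for j using \<tau> T that by (simp add: sum_nonneg_eq_0_iff)
    then have "noise x ?L h r \<beta> = 0" for h \<beta> unfolding noise_def by (intro sum.neutral) auto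
    then show ?thesis using True \<kappa> by simp
  next
    case False
    then have \<tau>p: "\<tau> > 0" using \<tau>0 by simp
    have bl: "buckets g r f < B" if "f \<in> S" for f using hashes_bucket_less[OF B S(1) g(1) that r] .
    have w1: "sum (query_weight S g r) {..<B} \<le> 12288 * ?k"
    proof -
      have "sum (query_weight S g r) {..<B} = (\<Sum>f\<in>S. 16 ^ card (component (buckets g) S f) * 1)"
        unfolding query_weight_def using sum_over_buckets[OF S(1), of "buckets g r" B "\<lambda>f. 16 ^ card (component (buckets g) S f)" "\<lambda>_. 1"] bl by simp
      also have "\<dots> \<le> linked_sum (2 * 16) S g" using component_le_linked_sum[OF S(1), of 16 g] by simp
      finally show ?thesis using g(2) by (simp add: bad_query_def)
    qed
    have w2: "(\<Sum>\<beta><B. (query_weight S g r \<beta>)\<^sup>2) \<le> 6291456 * ?k * \<kappa>"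
    proof -
      have "(\<Sum>\<beta><B. (query_weight S g r \<beta>)\<^sup>2) \<le> (\<Sum>f\<in>S. 1024 ^ card (component (buckets g) S f))"
        unfolding query_weight_def by (rule bucket_weight_sq[OF S(1) _ r]) (rule bl)
      also have "\<dots> \<le> linked_sum (2 * 1024) S g" using component_le_linked_sum[OF S(1), of 1024 g] by simp
      finally show ?thesis using g(2) by (simp add: bad_query_def)
    qed
    \<comment> \<open>Half of the admissible noise is reserved for the mean, see \<open>m1\<close>,
      and half for the deviation.\<close>
    let ?t = "\<epsilon>\<^sup>2 / 200 * \<tau>" and ?M1 = "12288 * ?k" and ?M2 = "6291456 * ?k * \<kappa>" and ?h = "?\<theta> * \<tau>"
    have t: "?t > 0" using \<tau>p \<epsilon> by simp
    have m1: "?M1 * \<tau> / real B \<le> ?t"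
    proof -
      have "12288 * ?k / real B \<le> \<epsilon>\<^sup>2 / 200" using le B k \<epsilon> by (simp add: field_simps)
      then have "12288 * ?k / real B * \<tau> \<le> \<epsilon>\<^sup>2 / 200 * \<tau>" using \<tau>0 by (rule mult_right_mono)
      then show ?thesis by simp
    qed
    have "?P {h. \<epsilon>\<^sup>2 / 100 * \<tau> < (\<Sum>\<beta><B. query_weight S g r \<beta> * (noise x ?L h r \<beta>)\<^sup>2)}
      \<le> measure_pmf.prob (hashes B T) {h. ?M1 * \<tau> / real B + ?t \<le> (\<Sum>\<beta><B. query_weight S g r \<beta> * (noise x ?L h r \<beta>)\<^sup>2)}"
      by (rule prob_mono) (use m1 in simp)
    also have "\<dots> = measure_pmf.prob (hashes B ?L) {h. ?M1 * \<tau> / real B + ?t \<le> (\<Sum>\<beta><B. query_weight S g r \<beta> * (noise x ?L h r \<beta>)\<^sup>2)}"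
      unfolding prob_eq_expect
    proof (rule expect_Pi_subset[OF T])
      fix u v :: "nat \<Rightarrow> nat \<Rightarrow> nat \<times> bool" assume "\<And>j. j \<in> ?L \<Longrightarrow> u j = v j"
      then have "noise x ?L u r \<beta> = noise x ?L v r \<beta>" for \<beta> unfolding noise_def by (intro sum.cong) auto
      then show "of_bool (?M1 * \<tau> / real B + ?t \<le> (\<Sum>\<beta><B. query_weight S g r \<beta> * (noise x ?L u r \<beta>)\<^sup>2)) =
        (of_bool (?M1 * \<tau> / real B + ?t \<le> (\<Sum>\<beta><B. query_weight S g r \<beta> * (noise x ?L v r \<beta>)\<^sup>2)) :: real)" by simp
    qed auto
    also have "\<dots> \<le> (?M2 / real B * (?h * \<tau>) + 2 * ?M2 * \<tau>\<^sup>2 / (real B)\<^sup>2) / ?t\<^sup>2"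
    proof (rule prob_noise[OF B r _ w1 w2 _ _ _ t])
      show "(\<Sum>j\<in>?L. (x j)\<^sup>2) \<le> \<tau>" unfolding \<tau> using T by (intro sum_mono2) auto
      show "(x j)\<^sup>2 \<le> ?h" if "j \<in> ?L" for j using that by (auto simp: H)
    qed (use T \<theta> \<tau>0 in auto)
    also have "\<dots> \<le> 1 / (80 * \<kappa>)"
    proof -
      let ?u = "?k / (\<epsilon>\<^sup>2 * real B)"
      have u: "0 \<le> ?u" "?u \<le> 1 / 2 ^ 48" using le k \<epsilon> B by (auto simp: field_simps)
      have "(?M2 / real B * (?h * \<tau>) + 2 * ?M2 * \<tau>\<^sup>2 / (real B)\<^sup>2) / ?t\<^sup>2
        = 40000 * 6291456 * (?u / \<kappa> + 2 * (\<kappa> / ?k) * ?u\<^sup>2)"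
        using \<tau>p \<epsilon> B k \<kappa> by (simp add: power2_eq_square field_simps)
      also have "\<dots> \<le> 40000 * 6291456 * (1 / 2 ^ 48 / \<kappa> + 2 * (1 / \<kappa>) * (1 / 2 ^ 48)\<^sup>2)"
      proof -
        have "\<kappa> * \<kappa> \<le> \<kappa> ^ 8" using \<kappa> power_increasing[of 2 8 \<kappa>] by (simp add: power2_eq_square)
        then have "\<kappa> / ?k \<le> 1 / \<kappa>" using \<kappa> k by (simp add: field_simps)
        then show ?thesis using u \<kappa> k
          by (intro mult_left_mono add_mono divide_right_mono mult_mono power_mono) auto
      qed
      also have "\<dots> \<le> 1 / (80 * \<kappa>)" using \<kappa> by (simp add: field_simps power2_eq_square)
      finally show ?thesis .
    qed
    finally show ?thesis .
  qed
  have "?P {h. bad_tail B x S H ?L g (\<epsilon>\<^sup>2 / 100 * \<tau>) h} \<le>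
     ?P {h. \<exists>f\<in>S. \<exists>r<5. \<exists>r'<5. r \<noteq> r' \<and> (\<exists>j\<in>H. buckets h r j = buckets g r f) \<and> (\<exists>j\<in>H. buckets h r' j = buckets g r' f)} +
     ?P {h. \<exists>r<5. \<epsilon>\<^sup>2 / 100 * \<tau> < (\<Sum>\<beta><B. query_weight S g r \<beta> * (noise x ?L h r \<beta>)\<^sup>2)}"
    by (rule prob_disj) (simp add: bad_tail_def)
  also have "?P {h. \<exists>r<5. \<epsilon>\<^sup>2 / 100 * \<tau> < (\<Sum>\<beta><B. query_weight S g r \<beta> * (noise x ?L h r \<beta>)\<^sup>2)}
     \<le> (\<Sum>r<5. ?P {h. \<epsilon>\<^sup>2 / 100 * \<tau> < (\<Sum>\<beta><B. query_weight S g r \<beta> * (noise x ?L h r \<beta>)\<^sup>2)})"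
    by (rule prob_union_bound) auto
  also have "\<dots> \<le> (\<Sum>r<5::nat. 1 / (80 * \<kappa>))" by (intro sum_mono light) auto
  finally show ?thesis using heavy \<kappa> by (simp add: field_simps)
qed

text \<open>The factor 5 of \<open>peel_total_error\<close> and the five rows turn the bound
  \<open>\<epsilon>\<^sup>2 / 100\<close> per row into \<open>\<epsilon>\<^sup>2 / 4\<close>.
  Components and weights depend on \<open>g\<close> alone, noise values on \<open>h\<close>
  alone.\<close>

lemma set_query_good_merge:
  assumes S: "S \<subseteq> {..<n}" and B: "B > 0" and g: "g \<in> set_pmf (hashes B S)" and nq: "\<not> bad_query \<kappa> S g"
    and H: "H \<subseteq> {..<n} - S" and nt: "\<not> bad_tail B x S H ({..<n} - S - H) g (\<epsilon>\<^sup>2 / 100 * (\<Sum>j\<in>{..<n} - S. (x j)\<^sup>2)) h"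
  shows "set_query_good n x S (\<epsilon>\<^sup>2 / 4) (\<lambda>j. if j \<in> S then g j else h j)"
  unfolding set_query_good_def
proof (intro allI impI)
  let ?\<omega> = "\<lambda>j. if j \<in> S then g j else h j" and ?L = "{..<n} - S - H" and ?\<tau> = "\<Sum>j\<in>{..<n} - S. (x j)\<^sup>2"
  fix D est assume p: "peel n x ?\<omega> S D est" and stop: "\<forall>e\<in>S - D. card (isolated (buckets ?\<omega>) (S - D) e) < 3"
  have fin: "finite S" using finite_subset[OF S] by simp
  have "stopping (buckets ?\<omega>) U = stopping (buckets g) U" if "U \<subseteq> S" for U
    by (rule stopping_cong) (use that in auto)
  then have "\<not> (\<exists>U\<subseteq>S. stopping (buckets ?\<omega>) U)" using nq unfolding bad_query_def by blast
  with p stop have DS: "D = S" by (intro peel_complete) auto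
  have comp: "component (buckets ?\<omega>) S f = component (buckets g) S f" for f
    by (rule component_cong) auto
  have noise: "noise x ?L ?\<omega> r \<beta> = noise x ?L h r \<beta>" for r \<beta>
    unfolding noise_def by (intro sum.cong) auto
  have hh: "heavy_hit H (buckets ?\<omega>) e r \<longleftrightarrow> (\<exists>j\<in>H. buckets h r j = buckets g r e)" if "e \<in> S" for e r
  proof -
    have "j \<notin> S" if "j \<in> H" for j using H that by auto
    then show ?thesis using that unfolding heavy_hit_def by (intro bex_cong) auto
  qed
  have "(\<Sum>e\<in>S. (est e - x e)\<^sup>2) \<le> 5 * (\<Sum>r<5. \<Sum>f\<in>S. 16 ^ card (component (buckets ?\<omega>) S f) * (noise x ?L ?\<omega> r (buckets ?\<omega> r f))\<^sup>2)"
  proof (rule peel_total_error[OF S H _ p[unfolded DS]])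
    fix e r r' :: nat assume "e \<in> S" "r < 5" "r' < 5" "r \<noteq> r'" "heavy_hit H (buckets ?\<omega>) e r"
    moreover have "\<not> (\<exists>f\<in>S. \<exists>r<5. \<exists>r'<5. r \<noteq> r' \<and> (\<exists>j\<in>H. buckets h r j = buckets g r f) \<and> (\<exists>j\<in>H. buckets h r' j = buckets g r' f))"
      using nt unfolding bad_tail_def by (rule contrapos_nn) (rule disjI1)
    ultimately show "\<not> heavy_hit H (buckets ?\<omega>) e r'" unfolding hh[OF \<open>e \<in> S\<close>] by metis
  qed
  also have "\<dots> = 5 * (\<Sum>r<5. \<Sum>\<beta><B. query_weight S g r \<beta> * (noise x ?L h r \<beta>)\<^sup>2)"
  proof -
    have "(\<Sum>f\<in>S. 16 ^ card (component (buckets ?\<omega>) S f) * (noise x ?L ?\<omega> r (buckets ?\<omega> r f))\<^sup>2)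
        = (\<Sum>\<beta><B. query_weight S g r \<beta> * (noise x ?L h r \<beta>)\<^sup>2)" if "r < 5" for r
    proof -
      have "(\<Sum>f\<in>S. 16 ^ card (component (buckets ?\<omega>) S f) * (noise x ?L ?\<omega> r (buckets ?\<omega> r f))\<^sup>2)
        = (\<Sum>f\<in>S. 16 ^ card (component (buckets g) S f) * (noise x ?L h r (buckets g r f))\<^sup>2)"
        unfolding comp noise by (intro sum.cong) auto
      also have "\<dots> = (\<Sum>\<beta><B. query_weight S g r \<beta> * (noise x ?L h r \<beta>)\<^sup>2)"
        unfolding query_weight_def
        by (rule sum_over_buckets[OF fin]) (rule hashes_bucket_less[OF B fin g _ that])
      finally show ?thesis .
    qed
    then show ?thesis by simp
  qed
  also have "\<dots> \<le> 5 * (\<Sum>r<5::nat. \<epsilon>\<^sup>2 / 100 * ?\<tau>)"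
  proof (intro mult_left_mono sum_mono)
    fix r assume "r \<in> {..<5::nat}"
    then have "\<not> \<epsilon>\<^sup>2 / 100 * ?\<tau> < (\<Sum>\<beta><B. query_weight S g r \<beta> * (noise x ?L h r \<beta>)\<^sup>2)"
      using nt unfolding bad_tail_def by blast
    then show "(\<Sum>\<beta><B. query_weight S g r \<beta> * (noise x ?L h r \<beta>)\<^sup>2) \<le> \<epsilon>\<^sup>2 / 100 * ?\<tau>" by simp
  qed simp
  finally have "(\<Sum>e\<in>S. (est e - x e)\<^sup>2) \<le> \<epsilon>\<^sup>2 / 4 * ?\<tau>" by simp
  then show "D = S \<and> (\<Sum>e\<in>S. (est e - x e)\<^sup>2) \<le> \<epsilon>\<^sup>2 / 4 * ?\<tau>" using DS by simp
qed

text \<open>The hashes of \<open>S\<close> are drawn first. Once they are good, the buckets and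
  weights of the queried elements are constants in the experiment that draws the hashes of the
  tail.\<close>

lemma prob_set_query:
  fixes B n :: nat and x :: "nat \<Rightarrow> real"
  assumes S: "S \<subseteq> {..<n}" "card S > 0" and \<kappa>: "\<kappa> \<ge> 1" "\<kappa> ^ 8 = real (card S)"
    and \<epsilon>: "0 < \<epsilon>" "\<epsilon> < 1" and le: "2 ^ 48 * real (card S) \<le> \<epsilon>\<^sup>2 * real B"
  shows "measure_pmf.prob (hashes B {..<n}) {\<omega>. \<not> set_query_good n x S (\<epsilon>\<^sup>2 / 4) \<omega>} \<le> 1 / (4 * \<kappa>)"
proof -
  have fin: "finite S" using finite_subset[OF S(1)] by simp
  have "0 < 2 ^ 48 * real (card S)" using S by simp
  then have B: "B > 0" using le \<epsilon> by (auto intro!: gr0I)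
  let ?T = "{..<n} - S"
  have U: "{..<n} = S \<union> ?T" using S by auto
  define H where "H = {j\<in>?T. \<epsilon>\<^sup>2 / \<kappa>\<^sup>2 * (\<Sum>j\<in>?T. (x j)\<^sup>2) < (x j)\<^sup>2}"
  let ?m = "\<lambda>g h j. if j \<in> S then g j else h j"
  have finr: "finite (set_pmf (row_hash B))" by (rule finite_row_hash[OF B])
  have finS: "finite (set_pmf (hashes B S))" by (rule finite_hashes[OF B fin])
  have \<kappa>k: "\<kappa> \<le> real (card S)" using \<kappa> power_increasing[of 1 8 \<kappa>] by simp
  have "\<epsilon>\<^sup>2 \<le> 1" using \<epsilon> by (simp add: power_le_one)
  then have "\<epsilon>\<^sup>2 * real B \<le> real B" by (simp add: mult_left_le_one_le)
  moreover have "(2::real) ^ 30 * real (card S) \<le> 2 ^ 48 * real (card S)" by (intro mult_right_mono) auto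
  ultimately have leB: "2 ^ 30 * real (card S) \<le> real B" using le by linarith
  have "measure_pmf.prob (hashes B {..<n}) {\<omega>. \<not> set_query_good n x S (\<epsilon>\<^sup>2 / 4) \<omega>}
    = expect (hashes B (S \<union> ?T)) (\<lambda>\<omega>. of_bool (\<not> set_query_good n x S (\<epsilon>\<^sup>2 / 4) \<omega>))"
    unfolding prob_eq_expect U[symmetric] ..
  also have "\<dots> = expect (hashes B S) (\<lambda>g. measure_pmf.prob (hashes B ?T) {h. \<not> set_query_good n x S (\<epsilon>\<^sup>2 / 4) (?m g h)})"
    unfolding prob_eq_expect by (rule expect_Pi_union) (use fin finr in auto)
  also have "\<dots> \<le> expect (hashes B S) (\<lambda>g. of_bool (bad_query \<kappa> S g) + 1 / (8 * \<kappa>))"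
  proof (rule expect_mono[OF finS])
    fix g assume g: "g \<in> set_pmf (hashes B S)"
    show "measure_pmf.prob (hashes B ?T) {h. \<not> set_query_good n x S (\<epsilon>\<^sup>2 / 4) (?m g h)} \<le> of_bool (bad_query \<kappa> S g) + 1 / (8 * \<kappa>)"
    proof (cases "bad_query \<kappa> S g")
      case True
      have "measure_pmf.prob (hashes B ?T) {h. \<not> set_query_good n x S (\<epsilon>\<^sup>2 / 4) (?m g h)} \<le> 1" by simp
      moreover have "0 \<le> 1 / (8 * \<kappa>)" using \<kappa>(1) by (intro divide_nonneg_nonneg) auto
      moreover have "of_bool (bad_query \<kappa> S g) = (1 :: real)" using True by simp
      ultimately show ?thesis by linarith
    next
      case False
      have "measure_pmf.prob (hashes B ?T) {h. \<not> set_query_good n x S (\<epsilon>\<^sup>2 / 4) (?m g h)}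
        \<le> measure_pmf.prob (hashes B ?T) {h. bad_tail B x S H (?T - H) g (\<epsilon>\<^sup>2 / 100 * (\<Sum>j\<in>?T. (x j)\<^sup>2)) h}"
        by (rule prob_mono) (use set_query_good_merge[OF S(1) B g False, of H] in \<open>auto simp: H_def\<close>)
      also have "\<dots> \<le> 1 / (8 * \<kappa>)"
        by (rule prob_bad_tail[OF B fin S(2) \<kappa> \<epsilon> le g False _ refl]) (auto simp: H_def)
      finally show ?thesis using False by simp
    qed
  qed
  also have "\<dots> = measure_pmf.prob (hashes B S) {g. bad_query \<kappa> S g} + 1 / (8 * \<kappa>)"
    unfolding prob_eq_expect by (simp add: expect_add[OF finS])
  also have "\<dots> \<le> 1 / (8 * \<kappa>) + 1 / (8 * \<kappa>)"
    by (intro add_right_mono prob_bad_query B fin S(2) \<kappa>(1) \<kappa>k leB)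
  finally show ?thesis using \<kappa> by (simp add: field_simps)
qed

section \<open>Approximate medians and top blocks\<close>

text \<open>Rank inside the group of \<open>g\<close> consecutive positions that contains
  \<open>e\<close>. Breaking ties by position makes ranks within a group distinct.\<close>

definition grank :: "(nat \<Rightarrow> real) \<Rightarrow> nat \<Rightarrow> nat \<Rightarrow> nat" where
  "grank Z g e = card {e'. e' div g = e div g \<and> (Z e' < Z e \<or> Z e' = Z e \<and> e' < e)}"

text \<open>From every sorted group only the ranks 0, 4, 8, ... survive, giving
  \<open>g div 4\<close> values per group. The described position exists and is unique by
  \<open>bij_grank\<close> when \<open>g\<close> is a positive multiple of 4.\<close>

definition thin :: "(nat \<Rightarrow> real) \<Rightarrow> nat \<Rightarrow> nat \<Rightarrow> real" where
  "thin Z g q = Z (THE e. e div g = q div (g div 4) \<and> grank Z g e = 4 * (q mod (g div 4)))"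

text \<open>
  Sorting groups of size \<open>g\<close> by counting costs \<open>g\<close> per element; since thinning divides the length
  by 4 while \<open>g\<close> only doubles, the total cost stays linear, and the rank errors \<open>3/g\<close> form a
  geometric series.
\<close>

primrec approx_median :: "nat \<Rightarrow> nat \<Rightarrow> (nat \<Rightarrow> real) \<Rightarrow> real" where
  "approx_median 0 g Z = thin Z g (g div 8)"
| "approx_median (Suc h) g Z = approx_median h (2 * g) (thin Z g)"

lemma group_eq:
  fixes g :: nat
  assumes "0 < g" shows "{e. e div g = \<gamma>} = {\<gamma> * g..<\<gamma> * g + g}"
proof (rule Set.set_eqI)
  fix e
  have "e = e div g * g + e mod g" "e mod g < g" using assms by simp_all
  then have "e \<in> {\<gamma> * g..<\<gamma> * g + g}" if "e div g = \<gamma>" using that by auto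
  moreover have "e div g = \<gamma>" if "e \<in> {\<gamma> * g..<\<gamma> * g + g}"
    using that by (intro div_nat_eqI) (auto simp: mult.commute)
  ultimately show "e \<in> {e. e div g = \<gamma>} \<longleftrightarrow> e \<in> {\<gamma> * g..<\<gamma> * g + g}" by blast
qed

lemma finite_group:
  fixes g :: nat
  assumes "0 < g" shows "finite {e. e div g = \<gamma> \<and> P e}"
  by (rule finite_subset[of _ "{\<gamma> * g..<\<gamma> * g + g}"]) (use group_eq[OF assms, of \<gamma>] in auto)

lemma card_group: "0 < g \<Longrightarrow> card {e. e div g = \<gamma>} = g" for g :: nat
  by (simp add: group_eq)

lemma grank_less: "0 < g \<Longrightarrow> grank Z g e < g"
proof -
  assume g: "0 < g"
  have "grank Z g e \<le> card ({e'. e' div g = e div g} - {e})"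
    unfolding grank_def by (rule card_mono) (use finite_group[OF g, of "e div g" "\<lambda>_. True"] in auto)
  also have "\<dots> < g" using card_group[OF g, of "e div g"] finite_group[OF g, of "e div g" "\<lambda>_. True"] g
    by (simp add: card_Diff_singleton)
  finally show ?thesis .
qed

lemma grank_mono:
  assumes "0 < g" "e div g = f div g" "Z e < Z f \<or> Z e = Z f \<and> e < f"
  shows "grank Z g e < grank Z g f"
  unfolding grank_def
proof (rule psubset_card_mono)
  show "finite {e'. e' div g = f div g \<and> (Z e' < Z f \<or> Z e' = Z f \<and> e' < f)}" by (rule finite_group[OF assms(1)])
  show "{e'. e' div g = e div g \<and> (Z e' < Z e \<or> Z e' = Z e \<and> e' < e)} \<subset> {e'. e' div g = f div g \<and> (Z e' < Z f \<or> Z e' = Z f \<and> e' < f)}"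
    using assms(2,3) by (intro psubsetI) (auto simp: set_eq_iff)
qed

lemma bij_grank:
  assumes "0 < g" shows "bij_betw (grank Z g) {e. e div g = \<gamma>} {..<g}"
proof -
  have inj: "inj_on (grank Z g) {e. e div g = \<gamma>}"
  proof (rule inj_onI)
    fix e f assume ef: "e \<in> {e. e div g = \<gamma>}" "f \<in> {e. e div g = \<gamma>}" "grank Z g e = grank Z g f"
    show "e = f"
    proof (rule ccontr)
      assume "e \<noteq> f"
      then have "(Z e < Z f \<or> Z e = Z f \<and> e < f) \<or> (Z f < Z e \<or> Z f = Z e \<and> f < e)" by linarith
      then show False using grank_mono[OF assms, of e f Z] grank_mono[OF assms, of f e Z] ef by auto
    qed
  qed
  moreover have "grank Z g ` {e. e div g = \<gamma>} = {..<g}"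
  proof (rule card_subset_eq)
    show "grank Z g ` {e. e div g = \<gamma>} \<subseteq> {..<g}" using grank_less[OF assms] by auto
    show "card (grank Z g ` {e. e div g = \<gamma>}) = card {..<g}" using inj assms by (simp add: card_image card_group)
  qed simp
  ultimately show ?thesis by (simp add: bij_betw_def)
qed

lemma thin_eq:
  assumes g: "0 < g" and e: "e div g = q div (g div 4)" "grank Z g e = 4 * (q mod (g div 4))"
  shows "thin Z g q = Z e"
proof -
  have "(THE e. e div g = q div (g div 4) \<and> grank Z g e = 4 * (q mod (g div 4))) = e"
  proof (rule the_equality)
    fix f assume f: "f div g = q div (g div 4) \<and> grank Z g f = 4 * (q mod (g div 4))"
    have "inj_on (grank Z g) {e. e div g = q div (g div 4)}"
      using bij_grank[OF g] by (rule bij_betw_imp_inj_on)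
    moreover have "grank Z g f = grank Z g e" using e(2) conjunct2[OF f] by (rule trans[OF _ sym, rotated])
    moreover have "f \<in> {e. e div g = q div (g div 4)}" using conjunct1[OF f] by (rule CollectI)
    moreover have "e \<in> {e. e div g = q div (g div 4)}" using e(1) by (rule CollectI)
    ultimately show "f = e" by (rule inj_onD)
  qed (use e in simp)
  then show ?thesis by (simp add: thin_def)
qed

lemma thin_ex:
  assumes g: "0 < g" "4 dvd g"
  obtains e where "e div g = q div (g div 4)" "grank Z g e = 4 * (q mod (g div 4))" "thin Z g q = Z e"
proof -
  have "q mod (g div 4) < g div 4" using g by (intro mod_less_divisor) (auto elim!: dvdE)
  then have "4 * (q mod (g div 4)) \<in> {..<g}" using g by (auto elim!: dvdE)
  then have "4 * (q mod (g div 4)) \<in> grank Z g ` {e. e div g = q div (g div 4)}"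
    by (simp only: bij_betw_imp_surj_on[OF bij_grank[OF g(1)]])
  then obtain e where e: "4 * (q mod (g div 4)) = grank Z g e" "e \<in> {e. e div g = q div (g div 4)}"
    by (rule imageE)
  then have "e div g = q div (g div 4)" "grank Z g e = 4 * (q mod (g div 4))" by simp_all
  then show ?thesis using thin_eq[OF g(1)] by (intro that)
qed

text \<open>The entries satisfying a downward closed property occupy an initial segment of the
  ranks.\<close>

lemma grank_low:
  assumes g: "0 < g" and P: "\<And>a b. a \<le> b \<Longrightarrow> P b \<Longrightarrow> P a" and e: "e div g = \<gamma>"
  shows "P (Z e) \<longleftrightarrow> grank Z g e < card {e. e div g = \<gamma> \<and> P (Z e)}"
proof
  assume Pe: "P (Z e)"
  have "{e'. e' div g = e div g \<and> (Z e' < Z e \<or> Z e' = Z e \<and> e' < e)} \<subset> {e. e div g = \<gamma> \<and> P (Z e)}"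
  proof
    show "{e'. e' div g = e div g \<and> (Z e' < Z e \<or> Z e' = Z e \<and> e' < e)} \<subseteq> {e. e div g = \<gamma> \<and> P (Z e)}"
      using Pe e P[of _ "Z e"] by auto
    show "{e'. e' div g = e div g \<and> (Z e' < Z e \<or> Z e' = Z e \<and> e' < e)} \<noteq> {e. e div g = \<gamma> \<and> P (Z e)}"
      using Pe e by blast
  qed
  then show "grank Z g e < card {e. e div g = \<gamma> \<and> P (Z e)}"
    unfolding grank_def by (rule psubset_card_mono[OF finite_group[OF g]])
next
  assume l: "grank Z g e < card {e. e div g = \<gamma> \<and> P (Z e)}"
  show "P (Z e)"
  proof (rule ccontr)
    assume n: "\<not> P (Z e)"
    have "{e. e div g = \<gamma> \<and> P (Z e)} \<subseteq> {e'. e' div g = e div g \<and> (Z e' < Z e \<or> Z e' = Z e \<and> e' < e)}"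
    proof clarify
      fix f assume f: "P (Z f)" "\<gamma> = f div g"
      then have "Z f < Z e" using P[of "Z e" "Z f"] n by (meson not_le)
      then show "f div g = e div g \<and> (Z f < Z e \<or> Z f = Z e \<and> f < e)" using e f by simp
    qed
    then have "card {e. e div g = \<gamma> \<and> P (Z e)} \<le> grank Z g e"
      unfolding grank_def by (rule card_mono[OF finite_group[OF g]])
    then show False using l by simp
  qed
qed

text \<open>An estimate can fail by being too small or too large; both failures are rays of the real
  line and are treated together.\<close>

definition one_sided :: "(real \<Rightarrow> bool) \<Rightarrow> bool" where
  "one_sided P \<longleftrightarrow> (\<forall>a b. a \<le> b \<longrightarrow> P b \<longrightarrow> P a) \<or> (\<forall>a b. a \<le> b \<longrightarrow> P a \<longrightarrow> P b)"

lemma one_sided_rank: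
  fixes Z :: "nat \<Rightarrow> real" and g \<gamma> :: nat
  assumes g: "0 < g" and P: "one_sided P"
  obtains "\<And>e. e div g = \<gamma> \<Longrightarrow> P (Z e) \<longleftrightarrow> grank Z g e < card {e. e div g = \<gamma> \<and> P (Z e)}"
  | "\<And>e. e div g = \<gamma> \<Longrightarrow> P (Z e) \<longleftrightarrow> g \<le> grank Z g e + card {e. e div g = \<gamma> \<and> P (Z e)}"
proof (cases "\<forall>a b. a \<le> b \<longrightarrow> P b \<longrightarrow> P a")
  case True
  then have low: "\<And>a b. a \<le> b \<Longrightarrow> P b \<Longrightarrow> P a" by blast
  show ?thesis by (rule that(1)) (rule grank_low[where P=P, OF g low])
next
  case False
  then have up: "\<And>a b. a \<le> b \<Longrightarrow> \<not> P b \<Longrightarrow> \<not> P a" using P unfolding one_sided_def by blast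
  have "{e. e div g = \<gamma> \<and> P (Z e)} \<union> {e. e div g = \<gamma> \<and> \<not> P (Z e)} = {e. e div g = \<gamma>}" by auto
  then have c: "card {e. e div g = \<gamma> \<and> P (Z e)} + card {e. e div g = \<gamma> \<and> \<not> P (Z e)} = g"
    using card_Un_disjoint[OF finite_group[OF g, of \<gamma> "\<lambda>e. P (Z e)"] finite_group[OF g, of \<gamma> "\<lambda>e. \<not> P (Z e)"]]
      card_group[OF g, of \<gamma>] by (simp add: disjoint_iff)
  have "P (Z e) \<longleftrightarrow> g \<le> grank Z g e + card {e. e div g = \<gamma> \<and> P (Z e)}" if e: "e div g = \<gamma>" for e
  proof -
    have "\<not> P (Z e) \<longleftrightarrow> grank Z g e < card {e. e div g = \<gamma> \<and> \<not> P (Z e)}"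
      by (rule grank_low[where P="\<lambda>a. \<not> P a", OF g up e])
    then show ?thesis using c by linarith
  qed
  then show ?thesis by (rule that(2))
qed

text \<open>If the \<open>c\<close> entries with \<open>P\<close> have the lowest ranks, the
  multiples of 4 among these ranks number \<open>c / 4\<close> rounded up; if they have the highest
  ranks, \<open>c / 4\<close> rounded down, because \<open>g\<close> is a multiple of 4. The loss is
  thus at most 3 before division by 4.\<close>

lemma card_thin_group:
  assumes g: "0 < g" "4 dvd g" and P: "one_sided P"
  shows "4 * card {q. q div (g div 4) = \<gamma> \<and> P (thin Z g q)} \<le> card {e. e div g = \<gamma> \<and> P (Z e)} + 3"
proof -
  let ?c = "card {e. e div g = \<gamma> \<and> P (Z e)}" and ?w = "g div 4"
  have w: "0 < ?w" "4 * ?w = g" using g by (auto elim!: dvdE)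
  let ?Q = "{q. q div ?w = \<gamma> \<and> P (thin Z g q)}"
  have inj: "inj_on (\<lambda>q. q mod ?w) ?Q" by (rule inj_onI) (metis (mono_tags, lifting) div_mult_mod_eq mem_Collect_eq)
  have lt: "q mod ?w < ?w" for q using w by simp
  from g(1) P show ?thesis
  proof (rule one_sided_rank[where \<gamma>=\<gamma> and Z=Z])
    assume low: "\<And>e. e div g = \<gamma> \<Longrightarrow> P (Z e) \<longleftrightarrow> grank Z g e < ?c"
    have "(\<lambda>q. q mod ?w) ` ?Q \<subseteq> {..<(?c + 3) div 4}"
    proof (intro image_subsetI)
      fix q assume q: "q \<in> ?Q"
      obtain e where e: "e div g = q div ?w" "grank Z g e = 4 * (q mod ?w)" "thin Z g q = Z e" by (rule thin_ex[OF g, of q Z])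
      then have "4 * (q mod ?w) < ?c" using low[of e] q by auto
      then show "q mod ?w \<in> {..<(?c + 3) div 4}" by auto
    qed
    then have "card ?Q \<le> card {..<(?c + 3) div 4}" by (rule card_inj_on_le[OF inj]) simp
    then show ?thesis by simp
  next
    assume up: "\<And>e. e div g = \<gamma> \<Longrightarrow> P (Z e) \<longleftrightarrow> g \<le> grank Z g e + ?c"
    have sub: "(\<lambda>q. ?w - 1 - q mod ?w) ` ?Q \<subseteq> {..<?c div 4}"
    proof (intro image_subsetI)
      fix q assume q: "q \<in> ?Q"
      obtain e where e: "e div g = q div ?w" "grank Z g e = 4 * (q mod ?w)" "thin Z g q = Z e" by (rule thin_ex[OF g, of q Z])
      then have "g \<le> 4 * (q mod ?w) + ?c" using up[of e] q by auto
      then have "4 * (?w - q mod ?w) \<le> ?c" using w(2) by (simp only: diff_mult_distrib2)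
      then have "4 * (?w - q mod ?w) div 4 \<le> ?c div 4" by (rule div_le_mono)
      then have "?w - q mod ?w \<le> ?c div 4" by simp
      then show "?w - 1 - q mod ?w \<in> {..<?c div 4}" using lt[of q] unfolding lessThan_iff by linarith
    qed
    have "inj_on (\<lambda>q. ?w - 1 - q mod ?w) ?Q"
    proof (rule inj_onI)
      fix p q assume pq: "p \<in> ?Q" "q \<in> ?Q" "?w - 1 - p mod ?w = ?w - 1 - q mod ?w"
      then have "p mod ?w = q mod ?w" using lt[of p] lt[of q] by linarith
      then show "p = q" using pq(1,2) by (rule inj_onD[OF inj])
    qed
    then have "card ?Q \<le> card {..<?c div 4}" using sub by (rule card_inj_on_le) simp
    then show ?thesis by simp
  qed
qed

lemma card_by_groups:
  fixes g :: nat
  assumes "0 < g"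
  shows "card {e. e < w * g \<and> P e} = (\<Sum>\<gamma><w. card {e. e div g = \<gamma> \<and> P e})"
proof -
  have "{e. e < w * g \<and> P e} = (\<Union>\<gamma><w. {e. e div g = \<gamma> \<and> P e})"
    using assms by (auto simp: div_less_iff_less_mult)
  then show ?thesis using assms by (simp only:, subst card_UN_disjoint) (auto simp: finite_group)
qed

lemma card_thin:
  assumes g: "0 < g" "4 dvd g" and P: "one_sided P"
  shows "4 * card {q. q < w * (g div 4) \<and> P (thin Z g q)} \<le> card {e. e < w * g \<and> P (Z e)} + 3 * w"
proof -
  have w: "0 < g div 4" using g by (auto elim!: dvdE)
  have "4 * card {q. q < w * (g div 4) \<and> P (thin Z g q)} = (\<Sum>\<gamma><w. 4 * card {q. q div (g div 4) = \<gamma> \<and> P (thin Z g q)})"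
    by (simp add: card_by_groups[OF w] sum_distrib_left)
  also have "\<dots> \<le> (\<Sum>\<gamma><w. card {e. e div g = \<gamma> \<and> P (Z e)} + 3)"
    by (intro sum_mono card_thin_group g P)
  also have "\<dots> = card {e. e < w * g \<and> P (Z e)} + 3 * w"
    by (simp add: card_by_groups[OF g(1)] sum.distrib)
  finally show ?thesis .
qed

text \<open>The slack \<open>12 * 8 ^ h\<close> is self-reproducing. Thinning
  \<open>8 ^ Suc h\<close> groups loses at most \<open>24 * 8 ^ h\<close> entries to rounding, that
  is \<open>48 * 8 ^ h\<close> in the doubled count: half of the available
  \<open>96 * 8 ^ h\<close>. The other half, divided by 4 like the length, is the slack of the next
  level.\<close>

lemma approx_median_aux:
  assumes P: "one_sided P" and "0 < g" "8 dvd g"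
    and "2 * card {e. e < 8 ^ h * g \<and> P (Z e)} + 12 * 8 ^ h < 8 ^ h * g"
  shows "\<not> P (approx_median h g Z)"
  using assms(2-)
proof (induction h arbitrary: g Z)
  case 0
  have g4: "4 dvd g" using 0 by (metis dvd_trans numeral_Bit0 dvd_triv_left mult_2 dvd_add_triv_left_iff dvd_refl)
  obtain e where e: "e div g = (g div 8) div (g div 4)" "grank Z g e = 4 * ((g div 8) mod (g div 4))" "thin Z g (g div 8) = Z e"
    by (rule thin_ex[OF 0(1) g4, of "g div 8" Z])
  \<comment> \<open>Position \<open>g div 8\<close> of the thinned last group holds the value of
    rank \<open>4 * (g div 8)\<close>, which is the middle rank \<open>g / 2\<close>.\<close>
  have "(g div 8) div (g div 4) = 0" "(g div 8) mod (g div 4) = g div 8" using 0(1,2) by (auto elim!: dvdE)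
  then have e': "e div g = 0" "2 * grank Z g e = g" using e 0(2) by (auto elim!: dvdE)
  have c: "card {e. e < 8 ^ 0 * g \<and> P (Z e)} = card {e. e div g = 0 \<and> P (Z e)}"
    using 0(1) by (intro arg_cong[where f=card]) (auto simp: div_eq_0_iff)
  from 0(1) P show ?case
  proof (rule one_sided_rank[where \<gamma>=0 and Z=Z])
    assume "\<And>e. e div g = 0 \<Longrightarrow> P (Z e) \<longleftrightarrow> grank Z g e < card {e. e div g = 0 \<and> P (Z e)}"
    from this[OF e'(1)] show ?thesis using e e' 0(3) c by simp
  next
    assume "\<And>e. e div g = 0 \<Longrightarrow> P (Z e) \<longleftrightarrow> g \<le> grank Z g e + card {e. e div g = 0 \<and> P (Z e)}"
    from this[OF e'(1)] show ?thesis using e e' 0(3) c by simp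
  qed
next
  case (Suc h)
  have g4: "4 dvd g" using Suc.prems(2) by (metis dvd_trans dvd_triv_left numeral_Bit0 mult_2 dvd_add_triv_left_iff dvd_refl)
  then have eq: "8 ^ h * (2 * g) = 8 ^ Suc h * (g div 4)" by (auto elim!: dvdE)
  have "4 * card {q. q < 8 ^ Suc h * (g div 4) \<and> P (thin Z g q)} \<le> card {e. e < 8 ^ Suc h * g \<and> P (Z e)} + 3 * 8 ^ Suc h"
    by (rule card_thin[OF Suc.prems(1) g4 P])
  then have "8 * card {q. q < 8 ^ h * (2 * g) \<and> P (thin Z g q)} + 48 * 8 ^ h < 8 ^ Suc h * g"
    using Suc.prems(3) unfolding eq by simp
  then have "2 * card {q. q < 8 ^ h * (2 * g) \<and> P (thin Z g q)} + 12 * 8 ^ h < 8 ^ h * (2 * g)" by simp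
  then have "\<not> P (approx_median h (2 * g) (thin Z g))"
    using Suc.prems(1,2) by (intro Suc.IH) auto
  then show ?case by simp
qed

text \<open>With groups of 64 a quarter of bad entries is tolerable, as
  \<open>2 * 16 + 12 < 64\<close>.\<close>

lemma approx_median:
  assumes "one_sided P" "4 * card {e. e < 64 * 8 ^ h \<and> P (Z e)} \<le> 64 * 8 ^ h"
  shows "\<not> P (approx_median h 64 Z)"
proof (rule approx_median_aux[OF assms(1)])
  have "card {e. e < 8 ^ h * 64 \<and> P (Z e)} \<le> 16 * 8 ^ h" using assms(2) by (simp add: mult.commute)
  moreover have "16 * 8 ^ h < 26 * (8 ^ h :: nat)" by simp
  ultimately show "2 * card {e. e < 8 ^ h * 64 \<and> P (Z e)} + 12 * 8 ^ h < 8 ^ h * (64::nat)" by linarith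
qed auto

section \<open>Sets of largest estimates and the energy they miss\<close>

definition topset :: "(nat \<Rightarrow> real) \<Rightarrow> nat \<Rightarrow> nat \<Rightarrow> nat set \<Rightarrow> bool" where
  "topset E N K A \<longleftrightarrow> A \<subseteq> {..<N} \<and> card A = K \<and> (\<forall>i\<in>A. \<forall>j\<in>{..<N} - A. E j < E i \<or> E j = E i \<and> i < j)"

text \<open>Two different sets of equal size each contain an element missing from the other, and
  these two would have to dominate one another. Uniqueness makes the selected set a function of the
  estimates.\<close>

lemma topset_unique:
  assumes "topset E N K A" "topset E N K A'" shows "A = A'"
proof (rule ccontr)
  assume ne: "A \<noteq> A'"
  have fin: "finite A" "finite A'" using assms finite_subset by (auto simp: topset_def)
  have c: "card A = card A'" using assms by (simp add: topset_def)
  have "\<not> A \<subseteq> A'" using card_subset_eq[OF fin(2) _ c] ne by blast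
  moreover have "\<not> A' \<subseteq> A" using card_subset_eq[OF fin(1) _ c[symmetric]] ne by blast
  ultimately obtain i j where "i \<in> A" "i \<notin> A'" "j \<in> A'" "j \<notin> A" by blast
  then have "E j < E i \<or> E j = E i \<and> i < j" "E i < E j \<or> E i = E j \<and> j < i"
    using assms unfolding topset_def by blast+
  then show False by auto
qed

text \<open>Exchange argument: the missed blocks of \<open>Q - A\<close> are matched injectively
  with wrongly chosen blocks of \<open>A - Q\<close>, whose estimates are at least as large. So the
  missed energy exceeds the wrongly gained energy only by the multiplicative error on the latter,
  itself part of the tail \<open>R\<close>, and by at most \<open>K\<close> additive errors
  \<open>e * R / K\<close>.\<close>

lemma topset_energy:
  fixes E a :: "nat \<Rightarrow> real"
  assumes top: "topset E N K A" and K: "K > 0" and s: "s > 0" and e: "0 < e" "e \<le> 1 / 16"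
    and a: "\<And>i. 0 \<le> a i" and Oset: "Q \<subseteq> {..<N}" "card Q \<le> K" and R: "R = (\<Sum>i\<in>{..<N} - Q. a i)"
    and lo: "\<And>i. i < N \<Longrightarrow> (1 - e) * s * a i \<le> E i"
    and hi: "\<And>i. i < N \<Longrightarrow> E i \<le> (1 + e) * s * (a i + e * R / real K)"
  shows "(\<Sum>i\<in>{..<N} - A. a i) \<le> (1 + 8 * e) * R"
proof -
  have A: "A \<subseteq> {..<N}" "card A = K" using top by (auto simp: topset_def)
  have fin: "finite A" "finite Q" using A Oset finite_subset by auto
  have R0: "R \<ge> 0" unfolding R using a by (intro sum_nonneg) auto
  let ?\<tau> = "e * R / real K"
  have "card (Q - A) + card (Q \<inter> A) = card Q" "card (A - Q) + card (A \<inter> Q) = card A"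
    using fin by (simp_all add: card_Diff_subset_Int Int_commute card_mono le_add_diff_inverse2)
  then have "card (Q - A) \<le> card (A - Q)" using A Oset by (simp add: Int_commute)
  then obtain \<phi> where \<phi>: "inj_on \<phi> (Q - A)" "\<phi> ` (Q - A) \<subseteq> A - Q"
    using fin by (meson card_le_inj finite_Diff)
  have one: "(1 - e) * a i \<le> (1 + e) * (a (\<phi> i) + ?\<tau>)" if i: "i \<in> Q - A" for i
  proof -
    have \<phi>i: "\<phi> i \<in> A" "i \<in> {..<N} - A" "\<phi> i < N" "i < N" using \<phi>(2) i A Oset by auto
    have "E i < E (\<phi> i) \<or> E i = E (\<phi> i) \<and> \<phi> i < i" using top \<phi>i(1,2) unfolding topset_def by blast
    then have "E i \<le> E (\<phi> i)" by linarith
    with lo[OF \<phi>i(4)] hi[OF \<phi>i(3)] have "(1 - e) * s * a i \<le> (1 + e) * s * (a (\<phi> i) + ?\<tau>)" by linarith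
    then have "s * ((1 - e) * a i) \<le> s * ((1 + e) * (a (\<phi> i) + ?\<tau>))" by (simp add: mult_ac)
    then show ?thesis using s by (rule mult_left_le_imp_le)
  qed
  let ?X = "\<Sum>i\<in>Q - A. a i" and ?Y = "\<Sum>i\<in>A - Q. a i"
  have "(1 - e) * ?X = (\<Sum>i\<in>Q - A. (1 - e) * a i)" by (simp add: sum_distrib_left)
  also have "\<dots> \<le> (\<Sum>i\<in>Q - A. (1 + e) * (a (\<phi> i) + ?\<tau>))" by (intro sum_mono one)
  also have "\<dots> = (1 + e) * ((\<Sum>i\<in>Q - A. a (\<phi> i)) + real (card (Q - A)) * ?\<tau>)"
    by (simp add: sum_distrib_left sum.distrib algebra_simps)
  also have "(\<Sum>i\<in>Q - A. a (\<phi> i)) = (\<Sum>i\<in>\<phi> ` (Q - A). a i)" using \<phi> by (simp add: sum.reindex)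
  also have "(\<Sum>i\<in>\<phi> ` (Q - A). a i) \<le> ?Y" using \<phi> fin a by (intro sum_mono2) auto
  also have "real (card (Q - A)) * ?\<tau> \<le> real K * ?\<tau>"
  proof (rule mult_right_mono)
    show "real (card (Q - A)) \<le> real K" using Oset fin card_mono[of Q "Q - A"] by simp
  qed (use e R0 K in auto)
  also have "real K * ?\<tau> = e * R" using K by simp
  finally have 1: "(1 - e) * ?X \<le> (1 + e) * (?Y + e * R)" using e by simp
  have Y: "?Y \<le> R" unfolding R using a A by (intro sum_mono2) auto
  have Y0: "0 \<le> ?Y" using a by (intro sum_nonneg) auto
  \<comment> \<open>Multiplicative and additive error contribute at most \<open>2 * e * R\<close>
    each; dividing by \<open>1 - e\<close>, which is at least 1/2, doubles the total to
    \<open>8 * e * R\<close>.\<close>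
  have "(1 - e) * ?X \<le> (1 - e) * (?Y + 4 * e * R + 4 * e * R)"
  proof -
    have "(1 + e) * (?Y + e * R) = (1 - e) * ?Y + 2 * e * ?Y + (1 + e) * (e * R)" by (simp add: algebra_simps)
    also have "\<dots> \<le> (1 - e) * ?Y + 2 * e * R + 2 * (e * R)"
      using Y e R0 by (intro add_mono mult_left_mono mult_right_mono order_refl) auto
    also have "\<dots> \<le> (1 - e) * ?Y + (1 - e) * (8 * (e * R))"
    proof -
      have "4 * (e * R) \<le> ((1 - e) * 8) * (e * R)" using e R0 by (intro mult_right_mono) auto
      then show ?thesis by (simp only: mult.assoc)
    qed
    finally show ?thesis using 1 by (simp add: algebra_simps)
  qed
  then have X: "?X \<le> ?Y + 8 * e * R" using e by (simp add: mult_ac)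
  have "(\<Sum>i\<in>{..<N} - A. a i) + ?Y = R + ?X"
  proof -
    \<comment> \<open>Both sides are the complement of \<open>A \<inter> Q\<close>.\<close>
    have "({..<N} - A) \<union> (A - Q) = ({..<N} - Q) \<union> (Q - A)" using A Oset by auto
    then have "(\<Sum>i\<in>({..<N} - A) \<union> (A - Q). a i) = (\<Sum>i\<in>({..<N} - Q) \<union> (Q - A). a i)" by simp
    then show ?thesis unfolding R using fin by (subst (asm) (1 2) sum.union_disjoint) auto
  qed
  then show ?thesis using X by (simp add: algebra_simps)
qed

section \<open>Block energy sketches\<close>

definition sign_row :: "nat \<Rightarrow> (nat \<Rightarrow> bool) pmf" where
  "sign_row s = Pi_pmf {..<s} False (\<lambda>_. pmf_of_set UNIV)"

lemma finite_sign_row: "finite (set_pmf (sign_row s))"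
  unfolding sign_row_def by (rule finite_set_Pi_pmf) auto

lemma expect_coin: "expect (pmf_of_set UNIV) sgn_bit = 0"
  by (subst integral_pmf_of_set) (auto simp: UNIV_bool sgn_bit_def)

lemma expect_sign: "t < s \<Longrightarrow> expect (sign_row s) (\<lambda>v. sgn_bit (v t)) = 0"
  unfolding sign_row_def by (subst expect_Pi_component) (auto simp: expect_coin)

text \<open>Squared signs are 1, so the diagonal term is the constant \<open>s\<close> and
  contributes no variance: \<open>q\<close> is 0.\<close>

lemma sign_quadratic_sketch:
  "quadratic_sketch (sign_row s) (\<lambda>v t. sgn_bit (v t)) {..<s} (\<lambda>_. 1) 1 0"
proof
  have sq: "(sgn_bit v)\<^sup>2 = 1" for v by (simp add: power2_eq_square)
  have A: "(\<Sum>\<gamma><s. 1 * (sgn_bit (v \<gamma>))\<^sup>2) = real s" for v by (simp add: sq)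
  fix \<beta> assume \<beta>: "\<beta> \<in> {..<s}"
  show "expect (sign_row s) (\<lambda>v. sgn_bit (v \<beta>)) = 0" using \<beta> by (simp add: expect_sign)
  show "expect (sign_row s) (\<lambda>v. sgn_bit (v \<beta>) * (\<Sum>\<gamma><s. 1 * (sgn_bit (v \<gamma>))\<^sup>2)) = 0"
    unfolding A using \<beta> by (simp add: expect_sign)
  fix \<gamma> assume \<gamma>: "\<gamma> \<in> {..<s}"
  show "expect (sign_row s) (\<lambda>v. sgn_bit (v \<beta>) * sgn_bit (v \<gamma>)) = (if \<beta> = \<gamma> then 1 else 0)"
  proof (cases "\<beta> = \<gamma>")
    case False
    have "expect (sign_row s) (\<lambda>v. sgn_bit (v \<beta>) * sgn_bit (v \<gamma>)) =
      expect (Pi_pmf {\<beta>} False (\<lambda>_. pmf_of_set UNIV)) (\<lambda>v. sgn_bit (v \<beta>)) *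
      expect (Pi_pmf {\<gamma>} False (\<lambda>_. pmf_of_set UNIV)) (\<lambda>v. sgn_bit (v \<gamma>))"
      unfolding sign_row_def by (rule expect_Pi_indep) (use \<beta> \<gamma> False in auto)
    also have "expect (Pi_pmf {\<beta>} False (\<lambda>_. pmf_of_set UNIV)) (\<lambda>v. sgn_bit (v \<beta>)) = 0"
      by (subst expect_Pi_component) (auto simp: expect_coin)
    finally show ?thesis using False by simp
  qed (simp)
next
  have sq: "(sgn_bit v)\<^sup>2 = 1" for v by (simp add: power2_eq_square)
  show "expect (sign_row s) (\<lambda>v. (\<Sum>\<gamma><s. 1 * (sgn_bit (v \<gamma>))\<^sup>2)\<^sup>2) - (1 * sum (\<lambda>_. 1) {..<s})\<^sup>2 \<le> 0"
    by (simp add: sq)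
qed (simp_all add: finite_sign_row)

abbreviation sign_hashes :: "nat set \<Rightarrow> nat \<Rightarrow> (nat \<Rightarrow> nat \<Rightarrow> bool) pmf" where
  "sign_hashes J s \<equiv> Pi_pmf J (\<lambda>_. False) (\<lambda>_. sign_row s)"

lemma finite_sign_hashes: "finite J \<Longrightarrow> finite (set_pmf (sign_hashes J s))"
  by (rule finite_set_Pi_pmf) (auto simp: finite_sign_row)

text \<open>The variance is at most \<open>2 * s * A\<^sup>2\<close> against a squared deviation of
  \<open>(e * s * A)\<^sup>2\<close>. No bound on single coordinates is needed because the fourth
  powers have coefficient 0.\<close>

lemma prob_sign:
  fixes x :: "nat \<Rightarrow> real"
  assumes J: "J \<subseteq> {..<n}" and s: "s > 0" and e: "e > 0" and A: "A = (\<Sum>j\<in>J. (x j)\<^sup>2)"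
  defines "Z \<equiv> \<lambda>v. \<Sum>t<s. (\<Sum>j\<in>J. x j * sgn_bit (v j t))\<^sup>2"
  shows "measure_pmf.prob (sign_hashes {..<n} s) {v. \<not> ((1 - e) * real s * A \<le> Z v \<and> Z v \<le> (1 + e) * real s * A)}
    \<le> 2 / (real s * e\<^sup>2)"
proof -
  interpret quadratic_sketch "sign_row s" "\<lambda>v t. sgn_bit (v t)" "{..<s}" "\<lambda>_. 1" 1 0 "\<lambda>_. False" x
    by (rule sign_quadratic_sketch)
  have finJ: "finite J" using finite_subset[OF J] by simp
  have A0: "A \<ge> 0" unfolding A by (intro sum_nonneg) auto
  have X: "X J v = Z v" for v by (simp add: X_def N_def Z_def)
  show ?thesis
  proof (cases "A = 0")
    case True
    then have "x j = 0" if "j \<in> J" for j using A finJ that by (simp add: sum_nonneg_eq_0_iff)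
    then have "Z v = 0" for v unfolding Z_def by (intro sum.neutral ballI) simp
    then show ?thesis using True by simp
  next
    case False
    then have Ap: "A > 0" using A0 by simp
    have EX: "expect (sign_hashes J s) (X J) = real s * A" using expect_X[OF finJ] by (simp add: A)
    have t: "e * real s * A > 0" using e s Ap by simp
    have "measure_pmf.prob (sign_hashes {..<n} s) {v. \<not> ((1 - e) * real s * A \<le> Z v \<and> Z v \<le> (1 + e) * real s * A)}
       = measure_pmf.prob (sign_hashes J s) {v. \<not> ((1 - e) * real s * A \<le> Z v \<and> Z v \<le> (1 + e) * real s * A)}"
      unfolding prob_eq_expect
    proof (rule expect_Pi_subset[OF finite_lessThan J])
      fix g h :: "nat \<Rightarrow> nat \<Rightarrow> bool" assume "\<And>j. j \<in> J \<Longrightarrow> g j = h j"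
      then have "Z g = Z h" unfolding Z_def by simp
      then show "of_bool (\<not> ((1 - e) * real s * A \<le> Z g \<and> Z g \<le> (1 + e) * real s * A)) =
        (of_bool (\<not> ((1 - e) * real s * A \<le> Z h \<and> Z h \<le> (1 + e) * real s * A)) :: real)" by simp
    qed
    also have "\<dots> \<le> measure_pmf.prob (sign_hashes J s) {v. e * real s * A \<le> \<bar>X J v - expect (sign_hashes J s) (X J)\<bar>}"
      unfolding EX X by (rule prob_mono) (auto simp: algebra_simps abs_if)
    also have "\<dots> \<le> (2 * real s * A\<^sup>2) / (e * real s * A)\<^sup>2"
      using expect_X_sq[OF finJ] by (intro prob_chebyshev finite_sign_hashes finJ t) (simp add: A)
    also have "\<dots> = 2 / (real s * e\<^sup>2)" using Ap s by (simp add: power2_eq_square field_simps)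
    finally show ?thesis .
  qed
qed

section \<open>Bucketing of blocks and a single repetition of the estimate\<close>

abbreviation block_hashes :: "nat \<Rightarrow> nat \<Rightarrow> (nat \<Rightarrow> nat) pmf" where
  "block_hashes N B \<equiv> Pi_pmf {..<N} 0 (\<lambda>_. pmf_of_set {..<B})"

lemma finite_block_hashes: "B > 0 \<Longrightarrow> finite (set_pmf (block_hashes N B))"
  by (rule finite_set_Pi_pmf) (auto simp: set_pmf_of_set lessThan_empty_iff)

lemma prob_block_collision:
  assumes B: "B > 0" and i: "i < N" "i' < N" "i \<noteq> i'"
  shows "expect (block_hashes N B) (\<lambda>h. of_bool (h i' = h i)) = 1 / real B"
proof -
  have finp: "finite (set_pmf (pmf_of_set {..<B}))" using B by (simp add: set_pmf_of_set lessThan_empty_iff)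
  have "expect (block_hashes N B) (\<lambda>h. of_bool (h i' = h i)) =
      expect (Pi_pmf (insert i {i'}) 0 (\<lambda>_. pmf_of_set {..<B})) (\<lambda>h. of_bool (h i' = h i))"
    by (rule expect_Pi_subset) (use i in auto)
  also have "\<dots> = expect (Pi_pmf {i'} 0 (\<lambda>_. pmf_of_set {..<B})) (\<lambda>g. expect (pmf_of_set {..<B}) (\<lambda>v. of_bool (g i' = v)))"
    using i finp by (subst expect_Pi_insert) auto
  also have "\<dots> = expect (pmf_of_set {..<B}) (\<lambda>w. expect (pmf_of_set {..<B}) (\<lambda>v. of_bool (w = v)))"
    by (rule expect_Pi_component) auto
  also have "\<dots> = expect (pmf_of_set {..<B}) (\<lambda>w. 1 / real B)"
  proof (rule expect_cong)
    fix w assume "w \<in> set_pmf (pmf_of_set {..<B})"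
    then have w: "w < B" using B by (simp add: set_pmf_of_set lessThan_empty_iff)
    have "expect (pmf_of_set {..<B}) (\<lambda>v. of_bool (w = v)) = (\<Sum>v<B. of_bool (w = v)) / real B"
      using B by (subst integral_pmf_of_set) (auto simp: lessThan_empty_iff)
    also have "(\<Sum>v<B. of_bool (w = v)) = (1 :: real)" using w by (simp add: of_bool_def)
    finally show "expect (pmf_of_set {..<B}) (\<lambda>v. of_bool (w = v)) = 1 / real B" .
  qed
  finally show ?thesis by simp
qed

text \<open>Buckets are drawn per block but signs per coordinate: a block is never split, and its
  bucket yields the sum of all energies inside it.\<close>

definition sketch_pmf :: "nat \<Rightarrow> nat \<Rightarrow> nat \<Rightarrow> nat \<Rightarrow> ((nat \<Rightarrow> nat) \<times> (nat \<Rightarrow> nat \<Rightarrow> bool)) pmf" where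
  "sketch_pmf N n s B = pair_pmf (block_hashes N B) (sign_hashes {..<n} s)"

definition sketch_row :: "(nat \<Rightarrow> real) \<Rightarrow> nat \<Rightarrow> nat \<Rightarrow> (nat \<Rightarrow> nat) \<times> (nat \<Rightarrow> nat \<Rightarrow> bool) \<Rightarrow> nat \<Rightarrow> nat \<Rightarrow> real" where
  "sketch_row x b n u i t = (\<Sum>j | j < n \<and> fst u (j div b) = fst u i. x j * sgn_bit (snd u j t))"

definition sketch_est :: "(nat \<Rightarrow> real) \<Rightarrow> nat \<Rightarrow> nat \<Rightarrow> nat \<Rightarrow> (nat \<Rightarrow> nat) \<times> (nat \<Rightarrow> nat \<Rightarrow> bool) \<Rightarrow> nat \<Rightarrow> real" where
  "sketch_est x b n s u i = (\<Sum>t<s. (sketch_row x b n u i t)\<^sup>2)"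

definition energy :: "(nat \<Rightarrow> real) \<Rightarrow> nat \<Rightarrow> nat \<Rightarrow> real" where
  "energy x b i = (\<Sum>j\<in>block b i. (x j)\<^sup>2)"

lemma energy_nonneg: "0 \<le> energy x b i"
  unfolding energy_def by (intro sum_nonneg) auto

lemma block_iff:
  assumes "b > 0" shows "j \<in> block b i \<longleftrightarrow> j div b = i"
proof -
  have "block b i = {j. j div b = i}" unfolding block_def group_eq[OF assms] by (simp add: add.commute)
  then show ?thesis by simp
qed

lemma sum_by_blocks:
  assumes b: "b > 0" and I: "I \<subseteq> {..<N}" and n: "n = N * b"
  shows "(\<Sum>j | j < n \<and> j div b \<in> I. (x j)\<^sup>2) = (\<Sum>i\<in>I. energy x b i)"
proof -
  have finI: "finite I" using finite_subset[OF I] by simp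
  have lt: "j < n" if "j div b \<in> I" for j
    using that I b n by (auto simp: div_less_iff_less_mult)
  have "(\<Sum>j | j < n \<and> j div b \<in> I. (x j)\<^sup>2) = (\<Sum>i\<in>I. \<Sum>j\<in>{j\<in>{j. j < n \<and> j div b \<in> I}. j div b = i}. (x j)\<^sup>2)"
    by (rule sum.group[symmetric]) (use finI in auto)
  also have "\<dots> = (\<Sum>i\<in>I. energy x b i)"
    unfolding energy_def using lt b by (intro sum.cong refl) (auto simp: block_iff)
  finally show ?thesis .
qed

text \<open>Colliding blocks can only add energy, so the additive term appears in the upper bound
  alone.\<close>

definition est_ok :: "real \<Rightarrow> real \<Rightarrow> real \<Rightarrow> real \<Rightarrow> real \<Rightarrow> bool" where
  "est_ok e s a \<tau> z \<longleftrightarrow> (1 - e) * s * a \<le> z \<and> z \<le> (1 + e) * s * (a + \<tau>)"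

text \<open>Two events spoil the bucket of \<open>i\<close>: another block of \<open>Q\<close> falls
  into it, or the tail blocks falling into it carry more than \<tau>, which Markov controls since
  their mean mass is at most \<open>R / B\<close>. Each has probability at most
  \<open>1 / 2 ^ 10\<close>; the sign sums add \<open>1 / 2 ^ 9\<close>.\<close>

lemma prob_sketch:
  assumes b: "b > 0" and n: "n = N * b" and i: "i < N" and K: "K > 0" and Q: "Q \<subseteq> {..<N}" "card Q \<le> K"
    and e: "0 < e" "e \<le> 1" and R: "R = (\<Sum>i\<in>{..<N} - Q. energy x b i)"
    and s: "2 ^ 10 \<le> e\<^sup>2 * real s" and B: "2 ^ 10 * real K \<le> e * real B"
  shows "measure_pmf.prob (sketch_pmf N n s B) {u. \<not> est_ok e s (energy x b i) (e * R / real K) (sketch_est x b n s u i)} \<le> 1 / 2 ^ 8"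
proof -
  let ?a = "energy x b" and ?\<tau> = "e * R / real K"
  have s0: "s > 0" using s by (auto intro!: gr0I)
  have "0 < 2 ^ 10 * real K" using K by simp
  then have B0: "B > 0" using B by (auto intro!: gr0I)
  have R0: "R \<ge> 0" unfolding R by (intro sum_nonneg energy_nonneg)
  have finH: "finite (set_pmf (block_hashes N B))" by (rule finite_block_hashes[OF B0])
  have finS: "finite (set_pmf (sign_hashes {..<n} s))" by (rule finite_sign_hashes) simp
  have finQ: "finite Q" using finite_subset[OF Q(1)] by simp
  define mass where "mass h = (\<Sum>i'\<in>{..<N} - Q - {i}. ?a i' * of_bool (h i' = h i))" for h :: "nat \<Rightarrow> nat"
  define bad where "bad h \<longleftrightarrow> (\<exists>i'\<in>Q - {i}. h i' = h i) \<or> ?\<tau> < mass h" for h :: "nat \<Rightarrow> nat"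
  have "measure_pmf.prob (block_hashes N B) {h. bad h} \<le>
     measure_pmf.prob (block_hashes N B) {h. \<exists>i'\<in>Q - {i}. h i' = h i} + measure_pmf.prob (block_hashes N B) {h. ?\<tau> < mass h}"
    by (rule prob_disj) (auto simp: bad_def)
  also have "measure_pmf.prob (block_hashes N B) {h. \<exists>i'\<in>Q - {i}. h i' = h i} \<le> 1 / 2 ^ 10"
  proof -
    have "measure_pmf.prob (block_hashes N B) {h. \<exists>i'\<in>Q - {i}. h i' = h i} \<le> (\<Sum>i'\<in>Q - {i}. measure_pmf.prob (block_hashes N B) {h. h i' = h i})"
      by (rule prob_union_bound) (use finQ in auto)
    also have "\<dots> = (\<Sum>i'\<in>Q - {i}. 1 / real B)"
      unfolding prob_eq_expect by (intro sum.cong refl prob_block_collision B0 i) (use Q in auto)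
    also have "\<dots> \<le> real K / real B"
    proof -
      have "card (Q - {i}) \<le> K" using Q finQ card_mono[of Q "Q - {i}"] by auto
      then show ?thesis by (simp add: divide_right_mono)
    qed
    also have "\<dots> \<le> 1 / 2 ^ 10"
    proof -
      have "e * real B \<le> 1 * real B" using e by (intro mult_right_mono) auto
      then have "2 ^ 10 * real K \<le> real B" using B by linarith
      then show ?thesis using B0 by (simp add: field_simps)
    qed
    finally show ?thesis .
  qed
  also have "measure_pmf.prob (block_hashes N B) {h. ?\<tau> < mass h} \<le> 1 / 2 ^ 10"
  proof -
    have "expect (block_hashes N B) mass = (\<Sum>i'\<in>{..<N} - Q - {i}. ?a i' * (1 / real B))"
      unfolding mass_def expect_sum[OF finH]
    proof (rule sum.cong[OF refl])
      fix i' assume "i' \<in> {..<N} - Q - {i}"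
      then show "expect (block_hashes N B) (\<lambda>h. ?a i' * of_bool (h i' = h i)) = ?a i' * (1 / real B)"
        using prob_block_collision[OF B0 i, of i'] by simp
    qed
    also have "\<dots> = (\<Sum>i'\<in>{..<N} - Q - {i}. ?a i') / real B" by (simp add: sum_divide_distrib)
    also have "\<dots> \<le> R / real B"
      unfolding R by (intro divide_right_mono sum_mono2 energy_nonneg) auto
    finally have em: "expect (block_hashes N B) mass \<le> R / real B" .
    show ?thesis
    proof (cases "R = 0")
      case True
      then have z: "?a i' = 0" if "i' \<in> {..<N} - Q" for i'
        using that R by (simp add: sum_nonneg_eq_0_iff energy_nonneg)
      have "mass h = 0" for h unfolding mass_def by (intro sum.neutral ballI) (simp add: z)
      then show ?thesis using True by simp
    next
      case False
      then have \<tau>: "?\<tau> > 0" using R0 e K by simp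
      have "measure_pmf.prob (block_hashes N B) {h. ?\<tau> < mass h} \<le> measure_pmf.prob (block_hashes N B) {h. ?\<tau> \<le> mass h}"
        by (rule prob_mono) simp
      also have "\<dots> \<le> expect (block_hashes N B) mass / ?\<tau>"
        by (rule prob_markov[OF finH _ \<tau>]) (auto simp: mass_def energy_nonneg intro!: sum_nonneg mult_nonneg_nonneg)
      also have "\<dots> \<le> R / real B / ?\<tau>" using em \<tau> by (intro divide_right_mono) auto
      also have "\<dots> = real K / (e * real B)" using False by (simp add: field_simps)
      also have "\<dots> \<le> 1 / 2 ^ 10" using B B0 e by (simp add: field_simps)
      finally show ?thesis .
    qed
  qed
  finally have bad: "measure_pmf.prob (block_hashes N B) {h. bad h} \<le> 1 / 2 ^ 9" by simp
  let ?G = "\<lambda>u. est_ok e s (?a i) ?\<tau> (sketch_est x b n s u i)"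
  have sgn: "measure_pmf.prob (sign_hashes {..<n} s) {v. \<not> ?G (h, v)} \<le> of_bool (bad h) + 1 / 2 ^ 9" for h
  proof (cases "bad h")
    case True
    have "measure_pmf.prob (sign_hashes {..<n} s) {v. \<not> ?G (h, v)} \<le> 1" by simp
    moreover have "of_bool (bad h) = (1::real)" "(0::real) \<le> 1 / 2 ^ 9" using True by auto
    ultimately show ?thesis by linarith
  next
    case False
    let ?J = "{j. j < n \<and> h (j div b) = h i}"
    define A where "A = (\<Sum>j\<in>?J. (x j)\<^sup>2)"
    let ?I = "{i'. i' < N \<and> h i' = h i}"
    have J: "?J = {j. j < n \<and> j div b \<in> ?I}"
      using b n by (auto simp: div_less_iff_less_mult)
    have "A = (\<Sum>i'\<in>?I. ?a i')"
      unfolding A_def J by (rule sum_by_blocks[OF b _ n]) auto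
    \<comment> \<open>For a good bucket hash no further block of \<open>Q\<close> shares the bucket,
      so it contains only \<open>i\<close> and tail blocks.\<close>
    also have "?I = insert i {i'\<in>{..<N} - Q - {i}. h i' = h i}"
      using False i by (auto simp: bad_def)
    also have "(\<Sum>i'\<in>insert i {i'\<in>{..<N} - Q - {i}. h i' = h i}. ?a i') = ?a i + (\<Sum>i'\<in>{i'\<in>{..<N} - Q - {i}. h i' = h i}. ?a i')"
      by (subst sum.insert) auto
    also have "(\<Sum>i'\<in>{i'\<in>{..<N} - Q - {i}. h i' = h i}. ?a i') = mass h"
      unfolding mass_def by (subst sum.inter_filter, simp, intro sum.cong refl) simp
    finally have Aeq: "A = ?a i + mass h" .
    have m: "0 \<le> mass h" "mass h \<le> ?\<tau>"
      using False by (auto simp: bad_def mass_def energy_nonneg intro!: sum_nonneg mult_nonneg_nonneg)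
    have "measure_pmf.prob (sign_hashes {..<n} s) {v. \<not> ?G (h, v)} \<le>
      measure_pmf.prob (sign_hashes {..<n} s) {v. \<not> ((1 - e) * real s * A \<le> (\<Sum>t<s. (\<Sum>j\<in>?J. x j * sgn_bit (v j t))\<^sup>2)
         \<and> (\<Sum>t<s. (\<Sum>j\<in>?J. x j * sgn_bit (v j t))\<^sup>2) \<le> (1 + e) * real s * A)}"
    proof (rule prob_mono, rule contrapos_nn, assumption)
      fix v assume ok: "(1 - e) * real s * A \<le> (\<Sum>t<s. (\<Sum>j\<in>?J. x j * sgn_bit (v j t))\<^sup>2)
         \<and> (\<Sum>t<s. (\<Sum>j\<in>?J. x j * sgn_bit (v j t))\<^sup>2) \<le> (1 + e) * real s * A"
      have "(1 - e) * real s * ?a i \<le> (1 - e) * real s * A" "(1 + e) * real s * A \<le> (1 + e) * real s * (?a i + ?\<tau>)"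
        using Aeq m e by (auto intro!: mult_left_mono)
      then show "?G (h, v)" using ok by (simp add: est_ok_def sketch_est_def sketch_row_def)
    qed
    also have "\<dots> \<le> 2 / (real s * e\<^sup>2)"
      by (rule prob_sign[OF _ s0 e(1) A_def]) auto
    also have "\<dots> \<le> 1 / 2 ^ 9" using s s0 e by (simp add: field_simps)
    finally show ?thesis using False by simp
  qed
  have "measure_pmf.prob (sketch_pmf N n s B) {u. \<not> ?G u} = expect (block_hashes N B) (\<lambda>h. measure_pmf.prob (sign_hashes {..<n} s) {v. \<not> ?G (h, v)})"
    unfolding prob_eq_expect sketch_pmf_def by (rule expect_pair[OF finH finS])
  also have "\<dots> \<le> expect (block_hashes N B) (\<lambda>h. of_bool (bad h) + 1 / 2 ^ 9)"
    by (rule expect_mono[OF finH sgn])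
  also have "\<dots> = measure_pmf.prob (block_hashes N B) {h. bad h} + 1 / 2 ^ 9"
    unfolding prob_eq_expect by (simp add: expect_add[OF finH])
  finally show ?thesis using bad by simp
qed

text \<open>A wrong median forces more than a quarter of the \<open>L\<close> repetitions to be bad.
  The union over fewer than \<open>2 ^ L\<close> choices of a quarter, each of probability
  \<open>2 ^ (- 8 * L / 4)\<close>, leaves \<open>2 ^ (- L)\<close>.\<close>

lemma prob_median:
  fixes U :: "'u pmf"
  assumes p: "measure_pmf.prob U {u. \<not> est_ok e s a \<tau> (f u)} \<le> 1 / 2 ^ 8" and L: "L = 64 * 8 ^ H"
  shows "measure_pmf.prob (Pi_pmf {..<L} d (\<lambda>_. U)) {u. \<not> est_ok e s a \<tau> (approx_median H 64 (\<lambda>l. f (u l)))} \<le> 1 / 2 ^ L"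
proof -
  let ?I = "{\<Lambda>. \<Lambda> \<subseteq> {..<L} \<and> card \<Lambda> = L div 4}"
  let ?P = "measure_pmf.prob (Pi_pmf {..<L} d (\<lambda>_. U))"
  have finI: "finite ?I" by (rule finite_subset[of _ "Pow {..<L}"]) auto
  have "?P {u. \<not> est_ok e s a \<tau> (approx_median H 64 (\<lambda>l. f (u l)))}
     \<le> (\<Sum>\<Lambda>\<in>?I. ?P {u. \<forall>l\<in>\<Lambda>. \<not> est_ok e s a \<tau> (f (u l))})"
  proof (rule prob_union_bound[OF finI])
    fix u assume bad: "\<not> est_ok e s a \<tau> (approx_median H 64 (\<lambda>l. f (u l)))"
    let ?bad = "{l. l < L \<and> \<not> est_ok e s a \<tau> (f (u l))}"
    have "L < 4 * card ?bad"
    proof (rule ccontr)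
      assume "\<not> L < 4 * card ?bad"
      then have le: "4 * card ?bad \<le> 64 * 8 ^ H" using L by simp
      have sub: "4 * card {l. l < 64 * 8 ^ H \<and> P (f (u l))} \<le> 64 * 8 ^ H"
        if "\<And>z. P z \<Longrightarrow> \<not> est_ok e s a \<tau> z" for P
      proof -
        have "card {l. l < 64 * 8 ^ H \<and> P (f (u l))} \<le> card ?bad" using that L by (intro card_mono) auto
        then show ?thesis using le by linarith
      qed
      \<comment> \<open>The two rays of failure are excluded separately, each with the same count of
        bad repetitions.\<close>
      have "\<not> approx_median H 64 (\<lambda>l. f (u l)) < (1 - e) * s * a"
        by (rule approx_median[where P="\<lambda>z. z < (1 - e) * s * a"], force simp: one_sided_def)
          (rule sub, simp add: est_ok_def)
      moreover have "\<not> (1 + e) * s * (a + \<tau>) < approx_median H 64 (\<lambda>l. f (u l))"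
        by (rule approx_median[where P="\<lambda>z. (1 + e) * s * (a + \<tau>) < z"], force simp: one_sided_def)
          (rule sub, simp add: est_ok_def)
      ultimately show False using bad by (simp add: est_ok_def not_less)
    qed
    then have "L div 4 \<le> card ?bad" by simp
    then obtain \<Lambda> where "\<Lambda> \<subseteq> ?bad" "card \<Lambda> = L div 4" by (meson obtain_subset_with_card_n)
    then show "\<exists>\<Lambda>\<in>?I. \<forall>l\<in>\<Lambda>. \<not> est_ok e s a \<tau> (f (u l))" by (intro bexI[of _ \<Lambda>]) auto
  qed
  also have "\<dots> \<le> (\<Sum>\<Lambda>\<in>?I. (1 / 2 ^ 8) ^ (L div 4))"
  proof (rule sum_mono)
    fix \<Lambda> assume \<Lambda>: "\<Lambda> \<in> ?I"
    have "{u. \<forall>l\<in>\<Lambda>. \<not> est_ok e s a \<tau> (f (u l))} = Pi {..<L} (\<lambda>l. if l \<in> \<Lambda> then {v. \<not> est_ok e s a \<tau> (f v)} else UNIV)"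
      using \<Lambda> by (auto simp: Pi_def split: if_splits)
    then have "?P {u. \<forall>l\<in>\<Lambda>. \<not> est_ok e s a \<tau> (f (u l))}
       = (\<Prod>l<L. measure_pmf.prob U (if l \<in> \<Lambda> then {v. \<not> est_ok e s a \<tau> (f v)} else UNIV))"
      by (simp only: measure_Pi_pmf_Pi[OF finite_lessThan])
    also have "\<dots> \<le> (\<Prod>l<L. if l \<in> \<Lambda> then 1 / 2 ^ 8 else 1)"
      by (rule prod_mono) (use p in auto)
    also have "\<dots> = (1 / 2 ^ 8) ^ (L div 4)" using \<Lambda> by (simp add: prod.If_cases Int_absorb1)
    finally show "?P {u. \<forall>l\<in>\<Lambda>. \<not> est_ok e s a \<tau> (f (u l))} \<le> (1 / 2 ^ 8) ^ (L div 4)" .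
  qed
  also have "\<dots> = real (card ?I) * (1 / 2 ^ 8) ^ (L div 4)" by simp
  also have "\<dots> \<le> 2 ^ L * (1 / 2 ^ 8) ^ (L div 4)"
  proof (rule mult_right_mono)
    have "card ?I \<le> card (Pow {..<L})" by (intro card_mono) auto
    then have "real (card ?I) \<le> real (2 ^ L)" by (simp only: of_nat_le_iff card_Pow card_lessThan finite_lessThan)
    then show "real (card ?I) \<le> 2 ^ L" by simp
  qed simp
  also have "\<dots> = 1 / 2 ^ L"
  proof -
    define w where "w = L div 4"
    have "L = 4 * w" using L by (simp add: w_def)
    then have "(2::real) ^ L = 16 ^ w" by (simp add: power_mult)
    moreover have "((2::real) ^ 8) ^ w = 16 ^ w * 16 ^ w" by (simp flip: power_mult_distrib)
    ultimately show ?thesis unfolding w_def[symmetric] power_one_over[symmetric] power_divide by simp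
  qed
  finally show ?thesis .
qed

section \<open>Reasoning about executions\<close>

text \<open>Total correctness with a step budget: termination, running time and word size are all
  witnessed by one execution. The word bound is an integer so that index bounds remain in integer
  arithmetic.\<close>

definition runs :: "input \<Rightarrow> int \<Rightarrow> com \<Rightarrow> state \<Rightarrow> nat \<Rightarrow> (state \<Rightarrow> bool) \<Rightarrow> bool" where
  "runs I W P s T Q \<longleftrightarrow> (\<exists>t s'. exec I (real_of_int W) P s t s' \<and> t \<le> T \<and> Q s')"

lemma runs_mono: "runs I W P s T Q \<Longrightarrow> T \<le> T' \<Longrightarrow> (\<And>s. Q s \<Longrightarrow> Q' s) \<Longrightarrow> runs I W P s T' Q'"
  unfolding runs_def by (meson order_trans)

lemma runs_Skip: "1 \<le> T \<Longrightarrow> Q s \<Longrightarrow> runs I W Skip s T Q"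
  unfolding runs_def by (intro exI conjI, rule exec.Skip)

lemma runs_IStore:
  assumes "1 \<le> T" "\<bar>ival I s e\<bar> \<le> W" "\<bar>ival I s f\<bar> \<le> W"
    "Q (s\<lparr>imem := (imem s)(a := (imem s a)(ival I s e := ival I s f))\<rparr>)"
  shows "runs I W (IStore a e f) s T Q"
proof -
  have "exec I (real_of_int W) (IStore a e f) s 1 (s\<lparr>imem := (imem s)(a := (imem s a)(ival I s e := ival I s f))\<rparr>)"
    by (rule exec.IStore[OF refl refl]) (use assms in linarith)+
  then show ?thesis unfolding runs_def using assms by blast
qed

lemma runs_RStore:
  assumes "1 \<le> T" "\<bar>ival I s e\<bar> \<le> W"
    "Q (s\<lparr>rmem := (rmem s)(a := (rmem s a)(ival I s e := rval I s f))\<rparr>)"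
  shows "runs I W (RStore a e f) s T Q"
proof -
  have "exec I (real_of_int W) (RStore a e f) s 1 (s\<lparr>rmem := (rmem s)(a := (rmem s a)(ival I s e := rval I s f))\<rparr>)"
    by (rule exec.RStore[OF refl refl]) (use assms in linarith)+
  then show ?thesis unfolding runs_def using assms by blast
qed

lemma runs_Output:
  assumes "1 \<le> T" "\<bar>ival I s e\<bar> \<le> W" "Q (s\<lparr>outp := (outp s)(ival I s e := rval I s f)\<rparr>)"
  shows "runs I W (Output e f) s T Q"
proof -
  have "exec I (real_of_int W) (Output e f) s 1 (s\<lparr>outp := (outp s)(ival I s e := rval I s f)\<rparr>)"
    by (rule exec.Output[OF refl refl]) (use assms in linarith)+
  then show ?thesis unfolding runs_def using assms by blast
qed

lemma runs_Seq:
  assumes "runs I W P s T1 (\<lambda>s'. runs I W R s' T2 Q)" "T1 + T2 \<le> T"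
  shows "runs I W (Seq P R) s T Q"
proof -
  from assms(1) obtain t s' t' s'' where
    "exec I (real_of_int W) P s t s'" "t \<le> T1" "exec I (real_of_int W) R s' t' s''" "t' \<le> T2" "Q s''"
    unfolding runs_def by blast
  then show ?thesis unfolding runs_def using assms(2) exec.Seq
    by (intro exI[of _ "t + t'"] exI[of _ s'']) auto
qed

lemma runs_Cond:
  assumes "1 \<le> T" "bval I s p \<Longrightarrow> runs I W P s (T - 1) Q" "\<not> bval I s p \<Longrightarrow> runs I W R s (T - 1) Q"
  shows "runs I W (Cond p P R) s T Q"
proof (cases "bval I s p")
  case True
  then obtain t s' where "exec I (real_of_int W) P s t s'" "t \<le> T - 1" "Q s'" using assms unfolding runs_def by blast
  then show ?thesis unfolding runs_def using assms(1) exec.CondTrue[OF True]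
    by (intro exI[of _ "1 + t"] exI[of _ s']) auto
next
  case False
  then obtain t s' where "exec I (real_of_int W) R s t s'" "t \<le> T - 1" "Q s'" using assms unfolding runs_def by blast
  then show ?thesis unfolding runs_def using assms(1) exec.CondFalse[OF False]
    by (intro exI[of _ "1 + t"] exI[of _ s']) auto
qed

lemma runs_While_end: "1 \<le> T \<Longrightarrow> \<not> bval I s p \<Longrightarrow> Q s \<Longrightarrow> runs I W (While p P) s T Q"
  unfolding runs_def by (intro exI conjI, rule exec.WhileFalse)

lemma runs_While_step:
  assumes "bval I s p" "runs I W P s T1 (\<lambda>s'. runs I W (While p P) s' T2 Q)" "1 + T1 + T2 \<le> T"
  shows "runs I W (While p P) s T Q"
proof -
  from assms(2) obtain t s' t' s'' where
    "exec I (real_of_int W) P s t s'" "t \<le> T1" "exec I (real_of_int W) (While p P) s' t' s''" "t' \<le> T2" "Q s''"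
    unfolding runs_def by blast
  then show ?thesis unfolding runs_def using assms(1,3) exec.WhileTrue
    by (intro exI[of _ "1 + t + t'"] exI[of _ s'']) auto
qed

text \<open>The variant \<mu> also bounds the number of iterations, each costing the body and one
  test; the final test is the extra step.\<close>

lemma runs_While:
  assumes "Inv s" and step: "\<And>s. Inv s \<Longrightarrow> bval I s p \<Longrightarrow> runs I W P s T (\<lambda>s'. Inv s' \<and> \<mu> s' < (\<mu> s :: nat))"
    and post: "\<And>s. Inv s \<Longrightarrow> \<not> bval I s p \<Longrightarrow> Q s" and "\<mu> s * (T + 1) + 1 \<le> T'"
  shows "runs I W (While p P) s T' Q"
  using assms(1,4)
proof (induction "\<mu> s" arbitrary: s T' rule: less_induct)
  case less
  show ?case
  proof (cases "bval I s p")
    case True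
    then have pos: "runs I W P s T (\<lambda>s'. Inv s' \<and> \<mu> s' < \<mu> s)" using step less.prems by blast
    then have m: "\<mu> s > 0" unfolding runs_def by auto
    have "runs I W P s T (\<lambda>s'. runs I W (While p P) s' ((\<mu> s - 1) * (T + 1) + 1) Q)"
    proof (rule runs_mono[OF pos order_refl])
      fix s' assume s': "Inv s' \<and> \<mu> s' < \<mu> s"
      then have "\<mu> s' * (T + 1) \<le> (\<mu> s - 1) * (T + 1)" using m by (intro mult_le_mono1) linarith
      then show "runs I W (While p P) s' ((\<mu> s - 1) * (T + 1) + 1) Q" using s' by (intro less.hyps) auto
    qed
    moreover have "1 + T + ((\<mu> s - 1) * (T + 1) + 1) \<le> T'"
      using less.prems(2) m by (cases "\<mu> s") auto
    ultimately show ?thesis by (rule runs_While_step[OF True])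
  next
    case False
    then show ?thesis using post less.prems by (intro runs_While_end) auto
  qed
qed

abbreviation Var :: "nat \<Rightarrow> iexp" where "Var v \<equiv> ILoad v (IConst 0)"

definition For :: "nat \<Rightarrow> iexp \<Rightarrow> com \<Rightarrow> com" where
  "For v hi body = Seq (IStore v (IConst 0) (IConst 0))
     (While (ILess (Var v) hi) (Seq body (IStore v (IConst 0) (IAdd (Var v) (IConst 1)))))"

abbreviation setv :: "nat \<Rightarrow> int \<Rightarrow> state \<Rightarrow> state" where
  "setv v x s \<equiv> s\<lparr>imem := (imem s)(v := (imem s v)(0 := x))\<rparr>"

text \<open>The invariant speaks about states whose counter is already set, hence the
  \<open>setv\<close> in the premise on the body. An iteration costs test, body and increment; the
  last 2 are the initial store and the final test.\<close>

lemma runs_For: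
  assumes W: "int n \<le> W" and init: "Inv 0 (setv v 0 s)"
    and hi: "\<And>i s. i \<le> n \<Longrightarrow> Inv i s \<Longrightarrow> ival I s hi = int n"
    and step: "\<And>i s. i < n \<Longrightarrow> Inv i s \<Longrightarrow> imem s v 0 = int i \<Longrightarrow>
      runs I W body s T (\<lambda>s'. imem s' v 0 = int i \<and> Inv (Suc i) (setv v (int (Suc i)) s'))"
    and post: "\<And>s. Inv n s \<Longrightarrow> imem s v 0 = int n \<Longrightarrow> Q s" and T: "n * (T + 2) + 2 \<le> T'"
  shows "runs I W (For v hi body) s T' Q"
proof -
  let ?p = "ILess (Var v) hi" and ?B = "Seq body (IStore v (IConst 0) (IAdd (Var v) (IConst 1)))"
  have loop: "runs I W (While ?p ?B) s (d * (T + 2) + 1) Q"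
    if "Inv i s" "imem s v 0 = int i" "i + d = n" for d i s
    using that
  proof (induction d arbitrary: i s)
    case 0
    then show ?case using hi[of n s] post by (intro runs_While_end) auto
  next
    case (Suc d)
    then have i: "i < n" by simp
    have "runs I W ?B s (T + 1) (\<lambda>s'. runs I W (While ?p ?B) s' (d * (T + 2) + 1) Q)"
    proof (rule runs_Seq[OF runs_mono[OF step[OF i Suc.prems(1,2)] order_refl] order_refl])
      fix s' assume s': "imem s' v 0 = int i \<and> Inv (Suc i) (setv v (int (Suc i)) s')"
      have eq: "imem s' v 0 + 1 = int (Suc i)" using s' by simp
      show "runs I W (IStore v (IConst 0) (IAdd (Var v) (IConst 1))) s' 1 (\<lambda>s'. runs I W (While ?p ?B) s' (d * (T + 2) + 1) Q)"
      proof (rule runs_IStore)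
        show "runs I W (While ?p ?B) (s'\<lparr>imem := (imem s')(v := (imem s' v)(ival I s' (IConst 0) := ival I s' (IAdd (Var v) (IConst 1))))\<rparr>) (d * (T + 2) + 1) Q"
          unfolding ival.simps eq using s' Suc.prems(3) by (intro Suc.IH[of "Suc i"]) auto
      qed (use s' i W in auto)
    qed
    moreover have "bval I s ?p" using hi[of i s] Suc.prems i by simp
    ultimately show ?case by (intro runs_While_step) auto
  qed
  show ?thesis unfolding For_def
  proof (rule runs_Seq[where ?T1.0 = 1 and ?T2.0 = "n * (T + 2) + 1"])
    show "runs I W (IStore v (IConst 0) (IConst 0)) s 1 (\<lambda>s'. runs I W (While ?p ?B) s' (n * (T + 2) + 1) Q)"
    proof (rule runs_IStore)
      show "runs I W (While ?p ?B) (s\<lparr>imem := (imem s)(v := (imem s v)(ival I s (IConst 0) := ival I s (IConst 0)))\<rparr>) (n * (T + 2) + 1) Q"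
        unfolding ival.simps by (rule loop[of 0]) (use init in auto)
    qed (use W in auto)
  qed (use T in simp)
qed

section \<open>The sketch phase\<close>

text \<open>The padding makes this remainder equal to \<open>s\<close>, see \<open>rows_mod\<close>;
  \<open>eL\<close> then extracts \<open>L\<close> from the column degree
  \<open>L * s + 5\<close>.\<close>

definition eS :: iexp where "eS = IMod ParRows (ColDeg (IConst 0))"
definition eL :: iexp where "eL = IDiv (ISub (ColDeg (IConst 0)) (IConst 5)) eS"
definition eN :: iexp where "eN = IDiv ParN ParB"
definition eK :: iexp where "eK = IDiv ParK ParB"
text \<open>A row number is twice a pair number plus the sign bit, so halving yields the pair and
  the remainder yields the sign.\<close>

definition ePair :: "iexp \<Rightarrow> iexp \<Rightarrow> iexp" where "ePair j q = IDiv (ColOne j q) (IConst 2)"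
definition eDiff :: "iexp \<Rightarrow> rexp" where
  "eDiff p = RSub (Meas (IMul (IConst 2) p)) (Meas (IAdd (IMul (IConst 2) p) (IConst 1)))"

text \<open>The correctness proof of the program sees the matrix only through this interface: the
  \<open>q\<close>-th one of column \<open>j\<close> names a pair and a sign, and \<open>Y\<close>
  is the difference of a pair. In the bound on \<open>W\<close>, the term \<open>n * k\<close> is
  there for sums of coordinate indices.\<close>

locale recovery_input =
  fixes I :: input and W :: int and n k b N K s L H M :: nat
    and pidx :: "nat \<Rightarrow> nat \<Rightarrow> nat" and sg :: "nat \<Rightarrow> nat \<Rightarrow> bool" and Y :: "nat \<Rightarrow> real"
  assumes inp: "in_n I = n" "in_k I = k" "in_b I = b"
    and dims: "n = N * b" "k = K * b" "0 < b" "0 < K" "K < N"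
    and deg: "\<And>j. j < n \<Longrightarrow> length (col_ones (in_mat I) j) = L * s + 5"
    and rows: "dim_vec (in_meas I) mod (L * s + 5) = s"
    and L: "L = 64 * 8 ^ H" and s0: "0 < s"
    and one: "\<And>j q. j < n \<Longrightarrow> q < L * s + 5 \<Longrightarrow> col_ones (in_mat I) j ! q = 2 * pidx q j + of_bool (sg q j)"
    and pidx: "\<And>j q. j < n \<Longrightarrow> q < L * s + 5 \<Longrightarrow> pidx q j < M"
    and meas: "\<And>p. p < M \<Longrightarrow> 2 * p + 1 < dim_vec (in_meas I) \<and> in_meas I $ (2 * p) - in_meas I $ (2 * p + 1) = Y p"
    and W: "16 * int (M + n * k + n + k + L + s) \<le> W"
begin

lemma n0: "0 < n" using dims by simp

lemma ival_eS: "ival I st eS = int s"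
proof -
  have "int (dim_vec (in_meas I)) mod int (L * s + 5) = int s" by (simp only: rows of_nat_mod[symmetric])
  then show ?thesis using deg[OF n0] by (simp add: eS_def)
qed

lemma W_bounds: "int N \<le> W \<and> int L \<le> W \<and> 2 * int L \<le> W \<and> int s \<le> W \<and> int K \<le> W \<and> 2 * int N \<le> W \<and> int M \<le> W
    \<and> int n \<le> W \<and> int (n * k) \<le> W \<and> 6 * int k \<le> W"
proof -
  have f: "N \<le> n" "K \<le> k" using dims by auto
  define p where "p = n * k"
  have "int x \<le> W" if "x \<le> 16 * (M + p + n + k + L + s)" for x
  proof -
    have "int x \<le> int (16 * (M + p + n + k + L + s))" using that by (simp only: of_nat_le_iff)
    also have "\<dots> \<le> W" using W by (simp add: p_def)
    finally show ?thesis .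
  qed
  from this[of N] this[of L] this[of "2 * L"] this[of s] this[of K] this[of "2 * N"] this[of M] this[of n] this[of p] this[of "6 * k"]
  show ?thesis unfolding p_def[symmetric] using f by simp
qed

lemma ival_eL: "ival I st eL = int L"
  using deg[OF n0] s0 by (simp add: eL_def ival_eS)

lemma ival_eN: "ival I st eN = int N"
  using dims by (simp add: eN_def inp)

lemma ival_eK: "ival I st eK = int K"
  using dims by (simp add: eK_def inp)

lemma ival_ColOne:
  assumes "ival I st e = int j" "ival I st f = int q" "j < n" "q < L * s + 5"
  shows "ival I st (ColOne e f) = 2 * int (pidx q j) + of_bool (sg q j)"
  using assms deg[OF assms(3)] one[OF assms(3,4)] by simp

lemma ival_ePair:
  assumes "ival I st e = int j" "ival I st f = int q" "j < n" "q < L * s + 5"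
  shows "ival I st (ePair e f) = int (pidx q j)"
  unfolding ePair_def using ival_ColOne[OF assms] by (simp del: ival.simps(7) add: ival.simps(1,13))

lemma rval_eDiff:
  assumes "ival I st e = int p" "p < M"
  shows "rval I st (eDiff e) = Y p"
proof -
  have "nat (2 * int p) = 2 * p" "nat (2 * int p + 1) = 2 * p + 1" by auto
  then show ?thesis using assms meas[OF assms(2)] by (simp add: eDiff_def)
qed

end

text \<open>The arrays from 20 on belong to the peeling phase, which relies on their initial zeros;
  the earlier phases carry this condition along.\<close>

definition fresh :: "state \<Rightarrow> bool" where
  "fresh st \<longleftrightarrow> (\<forall>a\<ge>20. imem st a = (\<lambda>_. 0)) \<and> outp st = (\<lambda>_. 0)"

text \<open>All coordinates of a block share its bucket, so the first one, \<open>i * b\<close>,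
  suffices to find it.\<close>

definition sketch_value :: iexp where
  "sketch_value = ePair (IMul (Var 0) ParB) (IAdd (IMul (Var 1) eS) (Var 2))"

definition sketch_loop :: com where
  "sketch_loop = For 1 eL (Seq (RStore 0 (Var 1) (ROfInt (IConst 0)))
     (For 2 eS (RStore 0 (Var 1) (RAdd (RLoad 0 (Var 1)) (RMul (eDiff sketch_value) (eDiff sketch_value))))))"

context recovery_input begin

definition Zv :: "nat \<Rightarrow> nat \<Rightarrow> real" where
  "Zv i l = (\<Sum>t<s. (Y (pidx (l * s + t) (i * b)))\<^sup>2)"

lemma rval_sketch_value:
  assumes "imem st 0 0 = int i" "i < N" "imem st 1 0 = int l" "l < L" "imem st 2 0 = int t" "t < s"
  shows "rval I st (eDiff sketch_value) = Y (pidx (l * s + t) (i * b))"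
proof -
  have "l * s + t < (l + 1) * s" using assms by simp
  also have "\<dots> \<le> L * s" using assms by (intro mult_le_mono1) simp
  finally have q: "l * s + t < L * s + 5" by simp
  have j: "i * b < n" using assms dims by simp
  have "ival I st sketch_value = int (pidx (l * s + t) (i * b))"
    unfolding sketch_value_def by (rule ival_ePair) (use assms q j in \<open>simp_all add: ival_eS inp\<close>)
  then show ?thesis by (rule rval_eDiff) (rule pidx[OF j q])
qed

lemma runs_sketch_loop:
  assumes "imem st 0 0 = int i" "i < N" "fresh st" "rmem st 1 = E"
  shows "runs I W sketch_loop st (L * (s * 3 + 5) + 2)
    (\<lambda>s'. imem s' 0 0 = int i \<and> fresh s' \<and> rmem s' 1 = E \<and> (\<forall>l<L. rmem s' 0 (int l) = Zv i l))"
  unfolding sketch_loop_def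
proof (rule runs_For[where Inv = "\<lambda>l s'. imem s' 0 0 = int i \<and> fresh s' \<and> rmem s' 1 = E \<and> (\<forall>l'<l. rmem s' 0 (int l') = Zv i l')"
      and n = L and T = "s * 3 + 3"])
  fix l s1
  assume l: "l < L" and inv: "imem s1 0 0 = int i \<and> fresh s1 \<and> rmem s1 1 = E \<and> (\<forall>l'<l. rmem s1 0 (int l') = Zv i l')"
    and v: "imem s1 1 0 = int l"
  show "runs I W (Seq (RStore 0 (Var 1) (ROfInt (IConst 0)))
     (For 2 eS (RStore 0 (Var 1) (RAdd (RLoad 0 (Var 1)) (RMul (eDiff sketch_value) (eDiff sketch_value)))))) s1 (s * 3 + 3)
     (\<lambda>s'. imem s' 1 0 = int l \<and> (imem (setv 1 (int (Suc l)) s') 0 0 = int i \<and> fresh (setv 1 (int (Suc l)) s') \<and>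
        rmem (setv 1 (int (Suc l)) s') 1 = E \<and> (\<forall>l'<Suc l. rmem (setv 1 (int (Suc l)) s') 0 (int l') = Zv i l')))"
  proof (rule runs_Seq[where ?T1.0 = 1 and ?T2.0 = "s * 3 + 2"], rule runs_RStore, goal_cases)
    case 3
    show ?case
    proof (rule runs_For[where Inv = "\<lambda>t s'. imem s' 1 0 = int l \<and> imem s' 0 0 = int i \<and> fresh s' \<and> rmem s' 1 = E \<and>
        (\<forall>l'<l. rmem s' 0 (int l') = Zv i l') \<and> rmem s' 0 (int l) = (\<Sum>t'<t. (Y (pidx (l * s + t') (i * b)))\<^sup>2)" and n = s and T = 1], goal_cases)
      case (4 t s2)
      then have r: "rval I s2 (eDiff sketch_value) = Y (pidx (l * s + t) (i * b))"
        using assms(2) l by (intro rval_sketch_value) auto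
      show ?case using 4 W_bounds l r by (intro runs_RStore) (auto simp: power2_eq_square fresh_def)
    qed (use inv v W_bounds in \<open>auto simp: ival_eS Zv_def less_Suc_eq fresh_def\<close>)
  qed (use v l W_bounds in auto)
qed (use assms W_bounds in \<open>auto simp: ival_eL fresh_def\<close>)

end

section \<open>The thinned median as a program\<close>

definition thin_before :: bexp where
  "thin_before = (let e' = IAdd (IMul (IDiv (Var 5) (Var 4)) (Var 4)) (Var 6) in
     BNot (BAnd (BNot (RLess (RLoad 0 e') (RLoad 0 (Var 5))))
       (BNot (BAnd (BNot (RLess (RLoad 0 (Var 5)) (RLoad 0 e'))) (ILess e' (Var 5))))))"

text \<open>Real array 0 holds the current sequence and 2 its thinned version; integer variables 3
  and 4 are length and group size, and 7 counts the rank of position 5 by comparison with its whole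
  group.\<close>

definition thin_body :: com where
  "thin_body = Seq (IStore 7 (IConst 0) (IConst 0))
     (Seq (For 6 (Var 4) (Cond thin_before (IStore 7 (IConst 0) (IAdd (Var 7) (IConst 1))) Skip))
       (Cond (ILess (IMod (Var 7) (IConst 4)) (IConst 1))
         (RStore 2 (IAdd (IMul (IDiv (Var 5) (Var 4)) (IDiv (Var 4) (IConst 4))) (IDiv (Var 7) (IConst 4))) (RLoad 0 (Var 5)))
         Skip))"

definition thin_level :: com where
  "thin_level = Seq (For 5 (Var 3) thin_body)
     (Seq (IStore 3 (IConst 0) (IDiv (Var 3) (IConst 4)))
       (Seq (IStore 4 (IConst 0) (IMul (IConst 2) (Var 4)))
         (For 5 (Var 3) (RStore 0 (Var 5) (RLoad 2 (Var 5))))))"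

text \<open>Length divided by 4 and doubled group size keep the length at least the group size until
  a single group is left; thinning that one makes the test fail.\<close>

definition median_loop :: com where
  "median_loop = While (BNot (ILess (Var 3) (Var 4))) thin_level"

definition med_frame :: "nat \<Rightarrow> (int \<Rightarrow> real) \<Rightarrow> nat \<Rightarrow> nat \<Rightarrow> state \<Rightarrow> bool" where
  "med_frame i E m g st \<longleftrightarrow> imem st 0 0 = int i \<and> fresh st \<and> rmem st 1 = E \<and> imem st 3 0 = int m \<and> imem st 4 0 = int g"

lemma runs_thin_body:
  assumes fr: "med_frame i E m g st" and g: "0 < g" "4 dvd g" and e: "e < m" "imem st 5 0 = int e"
    and W: "2 * int m \<le> W" "2 * int g \<le> W" and Z: "\<forall>e<m. rmem st 0 (int e) = Z e" and gm: "g dvd m"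
  shows "runs I W thin_body st (4 * g + 5) (\<lambda>s'. med_frame i E m g s' \<and> imem s' 5 0 = int e \<and> rmem s' 0 = rmem st 0 \<and>
     rmem s' 2 = (if grank Z g e mod 4 = 0 then (rmem st 2)(int (e div g * (g div 4) + grank Z g e div 4) := Z e) else rmem st 2))"
  unfolding thin_body_def
proof (rule runs_Seq[where ?T1.0 = 1 and ?T2.0 = "4 * g + 4"], rule runs_IStore, goal_cases)
  case 4
  let ?B = "\<lambda>e'. Z e' < Z e \<or> Z e' = Z e \<and> e' < e"
  let ?R = "\<lambda>x. {e'. e div g * g \<le> e' \<and> e' < e div g * g + x \<and> ?B e'}"
  have finR: "finite (?R x)" for x by (rule finite_subset[of _ "{..<e div g * g + x}"]) auto
  have Rg: "card (?R g) = grank Z g e"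
  proof -
    have "e' \<in> {e'. e' div g = e div g} \<longleftrightarrow> e' \<in> {e div g * g..<e div g * g + g}" for e'
      by (simp only: group_eq[OF g(1)])
    then have "e' div g = e div g \<longleftrightarrow> e div g * g \<le> e' \<and> e' < e div g * g + g" for e' by simp
    then show ?thesis unfolding grank_def by (simp only: conj_assoc)
  qed
  \<comment> \<open>Since \<open>g\<close> divides \<open>m\<close>, the whole group lies inside the
    array and every comparison reads a meaningful cell.\<close>
  have top: "e div g * g + g \<le> m"
  proof -
    have "e div g < m div g" using e gm g by (metis div_less_iff_less_mult dvd_div_mult_self)
    then have "(e div g + 1) * g \<le> m div g * g" by (intro mult_le_mono1) simp
    then show ?thesis using gm by simp
  qed
  have low: "card (?R x) \<le> x" for x
  proof -
    have "card (?R x) \<le> card {e div g * g..<e div g * g + x}" by (intro card_mono) auto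
    then show ?thesis by simp
  qed
  let ?Q = "\<lambda>s'. med_frame i E m g s' \<and> imem s' 5 0 = int e \<and> rmem s' 0 = rmem st 0 \<and>
     rmem s' 2 = (if grank Z g e mod 4 = 0 then (rmem st 2)(int (e div g * (g div 4) + grank Z g e div 4) := Z e) else rmem st 2)"
  show ?case
  proof (rule runs_Seq[where ?T1.0 = "g * 4 + 2" and ?T2.0 = 2],
      rule runs_For[where Inv = "\<lambda>x s'. med_frame i E m g s' \<and> imem s' 5 0 = int e \<and> rmem s' 0 = rmem st 0 \<and> rmem s' 2 = rmem st 2 \<and>
        imem s' 7 0 = int (card (?R x))" and n = g and T = 2], goal_cases)
    case (4 x s1)
    let ?e' = "e div g * g + x"
    have i4: "imem s1 4 0 = int g" using 4 by (simp add: med_frame_def)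
    have idx: "int e div int g * int g + int x = int ?e'" by (simp add: zdiv_int)
    have rd: "rmem st 0 (int ?e') = Z ?e'" "rmem st 0 (int e) = Z e"
    proof -
      have "?e' < m" using top 4(1) by linarith
      then show "rmem st 0 (int ?e') = Z ?e'" "rmem st 0 (int e) = Z e" using Z e by blast+
    qed
    have b: "bval I s1 thin_before \<longleftrightarrow> ?B ?e'"
      unfolding thin_before_def Let_def using 4 i4
      by (simp only: bval.simps ival.simps rval.simps idx rd of_nat_less_iff) auto
    have R: "card (?R (Suc x)) = (if ?B ?e' then Suc (card (?R x)) else card (?R x))"
    proof -
      have "?R (Suc x) = (if ?B ?e' then insert ?e' (?R x) else ?R x)" by (auto simp: less_Suc_eq)
      moreover have "?e' \<notin> ?R x" by simp
      ultimately show ?thesis using finR[of x] by (simp del: mem_Collect_eq)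
    qed
    show ?case
    proof (rule runs_Cond)
      assume "bval I s1 thin_before"
      then show "runs I W (IStore 7 (IConst 0) (IAdd (Var 7) (IConst 1))) s1 (2 - 1) (\<lambda>s'. imem s' 6 0 = int x \<and>
          med_frame i E m g (setv 6 (int (Suc x)) s') \<and> imem (setv 6 (int (Suc x)) s') 5 0 = int e \<and> rmem (setv 6 (int (Suc x)) s') 0 = rmem st 0 \<and>
          rmem (setv 6 (int (Suc x)) s') 2 = rmem st 2 \<and> imem (setv 6 (int (Suc x)) s') 7 0 = int (card (?R (Suc x))))"
        using 4 b R low[of x] W \<open>bval I s1 thin_before\<close> by (intro runs_IStore) (auto simp: med_frame_def fresh_def)
    next
      assume "\<not> bval I s1 thin_before"
      then show "runs I W Skip s1 (2 - 1) (\<lambda>s'. imem s' 6 0 = int x \<and>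
          med_frame i E m g (setv 6 (int (Suc x)) s') \<and> imem (setv 6 (int (Suc x)) s') 5 0 = int e \<and> rmem (setv 6 (int (Suc x)) s') 0 = rmem st 0 \<and>
          rmem (setv 6 (int (Suc x)) s') 2 = rmem st 2 \<and> imem (setv 6 (int (Suc x)) s') 7 0 = int (card (?R (Suc x))))"
        using 4 b R by (intro runs_Skip) (auto simp: med_frame_def fresh_def)
    qed simp
  next
    case (5 s1)
    then have r: "imem s1 7 0 = int (grank Z g e)" "imem s1 4 0 = int g" "imem s1 5 0 = int e" "rmem s1 0 (int e) = Z e"
      using Rg Z e by (simp_all add: med_frame_def)
    have pos: "int e div int g * (int g div 4) + int (grank Z g e) div 4 = int (e div g * (g div 4) + grank Z g e div 4)"
      by (simp add: zdiv_int)
    have "e div g * (g div 4) + grank Z g e div 4 \<le> e div g * g + g"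
      using grank_less[OF g(1), of Z e] by (intro add_mono mult_le_mono) auto
    then have posW: "int (e div g * (g div 4) + grank Z g e div 4) \<le> W" using top W by linarith
    have md: "int (grank Z g e) mod 4 < 1 \<longleftrightarrow> grank Z g e mod 4 = 0"
    proof -
      have "int (grank Z g e) mod 4 = int (grank Z g e mod 4)" by (simp add: zmod_int)
      then show ?thesis by simp
    qed
    show ?case
    proof (rule runs_Cond)
      assume "bval I s1 (ILess (IMod (Var 7) (IConst 4)) (IConst 1))"
      then have "grank Z g e mod 4 = 0" using r md by simp
      show "runs I W (RStore 2 (IAdd (IMul (IDiv (Var 5) (Var 4)) (IDiv (Var 4) (IConst 4))) (IDiv (Var 7) (IConst 4))) (RLoad 0 (Var 5))) s1 (2 - 1)
        (\<lambda>s'. med_frame i E m g s' \<and> imem s' 5 0 = int e \<and> rmem s' 0 = rmem st 0 \<and>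
          rmem s' 2 = (if grank Z g e mod 4 = 0 then (rmem st 2)(int (e div g * (g div 4) + grank Z g e div 4) := Z e) else rmem st 2))"
      proof (rule runs_RStore)
        have ix: "ival I s1 (IAdd (IMul (IDiv (Var 5) (Var 4)) (IDiv (Var 4) (IConst 4))) (IDiv (Var 7) (IConst 4)))
            = int (e div g * (g div 4) + grank Z g e div 4)" unfolding ival.simps r by (rule pos)
        show "\<bar>ival I s1 (IAdd (IMul (IDiv (Var 5) (Var 4)) (IDiv (Var 4) (IConst 4))) (IDiv (Var 7) (IConst 4)))\<bar> \<le> W"
          unfolding ix using posW by simp
        have rv: "rval I s1 (RLoad 0 (Var 5)) = Z e" using r by simp
        have "med_frame i E m g s1" "rmem s1 0 = rmem st 0" "rmem s1 2 = rmem st 2" using 5 by blast+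
        then show "?Q (s1\<lparr>rmem := (rmem s1)(2 := (rmem s1 2)(ival I s1 (IAdd (IMul (IDiv (Var 5) (Var 4)) (IDiv (Var 4) (IConst 4))) (IDiv (Var 7) (IConst 4))) := rval I s1 (RLoad 0 (Var 5))))\<rparr>)"
          unfolding ix rv using r \<open>grank Z g e mod 4 = 0\<close> by (simp add: med_frame_def fresh_def)
      qed simp
    next
      assume "\<not> bval I s1 (ILess (IMod (Var 7) (IConst 4)) (IConst 1))"
      then have "grank Z g e mod 4 \<noteq> 0" using r md by simp
      then show "runs I W Skip s1 (2 - 1) (\<lambda>s'. med_frame i E m g s' \<and> imem s' 5 0 = int e \<and> rmem s' 0 = rmem st 0 \<and>
          rmem s' 2 = (if grank Z g e mod 4 = 0 then (rmem st 2)(int (e div g * (g div 4) + grank Z g e div 4) := Z e) else rmem st 2))"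
        using 5 by (intro runs_Skip) (auto simp: med_frame_def fresh_def)
    qed simp
  qed (use fr e W in \<open>auto simp: med_frame_def fresh_def\<close>)
qed (use W in auto)

lemma runs_thin_level:
  assumes fr: "med_frame i E m g st" and g: "0 < g" "4 dvd g" and gm: "g dvd m"
    and W: "2 * int m \<le> W" "2 * int g \<le> W" and Z: "\<forall>e<m. rmem st 0 (int e) = Z e"
  shows "runs I W thin_level st (m * (4 * g + 7) + 3 * (m div 4) + 6)
    (\<lambda>s'. med_frame i E (m div 4) (2 * g) s' \<and> (\<forall>q<m div 4. rmem s' 0 (int q) = thin Z g q))"
  unfolding thin_level_def
proof (rule runs_Seq[where ?T1.0 = "m * (4 * g + 7) + 2" and ?T2.0 = "3 * (m div 4) + 4"])
  let ?w = "g div 4"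
  have w: "0 < ?w" using g by (auto elim!: dvdE)
  \<comment> \<open>The invariant is indexed by the source position \<open>e\<close> of a kept
    value; only at the end does \<open>thin_ex\<close> supply a source for every target
    \<open>q\<close>.\<close>
  let ?Inv = "\<lambda>x s'. med_frame i E m g s' \<and> (\<forall>e<m. rmem s' 0 (int e) = Z e) \<and>
    (\<forall>q e. e < x \<longrightarrow> e div g = q div ?w \<longrightarrow> grank Z g e = 4 * (q mod ?w) \<longrightarrow> rmem s' 2 (int q) = thin Z g q)"
  show "runs I W (For 5 (Var 3) thin_body) st (m * (4 * g + 7) + 2) (\<lambda>s'. runs I W
     (Seq (IStore 3 (IConst 0) (IDiv (Var 3) (IConst 4))) (Seq (IStore 4 (IConst 0) (IMul (IConst 2) (Var 4)))
         (For 5 (Var 3) (RStore 0 (Var 5) (RLoad 2 (Var 5)))))) s' (3 * (m div 4) + 4)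
    (\<lambda>s'. med_frame i E (m div 4) (2 * g) s' \<and> (\<forall>q<m div 4. rmem s' 0 (int q) = thin Z g q)))"
  proof (rule runs_For[where Inv = ?Inv and n = m and T = "4 * g + 5"], goal_cases)
    case (4 x s1)
    have Zs: "\<forall>e<m. rmem s1 0 (int e) = Z e" using 4 by blast
    let ?pos = "x div g * ?w + grank Z g x div 4"
    show ?case
    proof (rule runs_mono[OF runs_thin_body[OF _ g 4(1,3) W Zs gm] order_refl])
      fix s2
      assume s2: "med_frame i E m g s2 \<and> imem s2 5 0 = int x \<and> rmem s2 0 = rmem s1 0 \<and>
         rmem s2 2 = (if grank Z g x mod 4 = 0 then (rmem s1 2)(int ?pos := Z x) else rmem s1 2)"
      have new: "rmem s2 2 (int q) = thin Z g q"
        if "e < Suc x" "e div g = q div ?w" "grank Z g e = 4 * (q mod ?w)" for q e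
      \<comment> \<open>A target cell determines group and rank of its source, so a write can hit
        cell \<open>q\<close> only with the right value.\<close>
      proof (cases "grank Z g x mod 4 = 0 \<and> q = ?pos")
        case True
        have "grank Z g x div 4 < ?w" using grank_less[OF g(1), of Z x] g by (auto elim!: dvdE)
        then have "q div ?w = x div g" "q mod ?w = grank Z g x div 4" using True w by simp_all
        then have "thin Z g q = Z x" using True by (intro thin_eq[OF g(1)]) auto
        then show ?thesis using s2 True by simp
      next
        case False
        have "e \<noteq> x"
        proof
          assume "e = x"
          then have "grank Z g x mod 4 = 0" "grank Z g x div 4 = q mod ?w" using that by simp_all
          moreover have "x div g = q div ?w" using that(2) \<open>e = x\<close> by (simp only:)
          ultimately have "?pos = q div ?w * ?w + q mod ?w" by (simp only:)
          then have "?pos = q" by (simp only: div_mult_mod_eq)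
          then show False using False \<open>grank Z g x mod 4 = 0\<close> by simp
        qed
        then have "e < x" using that(1) by simp
        then have "rmem s1 2 (int q) = thin Z g q" using that(2,3) 4(2) by blast
        moreover have "rmem s2 2 (int q) = rmem s1 2 (int q)"
        proof (cases "grank Z g x mod 4 = 0")
          case True
          then have ne: "int q \<noteq> int ?pos" using False by (simp only: of_nat_eq_iff) simp
          have "rmem s2 2 = (rmem s1 2)(int ?pos := Z x)" using s2 True by (simp only: simp_thms if_True)
          then show ?thesis by (simp only: fun_upd_other[OF ne])
        qed (use s2 in simp)
        ultimately show ?thesis by simp
      qed
      show "imem s2 5 0 = int x \<and> ?Inv (Suc x) (setv 5 (int (Suc x)) s2)"
        using s2 Zs new by (auto simp: med_frame_def fresh_def)
    qed (use 4 in blast)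
  next
    case (5 s1)
    have th: "rmem s1 2 (int q) = thin Z g q" if q: "q < m div 4" for q
    proof -
      obtain e where e: "e div g = q div ?w" "grank Z g e = 4 * (q mod ?w)" by (rule thin_ex[OF g, of q Z])
      have "m div 4 = m div g * ?w" using gm g by (auto elim!: dvdE)
      then have "q div ?w < m div g" using q w by (simp add: div_less_iff_less_mult)
      then have "e < m" using e gm g by (metis div_less_iff_less_mult dvd_div_mult_self)
      then show ?thesis using 5 e by blast
    qed
    have m4: "int m div 4 = int (m div 4)" by (simp add: zdiv_int)
    have f: "imem s1 0 0 = int i" "fresh s1" "rmem s1 1 = E" "imem s1 3 0 = int m" "imem s1 4 0 = int g"
      using 5 by (auto simp: med_frame_def)
    show ?case
    proof (rule runs_Seq[where ?T1.0 = 1 and ?T2.0 = "3 * (m div 4) + 3"], rule runs_IStore, goal_cases)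
      case 4
      show ?case
      proof (rule runs_Seq[where ?T1.0 = 1 and ?T2.0 = "3 * (m div 4) + 2"], rule runs_IStore, goal_cases)
        case 4
        show ?case
          by (rule runs_For[where Inv = "\<lambda>x s'. med_frame i E (m div 4) (2 * g) s' \<and> (\<forall>q<m div 4. rmem s' 2 (int q) = thin Z g q) \<and>
              (\<forall>q<x. rmem s' 0 (int q) = thin Z g q)" and n = "m div 4" and T = 1])
            (use W f th in \<open>auto simp: med_frame_def fresh_def m4 less_Suc_eq intro!: runs_RStore\<close>)
      qed (use f W in \<open>auto simp: m4\<close>)
    qed (use f W in \<open>auto simp: m4\<close>)
  qed (use fr W Z in \<open>auto simp: med_frame_def fresh_def\<close>)
qed simp

text \<open>A level costs about four times length times group size, and this product halves from
  level to level because the length shrinks by 4 while the group size doubles. The sum stays below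
  12 times the initial product; with groups of 64 this is \<open>768 * L\<close>.\<close>

lemma runs_median_loop:
  assumes "med_frame i E (8 ^ h * g) g st" "64 \<le> g" "8 dvd g" "2 * int (8 ^ h * g) \<le> W"
    and "\<forall>e<8 ^ h * g. rmem st 0 (int e) = Z e"
  shows "runs I W median_loop st (12 * 8 ^ h * g * g)
    (\<lambda>s'. \<exists>m. imem s' 0 0 = int i \<and> fresh s' \<and> rmem s' 1 = E \<and> imem s' 3 0 = int m \<and> rmem s' 0 (int (m div 2)) = approx_median h g Z)"
  using assms
proof (induction h arbitrary: g st Z)
  case 0
  have g: "0 < g" "4 dvd g" using 0 by (auto elim!: dvdE)
  have lev: "runs I W thin_level st (g * (4 * g + 7) + 3 * (g div 4) + 6)
    (\<lambda>s'. med_frame i E (g div 4) (2 * g) s' \<and> (\<forall>q<g div 4. rmem s' 0 (int q) = thin Z g q))"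
    using 0 g by (intro runs_thin_level) auto
  show ?case unfolding median_loop_def
  proof (rule runs_While_step[where ?T2.0 = 1, OF _ runs_mono[OF lev order_refl]])
    show "bval I st (BNot (ILess (Var 3) (Var 4)))" using 0 by (simp add: med_frame_def)
    fix s1 assume s1: "med_frame i E (g div 4) (2 * g) s1 \<and> (\<forall>q<g div 4. rmem s1 0 (int q) = thin Z g q)"
    have lt: "g div 4 < 2 * g" using g by auto
    have v: "rmem s1 0 (int (g div 4 div 2)) = thin Z g (g div 8)"
    proof -
      \<comment> \<open>After the last level the length is \<open>g div 4\<close>, so the cell in
        its middle is the one selected by \<open>approx_median\<close>.\<close>
      have "g div 4 div 2 = g div 8" by (simp add: div_mult2_eq[symmetric])
      moreover have "g div 8 < g div 4" using 0(3) g by (auto elim!: dvdE)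
      ultimately show ?thesis using s1 by simp
    qed
    show "runs I W (While (BNot (ILess (Var 3) (Var 4))) thin_level) s1 1
      (\<lambda>s'. \<exists>m. imem s' 0 0 = int i \<and> fresh s' \<and> rmem s' 1 = E \<and> imem s' 3 0 = int m \<and> rmem s' 0 (int (m div 2)) = approx_median 0 g Z)"
      using s1 lt v by (intro runs_While_end exI[of _ "g div 4"]) (auto simp: med_frame_def)
  next
    have "64 * g \<le> g * g" using 0(2) by (rule mult_le_mono1)
    moreover have "1 + (g * (4 * g + 7) + 3 * (g div 4) + 6) + 1 \<le> 4 * (g * g) + 8 * g + 8" by (simp add: algebra_simps)
    ultimately show "1 + (g * (4 * g + 7) + 3 * (g div 4) + 6) + 1 \<le> 12 * 8 ^ 0 * g * g"
      using 0(2) by (simp only: power_0 mult_1_right mult.assoc)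
  qed
next
  case (Suc h)
  let ?m = "8 ^ Suc h * g"
  have g: "0 < g" "4 dvd g" using Suc.prems by (auto elim!: dvdE)
  have gm: "g \<le> ?m" by simp
  have m4: "?m div 4 = 8 ^ h * (2 * g)" by simp
  have lev: "runs I W thin_level st (?m * (4 * g + 7) + 3 * (?m div 4) + 6)
    (\<lambda>s'. med_frame i E (?m div 4) (2 * g) s' \<and> (\<forall>q<?m div 4. rmem s' 0 (int q) = thin Z g q))"
  proof (rule runs_thin_level[OF Suc.prems(1) g _ Suc.prems(4) _ Suc.prems(5)])
    have "int g \<le> int ?m" using gm by (simp only: of_nat_le_iff)
    then show "2 * int g \<le> W" using Suc.prems(4) by linarith
  qed simp
  show ?case unfolding median_loop_def
  proof (rule runs_While_step[where ?T2.0 = "12 * 8 ^ h * (2 * g) * (2 * g)", OF _ runs_mono[OF lev order_refl]])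
    have "\<not> ?m < g" using gm by (simp only: not_less)
    then show "bval I st (BNot (ILess (Var 3) (Var 4)))" using Suc.prems(1) unfolding med_frame_def bval.simps ival.simps by (simp only: of_nat_less_iff) simp
    fix s1 assume s1: "med_frame i E (?m div 4) (2 * g) s1 \<and> (\<forall>q<?m div 4. rmem s1 0 (int q) = thin Z g q)"
    have "int (8 ^ h * (2 * g)) \<le> int ?m" by simp
    then have W: "2 * int (8 ^ h * (2 * g)) \<le> W" using Suc.prems(4) by linarith
    show "runs I W (While (BNot (ILess (Var 3) (Var 4))) thin_level) s1 (12 * 8 ^ h * (2 * g) * (2 * g))
      (\<lambda>s'. \<exists>m. imem s' 0 0 = int i \<and> fresh s' \<and> rmem s' 1 = E \<and> imem s' 3 0 = int m \<and> rmem s' 0 (int (m div 2)) = approx_median (Suc h) g Z)"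
      unfolding median_loop_def[symmetric] approx_median.simps
      by (rule Suc.IH) (use s1 Suc.prems W in \<open>auto simp only: m4, auto\<close>)
  next
    define X where "X = 8 ^ h * g"
    have X: "?m = 8 * X" "12 * 8 ^ h * (2 * g) * (2 * g) = 48 * (X * g)" "12 * 8 ^ Suc h * g * g = 96 * (X * g)" by (simp_all add: X_def)
    have "64 * X \<le> X * g" using Suc.prems(2) by simp
    moreover have "g \<le> X" by (simp add: X_def)
    moreover have "1 + (8 * X * (4 * g + 7) + 3 * (8 * X div 4) + 6) \<le> 32 * (X * g) + 62 * X + 7" by (simp add: algebra_simps)
    ultimately show "1 + (?m * (4 * g + 7) + 3 * (?m div 4) + 6) + 12 * 8 ^ h * (2 * g) * (2 * g) \<le> 12 * 8 ^ Suc h * g * g"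
      unfolding X using Suc.prems(2) by linarith
  qed
qed

definition block_est :: com where
  "block_est = Seq sketch_loop (Seq (IStore 3 (IConst 0) eL) (Seq (IStore 4 (IConst 0) (IConst 64))
     (Seq median_loop (RStore 1 (Var 0) (RLoad 0 (IDiv (Var 3) (IConst 2)))))))"

definition phase1 :: com where "phase1 = For 0 eN block_est"

context recovery_input begin

definition est :: "nat \<Rightarrow> real" where "est i = approx_median H 64 (Zv i)"

lemma runs_block_est:
  assumes "imem st 0 0 = int i" "i < N" "fresh st" "rmem st 1 = E"
  shows "runs I W block_est st (L * (s * 3 + 5) + 768 * L + 5)
    (\<lambda>s'. imem s' 0 0 = int i \<and> fresh s' \<and> rmem s' 1 = E(int i := est i))"
proof -
  have L64: "64 \<le> L" by (simp add: L)
  have L8: "8 ^ H * 64 = L" by (simp add: L)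
  have ml: "runs I W median_loop s3 (768 * L)
     (\<lambda>s'. \<exists>m. imem s' 0 0 = int i \<and> fresh s' \<and> rmem s' 1 = E \<and> imem s' 3 0 = int m \<and> rmem s' 0 (int (m div 2)) = approx_median H 64 (Zv i))"
    if "med_frame i E L 64 s3" "\<forall>l<L. rmem s3 0 (int l) = Zv i l" for s3
    using runs_median_loop[of i E H 64 s3 W "Zv i" I, unfolded L8] that W_bounds L
    by (simp add: mult.commute mult.left_commute)
  show ?thesis unfolding block_est_def
  proof (rule runs_Seq[where ?T2.0 = "768 * L + 3", OF runs_mono[OF runs_sketch_loop[OF assms] order_refl]])
    fix s1 assume s1: "imem s1 0 0 = int i \<and> fresh s1 \<and> rmem s1 1 = E \<and> (\<forall>l<L. rmem s1 0 (int l) = Zv i l)"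
    show "runs I W (Seq (IStore 3 (IConst 0) eL) (Seq (IStore 4 (IConst 0) (IConst 64))
       (Seq median_loop (RStore 1 (Var 0) (RLoad 0 (IDiv (Var 3) (IConst 2))))))) s1 (768 * L + 3)
       (\<lambda>s'. imem s' 0 0 = int i \<and> fresh s' \<and> rmem s' 1 = E(int i := est i))"
    proof (rule runs_Seq[where ?T1.0 = 1 and ?T2.0 = "768 * L + 2"], rule runs_IStore, goal_cases)
      case 4
      show ?case
      proof (rule runs_Seq[where ?T1.0 = 1 and ?T2.0 = "768 * L + 1"], rule runs_IStore, goal_cases)
        case 4
        show ?case
        proof (rule runs_Seq[where ?T1.0 = "768 * L" and ?T2.0 = 1], rule runs_mono[OF ml order_refl], goal_cases)
          case (3 s5)
          then obtain m where m: "imem s5 0 0 = int i" "fresh s5" "rmem s5 1 = E" "imem s5 3 0 = int m" "rmem s5 0 (int (m div 2)) = est i"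
            by (auto simp: est_def)
          have "int m div 2 = int (m div 2)" by (simp add: zdiv_int)
          then show ?case using m W_bounds assms(2) by (intro runs_RStore) (auto simp: fresh_def)
        qed (use s1 in \<open>auto simp: med_frame_def fresh_def ival_eL\<close>)
      qed (use W_bounds L64 in auto)
    qed (use W_bounds in \<open>auto simp: ival_eL\<close>)
  qed simp
qed

lemma runs_phase1:
  assumes "fresh st"
  shows "runs I W phase1 st (N * (L * (s * 3 + 5) + 768 * L + 7) + 2)
    (\<lambda>s'. fresh s' \<and> (\<forall>i<N. rmem s' 1 (int i) = est i))"
  unfolding phase1_def
proof (rule runs_For[where Inv = "\<lambda>i s'. fresh s' \<and> (\<forall>i'<i. rmem s' 1 (int i') = est i')" and n = N
      and T = "L * (s * 3 + 5) + 768 * L + 5"], goal_cases)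
  case (4 i s1)
  show ?case
    by (rule runs_mono[OF runs_block_est[OF 4(3,1) _ refl] order_refl]) (use 4 in \<open>auto simp: fresh_def less_Suc_eq\<close>)
qed (use assms W_bounds in \<open>auto simp: ival_eN fresh_def\<close>)

end

section \<open>The tournament phase\<close>

definition beats :: "(nat \<Rightarrow> real) \<Rightarrow> nat \<Rightarrow> nat \<Rightarrow> bool" where
  "beats E c d \<longleftrightarrow> E d < E c \<or> E d = E c \<and> c < d"

definition winner :: "(nat \<Rightarrow> real) \<Rightarrow> nat \<Rightarrow> nat \<Rightarrow> nat" where
  "winner E l r = (if beats E r l then r else l)"

lemma beats_total: "c \<noteq> d \<Longrightarrow> beats E c d \<or> beats E d c"
  unfolding beats_def by linarith

lemma beats_trans: "beats E a b \<Longrightarrow> beats E b c \<Longrightarrow> beats E a c"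
  unfolding beats_def by linarith

lemma winner_beats: "c = l \<or> c = r \<Longrightarrow> winner E l r = c \<or> beats E (winner E l r) c"
  using beats_total[of l r E] by (auto simp: winner_def)

text \<open>
  The tournament tree has leaves \<open>N, \<dots>, 2N - 1\<close>, and the children of the inner node
  \<open>v\<close> are \<open>2v\<close> and \<open>2v + 1\<close>; since every node \<open>v \<ge> 2\<close> has the parent \<open>v div 2\<close>, no padding to
  a power of two is needed.
\<close>

definition node_ok :: "(nat \<Rightarrow> real) \<Rightarrow> (nat \<Rightarrow> nat) \<Rightarrow> nat \<Rightarrow> bool" where
  "node_ok E t v \<longleftrightarrow> t v = winner E (t (2 * v)) (t (2 * v + 1))"

text \<open>The reflexive ancestor relation in heap numbering.\<close>

definition above :: "nat \<Rightarrow> nat \<Rightarrow> bool" where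
  "above v u \<longleftrightarrow> (\<exists>d. v = u div 2 ^ d)"

lemma above_refl: "above v v" unfolding above_def by (rule exI[of _ 0]) simp

lemma above_parent: "above v u \<Longrightarrow> above (v div 2) u"
proof -
  assume "above v u"
  then obtain d where "v = u div 2 ^ d" by (auto simp: above_def)
  then have "v div 2 = u div (2 ^ d * 2)" by (simp only: div_mult2_eq)
  then have "v div 2 = u div 2 ^ Suc d" by (simp only: power_Suc mult.commute)
  then show ?thesis unfolding above_def by blast
qed

lemma above_cases: "above v u \<Longrightarrow> v = u \<or> above v (u div 2)"
proof -
  assume "above v u"
  then obtain d where d: "v = u div 2 ^ d" by (auto simp: above_def)
  show ?thesis
  proof (cases d)
    case (Suc d')
    then have "v = (u div 2) div 2 ^ d'" using d by (simp add: div_mult2_eq)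
    then show ?thesis unfolding above_def by blast
  qed (use d in simp)
qed

text \<open>Climbing from a node to the root, the label of each parent equals or beats the labels of
  its children.\<close>

lemma root_beats:
  assumes ok: "\<And>v. 1 \<le> v \<Longrightarrow> v < N \<Longrightarrow> node_ok E t v" and v: "1 \<le> v" "v < 2 * N"
  shows "t 1 = t v \<or> beats E (t 1) (t v)"
  using v
proof (induction v rule: less_induct)
  case (less v)
  show ?case
  proof (cases "v = 1")
    case False
    then have p: "1 \<le> v div 2" "v div 2 < N" "v div 2 < v" using less.prems by auto
    then have a: "t 1 = t (v div 2) \<or> beats E (t 1) (t (v div 2))" using less.IH less.prems by auto
    have "v = 2 * (v div 2) \<or> v = 2 * (v div 2) + 1" by linarith
    then have "t (v div 2) = t v \<or> beats E (t (v div 2)) (t v)"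
      using ok[OF p(1,2)] winner_beats[of "t v" "t (2 * (v div 2))" "t (2 * (v div 2) + 1)" E] unfolding node_ok_def by metis
    then show ?thesis using a beats_trans by metis
  qed simp
qed

text \<open>With only strict comparison, negation and conjunction available, the disjunction is
  written by De Morgan, and a tie is recognised as a failed strict comparison once the other one has
  failed too.\<close>

definition eBeats :: "iexp \<Rightarrow> iexp \<Rightarrow> bexp" where
  "eBeats c d = BNot (BAnd (BNot (RLess (RLoad 1 d) (RLoad 1 c)))
     (BNot (BAnd (BNot (RLess (RLoad 1 c) (RLoad 1 d))) (ILess c d))))"

definition combine :: com where
  "combine = (let l = ILoad 10 (IMul (IConst 2) (Var 12)); r = ILoad 10 (IAdd (IMul (IConst 2) (Var 12)) (IConst 1)) in
     Cond (eBeats r l) (IStore 10 (Var 12) r) (IStore 10 (Var 12) l))"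

text \<open>The counter of the first loop ends at \<open>N\<close> and is reused to descend through
  the inner nodes, so both children are complete before their parent.\<close>

definition heap_build :: com where
  "heap_build = Seq (For 12 eN (IStore 10 (IAdd eN (Var 12)) (Var 12)))
     (While (ILess (IConst 1) (Var 12)) (Seq (IStore 12 (IConst 0) (ISub (Var 12) (IConst 1))) combine))"

text \<open>The winner's estimate is replaced by -1, below every genuine estimate, so that it never
  wins again while a real block remains. Only the path from its leaf to the root has to be
  replayed.\<close>

definition heap_pop :: com where
  "heap_pop = Seq (IStore 14 (IConst 0) (ILoad 10 (IConst 1)))
     (Seq (IStore 11 (Var 13) (Var 14))
       (Seq (RStore 1 (Var 14) (ROfInt (IConst (-1))))
         (Seq (IStore 12 (IConst 0) (IDiv (IAdd eN (Var 14)) (IConst 2)))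
           (While (ILess (IConst 0) (Var 12)) (Seq combine (IStore 12 (IConst 0) (IDiv (Var 12) (IConst 2))))))))"

definition phase2 :: com where "phase2 = Seq heap_build (For 13 eK heap_pop)"

lemma runs_combine:
  assumes v: "imem st 12 0 = int v" "1 \<le> v" "v < N" and fr: "fresh st" and E: "\<forall>i<N. rmem st 1 (int i) = E i"
    and t: "imem st 10 (int (2 * v)) = int l" "imem st 10 (int (2 * v + 1)) = int r" "l < N" "r < N" and W: "2 * int N \<le> W"
  shows "runs I W combine st 2 (\<lambda>s'. s' = st\<lparr>imem := (imem st)(10 := (imem st 10)(int v := int (winner E l r)))\<rparr>)"
proof -
  let ?el = "ILoad 10 (IMul (IConst 2) (Var 12))" and ?er = "ILoad 10 (IAdd (IMul (IConst 2) (Var 12)) (IConst 1))"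
  have ix: "2 * int v = int (2 * v)" "2 * int v + 1 = int (2 * v + 1)" by simp_all
  have il: "ival I st ?el = int l" "ival I st ?er = int r"
    unfolding ival.simps v(1) by (simp only: ix(1) t(1), simp only: ix(2) t(2))
  have b: "bval I st (eBeats ?er ?el) \<longleftrightarrow> beats E r l"
    unfolding eBeats_def bval.simps rval.simps il using E t by (auto simp: beats_def)
  show ?thesis unfolding combine_def Let_def
  proof (rule runs_Cond)
    assume "bval I st (eBeats ?er ?el)"
    then have "winner E l r = r" using b by (simp add: winner_def)
    then show "runs I W (IStore 10 (Var 12) ?er) st (2 - 1) (\<lambda>s'. s' = st\<lparr>imem := (imem st)(10 := (imem st 10)(int v := int (winner E l r)))\<rparr>)"
      using il v t W by (intro runs_IStore) auto
  next
    assume "\<not> bval I st (eBeats ?er ?el)"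
    then have "winner E l r = l" using b by (simp add: winner_def)
    then show "runs I W (IStore 10 (Var 12) ?el) st (2 - 1) (\<lambda>s'. s' = st\<lparr>imem := (imem st)(10 := (imem st 10)(int v := int (winner E l r)))\<rparr>)"
      using il v t W by (intro runs_IStore) auto
  qed simp
qed

text \<open>State of the tree: the abstract tree \<open>t\<close> is stored at nodes \<open>lo, \<dots>, 2N - 1\<close>.\<close>

definition holds :: "nat \<Rightarrow> nat \<Rightarrow> (nat \<Rightarrow> real) \<Rightarrow> (nat \<Rightarrow> nat) \<Rightarrow> state \<Rightarrow> bool" where
  "holds N lo E t st \<longleftrightarrow> fresh st \<and> (\<forall>i<N. rmem st 1 (int i) = E i) \<and>
     (\<forall>v. lo \<le> v \<longrightarrow> v < 2 * N \<longrightarrow> imem st 10 (int v) = int (t v) \<and> t v < N \<and> above v (N + t v)) \<and> (\<forall>i<N. t (N + i) = i)"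

text \<open>The parameter \<open>lo\<close> serves both uses: \<open>lo = v + 1\<close> while the
  tree is being built downwards in node number, \<open>lo = 1\<close> while a path is
  repaired.\<close>

lemma combine_holds:
  assumes h: "holds N lo E t st" and v: "imem st 12 0 = int v" "1 \<le> v" "v < N" "lo \<le> 2 * v" and lo: "lo \<le> v + 1" and W: "2 * int N \<le> W"
  shows "runs I W combine st 2 (\<lambda>s'. \<exists>w. holds N (min lo v) E (t(v := w)) s' \<and> node_ok E (t(v := w)) v \<and>
     imem s' 12 = imem st 12 \<and> imem s' 13 = imem st 13 \<and> imem s' 11 = imem st 11)"
proof -
  let ?l = "t (2 * v)" and ?r = "t (2 * v + 1)"
  have lr: "imem st 10 (int (2 * v)) = int ?l" "?l < N" "above (2 * v) (N + ?l)"
      "imem st 10 (int (2 * v + 1)) = int ?r" "?r < N" "above (2 * v + 1) (N + ?r)"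
  proof -
    have gen: "imem st 10 (int u) = int (t u) \<and> t u < N \<and> above u (N + t u)" if "lo \<le> u" "u < 2 * N" for u
      using h that unfolding holds_def by blast
    have "imem st 10 (int (2 * v)) = int ?l \<and> ?l < N \<and> above (2 * v) (N + ?l)" by (rule gen) (use v in linarith)+
    then show "imem st 10 (int (2 * v)) = int ?l" "?l < N" "above (2 * v) (N + ?l)" by blast+
    have "imem st 10 (int (2 * v + 1)) = int ?r \<and> ?r < N \<and> above (2 * v + 1) (N + ?r)" by (rule gen) (use v in linarith)+
    then show "imem st 10 (int (2 * v + 1)) = int ?r" "?r < N" "above (2 * v + 1) (N + ?r)" by blast+
  qed
  let ?w = "winner E ?l ?r"
  have w: "?w < N" "above v (N + ?w)"
  proof -
    show "?w < N" using lr by (simp add: winner_def)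
    have "above (2 * v div 2) (N + ?l)" "above ((2 * v + 1) div 2) (N + ?r)" 
      by (rule above_parent[OF lr(3)], rule above_parent[OF lr(6)])
    then show "above v (N + ?w)" by (simp add: winner_def)
  qed
  show ?thesis
  proof (rule runs_mono[OF runs_combine[OF v(1-3) _ _ lr(1,4,2,5) W] order_refl])
    show "fresh st" "\<forall>i<N. rmem st 1 (int i) = E i" using h by (auto simp: holds_def)
    fix s' assume s': "s' = st\<lparr>imem := (imem st)(10 := (imem st 10)(int v := int ?w))\<rparr>"
    have "holds N (min lo v) E (t(v := ?w)) s'"
      unfolding holds_def
    proof (intro conjI allI impI)
      show "fresh s'" using h s' by (auto simp: holds_def fresh_def)
      show "rmem s' 1 (int i) = E i" if "i < N" for i using h s' that by (simp add: holds_def)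
      show "(t(v := ?w)) (N + i) = i" if "i < N" for i using h v that by (simp add: holds_def)
      fix u assume u: "min lo v \<le> u" "u < 2 * N"
      show "imem s' 10 (int u) = int ((t(v := ?w)) u)" "(t(v := ?w)) u < N" "above u (N + (t(v := ?w)) u)"
      proof -
        have "lo \<le> u" if "u \<noteq> v" using u lo that by linarith
        then have "imem s' 10 (int u) = int ((t(v := ?w)) u) \<and> (t(v := ?w)) u < N \<and> above u (N + (t(v := ?w)) u)"
          using w h s' u unfolding holds_def by (cases "u = v") auto
        then show "imem s' 10 (int u) = int ((t(v := ?w)) u)" "(t(v := ?w)) u < N" "above u (N + (t(v := ?w)) u)" by blast+
      qed
    qed
    moreover have "node_ok E (t(v := ?w)) v" using v by (simp add: node_ok_def)
    ultimately show "\<exists>w. holds N (min lo v) E (t(v := w)) s' \<and> node_ok E (t(v := w)) v \<and>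
       imem s' 12 = imem st 12 \<and> imem s' 13 = imem st 13 \<and> imem s' 11 = imem st 11"
      using s' by (intro exI[of _ ?w]) simp
  qed
qed

lemma node_ok_upd:
  assumes "node_ok E t u" "u \<noteq> v" "v \<noteq> 2 * u" "v \<noteq> 2 * u + 1" shows "node_ok E (t(v := w)) u"
  using assms by (simp add: node_ok_def)

definition heap_ok :: "nat \<Rightarrow> (nat \<Rightarrow> real) \<Rightarrow> (nat \<Rightarrow> nat) \<Rightarrow> bool" where
  "heap_ok N E t \<longleftrightarrow> (\<forall>u. 1 \<le> u \<longrightarrow> u < N \<longrightarrow> node_ok E t u)"

text \<open>The number of binary digits, equal to the number of rounds of a loop that halves a node
  down to 0.\<close>

fun height :: "nat \<Rightarrow> nat" where
  "height v = (if v = 0 then 0 else Suc (height (v div 2)))"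

declare height.simps [simp del]

lemma height_le: "0 < v \<Longrightarrow> 2 ^ height v \<le> 2 * v"
proof (induction v rule: less_induct)
  case (less v)
  show ?case
  proof (cases "v div 2 = 0")
    case True
    then have "height v = 1" using less.prems by (simp add: height.simps[of v] height.simps[of 0])
    then show ?thesis using less.prems by simp
  next
    case False
    then have "2 ^ height (v div 2) \<le> 2 * (v div 2)" using less.prems by (intro less.IH) auto
    then show ?thesis using less.prems by (simp add: height.simps[of v])
  qed
qed

lemma height_div2: "0 < v \<Longrightarrow> height (v div 2) < height v"
  by (simp add: height.simps[of v])

lemma height_mono: "u \<le> v \<Longrightarrow> height u \<le> height v"
proof (induction v arbitrary: u rule: less_induct)
  case (less v)
  show ?case
  proof (cases "u = 0")
    case True
    then show ?thesis by (simp add: height.simps[of 0])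
  next
    case False
    then have "height (u div 2) \<le> height (v div 2)" using less.prems by (intro less.IH) (auto intro: div_le_mono)
    then show ?thesis using False less.prems by (simp add: height.simps[of u] height.simps[of v])
  qed
qed

section \<open>Correctness of building the tree and of removing its winner\<close>

context recovery_input begin

lemma runs_heap_build:
  assumes fr: "fresh st" and E: "\<forall>i<N. rmem st 1 (int i) = E i"
  shows "runs I W heap_build st (8 * N + 5) (\<lambda>s'. \<exists>t. holds N 1 E t s' \<and> heap_ok N E t)"
  unfolding heap_build_def
proof (rule runs_Seq[where ?T1.0 = "N * 3 + 2" and ?T2.0 = "N * 4 + 1"],
    rule runs_For[where Inv = "\<lambda>x s'. fresh s' \<and> (\<forall>i<N. rmem s' 1 (int i) = E i) \<and> (\<forall>i<x. imem s' 10 (int (N + i)) = int i)" and n = N and T = 1], goal_cases)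
  case (4 x s1)
  then show ?case using W_bounds by (intro runs_IStore) (auto simp: ival_eN fresh_def less_Suc_eq)
next
  case (5 s1)
  let ?Inv = "\<lambda>s'. \<exists>v t. imem s' 12 0 = int v \<and> 1 \<le> v \<and> v \<le> N \<and> holds N v E t s' \<and> (\<forall>u. v \<le> u \<longrightarrow> u < N \<longrightarrow> node_ok E t u)"
  show ?case
  proof (rule runs_While[where Inv = ?Inv and \<mu> = "\<lambda>s'. nat (imem s' 12 0)" and T = 3])
    have "holds N N E (\<lambda>v. v - N) s1" unfolding holds_def
    proof (intro conjI allI impI)
      fix v assume v: "N \<le> v" "v < 2 * N"
      then obtain w where w: "v = N + w" "w < N" by (auto dest: le_Suc_ex)
      then have "imem s1 10 (int (N + w)) = int w" using 5 by blast
      then show "imem s1 10 (int v) = int (v - N)" by (simp add: w(1))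
      show "v - N < N" using v by simp
      show "above v (N + (v - N))" using v above_refl by simp
    qed (use 5 in auto)
    then show "?Inv s1" using 5 dims by (intro exI[of _ N] exI[of _ "\<lambda>v. v - N"]) auto
    fix s2 assume "?Inv s2" "bval I s2 (ILess (IConst 1) (Var 12))"
    then obtain v t where v: "imem s2 12 0 = int v" "1 < v" "v \<le> N" "holds N v E t s2" "\<forall>u. v \<le> u \<longrightarrow> u < N \<longrightarrow> node_ok E t u"
      by auto
    let ?s3 = "setv 12 (int (v - 1)) s2"
    have h3: "holds N v E t ?s3" using v(4) by (auto simp: holds_def fresh_def)
    have c: "runs I W combine ?s3 2 (\<lambda>s'. \<exists>w. holds N (min v (v - 1)) E (t(v - 1 := w)) s' \<and> node_ok E (t(v - 1 := w)) (v - 1) \<and>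
        imem s' 12 = imem ?s3 12 \<and> imem s' 13 = imem ?s3 13 \<and> imem s' 11 = imem ?s3 11)"
      by (rule combine_holds[OF h3]) (use v W_bounds in auto)
    show "runs I W (Seq (IStore 12 (IConst 0) (ISub (Var 12) (IConst 1))) combine) s2 3 (\<lambda>s'. ?Inv s' \<and> nat (imem s' 12 0) < nat (imem s2 12 0))"
    proof (rule runs_Seq[where ?T1.0 = 1 and ?T2.0 = 2], rule runs_IStore, goal_cases)
      case 4
      have eq: "s2\<lparr>imem := (imem s2)(12 := (imem s2 12)(ival I s2 (IConst 0) := ival I s2 (ISub (Var 12) (IConst 1))))\<rparr> = ?s3"
        using v by (simp add: of_nat_diff)
      show ?case unfolding eq
      proof (rule runs_mono[OF c order_refl])
        fix s' assume "\<exists>w. holds N (min v (v - 1)) E (t(v - 1 := w)) s' \<and> node_ok E (t(v - 1 := w)) (v - 1) \<and>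
          imem s' 12 = imem ?s3 12 \<and> imem s' 13 = imem ?s3 13 \<and> imem s' 11 = imem ?s3 11"
        moreover have "min v (v - 1) = v - 1" by simp
        ultimately obtain w where w: "holds N (v - 1) E (t(v - 1 := w)) s'" "node_ok E (t(v - 1 := w)) (v - 1)" "imem s' 12 = imem ?s3 12"
          by metis
        from w(3) have "imem s' 12 0 = int (v - 1)" by simp
        note w = w(1,2) this
        have "node_ok E (t(v - 1 := w)) u" if "v - 1 \<le> u" "u < N" for u
        proof (cases "u = v - 1")
          case False
          then show ?thesis using v that by (intro node_ok_upd) auto
        qed (use w in simp)
        then show "?Inv s' \<and> nat (imem s' 12 0) < nat (imem s2 12 0)"
          using w v by (intro conjI exI[of _ "v - 1"] exI[of _ "t(v - 1 := w)"]) auto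
      qed
    qed (use v W_bounds in auto)
  next
    fix s2 assume "?Inv s2" "\<not> bval I s2 (ILess (IConst 1) (Var 12))"
    then show "\<exists>t. holds N 1 E t s2 \<and> heap_ok N E t" by (auto simp: heap_ok_def dest!: le_antisym)
  qed (use 5 in simp)
qed (use fr E W_bounds in \<open>auto simp: ival_eN fresh_def\<close>)

text \<open>By \<open>holds\<close> a label occurs only at ancestors of its own leaf. Lowering the
  winner's estimate therefore cannot invalidate a node off the path of that leaf: neither child of
  such a node carries the changed label.\<close>

lemma runs_heap_pop:
  assumes h: "holds N 1 E t st" and ok: "heap_ok N E t" and q: "imem st 13 0 = int q" "q < K"
  shows "runs I W heap_pop st (4 * height N + 5) (\<lambda>s'. \<exists>t'. holds N 1 (E(t 1 := -1)) t' s' \<and> heap_ok N (E(t 1 := -1)) t' \<and>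
     imem s' 13 0 = int q \<and> imem s' 11 = (imem st 11)(int q := int (t 1)))"
proof -
  let ?w = "t 1" and ?E = "E(t 1 := -1)"
  have w: "imem st 10 1 = int ?w" "?w < N"
    using h dims unfolding holds_def by (auto dest!: spec[of _ "1::nat"])
  let ?v = "(N + ?w) div 2"
  have v: "?v < N" using w by linarith
  \<comment> \<open>All nodes are right except possibly the current one and its ancestors; when the
    walk reaches 0 no exception remains.\<close>
  let ?Inv = "\<lambda>s'. \<exists>v t'. imem s' 12 0 = int v \<and> v < N \<and> holds N 1 ?E t' s' \<and> (\<forall>u. 1 \<le> u \<longrightarrow> u < N \<longrightarrow> \<not> above u v \<longrightarrow> node_ok ?E t' u) \<and>
     imem s' 13 0 = int q \<and> imem s' 11 = (imem st 11)(int q := int ?w)"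
  have init: "node_ok ?E t u" if u: "1 \<le> u" "u < N" "\<not> above u ?v" for u
  proof -
    have ch: "t c \<noteq> ?w" if c: "c = 2 * u \<or> c = 2 * u + 1" for c
    proof
      assume tc: "t c = ?w"
      have cr: "1 \<le> c" "c < 2 * N" "c div 2 = u" using c u by auto
      then have "above c (N + ?w)" using h tc unfolding holds_def by metis
      then have "c = N + ?w \<or> above c ?v" by (rule above_cases)
      then have "above u ?v" using cr above_parent[of c ?v] above_refl[of ?v] by auto
      then show False using u by simp
    qed
    have "node_ok E t u" using ok u by (simp add: heap_ok_def)
    then show ?thesis using ch[of "2 * u"] ch[of "2 * u + 1"] by (simp add: node_ok_def winner_def beats_def)
  qed
  have loop: "runs I W (While (ILess (IConst 0) (Var 12)) (Seq combine (IStore 12 (IConst 0) (IDiv (Var 12) (IConst 2))))) s1 (4 * height N + 1)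
     (\<lambda>s'. \<exists>t'. holds N 1 ?E t' s' \<and> heap_ok N ?E t' \<and> imem s' 13 0 = int q \<and> imem s' 11 = (imem st 11)(int q := int ?w))"
    if s1: "?Inv s1" for s1
  proof (rule runs_While[where Inv = ?Inv and \<mu> = "\<lambda>s'. height (nat (imem s' 12 0))" and T = 3])
    fix s2 assume "?Inv s2" "bval I s2 (ILess (IConst 0) (Var 12))"
    then obtain v t' where v: "imem s2 12 0 = int v" "0 < v" "v < N" "holds N 1 ?E t' s2"
      "\<forall>u. 1 \<le> u \<longrightarrow> u < N \<longrightarrow> \<not> above u v \<longrightarrow> node_ok ?E t' u" "imem s2 13 0 = int q" "imem s2 11 = (imem st 11)(int q := int ?w)" by auto
    have c: "runs I W combine s2 2 (\<lambda>s'. \<exists>w. holds N (min 1 v) ?E (t'(v := w)) s' \<and> node_ok ?E (t'(v := w)) v \<and>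
        imem s' 12 = imem s2 12 \<and> imem s' 13 = imem s2 13 \<and> imem s' 11 = imem s2 11)"
      by (rule combine_holds[OF v(4)]) (use v W_bounds in auto)
    show "runs I W (Seq combine (IStore 12 (IConst 0) (IDiv (Var 12) (IConst 2)))) s2 3
      (\<lambda>s'. ?Inv s' \<and> height (nat (imem s' 12 0)) < height (nat (imem s2 12 0)))"
    proof (rule runs_Seq[where ?T1.0 = 2 and ?T2.0 = 1, OF runs_mono[OF c order_refl]])
      fix s3 assume "\<exists>w. holds N (min 1 v) ?E (t'(v := w)) s3 \<and> node_ok ?E (t'(v := w)) v \<and>
        imem s3 12 = imem s2 12 \<and> imem s3 13 = imem s2 13 \<and> imem s3 11 = imem s2 11"
      then obtain x where x: "holds N 1 ?E (t'(v := x)) s3" "node_ok ?E (t'(v := x)) v"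
        "imem s3 12 = imem s2 12" "imem s3 13 = imem s2 13" "imem s3 11 = imem s2 11" using v(2) by (auto simp: min_def split: if_splits)
      have nok: "node_ok ?E (t'(v := x)) u" if u: "1 \<le> u" "u < N" "\<not> above u (v div 2)" for u
      proof (cases "u = v")
        case False
        then have "\<not> above u v" using u above_cases by blast
        moreover have "v \<noteq> 2 * u" "v \<noteq> 2 * u + 1" using u above_refl[of u] by auto
        ultimately show ?thesis using v u False by (intro node_ok_upd) auto
      qed (use x in simp)
      have d: "int v div 2 = int (v div 2)" by (simp add: zdiv_int)
      show "runs I W (IStore 12 (IConst 0) (IDiv (Var 12) (IConst 2))) s3 1 (\<lambda>s'. ?Inv s' \<and> height (nat (imem s' 12 0)) < height (nat (imem s2 12 0)))"
      proof (rule runs_IStore, goal_cases)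
        case 4
        have h3: "holds N 1 ?E (t'(v := x)) (setv 12 (int (v div 2)) s3)" using x(1) by (auto simp: holds_def fresh_def)
        have eq: "s3\<lparr>imem := (imem s3)(12 := (imem s3 12)(ival I s3 (IConst 0) := ival I s3 (IDiv (Var 12) (IConst 2))))\<rparr> = setv 12 (int (v div 2)) s3"
          using x v d by simp
        have f: "imem s3 13 0 = int q" "imem s3 11 = (imem st 11)(int q := int ?w)" using x v by simp_all
        show ?case unfolding eq
          by (intro conjI exI[of _ "v div 2"] exI[of _ "t'(v := x)"] h3 allI impI nok) (use v f height_div2[OF v(2)] in auto)
      qed (use v x d W_bounds in auto)
    qed simp
  next
    fix s2 assume "?Inv s2" "\<not> bval I s2 (ILess (IConst 0) (Var 12))"
    moreover have "\<not> above u 0" if "1 \<le> u" for u using that by (simp add: above_def)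
    ultimately show "\<exists>t'. holds N 1 ?E t' s2 \<and> heap_ok N ?E t' \<and> imem s2 13 0 = int q \<and> imem s2 11 = (imem st 11)(int q := int ?w)"
      by (auto simp: heap_ok_def)
  next
    from s1 obtain v where "imem s1 12 0 = int v" "v < N" by auto
    then show "height (nat (imem s1 12 0)) * (3 + 1) + 1 \<le> 4 * height N + 1" using height_mono[of v N] by simp
  qed (rule s1)
  show ?thesis unfolding heap_pop_def
  proof (rule runs_Seq[where ?T1.0 = 1 and ?T2.0 = "4 * height N + 4"], rule runs_IStore, goal_cases)
    case 4
    show ?case
    proof (rule runs_Seq[where ?T1.0 = 1 and ?T2.0 = "4 * height N + 3"], rule runs_IStore, goal_cases)
      case 4
      show ?case
      proof (rule runs_Seq[where ?T1.0 = 1 and ?T2.0 = "4 * height N + 2"], rule runs_RStore, goal_cases)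
        case 3
        show ?case
        proof (rule runs_Seq[where ?T1.0 = 1 and ?T2.0 = "4 * height N + 1"], rule runs_IStore, goal_cases)
          case 4
          have d: "(int N + int ?w) div 2 = int ?v" by (simp add: zdiv_int)
          show ?case
          proof (rule loop, intro exI[of _ ?v] exI[of _ t] conjI)
            show "\<forall>u. 1 \<le> u \<longrightarrow> u < N \<longrightarrow> \<not> above u ?v \<longrightarrow> node_ok ?E t u" using init by blast
          qed (use h w v d q in \<open>auto simp: holds_def fresh_def ival_eN\<close>)
        qed (use h w v q W_bounds in \<open>auto simp: ival_eN zdiv_int[symmetric]\<close>)
      qed (use h w v q W_bounds in auto)
    qed (use h w v q W_bounds in auto)
  qed (use h w v q W_bounds in auto)
qed

lemma runs_phase2:
  assumes fr: "fresh st" and E: "\<forall>i<N. rmem st 1 (int i) = E i" and E0: "\<And>i. i < N \<Longrightarrow> 0 \<le> E i"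
  shows "runs I W phase2 st (8 * N + 5 + (K * (4 * height N + 7) + 2))
    (\<lambda>s'. fresh s' \<and> (\<exists>\<sigma>. topset E N K (\<sigma> ` {..<K}) \<and> inj_on \<sigma> {..<K} \<and> (\<forall>p<K. imem s' 11 (int p) = int (\<sigma> p))))"
  unfolding phase2_def
proof (rule runs_Seq[OF runs_mono[OF runs_heap_build[OF fr E] order_refl] order_refl])
  fix s0 assume "\<exists>t. holds N 1 E t s0 \<and> heap_ok N E t"
  then obtain t0 where t0: "holds N 1 E t0 s0" "heap_ok N E t0" by auto
  \<comment> \<open>The estimates as the tree sees them after the blocks in \<open>A\<close> were
    removed; \<open>E0\<close> places the sentinel strictly below all genuine values.\<close>
  let ?EA = "\<lambda>A i. if i \<in> A then -1 else E i"
  let ?Inv = "\<lambda>q s'. \<exists>\<sigma> t. inj_on \<sigma> {..<q} \<and> \<sigma> ` {..<q} \<subseteq> {..<N} \<and> (\<forall>p<q. imem s' 11 (int p) = int (\<sigma> p)) \<and>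
     holds N 1 (?EA (\<sigma> ` {..<q})) t s' \<and> heap_ok N (?EA (\<sigma> ` {..<q})) t \<and>
     (\<forall>i\<in>\<sigma> ` {..<q}. \<forall>j\<in>{..<N} - \<sigma> ` {..<q}. beats E i j)"
  show "runs I W (For 13 eK heap_pop) s0 (K * (4 * height N + 7) + 2)
    (\<lambda>s'. fresh s' \<and> (\<exists>\<sigma>. topset E N K (\<sigma> ` {..<K}) \<and> inj_on \<sigma> {..<K} \<and> (\<forall>p<K. imem s' 11 (int p) = int (\<sigma> p))))"
  proof (rule runs_For[where Inv = ?Inv and n = K and T = "4 * height N + 5"])
    show "?Inv 0 (setv 13 0 s0)" using t0 by (intro exI[of _ id] exI[of _ t0]) (auto simp: holds_def fresh_def)
  next
    fix q s1 assume q: "q < K" "?Inv q s1" "imem s1 13 0 = int q"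
    then obtain \<sigma> t where \<sigma>: "inj_on \<sigma> {..<q}" "\<sigma> ` {..<q} \<subseteq> {..<N}" "\<forall>p<q. imem s1 11 (int p) = int (\<sigma> p)"
      and t: "holds N 1 (?EA (\<sigma> ` {..<q})) t s1" "heap_ok N (?EA (\<sigma> ` {..<q})) t"
      and dom: "\<forall>i\<in>\<sigma> ` {..<q}. \<forall>j\<in>{..<N} - \<sigma> ` {..<q}. beats E i j" by auto
    let ?A = "\<sigma> ` {..<q}" and ?w = "t 1"
    have wN: "?w < N" using t(1) dims unfolding holds_def by (auto dest!: spec[of _ "1::nat"])
    have root: "?w = j \<or> beats (?EA ?A) ?w j" if "j < N" for j
    proof -
      have "t (N + j) = j" using t(1) that by (simp add: holds_def)
      then show ?thesis using root_beats[of N "?EA ?A" t "N + j"] t(2) that by (auto simp: heap_ok_def)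
    qed
    have "card ?A \<le> q" using card_image_le[of "{..<q}" \<sigma>] by simp
    \<comment> \<open>Since fewer than \<open>K < N\<close> blocks were removed, a genuine one
      remains and beats the sentinel, so the root is a new block.\<close>
    then have "\<not> {..<N} \<subseteq> ?A" using card_mono[of ?A "{..<N}"] q dims by auto
    then obtain j0 where j0: "j0 < N" "j0 \<notin> ?A" by auto
    have wA: "?w \<notin> ?A"
    proof
      assume "?w \<in> ?A"
      then have "beats (?EA ?A) ?w j0" using root[OF j0(1)] j0 by metis
      then show False using \<open>?w \<in> ?A\<close> j0 E0[OF j0(1)] by (auto simp: beats_def)
    qed
    have wdom: "beats E ?w j" if "j < N" "j \<notin> ?A" "j \<noteq> ?w" for j
      using root[OF that(1)] that wA by (auto simp: beats_def)
    let ?\<sigma> = "\<sigma>(q := ?w)"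
    have im: "?\<sigma> ` {..<Suc q} = insert ?w ?A" by (auto simp: lessThan_Suc)
    have ne: "\<sigma> p \<noteq> ?w" "?w \<noteq> \<sigma> p" if "p < q" for p
    proof -
      have "\<sigma> p \<in> ?A" using that by simp
      then show "\<sigma> p \<noteq> ?w" "?w \<noteq> \<sigma> p" using wA by metis+
    qed
    have inj: "inj_on ?\<sigma> {..<Suc q}"
    proof (rule inj_onI)
      fix a c assume "a \<in> {..<Suc q}" "c \<in> {..<Suc q}" "?\<sigma> a = ?\<sigma> c"
      then show "a = c" using inj_onD[OF \<sigma>(1), of a c] ne[of a] ne[of c]
        by (cases "a = q"; cases "c = q") simp_all
    qed
    have EA: "(?EA ?A)(?w := -1) = ?EA (insert ?w ?A)" by auto
    show "runs I W heap_pop s1 (4 * height N + 5) (\<lambda>s'. imem s' 13 0 = int q \<and> ?Inv (Suc q) (setv 13 (int (Suc q)) s'))"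
    proof (rule runs_mono[OF runs_heap_pop[OF t q(3,1)] order_refl])
      fix s' assume "\<exists>t'. holds N 1 ((?EA ?A)(?w := -1)) t' s' \<and> heap_ok N ((?EA ?A)(?w := -1)) t' \<and>
        imem s' 13 0 = int q \<and> imem s' 11 = (imem s1 11)(int q := int ?w)"
      then obtain t' where t': "holds N 1 (?EA (insert ?w ?A)) t' s'" "heap_ok N (?EA (insert ?w ?A)) t'"
        "imem s' 13 0 = int q" "imem s' 11 = (imem s1 11)(int q := int ?w)" unfolding EA by blast
      have "?Inv (Suc q) (setv 13 (int (Suc q)) s')"
      proof (rule exI[of _ ?\<sigma>], rule exI[of _ t'], intro conjI inj, unfold im)
        show "insert ?w ?A \<subseteq> {..<N}" using \<sigma>(2) wN by auto
        show "\<forall>p<Suc q. imem (setv 13 (int (Suc q)) s') 11 (int p) = int (?\<sigma> p)" using \<sigma>(3) t'(4) by (auto simp: less_Suc_eq)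
        show "holds N 1 (?EA (insert ?w ?A)) t' (setv 13 (int (Suc q)) s')" using t'(1) by (auto simp: holds_def fresh_def)
        show "heap_ok N (?EA (insert ?w ?A)) t'" by (rule t'(2))
        show "\<forall>i\<in>insert ?w ?A. \<forall>j\<in>{..<N} - insert ?w ?A. beats E i j" using dom wdom by auto
      qed
      then show "imem s' 13 0 = int q \<and> ?Inv (Suc q) (setv 13 (int (Suc q)) s')" using t'(3) by blast
    qed
  next
    fix s1 assume "?Inv K s1"
    then obtain \<sigma> t where \<sigma>: "inj_on \<sigma> {..<K}" "\<sigma> ` {..<K} \<subseteq> {..<N}" "\<forall>p<K. imem s1 11 (int p) = int (\<sigma> p)"
      "holds N 1 (?EA (\<sigma> ` {..<K})) t s1" "\<forall>i\<in>\<sigma> ` {..<K}. \<forall>j\<in>{..<N} - \<sigma> ` {..<K}. beats E i j" by blast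
    then have "topset E N K (\<sigma> ` {..<K})" by (auto simp: topset_def card_image beats_def)
    then show "fresh s1 \<and> (\<exists>\<sigma>. topset E N K (\<sigma> ` {..<K}) \<and> inj_on \<sigma> {..<K} \<and> (\<forall>p<K. imem s1 11 (int p) = int (\<sigma> p)))"
      using \<sigma> by (auto simp: holds_def)
  qed (use W_bounds in \<open>auto simp: ival_eK\<close>)
qed

end

section \<open>The peeling phase\<close>

definition eElem :: iexp where
  "eElem = IAdd (IMul (ILoad 11 (IDiv (Var 29) ParB)) ParB) (IMod (Var 29) ParB)"
definition eIdx :: iexp where "eIdx = IAdd (IMul eL eS) (Var 26)"
definition eBk :: iexp where "eBk = ePair (Var 27) eIdx"
definition eSg :: rexp where
  "eSg = ROfInt (ISub (IConst 1) (IMul (IConst 2) (IMod (ColOne (Var 27) eIdx) (IConst 2))))"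

text \<open>A bucket stores the number of its unresolved elements in array 20, the sum of their
  indices in 21 and its residual in real array 3. Once the number is 1 the sum is the remaining
  element, so no search is ever needed. Only buckets of queried coordinates are touched, which keeps
  loading linear in \<open>k\<close>.\<close>

definition load_pair :: com where
  "load_pair = Seq (IStore 20 eBk (IAdd (ILoad 20 eBk) (IConst 1)))
     (Seq (IStore 21 eBk (IAdd (ILoad 21 eBk) (Var 27))) (RStore 3 eBk (eDiff eBk)))"

definition load_all :: com where
  "load_all = For 29 ParK (Seq (IStore 27 (IConst 0) eElem)
     (Seq (IStore 22 (Var 29) (Var 27)) (For 26 (IConst 5) load_pair)))"

definition med_sel :: "rexp \<Rightarrow> rexp \<Rightarrow> rexp \<Rightarrow> com" where
  "med_sel lo hi c = Cond (RLess c lo) (RStore 5 (IConst 0) lo)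
     (Cond (RLess hi c) (RStore 5 (IConst 0) hi) (RStore 5 (IConst 0) c))"

definition med_com :: com where
  "med_com = (let a = RLoad 4 (IConst 0); b = RLoad 4 (IConst 1); c = RLoad 4 (IConst 2) in
     Cond (RLess a b) (med_sel a b c) (med_sel b a c))"

text \<open>A count that has dropped to 1 reveals an element that may have become peelable; it is
  appended to the queue in array 22, whose head and tail are variables 23 and 24.\<close>

definition unload_pair :: com where
  "unload_pair = Seq (IStore 20 eBk (ISub (ILoad 20 eBk) (IConst 1)))
     (Seq (IStore 21 eBk (ISub (ILoad 21 eBk) (Var 27)))
       (Seq (RStore 3 eBk (RSub (RLoad 3 eBk) (RMul eSg (RLoad 5 (IConst 0)))))
         (Cond (BAnd (ILess (ILoad 20 eBk) (IConst 2)) (ILess (IConst 0) (ILoad 20 eBk)))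
           (Seq (IStore 22 (Var 24) (ILoad 21 eBk)) (IStore 24 (IConst 0) (IAdd (Var 24) (IConst 1))))
           Skip)))"

definition resolve :: com where
  "resolve = Seq med_com (Seq (Output (Var 27) (RLoad 5 (IConst 0)))
     (Seq (IStore 25 (Var 27) (IConst 1)) (For 26 (IConst 5) unload_pair)))"

text \<open>The scanned element is itself still counted, so a count below 2 means that it is alone
  in the bucket.\<close>

definition scan :: com where
  "scan = For 26 (IConst 5) (Cond (ILess (ILoad 20 eBk) (IConst 2))
     (Seq (RStore 4 (Var 28) (RMul eSg (RLoad 3 eBk))) (IStore 28 (IConst 0) (IAdd (Var 28) (IConst 1)))) Skip)"

text \<open>An element can be queued several times, and before it has three isolated rows; the flag
  in array 25 and the test on variable 28 discard such entries.\<close>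

definition peel_body :: com where
  "peel_body = Seq (IStore 27 (IConst 0) (ILoad 22 (Var 23))) (Seq (IStore 23 (IConst 0) (IAdd (Var 23) (IConst 1)))
     (Cond (ILess (ILoad 25 (Var 27)) (IConst 1))
       (Seq (IStore 28 (IConst 0) (IConst 0)) (Seq scan (Cond (ILess (IConst 2) (Var 28)) resolve Skip))) Skip))"

definition phase3 :: com where
  "phase3 = Seq load_all (Seq (IStore 24 (IConst 0) ParK) (While (ILess (Var 23) (Var 24)) peel_body))"

lemma runs_med:
  assumes "0 \<le> W"
  shows "runs I W med_com st 4 (\<lambda>s'. s' = st\<lparr>rmem := (rmem st)(5 := (rmem st 5)(0 := med3 (rmem st 4 0) (rmem st 4 1) (rmem st 4 2)))\<rparr>)"
proof -
  have sel: "runs I W (med_sel lo hi c) st 3 (\<lambda>s'. s' = st\<lparr>rmem := (rmem st)(5 := (rmem st 5)(0 := max (rval I st lo) (min (rval I st hi) (rval I st c))))\<rparr>)"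
    if "rval I st lo \<le> rval I st hi" for lo hi c
    unfolding med_sel_def using that assms
    by (intro runs_Cond runs_RStore) (auto simp: max_def min_def)
  show ?thesis unfolding med_com_def Let_def
    using sel[of "RLoad 4 (IConst 0)" "RLoad 4 (IConst 1)" "RLoad 4 (IConst 2)"] sel[of "RLoad 4 (IConst 1)" "RLoad 4 (IConst 0)" "RLoad 4 (IConst 2)"]
    by (intro runs_Cond) (auto simp: med3_def max_def min_def split: if_splits)
qed

section \<open>Contents of the buckets during peeling\<close>

locale peel_input = recovery_input +
  fixes \<omega> :: "nat \<Rightarrow> nat \<Rightarrow> nat \<times> bool" and x :: "nat \<Rightarrow> real"
  assumes hk: "\<And>r r' j j'. r < 5 \<Longrightarrow> r' < 5 \<Longrightarrow> j < n \<Longrightarrow> j' < n \<Longrightarrow>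
      pidx (L * s + r) j = pidx (L * s + r') j' \<longleftrightarrow> r = r' \<and> buckets \<omega> r j = buckets \<omega> r j'"
    and hs: "\<And>r j. r < 5 \<Longrightarrow> j < n \<Longrightarrow> sg (L * s + r) j = snd (\<omega> j r)"
    and Yv: "\<And>r e. r < 5 \<Longrightarrow> e < n \<Longrightarrow> Y (pidx (L * s + r) e) = (\<Sum>j | j < n \<and> buckets \<omega> r j = buckets \<omega> r e. hsign \<omega> r j * x j)"
begin

definition P :: "nat \<times> nat \<Rightarrow> nat" where "P z = pidx (L * s + snd z) (fst z)"

definition bin :: "(nat \<times> nat) set \<Rightarrow> nat \<Rightarrow> (nat \<times> nat) set" where "bin A p = {z \<in> A. P z = p}"

lemma P_less: "j < n \<Longrightarrow> r < 5 \<Longrightarrow> P (j, r) < M"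
  unfolding P_def by (simp add: pidx)

lemma P_eq: "j < n \<Longrightarrow> j' < n \<Longrightarrow> r < 5 \<Longrightarrow> r' < 5 \<Longrightarrow> P (j, r) = P (j', r') \<longleftrightarrow> r = r' \<and> buckets \<omega> r j = buckets \<omega> r j'"
  unfolding P_def by (simp add: hk)

lemma bin_prod:
  assumes "U \<subseteq> {..<n}" "j < n" "r < 5"
  shows "bin (U \<times> {..<5}) (P (j, r)) = {f \<in> U. buckets \<omega> r f = buckets \<omega> r j} \<times> {r}"
  unfolding bin_def using assms by (auto simp: P_eq)

lemma ival_eBk:
  assumes "imem st 27 0 = int j" "imem st 26 0 = int r" "j < n" "r < 5"
  shows "ival I st eBk = int (P (j, r))"
  unfolding eBk_def P_def fst_conv snd_conv
  by (rule ival_ePair) (use assms in \<open>simp_all add: eIdx_def ival_eL ival_eS\<close>)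

lemma rval_eSg:
  assumes "imem st 27 0 = int j" "imem st 26 0 = int r" "j < n" "r < 5"
  shows "rval I st eSg = hsign \<omega> r j"
proof -
  have "ival I st (ColOne (Var 27) eIdx) = 2 * int (pidx (L * s + r) j) + of_bool (sg (L * s + r) j)"
    by (rule ival_ColOne) (use assms in \<open>simp_all add: eIdx_def ival_eL ival_eS\<close>)
  then show ?thesis unfolding eSg_def using hs[OF assms(4,3)]
    by (simp del: ival.simps(7) add: sgn_bit_def)
qed

text \<open>\<open>A\<close> and \<open>D\<close> are sets of unresolved and resolved pairs of
  element and row, rather than of elements, so that the invariant also describes the moments between
  the five updates of one element. Residuals are claimed only for buckets that were loaded.\<close>

definition mem_ok :: "(nat \<times> nat) set \<Rightarrow> (nat \<times> nat) set \<Rightarrow> (nat \<Rightarrow> real) \<Rightarrow> state \<Rightarrow> bool" where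
  "mem_ok A D es st \<longleftrightarrow> (\<forall>p<M. imem st 20 (int p) = int (card (bin A p))) \<and>
     (\<forall>p<M. imem st 21 (int p) = int (\<Sum>z\<in>bin A p. fst z)) \<and>
     (\<forall>z\<in>A \<union> D. rmem st 3 (int (P z)) = Y (P z) - (\<Sum>z'\<in>bin D (P z). hsign \<omega> (snd z') (fst z') * es (fst z')))"

lemma bin_insert: "bin (insert z A) p = (if P z = p then insert z (bin A p) else bin A p)"
  by (auto simp: bin_def)

lemma bin_remove: "bin (A - {z}) p = bin A p - {z}"
  by (auto simp: bin_def)

lemma k0: "0 < k" using dims by simp

lemma W5: "5 \<le> W" using k0 W_bounds by linarith

lemma finite_bin: "finite A \<Longrightarrow> finite (bin A p)"
  by (simp add: bin_def)

text \<open>A pair number determines its row, so an element occurs at most once in a bin. This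
  bounds the stored counts and index sums by \<open>k\<close> and \<open>n * k\<close>, as the word
  size requires.\<close>

lemma bin_bounds:
  assumes "A \<subseteq> S \<times> {..<5}" "S \<subseteq> {..<n}" "card S \<le> k"
  shows "card (bin A p) \<le> k" "(\<Sum>z\<in>bin A p. fst z) \<le> n * k"
proof -
  have fin: "finite S" using finite_subset[OF assms(2)] by simp
  have "inj_on fst (bin A p)"
  proof (rule inj_onI)
    fix z z' assume z: "z \<in> bin A p" "z' \<in> bin A p" "fst z = fst z'"
    obtain j r where jr: "z = (j, r)" by (cases z)
    obtain r' where jr': "z' = (j, r')" using z(3) jr by (cases z') simp
    have "(j, r) \<in> S \<times> {..<5}" "(j, r') \<in> S \<times> {..<5}" using subsetD[OF assms(1)] z(1,2) unfolding jr jr' bin_def by blast+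
    then have "j < n" "r < 5" "r' < 5" using assms(2) by auto
    moreover have "P (j, r) = P (j, r')" using z(1,2) unfolding jr jr' bin_def by simp
    ultimately have "snd z = snd z'" using P_eq[of j j r r'] jr jr' by simp
    then show "z = z'" using z(3) by (simp add: prod_eq_iff)
  qed
  moreover have "fst ` bin A p \<subseteq> S" using assms(1) unfolding bin_def by auto
  ultimately have "card (bin A p) \<le> card S" using fin by (rule card_inj_on_le)
  then show c: "card (bin A p) \<le> k" using assms(3) by simp
  have "(\<Sum>z\<in>bin A p. fst z) \<le> card (bin A p) * n"
  proof (rule sum_bounded_above[of "bin A p" fst n, simplified])
    show "fst z \<le> n" if "z \<in> bin A p" for z
    proof -
      have "z \<in> S \<times> {..<5}" using subsetD[OF assms(1)] that unfolding bin_def by blast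
      then show ?thesis using assms(2) by auto
    qed
  qed
  also have "\<dots> \<le> n * k" using c by (simp add: mult.commute mult_le_mono2)
  finally show "(\<Sum>z\<in>bin A p. fst z) \<le> n * k" .
qed

lemma runs_load_pair:
  assumes m: "mem_ok A {} es st" and A: "A \<subseteq> S \<times> {..<5}" "(j, r) \<notin> A" "(j, r) \<in> S \<times> {..<5}" and S: "S \<subseteq> {..<n}" "card S \<le> k"
    and v: "imem st 27 0 = int j" "imem st 26 0 = int r"
  shows "runs I W load_pair st 3 (\<lambda>s'. mem_ok (insert (j, r) A) {} es s' \<and> (\<forall>a. a \<noteq> 20 \<longrightarrow> a \<noteq> 21 \<longrightarrow> imem s' a = imem st a) \<and> outp s' = outp st)"
proof -
  have jr: "j < n" "r < 5" using A S by auto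
  let ?p = "P (j, r)"
  have p: "?p < M" by (rule P_less[OF jr])
  have finA: "finite A" using finite_subset[OF A(1)] finite_subset[OF S(1)] by simp
  have bk: "ival I st' eBk = int ?p" if "imem st' 27 0 = int j" "imem st' 26 0 = int r" for st' by (rule ival_eBk[OF that jr])
  have ins: "card (bin (insert (j, r) A) ?p) = Suc (card (bin A ?p))" "(\<Sum>z\<in>bin (insert (j, r) A) ?p. fst z) = j + (\<Sum>z\<in>bin A ?p. fst z)"
    using finA A(2) by (simp_all add: bin_insert finite_bin) (auto simp: bin_def)
  have bnd: "card (bin (insert (j, r) A) ?p) \<le> k" "(\<Sum>z\<in>bin (insert (j, r) A) ?p. fst z) \<le> n * k"
    using bin_bounds[of "insert (j, r) A" S ?p] A S by auto
  have cnt: "imem st 20 (int ?p) + 1 = int (card (bin (insert (j, r) A) ?p))" using m p ins by (simp add: mem_ok_def)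
  have ids: "imem st 21 (int ?p) + int j = int (\<Sum>z\<in>bin (insert (j, r) A) ?p. fst z)" using m p unfolding ins(2) by (simp add: mem_ok_def)
  have Wb: "int (card (bin (insert (j, r) A) ?p)) \<le> W" "int (\<Sum>z\<in>bin (insert (j, r) A) ?p. fst z) \<le> W" "int ?p \<le> W"
  proof -
    have "int (card (bin (insert (j, r) A) ?p)) \<le> int k" "int (\<Sum>z\<in>bin (insert (j, r) A) ?p. fst z) \<le> int (n * k)" "int ?p \<le> int M"
      using bnd p by (simp_all only: of_nat_le_iff less_imp_le)
    then show "int (card (bin (insert (j, r) A) ?p)) \<le> W" "int (\<Sum>z\<in>bin (insert (j, r) A) ?p. fst z) \<le> W" "int ?p \<le> W"
      using W_bounds by linarith+
  qed
  let ?s1 = "st\<lparr>imem := (imem st)(20 := (imem st 20)(int ?p := int (card (bin (insert (j, r) A) ?p))))\<rparr>"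
  let ?s2 = "?s1\<lparr>imem := (imem ?s1)(21 := (imem ?s1 21)(int ?p := int (\<Sum>z\<in>bin (insert (j, r) A) ?p. fst z)))\<rparr>"
  let ?s3 = "?s2\<lparr>rmem := (rmem ?s2)(3 := (rmem ?s2 3)(int ?p := Y ?p))\<rparr>"
  have v1: "imem ?s1 27 0 = int j" "imem ?s1 26 0 = int r" "imem ?s2 27 0 = int j" "imem ?s2 26 0 = int r" using v by simp_all
  show ?thesis unfolding load_pair_def
  proof (rule runs_Seq[where ?T1.0 = 1 and ?T2.0 = 2], rule runs_IStore, goal_cases)
    case 4
    have e1: "st\<lparr>imem := (imem st)(20 := (imem st 20)(ival I st eBk := ival I st (IAdd (ILoad 20 eBk) (IConst 1))))\<rparr> = ?s1"
      unfolding ival.simps bk[OF v] cnt ..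
    show ?case unfolding e1
    proof (rule runs_Seq[where ?T1.0 = 1 and ?T2.0 = 1], rule runs_IStore, goal_cases)
      case 4
      have "imem ?s1 21 (int ?p) + imem ?s1 27 0 = int (\<Sum>z\<in>bin (insert (j, r) A) ?p. fst z)" using ids v by simp
      then have e2: "?s1\<lparr>imem := (imem ?s1)(21 := (imem ?s1 21)(ival I ?s1 eBk := ival I ?s1 (IAdd (ILoad 21 eBk) (Var 27))))\<rparr> = ?s2"
        unfolding ival.simps bk[OF v1(1,2)] by (simp only:)
      show ?case unfolding e2
      proof (rule runs_RStore, goal_cases)
        case 3
        have e3: "?s2\<lparr>rmem := (rmem ?s2)(3 := (rmem ?s2 3)(ival I ?s2 eBk := rval I ?s2 (eDiff eBk)))\<rparr> = ?s3"
          unfolding bk[OF v1(3,4)] rval_eDiff[OF bk[OF v1(3,4)] p] ..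
        have "mem_ok (insert (j, r) A) {} es ?s3"
          unfolding mem_ok_def
        proof (intro conjI allI impI ballI)
          fix p' assume p': "p' < M"
          show "imem ?s3 20 (int p') = int (card (bin (insert (j, r) A) p'))"
            using m p' by (cases "p' = ?p") (simp_all add: mem_ok_def bin_insert)
          show "imem ?s3 21 (int p') = int (\<Sum>z\<in>bin (insert (j, r) A) p'. fst z)"
            using m p' by (cases "p' = ?p") (simp_all add: mem_ok_def bin_insert)
        next
          fix z assume z: "z \<in> insert (j, r) A \<union> {}"
          then show "rmem ?s3 3 (int (P z)) = Y (P z) - (\<Sum>z'\<in>bin {} (P z). hsign \<omega> (snd z') (fst z') * es (fst z'))"
            using m by (cases "P z = ?p") (auto simp: mem_ok_def bin_def)
        qed
        then show ?case unfolding e3 by simp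
      qed (use bk[OF v1(3,4)] Wb in simp_all)
    next
      case 3
      have "imem ?s1 21 (int ?p) + imem ?s1 27 0 = int (\<Sum>z\<in>bin (insert (j, r) A) ?p. fst z)" using ids v by simp
      then show ?case unfolding ival.simps bk[OF v1(1,2)] using Wb by (simp only:)
    qed (use bk[OF v1(1,2)] Wb in simp_all)
  next
    case 3
    show ?case unfolding ival.simps bk[OF v] cnt using Wb by simp
  qed (use bk[OF v] Wb in simp_all)
qed

lemma runs_load_all:
  assumes fr: "fresh st" and \<sigma>: "\<forall>p<K. imem st 11 (int p) = int (\<sigma> p)" "inj_on \<sigma> {..<K}" "\<sigma> ` {..<K} \<subseteq> {..<N}"
  defines "S \<equiv> (\<Union>i\<in>\<sigma> ` {..<K}. block b i)"
  shows "S \<subseteq> {..<n}" "card S = k"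
    "runs I W load_all st (k * 31 + 2) (\<lambda>s'. mem_ok (S \<times> {..<5}) {} (\<lambda>_. 0) s' \<and> (\<exists>qf. (\<forall>a<k. imem s' 22 (int a) = int (qf a)) \<and> qf ` {..<k} = S) \<and>
       imem s' 23 = (\<lambda>_. 0) \<and> imem s' 25 = (\<lambda>_. 0) \<and> outp s' = (\<lambda>_. 0))"
proof -
  \<comment> \<open>An enumeration of the selected coordinates block by block; it is what
    \<open>eElem\<close> computes and gives the initial queue.\<close>
  define qf where "qf q = \<sigma> (q div b) * b + q mod b" for q
  have dv: "q div b < K" if "q < k" for q using that dims by (simp add: div_less_iff_less_mult)
  have qfn: "qf q < n" if "q < k" for q
  proof -
    have "\<sigma> (q div b) < N" using \<sigma>(3) dv[OF that] by auto
    then have "(\<sigma> (q div b) + 1) * b \<le> N * b" by (intro mult_le_mono1) simp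
    moreover have "q mod b < b" using dims by simp
    ultimately show ?thesis using dims(1) unfolding qf_def add_mult_distrib by linarith
  qed
  have inj: "inj_on qf {..<k}"
  proof (rule inj_onI)
    fix q q' assume q: "q \<in> {..<k}" "q' \<in> {..<k}" "qf q = qf q'"
    have m: "q mod b < b" "q' mod b < b" using dims by simp_all
    have "qf q div b = \<sigma> (q div b)" "qf q' div b = \<sigma> (q' div b)" "qf q mod b = q mod b" "qf q' mod b = q' mod b"
      unfolding qf_def using m by simp_all
    then have "\<sigma> (q div b) = \<sigma> (q' div b)" "q mod b = q' mod b" using q(3) by simp_all
    then have "q div b = q' div b" using inj_onD[OF \<sigma>(2)] dv q by auto
    then show "q = q'" using \<open>q mod b = q' mod b\<close> by (metis div_mult_mod_eq)
  qed
  have im: "qf ` {..<k} = S"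
  proof (rule Set.set_eqI)
    fix f
    show "f \<in> qf ` {..<k} \<longleftrightarrow> f \<in> S"
    proof
      assume "f \<in> qf ` {..<k}"
      then obtain q where q: "q < k" "f = qf q" by auto
      have "f div b = \<sigma> (q div b)" using q dims unfolding qf_def by simp
      then show "f \<in> S" unfolding S_def using dims(3) dv[OF q(1)] by (auto simp: block_iff)
    next
      assume "f \<in> S"
      then obtain p where p: "p < K" "f div b = \<sigma> p" unfolding S_def using dims(3) by (auto simp: block_iff)
      let ?q = "p * b + f mod b"
      have fm: "f mod b < b" using dims by simp
      have "(p + 1) * b \<le> K * b" using p by (intro mult_le_mono1) simp
      then have "?q < k" using fm dims(2) unfolding add_mult_distrib by linarith
      moreover have "qf ?q = f"
      proof -
        have "?q div b = p" "?q mod b = f mod b" using fm by simp_all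
        then show ?thesis unfolding qf_def using p by (simp flip: p(2))
      qed
      ultimately show "f \<in> qf ` {..<k}" by (metis imageI lessThan_iff)
    qed
  qed
  show S: "S \<subseteq> {..<n}" unfolding im[symmetric] using qfn by auto
  show cS: "card S = k" unfolding im[symmetric] using inj by (simp add: card_image)
  let ?F = "\<lambda>s'. imem s' 11 = imem st 11 \<and> imem s' 23 = (\<lambda>_. 0) \<and> imem s' 25 = (\<lambda>_. 0) \<and> outp s' = (\<lambda>_. 0)"
  let ?Inv = "\<lambda>q s'. mem_ok (qf ` {..<q} \<times> {..<5}) {} (\<lambda>_. 0) s' \<and> (\<forall>a<q. imem s' 22 (int a) = int (qf a)) \<and> ?F s'"
  have mcong: "mem_ok A D es s'' = mem_ok A D es s'" if "imem s'' 20 = imem s' 20" "imem s'' 21 = imem s' 21" "rmem s'' 3 = rmem s' 3" for A D es s' s''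
    using that by (simp add: mem_ok_def)
  show "runs I W load_all st (k * 31 + 2) (\<lambda>s'. mem_ok (S \<times> {..<5}) {} (\<lambda>_. 0) s' \<and> (\<exists>qf. (\<forall>a<k. imem s' 22 (int a) = int (qf a)) \<and> qf ` {..<k} = S) \<and>
       imem s' 23 = (\<lambda>_. 0) \<and> imem s' 25 = (\<lambda>_. 0) \<and> outp s' = (\<lambda>_. 0))"
    unfolding load_all_def
  proof (rule runs_For[where Inv = ?Inv and n = k and T = 29])
    show "?Inv 0 (setv 29 0 st)" using fr by (auto simp: fresh_def mem_ok_def bin_def)
    fix q s1 assume q: "q < k" and inv: "?Inv q s1" and v: "imem s1 29 0 = int q"
    let ?j = "qf q"
    have el: "ival I s1 eElem = int ?j"
    proof -
      have "int q div int b = int (q div b)" "int q mod int b = int (q mod b)" by (simp_all add: zdiv_int zmod_int)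
      then show ?thesis unfolding eElem_def ival.simps v inp using inv \<sigma>(1) dv[OF q] by (simp add: qf_def)
    qed
    have jW: "int ?j \<le> W" "int q \<le> W" using qfn[OF q] q W_bounds by linarith+
    let ?s2 = "setv 27 (int ?j) s1"
    let ?s3 = "?s2\<lparr>imem := (imem ?s2)(22 := (imem ?s2 22)(int q := int ?j))\<rparr>"
    let ?A = "qf ` {..<q} \<times> {..<5::nat}"
    have jS: "?j \<in> S" unfolding im[symmetric] using q by simp
    have qS: "qf ` {..<q} \<subseteq> S" unfolding im[symmetric] using q by auto
    have jn: "?j \<notin> qf ` {..<q}"     proof
      assume "?j \<in> qf ` {..<q}"
      then obtain q' where "q' < q" "qf q = qf q'" by auto
      then show False using inj_onD[OF inj, of q q'] q by simp
    qed
    let ?G = "\<lambda>s'. imem s' 27 0 = int ?j \<and> imem s' 29 0 = int q \<and> (\<forall>a<Suc q. imem s' 22 (int a) = int (qf a)) \<and> ?F s'"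
    have fin: "runs I W (For 26 (IConst 5) load_pair) ?s3 27 (\<lambda>s'. imem s' 29 0 = int q \<and> ?Inv (Suc q) (setv 29 (int (Suc q)) s'))"
    proof (rule runs_For[where Inv = "\<lambda>r s'. mem_ok (?A \<union> {?j} \<times> {..<r}) {} (\<lambda>_. 0) s' \<and> ?G s'" and n = 5 and T = 3])
      show "mem_ok (?A \<union> {?j} \<times> {..<0}) {} (\<lambda>_. 0) (setv 26 0 ?s3) \<and> ?G (setv 26 0 ?s3)"
        using inv v by (auto simp: less_Suc_eq mem_ok_def)
      fix r s4 assume r: "r < (5::nat)" and i4: "mem_ok (?A \<union> {?j} \<times> {..<r}) {} (\<lambda>_. 0) s4 \<and> ?G s4" and v4: "imem s4 26 0 = int r"
      have ins: "insert (?j, r) (?A \<union> {?j} \<times> {..<r}) = ?A \<union> {?j} \<times> {..<Suc r}" by (auto simp: lessThan_Suc)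
      have lp: "runs I W load_pair s4 3 (\<lambda>s'. mem_ok (insert (?j, r) (?A \<union> {?j} \<times> {..<r})) {} (\<lambda>_. 0) s' \<and>
          (\<forall>a. a \<noteq> 20 \<longrightarrow> a \<noteq> 21 \<longrightarrow> imem s' a = imem s4 a) \<and> outp s' = outp s4)"
      proof (rule runs_load_pair[where S = S])
        show "?A \<union> {?j} \<times> {..<r} \<subseteq> S \<times> {..<5}" using qS jS r by auto
        show "(?j, r) \<notin> ?A \<union> {?j} \<times> {..<r}" using jn by auto
      qed (use i4 v4 jS r S cS in auto)
      show "runs I W load_pair s4 3 (\<lambda>s'. imem s' 26 0 = int r \<and> (mem_ok (?A \<union> {?j} \<times> {..<Suc r}) {} (\<lambda>_. 0) (setv 26 (int (Suc r)) s') \<and> ?G (setv 26 (int (Suc r)) s')))"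
      proof (rule runs_mono[OF lp order_refl])
        fix s' assume a: "mem_ok (insert (?j, r) (?A \<union> {?j} \<times> {..<r})) {} (\<lambda>_. 0) s' \<and> (\<forall>a. a \<noteq> 20 \<longrightarrow> a \<noteq> 21 \<longrightarrow> imem s' a = imem s4 a) \<and> outp s' = outp s4"
        then have "mem_ok (?A \<union> {?j} \<times> {..<Suc r}) {} (\<lambda>_. 0) (setv 26 (int (Suc r)) s')"
          unfolding ins by (subst mcong[of _ s']) auto
        moreover have "imem s' 26 0 = int r \<and> ?G (setv 26 (int (Suc r)) s')" using a i4 v4 by auto
        ultimately show "imem s' 26 0 = int r \<and> (mem_ok (?A \<union> {?j} \<times> {..<Suc r}) {} (\<lambda>_. 0) (setv 26 (int (Suc r)) s') \<and> ?G (setv 26 (int (Suc r)) s'))"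
          by blast
      qed
    next
      fix s4 assume a: "mem_ok (?A \<union> {?j} \<times> {..<5}) {} (\<lambda>_. 0) s4 \<and> ?G s4"
      have "?A \<union> {?j} \<times> {..<5} = qf ` {..<Suc q} \<times> {..<5}" by (auto simp: lessThan_Suc)
      then have "mem_ok (qf ` {..<Suc q} \<times> {..<5}) {} (\<lambda>_. 0) (setv 29 (int (Suc q)) s4)"
        using a by (subst mcong[of _ s4]) auto
      then show "imem s4 29 0 = int q \<and> ?Inv (Suc q) (setv 29 (int (Suc q)) s4)" using a by auto
    qed (use W5 in auto)
    show "runs I W (Seq (IStore 27 (IConst 0) eElem) (Seq (IStore 22 (Var 29) (Var 27)) (For 26 (IConst 5) load_pair))) s1 29
       (\<lambda>s'. imem s' 29 0 = int q \<and> ?Inv (Suc q) (setv 29 (int (Suc q)) s'))"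
    proof (rule runs_Seq[where ?T1.0 = 1 and ?T2.0 = 28], rule runs_IStore, goal_cases)
      case 4
      have e: "s1\<lparr>imem := (imem s1)(27 := (imem s1 27)(ival I s1 (IConst 0) := ival I s1 eElem))\<rparr> = ?s2" unfolding el by simp
      show ?case unfolding e
      proof (rule runs_Seq[where ?T1.0 = 1 and ?T2.0 = 27], rule runs_IStore, goal_cases)
        case 4
        have e3: "?s2\<lparr>imem := (imem ?s2)(22 := (imem ?s2 22)(ival I ?s2 (Var 29) := ival I ?s2 (Var 27)))\<rparr> = ?s3" using v by simp
        show ?case unfolding e3 by (rule fin)
      qed (use v jW W5 in auto)
    qed (use el jW W5 in auto)
  next
    fix s1 assume "?Inv k s1"
    then show "mem_ok (S \<times> {..<5}) {} (\<lambda>_. 0) s1 \<and> (\<exists>qf. (\<forall>a<k. imem s1 22 (int a) = int (qf a)) \<and> qf ` {..<k} = S) \<and>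
       imem s1 23 = (\<lambda>_. 0) \<and> imem s1 25 = (\<lambda>_. 0) \<and> outp s1 = (\<lambda>_. 0)"
      using im by (intro conjI exI[of _ qf]) auto
  qed (use W_bounds in \<open>auto simp: inp\<close>)
qed

end

section \<open>The queue and the resolution of single elements\<close>

locale peel_run = peel_input +
  fixes S :: "nat set"
  assumes S: "S \<subseteq> {..<n}" and cS: "card S = k"
begin

lemma finS: "finite S" using finite_subset[OF S] by simp

lemma bin_isolated:
  assumes "U \<subseteq> S" "j \<in> U" "r < 5"
  shows "card (bin (U \<times> {..<5}) (P (j, r))) < 2 \<longleftrightarrow> r \<in> isolated (buckets \<omega>) U j"
proof -
  let ?F = "{f \<in> U. buckets \<omega> r f = buckets \<omega> r j}"
  have fin: "finite ?F" using finite_subset[OF assms(1) finS] by simp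
  have U: "U \<subseteq> {..<n}" using assms(1) S by simp
  have "j < n" using U assms(2) by auto
  then have "card (bin (U \<times> {..<5}) (P (j, r))) = card ?F"
    unfolding bin_prod[OF U \<open>j < n\<close> assms(3)] by (simp add: card_cartesian_product)
  moreover have "card ?F < 2 \<longleftrightarrow> card ?F \<le> Suc 0" by auto
  moreover have "card ?F \<le> Suc 0 \<longleftrightarrow> (\<forall>f\<in>?F. \<forall>g\<in>?F. f = g)" using card_le_Suc0_iff_eq[OF fin] .
  moreover have "(\<forall>f\<in>?F. \<forall>g\<in>?F. f = g) \<longleftrightarrow> r \<in> isolated (buckets \<omega>) U j"
    using assms(2,3) unfolding isolated_def by auto
  ultimately show ?thesis by simp
qed

lemma residual_cell:
  assumes m: "mem_ok ((S - D) \<times> {..<5}) (D \<times> {..<5}) es st" and D: "D \<subseteq> S" and j: "j \<in> S" and r: "r < 5"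
  shows "hsign \<omega> r j * rmem st 3 (int (P (j, r))) = residual n x \<omega> D es r j"
proof -
  have jn: "j < n" and Dn: "D \<subseteq> {..<n}" using j S D by auto
  have "(j, r) \<in> (S - D) \<times> {..<5} \<union> D \<times> {..<5}" using j r by auto
  then have "rmem st 3 (int (P (j, r))) = Y (P (j, r)) - (\<Sum>z'\<in>bin (D \<times> {..<5}) (P (j, r)). hsign \<omega> (snd z') (fst z') * es (fst z'))"
    using m unfolding mem_ok_def by blast
  also have "(\<Sum>z'\<in>bin (D \<times> {..<5}) (P (j, r)). hsign \<omega> (snd z') (fst z') * es (fst z')) =
      (\<Sum>f | f \<in> D \<and> buckets \<omega> r f = buckets \<omega> r j. hsign \<omega> r f * es f)"
  proof -
    have im: "{f \<in> D. buckets \<omega> r f = buckets \<omega> r j} \<times> {r} = (\<lambda>f. (f, r)) ` {f. f \<in> D \<and> buckets \<omega> r f = buckets \<omega> r j}" by auto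
    show ?thesis unfolding bin_prod[OF Dn jn r] im by (subst sum.reindex) (auto simp: inj_on_def)
  qed
  also have "Y (P (j, r)) = (\<Sum>i | i < n \<and> buckets \<omega> r i = buckets \<omega> r j. hsign \<omega> r i * x i)"
    using Yv[OF r jn] by (simp add: P_def)
  finally show ?thesis by (simp add: residual_def)
qed

definition rows_of :: "nat set \<Rightarrow> nat \<Rightarrow> nat \<Rightarrow> nat list" where
  "rows_of U j r = filter (\<lambda>r. r \<in> isolated (buckets \<omega>) U j) [0..<r]"

lemma runs_scan:
  assumes m: "mem_ok ((S - D) \<times> {..<5}) (D \<times> {..<5}) es st" and D: "D \<subseteq> S" and j: "j \<in> S - D"
    and v: "imem st 27 0 = int j" "imem st 28 0 = 0"
  shows "runs I W scan st 27 (\<lambda>s'. (\<forall>a. a \<noteq> 26 \<longrightarrow> a \<noteq> 28 \<longrightarrow> imem s' a = imem st a) \<and> rmem s' 3 = rmem st 3 \<and> outp s' = outp st \<and>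
     imem s' 28 0 = int (length (rows_of (S - D) j 5)) \<and> (\<forall>i<length (rows_of (S - D) j 5). rmem s' 4 (int i) = residual n x \<omega> D es (rows_of (S - D) j 5 ! i) j))"
proof -
  have jn: "j < n" using j S by auto
  let ?l = "rows_of (S - D) j"
  let ?Inv = "\<lambda>r s'. (\<forall>a. a \<noteq> 26 \<longrightarrow> a \<noteq> 28 \<longrightarrow> imem s' a = imem st a) \<and> rmem s' 3 = rmem st 3 \<and> outp s' = outp st \<and>
     imem s' 28 0 = int (length (?l r)) \<and> (\<forall>i<length (?l r). rmem s' 4 (int i) = residual n x \<omega> D es (?l r ! i) j)"
  show ?thesis unfolding scan_def
  proof (rule runs_For[where Inv = ?Inv and n = 5 and T = 3])
    fix r and s1 :: state assume r: "r < (5::nat)" and inv: "?Inv r s1" and v1: "imem s1 26 0 = int r"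
    have v27: "imem s1 27 0 = int j" using inv v by simp
    have bk: "ival I s1 eBk = int (P (j, r))" by (rule ival_eBk[OF v27 v1 jn r])
    have len: "length (?l r) \<le> r" unfolding rows_of_def using length_filter_le[of _ "[0..<r]"] by (simp add: order_trans)
    have test: "bval I s1 (ILess (ILoad 20 eBk) (IConst 2)) \<longleftrightarrow> r \<in> isolated (buckets \<omega>) (S - D) j"
    proof -
      have "imem s1 20 (int (P (j, r))) = int (card (bin ((S - D) \<times> {..<5}) (P (j, r))))"
        using inv m P_less[OF jn r] by (simp add: mem_ok_def)
      then show ?thesis using bin_isolated[of "S - D" j r] j r by (simp add: bk)
    qed
    have res: "rval I s1 (RMul eSg (RLoad 3 eBk)) = residual n x \<omega> D es r j"
      using residual_cell[OF m D _ r, of j] j rval_eSg[OF v27 v1 jn r] inv by (simp add: bk)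
    have ix: "ival I s1 (Var 28) = int (length (?l r))" using inv by simp
    have lW: "\<bar>int (length (?l r))\<bar> \<le> W" "\<bar>int (length (?l r)) + 1\<bar> \<le> W" using len r W5 by auto
    show "runs I W (Cond (ILess (ILoad 20 eBk) (IConst 2))
       (Seq (RStore 4 (Var 28) (RMul eSg (RLoad 3 eBk))) (IStore 28 (IConst 0) (IAdd (Var 28) (IConst 1)))) Skip) s1 3
       (\<lambda>s'. imem s' 26 0 = int r \<and> ?Inv (Suc r) (setv 26 (int (Suc r)) s'))"
    proof (rule runs_Cond, goal_cases)
      case 2
      then have l: "?l (Suc r) = ?l r @ [r]" using test by (simp add: rows_of_def)
      show ?case
      proof (rule runs_Seq[where ?T1.0 = 1 and ?T2.0 = 1], rule runs_RStore, goal_cases)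
        case 3
        show ?case unfolding ix res
          by (rule runs_IStore) (use inv v1 lW W5 l in \<open>auto simp: nth_append less_Suc_eq\<close>)
      qed (use lW ix in auto)
    next
      case 3
      then have l: "?l (Suc r) = ?l r" using test by (simp add: rows_of_def)
      show ?case by (rule runs_Skip) (use inv v1 l in auto)
    qed simp
  qed (use v W5 in \<open>auto simp: rows_of_def\<close>)
qed

lemma runs_unload_pair:
  assumes m: "mem_ok A D es st" and A: "A \<subseteq> S \<times> {..<5}" "(j, r) \<in> A" and D: "(j, r) \<notin> D" "finite D"
    and v: "imem st 27 0 = int j" "imem st 26 0 = int r" "rmem st 5 0 = es j" "imem st 24 0 = int t" and t: "int t + 1 \<le> W"
  shows "runs I W unload_pair st 6 (\<lambda>s'. mem_ok (A - {(j, r)}) (insert (j, r) D) es s' \<and>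
     (\<forall>a. a \<noteq> 20 \<longrightarrow> a \<noteq> 21 \<longrightarrow> a \<noteq> 22 \<longrightarrow> a \<noteq> 24 \<longrightarrow> imem s' a = imem st a) \<and> outp s' = outp st \<and> rmem s' 5 = rmem st 5 \<and>
     (if card (bin (A - {(j, r)}) (P (j, r))) = 1
      then imem s' 24 0 = int (Suc t) \<and> imem s' 22 = (imem st 22)(int t := int (\<Sum>z\<in>bin (A - {(j, r)}) (P (j, r)). fst z))
      else imem s' 24 0 = int t \<and> imem s' 22 = imem st 22))"
proof -
  have jr: "j < n" "r < 5" using A S by auto
  let ?p = "P (j, r)" and ?A = "A - {(j, r)}"
  have p: "?p < M" by (rule P_less[OF jr])
  have finA: "finite A" using finite_subset[OF A(1)] finS by simp
  have bk: "ival I st' eBk = int ?p" if "imem st' 27 0 = int j" "imem st' 26 0 = int r" for st' by (rule ival_eBk[OF that jr])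
  have sgv: "rval I st' eSg = hsign \<omega> r j" if "imem st' 27 0 = int j" "imem st' 26 0 = int r" for st' by (rule rval_eSg[OF that jr])
  have mb: "(j, r) \<in> bin A ?p" "finite (bin A ?p)" using A finA by (auto simp: bin_def)
  have ins: "card (bin A ?p) = Suc (card (bin ?A ?p))" "(\<Sum>z\<in>bin A ?p. fst z) = j + (\<Sum>z\<in>bin ?A ?p. fst z)"
    unfolding bin_remove using card.remove[OF mb(2,1)] sum.remove[OF mb(2,1), of fst] by simp_all
  have bnd: "card (bin ?A ?p) \<le> k" "(\<Sum>z\<in>bin ?A ?p. fst z) \<le> n * k"
    using bin_bounds[of ?A S ?p] A S cS by auto
  define c where "c = card (bin ?A ?p)"
  define u where "u = (\<Sum>z\<in>bin ?A ?p. fst z)"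
  have cnt: "imem st 20 (int ?p) = int c + 1" using m p ins by (simp add: mem_ok_def c_def)
  have ids: "imem st 21 (int ?p) = int u + int j"
  proof -
    have "imem st 21 (int ?p) = int (\<Sum>z\<in>bin A ?p. fst z)" using m p unfolding mem_ok_def by blast
    then show ?thesis unfolding ins(2) u_def by simp
  qed
  have Wb: "int c \<le> W" "int u \<le> W" "int ?p \<le> W"
  proof -
    have "int c \<le> int k" "int u \<le> int (n * k)" "int ?p \<le> int M"
      using bnd p unfolding c_def u_def by (simp_all only: of_nat_le_iff less_imp_le)
    then show "int c \<le> W" "int u \<le> W" "int ?p \<le> W"
      using W_bounds by linarith+
  qed
  let ?s1 = "st\<lparr>imem := (imem st)(20 := (imem st 20)(int ?p := int c))\<rparr>"
  let ?s2 = "?s1\<lparr>imem := (imem ?s1)(21 := (imem ?s1 21)(int ?p := int u))\<rparr>"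
  let ?s3 = "?s2\<lparr>rmem := (rmem ?s2)(3 := (rmem ?s2 3)(int ?p := rmem st 3 (int ?p) - hsign \<omega> r j * es j))\<rparr>"
  have v1: "imem ?s1 27 0 = int j" "imem ?s1 26 0 = int r" "imem ?s2 27 0 = int j" "imem ?s2 26 0 = int r"
    "imem ?s3 27 0 = int j" "imem ?s3 26 0 = int r" using v by simp_all
  have ok3: "mem_ok ?A (insert (j, r) D) es ?s3"
    unfolding mem_ok_def
  proof (intro conjI allI impI ballI)
    fix p' assume p': "p' < M"
    have other: "bin ?A p' = bin A p'" if "p' \<noteq> ?p" using that by (auto simp: bin_def)
    show "imem ?s3 20 (int p') = int (card (bin ?A p'))"
      using m p' other by (cases "p' = ?p") (simp_all add: mem_ok_def c_def)
    show "imem ?s3 21 (int p') = int (\<Sum>z\<in>bin ?A p'. fst z)"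
      using m p' other by (cases "p' = ?p") (simp_all add: mem_ok_def u_def)
  next
    fix z assume "z \<in> ?A \<union> insert (j, r) D"
    then have "z \<in> A \<union> D" using A(2) by auto
    then have old: "rmem st 3 (int (P z)) = Y (P z) - (\<Sum>z'\<in>bin D (P z). hsign \<omega> (snd z') (fst z') * es (fst z'))"
      using m unfolding mem_ok_def by blast
    have "(j, r) \<notin> bin D (P z)" "finite (bin D (P z))" using D by (auto simp: bin_def)
    then show "rmem ?s3 3 (int (P z)) = Y (P z) - (\<Sum>z'\<in>bin (insert (j, r) D) (P z). hsign \<omega> (snd z') (fst z') * es (fst z'))"
      using old by (cases "P z = ?p") (simp_all add: bin_insert)
  qed
  have ok3': "mem_ok ?A (insert (j, r) D) es s'" if "imem s' 20 = imem ?s3 20" "imem s' 21 = imem ?s3 21" "rmem s' 3 = rmem ?s3 3" for s'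
    using ok3 unfolding mem_ok_def that .
  show ?thesis unfolding unload_pair_def c_def[symmetric] u_def[symmetric]
  proof (rule runs_Seq[where ?T1.0 = 1 and ?T2.0 = 5], rule runs_IStore, goal_cases)
    case 4
    have e1: "st\<lparr>imem := (imem st)(20 := (imem st 20)(ival I st eBk := ival I st (ISub (ILoad 20 eBk) (IConst 1))))\<rparr> = ?s1"
      unfolding ival.simps bk[OF v(1,2)] cnt by simp
    show ?case unfolding e1
    proof (rule runs_Seq[where ?T1.0 = 1 and ?T2.0 = 4], rule runs_IStore, goal_cases)
      case 4
      have "imem ?s1 21 (int ?p) - imem ?s1 27 0 = int u" using ids v by simp
      then have e2: "?s1\<lparr>imem := (imem ?s1)(21 := (imem ?s1 21)(ival I ?s1 eBk := ival I ?s1 (ISub (ILoad 21 eBk) (Var 27))))\<rparr> = ?s2"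
        unfolding ival.simps bk[OF v1(1,2)] by (simp only:)
      show ?case unfolding e2
      proof (rule runs_Seq[where ?T1.0 = 1 and ?T2.0 = 3], rule runs_RStore, goal_cases)
        case 3
        have e3: "?s2\<lparr>rmem := (rmem ?s2)(3 := (rmem ?s2 3)(ival I ?s2 eBk := rval I ?s2 (RSub (RLoad 3 eBk) (RMul eSg (RLoad 5 (IConst 0))))))\<rparr> = ?s3"
          unfolding rval.simps ival.simps bk[OF v1(3,4)] sgv[OF v1(3,4)] using v(3) by simp
        have c3: "imem ?s3 20 (int ?p) = int c" "imem ?s3 21 (int ?p) = int u" by simp_all
        show ?case unfolding e3
        proof (rule runs_Cond, goal_cases)
          case 2
          then have c1: "c = 1" unfolding bval.simps ival.simps bk[OF v1(5,6)] c3 by simp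
          let ?s4 = "?s3\<lparr>imem := (imem ?s3)(22 := (imem ?s3 22)(int t := int u))\<rparr>"
          have e4: "?s3\<lparr>imem := (imem ?s3)(22 := (imem ?s3 22)(ival I ?s3 (Var 24) := ival I ?s3 (ILoad 21 eBk)))\<rparr> = ?s4"
            unfolding ival.simps bk[OF v1(5,6)] c3 using v(4) by simp
          show ?case
          proof (rule runs_Seq[where ?T1.0 = 1 and ?T2.0 = 1], rule runs_IStore, goal_cases)
            case 4
            show ?case unfolding e4
              by (rule runs_IStore, simp, use W5 in simp, use v t in simp) (use v c1 in \<open>auto intro!: ok3'\<close>)
          next
            case 3
            show ?case unfolding ival.simps bk[OF v1(5,6)] c3 using Wb by simp
          qed (use v t in auto)
        next
          case 3
          then have c1: "c \<noteq> 1" unfolding bval.simps ival.simps bk[OF v1(5,6)] c3 by auto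
          show ?case by (rule runs_Skip) (use v c1 in \<open>auto intro!: ok3'\<close>)
        qed simp
      qed (use bk[OF v1(3,4)] Wb in simp_all)
    next
      case 3
      have "imem ?s1 21 (int ?p) - imem ?s1 27 0 = int u" using ids v by simp
      then have "ival I ?s1 (ISub (ILoad 21 eBk) (Var 27)) = int u" unfolding ival.simps bk[OF v1(1,2)] by (simp only:)
      then show ?case using Wb by (simp only: abs_of_nat)
    qed (use bk[OF v1(1,2)] Wb in simp_all)
  next
    case 3
    show ?case unfolding ival.simps bk[OF v(1,2)] cnt using Wb by simp
  qed (use bk[OF v(1,2)] Wb in simp_all)
qed

text \<open>The queue starts with all \<open>k\<close> elements and each resolution appends at most
  one per row, hence \<open>k + 5 * card D\<close>. Flags and output are tied to the abstract
  peeling state.\<close>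

definition core :: "nat set \<Rightarrow> (nat \<Rightarrow> real) \<Rightarrow> nat \<Rightarrow> state \<Rightarrow> bool" where
  "core D es t st \<longleftrightarrow> peel n x \<omega> S D es \<and> mem_ok ((S - D) \<times> {..<5}) (D \<times> {..<5}) es st \<and>
     imem st 24 0 = int t \<and> t \<le> k + 5 * card D \<and> (\<forall>a<t. imem st 22 (int a) \<in> int ` S) \<and>
     (\<forall>f\<in>S. imem st 25 (int f) = of_bool (f \<in> D)) \<and> outp st = (\<lambda>j. if 0 \<le> j \<and> nat j \<in> D then es (nat j) else 0)"

text \<open>Every element that could be peeled now waits in the queue between head and tail; an
  exhausted queue therefore means that peeling is stuck.\<close>

definition covered :: "nat set \<Rightarrow> nat \<Rightarrow> nat \<Rightarrow> state \<Rightarrow> bool" where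
  "covered D h t st \<longleftrightarrow> (\<forall>e\<in>S - D. 3 \<le> card (isolated (buckets \<omega>) (S - D) e) \<longrightarrow>
     (\<exists>a. h \<le> a \<and> a < t \<and> imem st 22 (int a) = int e))"

text \<open>Only resolved pairs are subtracted from the buckets, so the estimate of \<open>j\<close>
  can be fixed before the first of its five updates.\<close>

lemma mem_ok_upd:
  assumes "mem_ok A D es st" "\<And>r. (j, r) \<notin> D"
  shows "mem_ok A D (es(j := v)) st"
proof -
  have "(\<Sum>z'\<in>bin D p. hsign \<omega> (snd z') (fst z') * (es(j := v)) (fst z')) = (\<Sum>z'\<in>bin D p. hsign \<omega> (snd z') (fst z') * es (fst z'))" for p
  proof (rule sum.cong[OF refl])
    fix z assume "z \<in> bin D p"
    then have "fst z \<noteq> j" using assms(2) by (cases z) (auto simp: bin_def)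
    then show "hsign \<omega> (snd z) (fst z) * (es(j := v)) (fst z) = hsign \<omega> (snd z) (fst z) * es (fst z)" by simp
  qed
  then show ?thesis using assms(1) unfolding mem_ok_def by simp
qed

text \<open>If \<open>e\<close> shared a bucket with \<open>j\<close> and is alone there afterwards,
  the count of this bucket is 1 after the update and the index sum is \<open>e\<close>, so
  \<open>e\<close> is appended.\<close>

lemma runs_unload_all:
  assumes m: "mem_ok ((S - D) \<times> {..<5}) (D \<times> {..<5}) es st" and D: "D \<subseteq> S" and j: "j \<in> S - D"
    and v: "imem st 27 0 = int j" "rmem st 5 0 = v" "imem st 24 0 = int t" and t: "int t + 5 \<le> W"
    and q: "\<forall>a<t. imem st 22 (int a) \<in> int ` S"
  shows "runs I W (For 26 (IConst 5) unload_pair) st 42 (\<lambda>s'. mem_ok ((S - insert j D) \<times> {..<5}) (insert j D \<times> {..<5}) (es(j := v)) s' \<and>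
     imem s' 23 = imem st 23 \<and> imem s' 25 = imem st 25 \<and> outp s' = outp st \<and>
     (\<exists>t'. imem s' 24 0 = int t' \<and> t \<le> t' \<and> t' \<le> t + 5 \<and> (\<forall>a<t'. imem s' 22 (int a) \<in> int ` S) \<and>
       (\<forall>a<t. imem s' 22 (int a) = imem st 22 (int a)) \<and>
       (\<forall>e\<in>S - insert j D. \<forall>r. r \<in> isolated (buckets \<omega>) (S - insert j D) e \<longrightarrow> buckets \<omega> r j = buckets \<omega> r e \<longrightarrow>
          (\<exists>a. t \<le> a \<and> a < t' \<and> imem s' 22 (int a) = int e))))"
proof -
  have jn: "j < n" using j S by auto
  have finD: "finite D" using finite_subset[OF D finS] .
  let ?U = "S - insert j D" and ?es = "es(j := v)"
  let ?A = "\<lambda>r. (S - D) \<times> {..<5} - {j} \<times> {..<r}" and ?D = "\<lambda>r. D \<times> {..<5} \<union> {j} \<times> {..<r::nat}"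
  let ?Inv = "\<lambda>r s'. mem_ok (?A r) (?D r) ?es s' \<and> imem s' 27 0 = int j \<and> rmem s' 5 0 = v \<and>
     imem s' 23 = imem st 23 \<and> imem s' 25 = imem st 25 \<and> outp s' = outp st \<and>
     (\<exists>t'. imem s' 24 0 = int t' \<and> t \<le> t' \<and> t' \<le> t + r \<and> (\<forall>a<t'. imem s' 22 (int a) \<in> int ` S) \<and>
       (\<forall>a<t. imem s' 22 (int a) = imem st 22 (int a)) \<and>
       (\<forall>e\<in>?U. \<forall>r'<r. r' \<in> isolated (buckets \<omega>) ?U e \<longrightarrow> buckets \<omega> r' j = buckets \<omega> r' e \<longrightarrow>
          (\<exists>a. t \<le> a \<and> a < t' \<and> imem s' 22 (int a) = int e)))"
  have mcong: "mem_ok A D es s'' = mem_ok A D es s'" if "imem s'' 20 = imem s' 20" "imem s'' 21 = imem s' 21" "rmem s'' 3 = rmem s' 3" for A D es s' s''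
    using that by (simp add: mem_ok_def)
  show ?thesis
  proof (rule runs_For[where Inv = ?Inv and n = 5 and T = 6])
    have "mem_ok (?A 0) (?D 0) ?es st" using mem_ok_upd[OF m, of j v] j by simp
    then have "mem_ok (?A 0) (?D 0) ?es (setv 26 0 st)" by (subst mcong[of _ st]) auto
    then show "?Inv 0 (setv 26 0 st)" using v q by (intro conjI exI[of _ t]) auto
  next
    fix r s1 assume r: "r < (5::nat)" and inv: "?Inv r s1" and v1: "imem s1 26 0 = int r"
    from inv obtain t1 where t1: "imem s1 24 0 = int t1" "t \<le> t1" "t1 \<le> t + r" "\<forall>a<t1. imem s1 22 (int a) \<in> int ` S"
       "\<forall>a<t. imem s1 22 (int a) = imem st 22 (int a)"
       "\<forall>e\<in>?U. \<forall>r'<r. r' \<in> isolated (buckets \<omega>) ?U e \<longrightarrow> buckets \<omega> r' j = buckets \<omega> r' e \<longrightarrow>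
          (\<exists>a. t \<le> a \<and> a < t1 \<and> imem s1 22 (int a) = int e)" by blast
    have sets: "?A r - {(j, r)} = ?A (Suc r)" "insert (j, r) (?D r) = ?D (Suc r)" using less_Suc_eq by auto
    let ?F = "{f \<in> ?U. buckets \<omega> r f = buckets \<omega> r j}"
    have binF: "bin (?A (Suc r)) (P (j, r)) = ?F \<times> {r}"
    proof -
      have "bin (?A (Suc r)) (P (j, r)) = bin ((S - D) \<times> {..<5}) (P (j, r)) - {j} \<times> {..<Suc r}" unfolding bin_def by blast
      also have "\<dots> = {f \<in> S - D. buckets \<omega> r f = buckets \<omega> r j} \<times> {r} - {j} \<times> {..<Suc r}"
        using bin_prod[of "S - D" j r] S jn r by (simp add: subset_iff)
      also have "\<dots> = ?F \<times> {r}" by auto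
      finally show ?thesis .
    qed
    have up: "runs I W unload_pair s1 6 (\<lambda>s'. mem_ok (?A (Suc r)) (?D (Suc r)) ?es s' \<and>
     (\<forall>a. a \<noteq> 20 \<longrightarrow> a \<noteq> 21 \<longrightarrow> a \<noteq> 22 \<longrightarrow> a \<noteq> 24 \<longrightarrow> imem s' a = imem s1 a) \<and> outp s' = outp s1 \<and> rmem s' 5 = rmem s1 5 \<and>
     (if card (?F \<times> {r}) = 1
      then imem s' 24 0 = int (Suc t1) \<and> imem s' 22 = (imem s1 22)(int t1 := int (\<Sum>z\<in>?F \<times> {r}. fst z))
      else imem s' 24 0 = int t1 \<and> imem s' 22 = imem s1 22))"
      unfolding binF[symmetric] sets[symmetric]
    proof (rule runs_unload_pair)
      show "mem_ok (?A r) (?D r) ?es s1" using inv by blast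
      show "(j, r) \<in> ?A r" using j r by auto
      show "(j, r) \<notin> ?D r" using j by auto
      show "int t1 + 1 \<le> W" using t t1(3) r by linarith
    qed (use inv v1 t1 finD in auto)
    show "runs I W unload_pair s1 6 (\<lambda>s'. imem s' 26 0 = int r \<and> ?Inv (Suc r) (setv 26 (int (Suc r)) s'))"
    proof (rule runs_mono[OF up order_refl])
      fix s' assume a: "mem_ok (?A (Suc r)) (?D (Suc r)) ?es s' \<and>
     (\<forall>a. a \<noteq> 20 \<longrightarrow> a \<noteq> 21 \<longrightarrow> a \<noteq> 22 \<longrightarrow> a \<noteq> 24 \<longrightarrow> imem s' a = imem s1 a) \<and> outp s' = outp s1 \<and> rmem s' 5 = rmem s1 5 \<and>
     (if card (?F \<times> {r}) = 1
      then imem s' 24 0 = int (Suc t1) \<and> imem s' 22 = (imem s1 22)(int t1 := int (\<Sum>z\<in>?F \<times> {r}. fst z))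
      else imem s' 24 0 = int t1 \<and> imem s' 22 = imem s1 22)"
      let ?s = "setv 26 (int (Suc r)) s'"
      have ok: "mem_ok (?A (Suc r)) (?D (Suc r)) ?es ?s" using a by (subst mcong[of _ s']) auto
      have fr: "imem s' 26 0 = int r" "imem ?s 27 0 = int j \<and> rmem ?s 5 0 = v \<and> imem ?s 23 = imem st 23 \<and> imem ?s 25 = imem st 25 \<and> outp ?s = outp st"
        using a inv v1 by auto
      have "\<exists>t'. imem ?s 24 0 = int t' \<and> t \<le> t' \<and> t' \<le> t + Suc r \<and> (\<forall>a<t'. imem ?s 22 (int a) \<in> int ` S) \<and>
       (\<forall>a<t. imem ?s 22 (int a) = imem st 22 (int a)) \<and>
       (\<forall>e\<in>?U. \<forall>r'<Suc r. r' \<in> isolated (buckets \<omega>) ?U e \<longrightarrow> buckets \<omega> r' j = buckets \<omega> r' e \<longrightarrow>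
          (\<exists>a. t \<le> a \<and> a < t' \<and> imem ?s 22 (int a) = int e))"
      proof (cases "card (?F \<times> {r}) = 1")
        case True
        then have "card ?F = 1" by (simp add: card_cartesian_product)
        then obtain e0 where e0: "?F = {e0}" by (rule card_1_singletonE)
        have q0: "imem ?s 24 0 = int (Suc t1)" "imem ?s 22 = (imem s1 22)(int t1 := int e0)" using a True unfolding e0 by simp_all
        have e0S: "e0 \<in> S" using e0 by blast
        show ?thesis
        proof (rule exI[of _ "Suc t1"], intro conjI allI impI ballI)
          show "imem ?s 22 (int a) \<in> int ` S" if "a < Suc t1" for a
            using that t1(4) e0S unfolding q0(2) by (cases "a = t1") auto
          show "imem ?s 22 (int a) = imem st 22 (int a)" if "a < t" for a
            using that t1(2,5) unfolding q0(2) by simp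
          fix e r' assume e: "e \<in> ?U" "r' < Suc r" "r' \<in> isolated (buckets \<omega>) ?U e" "buckets \<omega> r' j = buckets \<omega> r' e"
          show "\<exists>a. t \<le> a \<and> a < Suc t1 \<and> imem ?s 22 (int a) = int e"
          proof (cases "r' = r")
            case True
            then have "e \<in> ?F" using e by auto
            then have "e = e0" unfolding e0 by simp
            then show ?thesis using t1(2) unfolding q0(2) by (intro exI[of _ t1]) simp
          next
            case False
            then have "r' < r" using e(2) by simp
            then obtain a where "t \<le> a" "a < t1" "imem s1 22 (int a) = int e" using t1(6) e by blast
            then show ?thesis unfolding q0(2) by (intro exI[of _ a]) simp
          qed
        qed (use q0(1) t1 in auto)
      next
        case False
        have q0: "imem ?s 24 0 = int t1" "imem ?s 22 = imem s1 22" using a False by simp_all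
        show ?thesis
        proof (rule exI[of _ t1], intro conjI allI impI ballI)
          fix e r' assume e: "e \<in> ?U" "r' < Suc r" "r' \<in> isolated (buckets \<omega>) ?U e" "buckets \<omega> r' j = buckets \<omega> r' e"
          have "r' \<noteq> r"
          proof
            assume "r' = r"
            then have "?F = {e}" using e unfolding isolated_def by auto
            then show False using False by simp
          qed
          then have "r' < r" using e(2) by simp
          then show "\<exists>a. t \<le> a \<and> a < t1 \<and> imem ?s 22 (int a) = int e" unfolding q0(2) using t1(6) e by blast
        qed (use q0 t1 in auto)
      qed
      then show "imem s' 26 0 = int r \<and> ?Inv (Suc r) ?s" using ok fr by blast
    qed
  next
    fix s1 assume inv: "?Inv 5 s1"
    have sets: "?A 5 = ?U \<times> {..<5}" "?D 5 = insert j D \<times> {..<5}" by auto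
    from inv obtain t1 where t1: "imem s1 24 0 = int t1" "t \<le> t1" "t1 \<le> t + 5" "\<forall>a<t1. imem s1 22 (int a) \<in> int ` S"
       "\<forall>a<t. imem s1 22 (int a) = imem st 22 (int a)"
       "\<forall>e\<in>?U. \<forall>r'<5. r' \<in> isolated (buckets \<omega>) ?U e \<longrightarrow> buckets \<omega> r' j = buckets \<omega> r' e \<longrightarrow>
          (\<exists>a. t \<le> a \<and> a < t1 \<and> imem s1 22 (int a) = int e)" by blast
    have "r < 5" if "r \<in> isolated (buckets \<omega>) ?U e" for r e using that unfolding isolated_def by simp
    then have "\<forall>e\<in>?U. \<forall>r. r \<in> isolated (buckets \<omega>) ?U e \<longrightarrow> buckets \<omega> r j = buckets \<omega> r e \<longrightarrow>
          (\<exists>a. t \<le> a \<and> a < t1 \<and> imem s1 22 (int a) = int e)" using t1(6) by blast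
    then show "mem_ok (?U \<times> {..<5}) (insert j D \<times> {..<5}) (es(j := v)) s1 \<and>
     imem s1 23 = imem st 23 \<and> imem s1 25 = imem st 25 \<and> outp s1 = outp st \<and>
     (\<exists>t'. imem s1 24 0 = int t' \<and> t \<le> t' \<and> t' \<le> t + 5 \<and> (\<forall>a<t'. imem s1 22 (int a) \<in> int ` S) \<and>
       (\<forall>a<t. imem s1 22 (int a) = imem st 22 (int a)) \<and>
       (\<forall>e\<in>?U. \<forall>r. r \<in> isolated (buckets \<omega>) ?U e \<longrightarrow> buckets \<omega> r j = buckets \<omega> r e \<longrightarrow>
          (\<exists>a. t \<le> a \<and> a < t' \<and> imem s1 22 (int a) = int e)))"
      using inv t1(1-5) unfolding sets by blast
  qed (use W5 in auto)
qed

lemma runs_resolve: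
  assumes c: "core D es t st" and j: "j \<in> S - D" "imem st 27 0 = int j"
    and r: "r\<^sub>1 \<in> isolated (buckets \<omega>) (S - D) j" "r\<^sub>2 \<in> isolated (buckets \<omega>) (S - D) j" "r\<^sub>3 \<in> isolated (buckets \<omega>) (S - D) j"
      "r\<^sub>1 \<noteq> r\<^sub>2" "r\<^sub>1 \<noteq> r\<^sub>3" "r\<^sub>2 \<noteq> r\<^sub>3"
    and res: "rmem st 4 0 = residual n x \<omega> D es r\<^sub>1 j" "rmem st 4 1 = residual n x \<omega> D es r\<^sub>2 j" "rmem st 4 2 = residual n x \<omega> D es r\<^sub>3 j"
  shows "runs I W resolve st 48 (\<lambda>s'. \<exists>es' t'. core (insert j D) es' t' s' \<and> imem s' 23 = imem st 23 \<and> t \<le> t' \<and> t' \<le> t + 5 \<and>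
     (\<forall>a<t. imem s' 22 (int a) = imem st 22 (int a)) \<and>
     (\<forall>e\<in>S - insert j D. \<forall>r. r \<in> isolated (buckets \<omega>) (S - insert j D) e \<longrightarrow> buckets \<omega> r j = buckets \<omega> r e \<longrightarrow>
          (\<exists>a. t \<le> a \<and> a < t' \<and> imem s' 22 (int a) = int e)))"
proof -
  have p: "peel n x \<omega> S D es" using c by (simp add: core_def)
  have D: "D \<subseteq> S" by (rule peel_subset[OF p])
  have jn: "j < n" using j S by auto
  have finD: "finite D" using finite_subset[OF D finS] .
  define v where "v = med3 (rmem st 4 0) (rmem st 4 1) (rmem st 4 2)"
  have p': "peel n x \<omega> S (insert j D) (es(j := v))"
    by (rule peel_step[OF p j(1) r]) (simp add: v_def res)
  let ?s1 = "st\<lparr>rmem := (rmem st)(5 := (rmem st 5)(0 := v))\<rparr>"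
  let ?s2 = "?s1\<lparr>outp := (outp ?s1)(int j := v)\<rparr>"
  let ?s3 = "?s2\<lparr>imem := (imem ?s2)(25 := (imem ?s2 25)(int j := 1))\<rparr>"
  have cD: "card D < k"
  proof -
    have "D \<subset> S" using D j by auto
    then show ?thesis using psubset_card_mono[OF finS] cS by metis
  qed
  have tk: "t \<le> k + 5 * card D" using c by (simp add: core_def)
  have tW: "int t + 5 \<le> W"
  proof -
    have "t + 5 \<le> 6 * k" using cD tk by simp
    then have "int (t + 5) \<le> int (6 * k)" by (simp only: of_nat_le_iff)
    then show ?thesis using W_bounds by simp
  qed
  have jW: "int j \<le> W" using jn W_bounds by linarith
  have m3: "mem_ok ((S - D) \<times> {..<5}) (D \<times> {..<5}) es ?s3" using c by (simp add: core_def mem_ok_def)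
  have ul: "runs I W (For 26 (IConst 5) unload_pair) ?s3 42 (\<lambda>s'. mem_ok ((S - insert j D) \<times> {..<5}) (insert j D \<times> {..<5}) (es(j := v)) s' \<and>
     imem s' 23 = imem ?s3 23 \<and> imem s' 25 = imem ?s3 25 \<and> outp s' = outp ?s3 \<and>
     (\<exists>t'. imem s' 24 0 = int t' \<and> t \<le> t' \<and> t' \<le> t + 5 \<and> (\<forall>a<t'. imem s' 22 (int a) \<in> int ` S) \<and>
       (\<forall>a<t. imem s' 22 (int a) = imem ?s3 22 (int a)) \<and>
       (\<forall>e\<in>S - insert j D. \<forall>r. r \<in> isolated (buckets \<omega>) (S - insert j D) e \<longrightarrow> buckets \<omega> r j = buckets \<omega> r e \<longrightarrow>
          (\<exists>a. t \<le> a \<and> a < t' \<and> imem s' 22 (int a) = int e))))"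
    by (rule runs_unload_all[OF m3 D j(1) _ _ _ tW]) (use c j in \<open>auto simp: core_def\<close>)
  have ul': "runs I W (For 26 (IConst 5) unload_pair) ?s3 42 (\<lambda>s'. \<exists>es' t'. core (insert j D) es' t' s' \<and> imem s' 23 = imem st 23 \<and> t \<le> t' \<and> t' \<le> t + 5 \<and>
     (\<forall>a<t. imem s' 22 (int a) = imem st 22 (int a)) \<and>
     (\<forall>e\<in>S - insert j D. \<forall>r. r \<in> isolated (buckets \<omega>) (S - insert j D) e \<longrightarrow> buckets \<omega> r j = buckets \<omega> r e \<longrightarrow>
          (\<exists>a. t \<le> a \<and> a < t' \<and> imem s' 22 (int a) = int e)))"
  proof (rule runs_mono[OF ul order_refl], elim conjE exE)
    fix s' t'
    assume a: "mem_ok ((S - insert j D) \<times> {..<5}) (insert j D \<times> {..<5}) (es(j := v)) s'" "imem s' 23 = imem ?s3 23"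
      "imem s' 25 = imem ?s3 25" "outp s' = outp ?s3" and t': "imem s' 24 0 = int t'" "t \<le> t'" "t' \<le> t + 5" "\<forall>a<t'. imem s' 22 (int a) \<in> int ` S"
      "\<forall>a<t. imem s' 22 (int a) = imem ?s3 22 (int a)"
      and cov: "\<forall>e\<in>S - insert j D. \<forall>r. r \<in> isolated (buckets \<omega>) (S - insert j D) e \<longrightarrow> buckets \<omega> r j = buckets \<omega> r e \<longrightarrow>
          (\<exists>a. t \<le> a \<and> a < t' \<and> imem s' 22 (int a) = int e)"
    have "core (insert j D) (es(j := v)) t' s'"
      unfolding core_def
    proof (intro conjI)
      show "t' \<le> k + 5 * card (insert j D)" using t'(3) tk finD j by simp
      show "\<forall>f\<in>S. imem s' 25 (int f) = of_bool (f \<in> insert j D)" using a(3) c by (auto simp: core_def)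
      have "outp s' = (outp st)(int j := v)" using a(4) by simp
      also have "outp st = (\<lambda>i. if 0 \<le> i \<and> nat i \<in> D then es (nat i) else 0)" using c by (simp add: core_def)
      finally show "outp s' = (\<lambda>i. if 0 \<le> i \<and> nat i \<in> insert j D then (es(j := v)) (nat i) else 0)"
        by (auto simp: fun_eq_iff)
    qed (use p' a t' in auto)
    then show "\<exists>es' t'. core (insert j D) es' t' s' \<and> imem s' 23 = imem st 23 \<and> t \<le> t' \<and> t' \<le> t + 5 \<and>
     (\<forall>a<t. imem s' 22 (int a) = imem st 22 (int a)) \<and>
     (\<forall>e\<in>S - insert j D. \<forall>r. r \<in> isolated (buckets \<omega>) (S - insert j D) e \<longrightarrow> buckets \<omega> r j = buckets \<omega> r e \<longrightarrow>
          (\<exists>a. t \<le> a \<and> a < t' \<and> imem s' 22 (int a) = int e))"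
      using a(2) t'(2,3,5) cov by (intro exI[of _ "es(j := v)"] exI[of _ t']) auto
  qed
  show ?thesis unfolding resolve_def
  proof (rule runs_Seq[where ?T1.0 = 4 and ?T2.0 = 44])
    show "runs I W med_com st 4 (\<lambda>s'. runs I W (Seq (Output (Var 27) (RLoad 5 (IConst 0)))
     (Seq (IStore 25 (Var 27) (IConst 1)) (For 26 (IConst 5) unload_pair))) s' 44 (\<lambda>s'. \<exists>es' t'. core (insert j D) es' t' s' \<and> imem s' 23 = imem st 23 \<and> t \<le> t' \<and> t' \<le> t + 5 \<and>
     (\<forall>a<t. imem s' 22 (int a) = imem st 22 (int a)) \<and>
     (\<forall>e\<in>S - insert j D. \<forall>r. r \<in> isolated (buckets \<omega>) (S - insert j D) e \<longrightarrow> buckets \<omega> r j = buckets \<omega> r e \<longrightarrow>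
          (\<exists>a. t \<le> a \<and> a < t' \<and> imem s' 22 (int a) = int e))))"
    proof (rule runs_mono[OF runs_med order_refl], use W5 in simp)
      fix s1 assume "s1 = st\<lparr>rmem := (rmem st)(5 := (rmem st 5)(0 := med3 (rmem st 4 0) (rmem st 4 1) (rmem st 4 2)))\<rparr>"
      then have s1: "s1 = ?s1" unfolding v_def .
      show "runs I W (Seq (Output (Var 27) (RLoad 5 (IConst 0)))
     (Seq (IStore 25 (Var 27) (IConst 1)) (For 26 (IConst 5) unload_pair))) s1 44 (\<lambda>s'. \<exists>es' t'. core (insert j D) es' t' s' \<and> imem s' 23 = imem st 23 \<and> t \<le> t' \<and> t' \<le> t + 5 \<and>
     (\<forall>a<t. imem s' 22 (int a) = imem st 22 (int a)) \<and>
     (\<forall>e\<in>S - insert j D. \<forall>r. r \<in> isolated (buckets \<omega>) (S - insert j D) e \<longrightarrow> buckets \<omega> r j = buckets \<omega> r e \<longrightarrow>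
          (\<exists>a. t \<le> a \<and> a < t' \<and> imem s' 22 (int a) = int e)))"
        unfolding s1
      proof (rule runs_Seq[where ?T1.0 = 1 and ?T2.0 = 43], rule runs_Output, goal_cases)
        case 3
        have e2: "?s1\<lparr>outp := (outp ?s1)(ival I ?s1 (Var 27) := rval I ?s1 (RLoad 5 (IConst 0)))\<rparr> = ?s2" using j(2) by simp
        show ?case unfolding e2
        proof (rule runs_Seq[where ?T1.0 = 1 and ?T2.0 = 42], rule runs_IStore, goal_cases)
          case 4
          have e3: "?s2\<lparr>imem := (imem ?s2)(25 := (imem ?s2 25)(ival I ?s2 (Var 27) := ival I ?s2 (IConst 1)))\<rparr> = ?s3" using j(2) by simp
          show ?case unfolding e3 by (rule ul')
        qed (use j(2) jW W5 in auto)
      qed (use j(2) jW in auto)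
    qed
  qed simp
qed

definition state_inv :: "nat set \<Rightarrow> (nat \<Rightarrow> real) \<Rightarrow> nat \<Rightarrow> nat \<Rightarrow> state \<Rightarrow> bool" where
  "state_inv D es h t st \<longleftrightarrow> core D es t st \<and> imem st 23 0 = int h \<and> h \<le> t \<and> covered D h t st"

text \<open>A resolution consumes one queue entry, appends at most five and clears one element
  weighted 6, so it lowers the potential by at least 2; a discarded entry lowers it by 1. Initially
  it is \<open>7 * k\<close>, and 81 steps per round give the \<open>567 * k\<close> of the
  loop.\<close>

definition potential :: "state \<Rightarrow> nat" where
  "potential st = nat (imem st 24 0 - imem st 23 0) + 6 * card {f \<in> S. imem st 25 (int f) = 0}"

lemma potential_eq:
  assumes "core D es t st" "imem st 23 0 = int h" "h \<le> t"
  shows "potential st = (t - h) + 6 * (k - card D)"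
proof -
  have D: "D \<subseteq> S" using assms(1) by (auto simp: core_def dest: peel_subset)
  have "{f \<in> S. imem st 25 (int f) = 0} = S - D" using assms(1) by (auto simp: core_def)
  then have "card {f \<in> S. imem st 25 (int f) = 0} = k - card D"
    using card_Diff_subset[OF finite_subset[OF D finS] D] cS by simp
  moreover have "nat (imem st 24 0 - imem st 23 0) = t - h" using assms by (simp add: core_def nat_diff_distrib)
  ultimately show ?thesis by (simp add: potential_def)
qed

lemma core_frame:
  assumes "core D es t st" "imem s' 20 = imem st 20" "imem s' 21 = imem st 21" "imem s' 22 = imem st 22"
    "imem s' 24 = imem st 24" "imem s' 25 = imem st 25" "rmem s' 3 = rmem st 3" "outp s' = outp st"
  shows "core D es t s'"
  using assms by (simp add: core_def mem_ok_def)

lemma isolated_remove: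
  assumes "j \<in> U" "e \<in> U - {j}" "r \<in> isolated bk (U - {j}) e" "r \<notin> isolated bk U e"
  shows "bk r j = bk r e"
  using assms unfolding isolated_def by auto

lemma runs_peel_body:
  assumes inv: "state_inv D es h t st" and ht: "h < t"
  shows "runs I W peel_body st 80 (\<lambda>s'. (\<exists>D es h t. state_inv D es h t s') \<and> potential s' < potential st)"
proof -
  let ?Q = "\<lambda>s'. (\<exists>D es h t. state_inv D es h t s') \<and> potential s' < potential st"
  have c: "core D es t st" and h: "imem st 23 0 = int h" "h \<le> t" and cov: "covered D h t st" using inv by (auto simp: state_inv_def)
  have D: "D \<subseteq> S" using c by (auto simp: core_def dest: peel_subset)
  have finD: "finite D" using finite_subset[OF D finS] .
  have pot: "potential st = (t - h) + 6 * (k - card D)" by (rule potential_eq[OF c h])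
  obtain j where j: "j \<in> S" "imem st 22 (int h) = int j" using c ht by (auto simp: core_def)
  have jn: "j < n" using j S by auto
  have hW: "int h + 1 \<le> W" "int j \<le> W"
  proof -
    have "card D \<le> k" using card_mono[OF finS D] cS by simp
    then have "h + 1 \<le> 6 * k" using ht c by (simp add: core_def)
    then have "int (h + 1) \<le> int (6 * k)" by (simp only: of_nat_le_iff)
    then show "int h + 1 \<le> W" using W_bounds by simp
    show "int j \<le> W" using jn W_bounds by linarith
  qed
  let ?s1 = "setv 27 (int j) st"
  let ?s2 = "setv 23 (int h + 1) ?s1"
  have c2: "core D es t ?s2" by (rule core_frame[OF c]) auto
  \<comment> \<open>The head entry may be dropped when its element is resolved or not yet peelable:
    in the latter case \<open>covered\<close> requires no entry for it.\<close>
  have stay: "?Q s'" if f: "imem s' 20 = imem st 20" "imem s' 21 = imem st 21" "imem s' 22 = imem st 22"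
      "imem s' 24 = imem st 24" "imem s' 25 = imem st 25" "imem s' 23 0 = int h + 1" "rmem s' 3 = rmem st 3" "outp s' = outp st"
    and no: "j \<in> D \<or> card (isolated (buckets \<omega>) (S - D) j) < 3" for s'
  proof -
    have c': "core D es t s'" by (rule core_frame[OF c]) (fact f)+
    have h': "imem s' 23 0 = int (Suc h)" using f(6) by simp
    have q': "imem s' 22 = imem st 22" by (fact f)
    have "covered D (Suc h) t s'"
      unfolding covered_def q'
    proof (intro ballI impI)
      fix e assume e: "e \<in> S - D" "3 \<le> card (isolated (buckets \<omega>) (S - D) e)"
      then obtain a where a: "h \<le> a" "a < t" "imem st 22 (int a) = int e" using cov unfolding covered_def by blast
      have "a \<noteq> h" using a(3) j(2) no e by auto
      then show "\<exists>a\<ge>Suc h. a < t \<and> imem st 22 (int a) = int e" using a by (intro exI[of _ a]) auto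
    qed
    then have "state_inv D es (Suc h) t s'" using c' h' ht by (simp add: state_inv_def)
    moreover have "potential s' < potential st" using potential_eq[OF c' h'] pot ht by simp
    ultimately show ?thesis by blast
  qed
  let ?l = "rows_of (S - D) j 5"
  have lset: "set ?l = isolated (buckets \<omega>) (S - D) j" "distinct ?l" unfolding rows_of_def by (auto simp: isolated_def)
  have lc: "length ?l = card (isolated (buckets \<omega>) (S - D) j)" using distinct_card[OF lset(2)] lset(1) by simp
  have main: "runs I W (Cond (ILess (ILoad 25 (Var 27)) (IConst 1))
       (Seq (IStore 28 (IConst 0) (IConst 0)) (Seq scan (Cond (ILess (IConst 2) (Var 28)) resolve Skip))) Skip) ?s2 78 ?Q"
  proof (rule runs_Cond, goal_cases)
    case 3
    then have "j \<in> D" using c j by (auto simp: core_def)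
    then show ?case by (intro runs_Skip stay) auto
  next
    case 2
    then have jD: "j \<in> S - D" using c j by (auto simp: core_def)
    let ?s3 = "setv 28 0 ?s2"
    have m3: "mem_ok ((S - D) \<times> {..<5}) (D \<times> {..<5}) es ?s3" using c by (simp add: core_def mem_ok_def)
    have sc: "runs I W scan ?s3 27 (\<lambda>s'. runs I W (Cond (ILess (IConst 2) (Var 28)) resolve Skip) s' 49 ?Q)"
    proof (rule runs_mono[OF runs_scan[OF m3 D jD] order_refl])
      fix s4 :: state
      assume a: "(\<forall>a. a \<noteq> 26 \<longrightarrow> a \<noteq> 28 \<longrightarrow> imem s4 a = imem ?s3 a) \<and> rmem s4 3 = rmem ?s3 3 \<and> outp s4 = outp ?s3 \<and>
         imem s4 28 0 = int (length ?l) \<and> (\<forall>i<length ?l. rmem s4 4 (int i) = residual n x \<omega> D es (?l ! i) j)"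
      show "runs I W (Cond (ILess (IConst 2) (Var 28)) resolve Skip) s4 49 ?Q"
      proof (rule runs_Cond, goal_cases)
        case 3
        then have "length ?l < 3" using a by simp
        then show ?case using a lc by (intro runs_Skip stay) auto
      next
        case 2
        then have l3: "3 \<le> length ?l" using a by simp
        have c4: "core D es t s4" by (rule core_frame[OF c]) (use a in auto)
        have in4: "?l ! 0 \<in> isolated (buckets \<omega>) (S - D) j" "?l ! 1 \<in> isolated (buckets \<omega>) (S - D) j" "?l ! 2 \<in> isolated (buckets \<omega>) (S - D) j"
          using l3 unfolding lset(1)[symmetric] by (auto intro!: nth_mem)
        have l012: "0 < length ?l" "1 < length ?l" "2 < length ?l" using l3 by linarith+
        have ne: "?l ! 0 \<noteq> ?l ! 1" "?l ! 0 \<noteq> ?l ! 2" "?l ! 1 \<noteq> ?l ! 2" using nth_eq_iff_index_eq[OF lset(2) l012(1,2)] nth_eq_iff_index_eq[OF lset(2) l012(1,3)] nth_eq_iff_index_eq[OF lset(2) l012(2,3)] by simp_all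
        have ri: "rmem s4 4 (int i) = residual n x \<omega> D es (?l ! i) j" if "i < length ?l" for i using a that by blast
        then have rs: "rmem s4 4 (int 0) = residual n x \<omega> D es (?l ! 0) j" "rmem s4 4 (int 1) = residual n x \<omega> D es (?l ! 1) j" "rmem s4 4 (int 2) = residual n x \<omega> D es (?l ! 2) j"
          using ri[OF l012(1)] ri[OF l012(2)] ri[OF l012(3)] by simp_all
        have v4: "imem s4 27 0 = int j" using a by simp
        have rr: "runs I W resolve s4 48 (\<lambda>s'. \<exists>es' t'. core (insert j D) es' t' s' \<and> imem s' 23 = imem s4 23 \<and> t \<le> t' \<and> t' \<le> t + 5 \<and>
           (\<forall>a<t. imem s' 22 (int a) = imem s4 22 (int a)) \<and>
           (\<forall>e\<in>S - insert j D. \<forall>r. r \<in> isolated (buckets \<omega>) (S - insert j D) e \<longrightarrow> buckets \<omega> r j = buckets \<omega> r e \<longrightarrow>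
                (\<exists>a. t \<le> a \<and> a < t' \<and> imem s' 22 (int a) = int e)))"
          by (rule runs_resolve[OF c4 jD v4 in4 ne]) (use rs in simp_all)
        have "runs I W resolve s4 48 ?Q"
        proof (rule runs_mono[OF rr order_refl], elim exE conjE)
          fix s' es' t'
          assume b: "core (insert j D) es' t' s'" "imem s' 23 = imem s4 23" "t \<le> t'" "t' \<le> t + 5"
            "\<forall>a<t. imem s' 22 (int a) = imem s4 22 (int a)"
            and nw: "\<forall>e\<in>S - insert j D. \<forall>r. r \<in> isolated (buckets \<omega>) (S - insert j D) e \<longrightarrow> buckets \<omega> r j = buckets \<omega> r e \<longrightarrow>
                (\<exists>a. t \<le> a \<and> a < t' \<and> imem s' 22 (int a) = int e)"
          have h': "imem s' 23 0 = int (Suc h)" using a b(2) by simp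
          have q4: "imem s4 22 = imem st 22" using a by simp
          have U: "S - insert j D = (S - D) - {j}" by auto
          \<comment> \<open>An element that was peelable before keeps its old entry, which is not
            the head since it differs from \<open>j\<close>. One that has just become peelable
            gained an isolated row by the removal of \<open>j\<close>, shared that bucket with
            \<open>j\<close>, and was appended.\<close>
          have "covered (insert j D) (Suc h) t' s'"
            unfolding covered_def
          proof (intro ballI impI)
            fix e assume e: "e \<in> S - insert j D" "3 \<le> card (isolated (buckets \<omega>) (S - insert j D) e)"
            show "\<exists>a\<ge>Suc h. a < t' \<and> imem s' 22 (int a) = int e"
            proof (cases "3 \<le> card (isolated (buckets \<omega>) (S - D) e)")
              case True
              have "e \<in> S - D" using e(1) by auto
              then obtain a where a: "h \<le> a" "a < t" "imem st 22 (int a) = int e" using True cov unfolding covered_def by blast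
              have "a \<noteq> h" using a(3) j(2) e(1) by auto
              then show ?thesis using a b(3,5) q4 by (intro exI[of _ a]) auto
            next
              case False
              have "\<not> isolated (buckets \<omega>) (S - insert j D) e \<subseteq> isolated (buckets \<omega>) (S - D) e"
              proof
                assume "isolated (buckets \<omega>) (S - insert j D) e \<subseteq> isolated (buckets \<omega>) (S - D) e"
                moreover have "finite (isolated (buckets \<omega>) (S - D) e)" by (rule finite_subset[of _ "{..<5}"]) (auto simp: isolated_def)
                ultimately have "card (isolated (buckets \<omega>) (S - insert j D) e) \<le> card (isolated (buckets \<omega>) (S - D) e)" by (intro card_mono)
                then show False using e(2) False by linarith
              qed
              then obtain r where r: "r \<in> isolated (buckets \<omega>) (S - insert j D) e" "r \<notin> isolated (buckets \<omega>) (S - D) e" by blast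
              have "buckets \<omega> r j = buckets \<omega> r e"
                by (rule isolated_remove[of j "S - D" e r "buckets \<omega>"]) (use jD e(1) r U in auto)
              then obtain a where "t \<le> a" "a < t'" "imem s' 22 (int a) = int e" using nw e(1) r(1) by blast
              then show ?thesis using ht by (intro exI[of _ a]) auto
            qed
          qed
          then have "state_inv (insert j D) es' (Suc h) t' s'" using b(1,3) h' ht by (simp add: state_inv_def)
          moreover have "potential s' < potential st"
          proof -
            have "card (insert j D) = Suc (card D)" using jD finD by simp
            moreover have "card (insert j D) \<le> k" using card_mono[OF finS, of "insert j D"] D jD cS by simp
            moreover have "potential s' = (t' - Suc h) + 6 * (k - card (insert j D))" using b(3) ht by (intro potential_eq[OF b(1) h']) simp
            ultimately show ?thesis using pot b(4) ht by simp
          qed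
          ultimately show "?Q s'" by blast
        qed
        then show ?case by simp
      qed simp
    qed simp_all
    show ?case
    proof (rule runs_Seq[where ?T1.0 = 1 and ?T2.0 = 76], rule runs_IStore, goal_cases)
      case 4
      have e: "?s2\<lparr>imem := (imem ?s2)(28 := (imem ?s2 28)(ival I ?s2 (IConst 0) := ival I ?s2 (IConst 0)))\<rparr> = ?s3" by simp
      show ?case unfolding e by (rule runs_Seq[OF sc]) simp
    qed (use W5 in auto)
  qed simp
  show ?thesis unfolding peel_body_def
  proof (rule runs_Seq[where ?T1.0 = 1 and ?T2.0 = 79], rule runs_IStore, goal_cases)
    case 4
    have e: "st\<lparr>imem := (imem st)(27 := (imem st 27)(ival I st (IConst 0) := ival I st (ILoad 22 (Var 23))))\<rparr> = ?s1" using h j by simp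
    show ?case unfolding e
    proof (rule runs_Seq[where ?T1.0 = 1 and ?T2.0 = 78], rule runs_IStore, goal_cases)
      case 4
      have e2: "?s1\<lparr>imem := (imem ?s1)(23 := (imem ?s1 23)(ival I ?s1 (IConst 0) := ival I ?s1 (IAdd (Var 23) (IConst 1))))\<rparr> = ?s2" using h by simp
      show ?case unfolding e2 by (rule main)
    qed (use h hW W5 in auto)
  qed (use h j hW W5 in auto)
qed

lemma runs_peel_loop:
  assumes m: "mem_ok (S \<times> {..<5}) {} (\<lambda>_. 0) st" and q: "\<forall>a<k. imem st 22 (int a) = int (qf a)" "qf ` {..<k} = S"
    and z: "imem st 23 = (\<lambda>_. 0)" "imem st 25 = (\<lambda>_. 0)" "outp st = (\<lambda>_. 0)" and tl: "imem st 24 0 = int k"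
  shows "runs I W (While (ILess (Var 23) (Var 24)) peel_body) st (567 * k + 1) (\<lambda>s'. \<exists>D es. peel n x \<omega> S D es \<and>
     (\<forall>e\<in>S - D. card (isolated (buckets \<omega>) (S - D) e) < 3) \<and> outp s' = (\<lambda>j. if 0 \<le> j \<and> nat j \<in> D then es (nat j) else 0))"
proof (rule runs_While[where Inv = "\<lambda>s'. \<exists>D es h t. state_inv D es h t s'" and \<mu> = potential and T = 80])
  have c: "core {} (\<lambda>_. 0) k st"
    unfolding core_def using m q z tl by (auto intro: peel_start)
  have "covered {} 0 k st" unfolding covered_def
  proof (intro ballI impI)
    fix e assume "e \<in> S - {}"
    then obtain a where "a < k" "e = qf a" using q(2) by auto
    then show "\<exists>a\<ge>0. a < k \<and> imem st 22 (int a) = int e" using q(1) by auto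
  qed
  then have "state_inv {} (\<lambda>_. 0) 0 k st" using c z by (simp add: state_inv_def)
  then show "\<exists>D es h t. state_inv D es h t st" by blast
  have "potential st = k - 0 + 6 * (k - card ({}::nat set))" by (rule potential_eq[OF c]) (use z in auto)
  then show "potential st * (80 + 1) + 1 \<le> 567 * k + 1" by simp
next
  fix s1 assume "\<exists>D es h t. state_inv D es h t s1" and b: "bval I s1 (ILess (Var 23) (Var 24))"
  then obtain D es h t where inv: "state_inv D es h t s1" by blast
  have "h < t" using b inv by (simp add: state_inv_def core_def)
  then show "runs I W peel_body s1 80 (\<lambda>s'. (\<exists>D es h t. state_inv D es h t s') \<and> potential s' < potential s1)"
    by (rule runs_peel_body[OF inv])
next
  fix s1 assume "\<exists>D es h t. state_inv D es h t s1" and b: "\<not> bval I s1 (ILess (Var 23) (Var 24))"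
  then obtain D es h t where inv: "state_inv D es h t s1" by blast
  have ht: "h = t" using b inv by (simp add: state_inv_def core_def)
  have "card (isolated (buckets \<omega>) (S - D) e) < 3" if "e \<in> S - D" for e
  proof (rule ccontr)
    assume "\<not> card (isolated (buckets \<omega>) (S - D) e) < 3"
    then have "\<exists>a. h \<le> a \<and> a < t \<and> imem s1 22 (int a) = int e" using inv that unfolding state_inv_def covered_def by (meson not_less)
    then show False using ht by auto
  qed
  then show "\<exists>D es. peel n x \<omega> S D es \<and> (\<forall>e\<in>S - D. card (isolated (buckets \<omega>) (S - D) e) < 3) \<and>
      outp s1 = (\<lambda>j. if 0 \<le> j \<and> nat j \<in> D then es (nat j) else 0)"
    using inv unfolding state_inv_def core_def by blast
qed

end

context peel_input begin

lemma runs_phase3: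
  assumes fr: "fresh st" and \<sigma>: "\<forall>p<K. imem st 11 (int p) = int (\<sigma> p)" "inj_on \<sigma> {..<K}" "\<sigma> ` {..<K} \<subseteq> {..<N}"
  defines "S \<equiv> (\<Union>i\<in>\<sigma> ` {..<K}. block b i)"
  shows "runs I W phase3 st (598 * k + 4) (\<lambda>s'. \<exists>D es. peel n x \<omega> S D es \<and>
     (\<forall>e\<in>S - D. card (isolated (buckets \<omega>) (S - D) e) < 3) \<and> outp s' = (\<lambda>j. if 0 \<le> j \<and> nat j \<in> D then es (nat j) else 0))"
proof -
  note ld = runs_load_all[OF fr \<sigma>, folded S_def]
  interpret peel_run I W n k b N K s L H M pidx sg Y \<omega> x S by unfold_locales (use ld in auto)
  have kW: "int k \<le> W" using W_bounds by linarith
  show ?thesis unfolding phase3_def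
  proof (rule runs_Seq[OF runs_mono[OF ld(3) order_refl]])
    fix s1
    assume "mem_ok (S \<times> {..<5}) {} (\<lambda>_. 0) s1 \<and> (\<exists>qf. (\<forall>a<k. imem s1 22 (int a) = int (qf a)) \<and> qf ` {..<k} = S) \<and>
       imem s1 23 = (\<lambda>_. 0) \<and> imem s1 25 = (\<lambda>_. 0) \<and> outp s1 = (\<lambda>_. 0)"
    then obtain qf where a: "mem_ok (S \<times> {..<5}) {} (\<lambda>_. 0) s1" "\<forall>a<k. imem s1 22 (int a) = int (qf a)" "qf ` {..<k} = S"
       "imem s1 23 = (\<lambda>_. 0)" "imem s1 25 = (\<lambda>_. 0)" "outp s1 = (\<lambda>_. 0)" by blast
    let ?s2 = "setv 24 (int k) s1"
    have lp: "runs I W (While (ILess (Var 23) (Var 24)) peel_body) ?s2 (567 * k + 1) (\<lambda>s'. \<exists>D es. peel n x \<omega> S D es \<and>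
       (\<forall>e\<in>S - D. card (isolated (buckets \<omega>) (S - D) e) < 3) \<and> outp s' = (\<lambda>j. if 0 \<le> j \<and> nat j \<in> D then es (nat j) else 0))"
      by (rule runs_peel_loop[where qf = qf]) (use a in \<open>auto simp: mem_ok_def\<close>)
    have e: "s1\<lparr>imem := (imem s1)(24 := (imem s1 24)(ival I s1 (IConst 0) := ival I s1 ParK))\<rparr> = ?s2" by (simp add: inp)
    show "runs I W (Seq (IStore 24 (IConst 0) ParK) (While (ILess (Var 23) (Var 24)) peel_body)) s1 (567 * k + 2) (\<lambda>s'. \<exists>D es. peel n x \<omega> S D es \<and>
       (\<forall>e\<in>S - D. card (isolated (buckets \<omega>) (S - D) e) < 3) \<and> outp s' = (\<lambda>j. if 0 \<le> j \<and> nat j \<in> D then es (nat j) else 0))"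
    proof (rule runs_Seq[where ?T1.0 = 1 and ?T2.0 = "567 * k + 1"], rule runs_IStore, goal_cases)
      case 4
      show ?case unfolding e by (rule lp)
    qed (use kW W5 in \<open>auto simp: inp\<close>)
  qed simp
qed

end

section \<open>The measurement matrix\<close>

lemma grank_cong:
  assumes "\<And>e'. e' div g = e div g \<Longrightarrow> Z e' = Z' e'"
  shows "grank Z g e = grank Z' g e"
  unfolding grank_def using assms by (intro arg_cong[where f = card] Collect_cong) auto

lemma thin_cong:
  assumes g: "0 < g" "4 dvd g" and Z: "\<And>e. e div g = q div (g div 4) \<Longrightarrow> Z e = Z' e"
  shows "thin Z g q = thin Z' g q"
proof -
  obtain e where e: "e div g = q div (g div 4)" "grank Z g e = 4 * (q mod (g div 4))" "thin Z g q = Z e"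
    by (rule thin_ex[OF g])
  have "grank Z' g e = 4 * (q mod (g div 4))"
    using grank_cong[of g e Z Z'] Z e(1,2) by simp
  then have "thin Z' g q = Z' e" by (rule thin_eq[OF g(1) e(1)])
  then show ?thesis using e Z by simp
qed

text \<open>The sums computed from the measurements agree with the ideal estimates only for the
  first \<open>L\<close> repetitions; the median looks at no others.\<close>

lemma approx_median_cong:
  assumes "0 < g" "8 dvd g" "\<And>e. e < 8 ^ h * g \<Longrightarrow> Z e = Z' e"
  shows "approx_median h g Z = approx_median h g Z'"
  using assms
proof (induction h arbitrary: g Z Z')
  case 0
  obtain c where c: "g = 8 * c" using 0(2) by (elim dvdE)
  have c0: "0 < c" using 0(1) c by simp
  show ?case unfolding approx_median.simps
  proof (rule thin_cong)
    fix e assume "e div g = g div 8 div (g div 4)"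
    then have "e div g = 0" using c c0 by simp
    then show "Z e = Z' e" using 0(1,3) by (simp add: div_eq_0_iff)
  qed (use c c0 in auto)
next
  case (Suc h)
  obtain c where c: "g = 8 * c" using Suc.prems(2) by (elim dvdE)
  have c0: "0 < c" using Suc.prems(1) c by simp
  show ?case unfolding approx_median.simps
  proof (rule Suc.IH)
    fix q assume q: "q < 8 ^ h * (2 * g)"
    show "thin Z g q = thin Z' g q"
    proof (rule thin_cong)
      fix e assume e: "e div g = q div (g div 4)"
      have "q < 8 ^ Suc h * (2 * c)" using q c by simp
      then have "e div g < 8 ^ Suc h" unfolding e using c c0 by (simp add: div_less_iff_less_mult)
      then have "e < 8 ^ Suc h * g" using Suc.prems(1) by (simp add: div_less_iff_less_mult)
      then show "Z e = Z' e" by (rule Suc.prems(3))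
    qed (use c c0 in auto)
  qed (use c c0 in auto)
qed

text \<open>This is what makes -1 a valid sentinel in the tournament.\<close>

lemma approx_median_nonneg:
  assumes "\<And>e. 0 \<le> Z e" shows "0 \<le> approx_median h 64 Z"
proof -
  have none: "{e. e < 64 * 8 ^ h \<and> Z e < 0} = {}" using assms by (auto simp: not_less)
  have "\<not> approx_median h 64 Z < 0"
    by (rule approx_median[where P = "\<lambda>z. z < 0"], force simp: one_sided_def) (simp add: none)
  then show ?thesis by simp
qed

lemma double_add_bool_inject: "2 * p + of_bool c = 2 * p' + of_bool c' \<longleftrightarrow> p = p' \<and> c = c'" for p p' :: nat
  by (cases c; cases c'; simp; presburger)

lemma exec_word_mono: "exec I W P s t s' \<Longrightarrow> W \<le> W' \<Longrightarrow> exec I W' P s t s'"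
proof (induction rule: exec.induct)
  case (Skip s)
  show ?case by (rule exec.Skip)
next
  case (IStore j s e v f a)
  then show ?case by (intro exec.IStore) auto
next
  case (RStore j s e v f a)
  then show ?case by (intro exec.RStore) auto
next
  case (Output j s e v f)
  then show ?case by (intro exec.Output) auto
next
  case (Seq P s t s' Q u s'')
  then show ?case by (intro exec.Seq) auto
next
  case (CondTrue s p P t s' Q)
  then show ?case by (intro exec.CondTrue) auto
next
  case (CondFalse s p Q t s' P)
  then show ?case by (intro exec.CondFalse) auto
next
  case (WhileFalse s p P)
  then show ?case by (intro exec.WhileFalse) auto
next
  case (WhileTrue s p P t s' u s'')
  then show ?case by (intro exec.WhileTrue) auto
qed

section \<open>Layout of the binary matrix\<close>

locale sketch_params =
  fixes n k b N K s L H B1 B :: nat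
  assumes dims: "n = N * b" "k = K * b" "0 < b" "0 < K" "K < N"
    and L: "L = 64 * 8 ^ H" and s0: "0 < s" and B1: "0 < B1" and B: "0 < B"
begin

definition M :: nat where "M = L * s * B1 + 5 * B"
definition Dg :: nat where "Dg = L * s + 5"
text \<open>All ones lie in the first \<open>2 * M\<close> rows. The remaining zero rows adjust the
  residue modulo the column degree \<open>Dg\<close> to \<open>s\<close>, which is smaller than
  \<open>Dg\<close>.\<close>

definition rows :: nat where "rows = (2 * M div Dg + 1) * Dg + s"

text \<open>The sketch rows come first, row \<open>q = l * s + t\<close> owning \<open>B1\<close>
  consecutive pairs, followed by the five query rows with \<open>B\<close> pairs each.\<close>

definition pidx :: "(nat \<Rightarrow> (nat \<Rightarrow> nat) \<times> (nat \<Rightarrow> nat \<Rightarrow> bool)) \<Rightarrow> (nat \<Rightarrow> nat \<Rightarrow> nat \<times> bool) \<Rightarrow> nat \<Rightarrow> nat \<Rightarrow> nat" where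
  "pidx \<omega>1 \<omega> q j = (if q < L * s then q * B1 + fst (\<omega>1 (q div s)) (j div b)
     else L * s * B1 + (q - L * s) * B + buckets \<omega> (q - L * s) j)"

definition sg :: "(nat \<Rightarrow> (nat \<Rightarrow> nat) \<times> (nat \<Rightarrow> nat \<Rightarrow> bool)) \<Rightarrow> (nat \<Rightarrow> nat \<Rightarrow> nat \<times> bool) \<Rightarrow> nat \<Rightarrow> nat \<Rightarrow> bool" where
  "sg \<omega>1 \<omega> q j = (if q < L * s then snd (\<omega>1 (q div s)) j (q mod s) else snd (\<omega> j (q - L * s)))"

definition line where "line \<omega>1 \<omega> q j = 2 * pidx \<omega>1 \<omega> q j + of_bool (sg \<omega>1 \<omega> q j)"

definition mat_of where
  "mat_of \<omega>1 \<omega> = mat rows n (\<lambda>(i, j). if \<exists>q<Dg. i = line \<omega>1 \<omega> q j then 1 else 0 :: real)"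

definition in_range where
  "in_range \<omega>1 \<omega> \<longleftrightarrow> (\<forall>l<L. \<forall>i<N. fst (\<omega>1 l) i < B1) \<and> (\<forall>j<n. \<forall>r<5. buckets \<omega> r j < B)"

text \<open>The start of the range of pairs owned by row \<open>q\<close>; the ranges are disjoint
  and increasing.\<close>

definition offset :: "nat \<Rightarrow> nat" where
  "offset q = (if q \<le> L * s then q * B1 else L * s * B1 + (q - L * s) * B)"

lemma offset_mono: "q \<le> q' \<Longrightarrow> offset q \<le> offset q'"
proof (rule lift_Suc_mono_le[of offset])
  fix q show "offset q \<le> offset (Suc q)"
    by (cases "Suc q \<le> L * s"; cases "q = L * s") (auto simp: offset_def Suc_diff_le)
qed

lemma carrier_mat_of: "mat_of \<omega>1 \<omega> \<in> carrier_mat rows n"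
  by (simp add: mat_of_def)

lemma binary_mat_of: "binary_mat (mat_of \<omega>1 \<omega>)"
  unfolding binary_mat_def elements_mat_def mat_of_def by auto

lemma Dg_pos: "0 < Dg" by (simp add: Dg_def)

lemma rows_ge: "2 * M \<le> rows"
  unfolding rows_def using dividend_less_div_times[OF Dg_pos, of "2 * M"] by simp

lemma rows_mod: "rows mod (L * s + 5) = s"
proof -
  have "1 * s \<le> L * s" unfolding L by (intro mult_le_mono1) simp
  then have "s < Dg" unfolding Dg_def by linarith
  then have "rows mod Dg = s" unfolding rows_def mod_mult_self3 by simp
  then show ?thesis by (simp only: Dg_def)
qed

context
  fixes \<omega>1 :: "nat \<Rightarrow> (nat \<Rightarrow> nat) \<times> (nat \<Rightarrow> nat \<Rightarrow> bool)" and \<omega> :: "nat \<Rightarrow> nat \<Rightarrow> nat \<times> bool"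
  assumes rng: "in_range \<omega>1 \<omega>"
begin

lemma pidx_bounds:
  assumes "q < Dg" "j < n"
  shows "offset q \<le> pidx \<omega>1 \<omega> q j" "pidx \<omega>1 \<omega> q j < offset (Suc q)"
proof -
  have "j div b < N" using assms(2) dims by (simp add: div_less_iff_less_mult)
  moreover have "q div s < L" if "q < L * s" using that s0 by (simp add: div_less_iff_less_mult)
  ultimately have 1: "fst (\<omega>1 (q div s)) (j div b) < B1" if "q < L * s" using that rng by (simp add: in_range_def)
  have 2: "buckets \<omega> (q - L * s) j < B" if "\<not> q < L * s" using that rng assms by (simp add: in_range_def Dg_def)
  show "offset q \<le> pidx \<omega>1 \<omega> q j" unfolding offset_def pidx_def by auto
  show "pidx \<omega>1 \<omega> q j < offset (Suc q)"
  proof (cases "q < L * s")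
    case True
    then show ?thesis using 1 by (simp add: offset_def pidx_def)
  next
    case False
    then show ?thesis using 2 by (simp add: offset_def pidx_def Suc_diff_le)
  qed
qed

lemma pidx_less: "q < q' \<Longrightarrow> q' < Dg \<Longrightarrow> j < n \<Longrightarrow> j' < n \<Longrightarrow> pidx \<omega>1 \<omega> q j < pidx \<omega>1 \<omega> q' j'"
  using pidx_bounds(2)[of q j] pidx_bounds(1)[of q' j'] offset_mono[of "Suc q" q'] by simp

lemma pidx_row: "q < Dg \<Longrightarrow> q' < Dg \<Longrightarrow> j < n \<Longrightarrow> j' < n \<Longrightarrow> pidx \<omega>1 \<omega> q j = pidx \<omega>1 \<omega> q' j' \<Longrightarrow> q = q'"
  using pidx_less[of q q' j j'] pidx_less[of q' q j' j] by (cases q q' rule: linorder_cases) auto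

lemma pidx_M: "q < Dg \<Longrightarrow> j < n \<Longrightarrow> pidx \<omega>1 \<omega> q j < M"
proof -
  assume a: "q < Dg" "j < n"
  have "offset (Suc q) \<le> offset Dg" by (rule offset_mono) (use a in simp)
  moreover have "offset Dg = M" by (simp add: offset_def Dg_def M_def)
  ultimately show ?thesis using pidx_bounds(2)[OF a] by simp
qed

lemma line_less: "q < Dg \<Longrightarrow> j < n \<Longrightarrow> line \<omega>1 \<omega> q j < rows"
  using pidx_M[of q j] rows_ge by (simp add: line_def)

text \<open>Because the ranges of pairs increase with \<open>q\<close>, the sorted list of ones is
  already in the order of the hash rows. The sparse column format thus serves as a table of hash
  values: the \<open>q\<close>-th one encodes bucket and sign of row \<open>q\<close>.\<close>

lemma col_ones_mat_of:
  assumes j: "j < n"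
  shows "col_ones (mat_of \<omega>1 \<omega>) j = map (\<lambda>q. line \<omega>1 \<omega> q j) [0..<Dg]"
proof -
  let ?l = "map (\<lambda>q. line \<omega>1 \<omega> q j) [0..<Dg]"
  have st: "sorted_wrt (<) ?l"
    unfolding sorted_wrt_iff_nth_less
  proof (intro allI impI)
    fix q q' assume q: "q < q'" "q' < length ?l"
    then have "pidx \<omega>1 \<omega> q j < pidx \<omega>1 \<omega> q' j" using pidx_less[of q q' j j] j by simp
    then show "?l ! q < ?l ! q'" using q by (simp add: line_def)
  qed
  have "{i. i < rows \<and> mat_of \<omega>1 \<omega> $$ (i, j) = 1} = set ?l"
    using j line_less[OF _ j] by (auto simp: mat_of_def split: if_splits)
  moreover have "sorted_list_of_set (set ?l) = ?l"
    by (rule sorted_list_of_set.idem_if_sorted_distinct) (use st in \<open>auto simp only: strict_sorted_iff\<close>)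
  ultimately show ?thesis using j by (simp only: col_ones_def) (simp add: mat_of_def)
qed

definition pair_value :: "real vec \<Rightarrow> nat \<Rightarrow> real" where
  "pair_value x p = (mat_of \<omega>1 \<omega> *\<^sub>v x) $ (2 * p) - (mat_of \<omega>1 \<omega> *\<^sub>v x) $ (2 * p + 1)"

text \<open>Every pair belongs to a single hash row, so a column meets it at most once, in the first
  row of the pair for a plus and in the second for a minus. Subtraction restores the sign.\<close>

lemma pair_value_eq:
  assumes x: "x \<in> carrier_vec n" and q: "q < Dg" and j0: "j0 < n"
  shows "pair_value x (pidx \<omega>1 \<omega> q j0) = (\<Sum>j | j < n \<and> pidx \<omega>1 \<omega> q j = pidx \<omega>1 \<omega> q j0. sgn_bit (sg \<omega>1 \<omega> q j) * x $ j)"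
proof -
  let ?p = "pidx \<omega>1 \<omega> q j0" and ?A = "mat_of \<omega>1 \<omega>"
  have p: "2 * ?p + 1 < rows" using pidx_M[OF q j0] rows_ge by linarith
  have entry: "(\<exists>q'<Dg. 2 * ?p + of_bool c = line \<omega>1 \<omega> q' j) \<longleftrightarrow> pidx \<omega>1 \<omega> q j = ?p \<and> sg \<omega>1 \<omega> q j = c" if "j < n" for j c
  proof
    assume "\<exists>q'<Dg. 2 * ?p + of_bool c = line \<omega>1 \<omega> q' j"
    then obtain q' where q': "q' < Dg" "?p = pidx \<omega>1 \<omega> q' j" "c = sg \<omega>1 \<omega> q' j"
      unfolding line_def double_add_bool_inject by auto
    then have "q = q'" using pidx_row[OF q q'(1) j0 that] by simp
    then show "pidx \<omega>1 \<omega> q j = ?p \<and> sg \<omega>1 \<omega> q j = c" using q' by simp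
  next
    assume "pidx \<omega>1 \<omega> q j = ?p \<and> sg \<omega>1 \<omega> q j = c"
    then show "\<exists>q'<Dg. 2 * ?p + of_bool c = line \<omega>1 \<omega> q' j" using q by (intro exI[of _ q]) (simp add: line_def)
  qed
  have val: "(?A *\<^sub>v x) $ i = (\<Sum>j<n. ?A $$ (i, j) * x $ j)" if "i < rows" for i
    using that x carrier_mat_of[of \<omega>1 \<omega>] by (simp add: scalar_prod_def lessThan_atLeast0)
  have e0: "?A $$ (2 * ?p, j) = of_bool (pidx \<omega>1 \<omega> q j = ?p \<and> \<not> sg \<omega>1 \<omega> q j)" if "j < n" for j
    using entry[OF that, of False] that p by (simp add: mat_of_def)
  have e1: "?A $$ (2 * ?p + 1, j) = of_bool (pidx \<omega>1 \<omega> q j = ?p \<and> sg \<omega>1 \<omega> q j)" if "j < n" for j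
    using entry[OF that, of True] that p by (simp add: mat_of_def)
  have "pair_value x ?p = (\<Sum>j<n. (?A $$ (2 * ?p, j) - ?A $$ (2 * ?p + 1, j)) * x $ j)"
    unfolding pair_value_def using val[of "2 * ?p"] val[of "2 * ?p + 1"] p
    by (simp only: sum_subtractf[symmetric] left_diff_distrib)
  also have "\<dots> = (\<Sum>j<n. if pidx \<omega>1 \<omega> q j = ?p then sgn_bit (sg \<omega>1 \<omega> q j) * x $ j else 0)"
    by (intro sum.cong refl, subst e0, simp, subst e1) (auto simp: sgn_bit_def)
  also have "\<dots> = (\<Sum>j | j < n \<and> pidx \<omega>1 \<omega> q j = ?p. sgn_bit (sg \<omega>1 \<omega> q j) * x $ j)"
    by (subst sum.If_cases) (auto simp: Int_def intro!: sum.cong)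
  finally show ?thesis .
qed

lemma sketch_row_pair_value:
  assumes x: "x \<in> carrier_vec n" and i: "i < N" "l < L" "t < s"
  shows "pair_value x (pidx \<omega>1 \<omega> (l * s + t) (i * b)) = sketch_row (\<lambda>j. x $ j) b n (\<omega>1 l) i t"
proof -
  have "l * s + t < (l + 1) * s" using i by simp
  also have "\<dots> \<le> L * s" using i by (intro mult_le_mono1) simp
  finally have q: "l * s + t < L * s" .
  have j: "i * b < n" using i dims by simp
  have ds: "(l * s + t) div s = l" "(l * s + t) mod s = t" using i s0 by simp_all
  have c: "pidx \<omega>1 \<omega> (l * s + t) j = pidx \<omega>1 \<omega> (l * s + t) (i * b) \<longleftrightarrow> fst (\<omega>1 l) (j div b) = fst (\<omega>1 l) i" for j
    using q dims(3) by (simp add: pidx_def ds)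
  have sgl: "sg \<omega>1 \<omega> (l * s + t) j = snd (\<omega>1 l) j t" for j using q by (simp only: sg_def ds if_True)
  have "l * s + t < Dg" using q by (simp add: Dg_def)
  from pair_value_eq[OF x this j] show ?thesis
    unfolding c sgl sketch_row_def by (simp only: mult.commute)
qed

lemma runs_recovery:
  fixes I :: input and W :: int and x :: "real vec"
  assumes I: "in_n I = n" "in_k I = k" "in_b I = b" "in_mat I = mat_of \<omega>1 \<omega>" "in_meas I = mat_of \<omega>1 \<omega> *\<^sub>v x"
    and x: "x \<in> carrier_vec n" and W: "16 * int (M + n * k + n + k + L + s) \<le> W"
  shows "runs I W (Seq phase1 (Seq phase2 phase3)) init_state
     ((N * (L * (s * 3 + 5) + 768 * L + 7) + 2) + ((8 * N + 5 + (K * (4 * height N + 7) + 2)) + (598 * k + 4)))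
     (\<lambda>s'. \<exists>A D es. topset (\<lambda>i. approx_median H 64 (\<lambda>l. sketch_est (\<lambda>j. x $ j) b n s (\<omega>1 l) i)) N K A \<and>
        peel n (\<lambda>j. x $ j) \<omega> (\<Union>i\<in>A. block b i) D es \<and>
        (\<forall>e\<in>(\<Union>i\<in>A. block b i) - D. card (isolated (buckets \<omega>) ((\<Union>i\<in>A. block b i) - D) e) < 3) \<and>
        outp s' = (\<lambda>j. if 0 \<le> j \<and> nat j \<in> D then es (nat j) else 0))"
proof -
  let ?Y = "pair_value x" and ?E = "\<lambda>i. approx_median H 64 (\<lambda>l. sketch_est (\<lambda>j. x $ j) b n s (\<omega>1 l) i)"
  have dr: "dim_vec (in_meas I) = rows" unfolding I using carrier_mat_of[of \<omega>1 \<omega>] by simp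
  interpret recovery_input I W n k b N K s L H M "pidx \<omega>1 \<omega>" "sg \<omega>1 \<omega>" ?Y
  proof unfold_locales
    show "length (col_ones (in_mat I) j) = L * s + 5" if "j < n" for j
      unfolding I col_ones_mat_of[OF that] by (simp add: Dg_def)
    show "dim_vec (in_meas I) mod (L * s + 5) = s" unfolding dr by (rule rows_mod)
    show "col_ones (in_mat I) j ! q = 2 * pidx \<omega>1 \<omega> q j + of_bool (sg \<omega>1 \<omega> q j)" if "j < n" "q < L * s + 5" for j q
      unfolding I col_ones_mat_of[OF that(1)] using that(2) by (simp add: Dg_def line_def)
    show "pidx \<omega>1 \<omega> q j < M" if "j < n" "q < L * s + 5" for j q
      using pidx_M that by (simp add: Dg_def)
    show "2 * p + 1 < dim_vec (in_meas I) \<and> in_meas I $ (2 * p) - in_meas I $ (2 * p + 1) = pair_value x p" if "p < M" for p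
    proof
      show "2 * p + 1 < dim_vec (in_meas I)" unfolding dr using that rows_ge by linarith
      show "in_meas I $ (2 * p) - in_meas I $ (2 * p + 1) = pair_value x p" unfolding pair_value_def I(5) ..
    qed
  qed (use I dims L s0 W in auto)
  have rel: "r < 5 \<Longrightarrow> pidx \<omega>1 \<omega> (L * s + r) j = L * s * B1 + r * B + buckets \<omega> r j" for r j by (simp add: pidx_def)
  interpret peel_input I W n k b N K s L H M "pidx \<omega>1 \<omega>" "sg \<omega>1 \<omega>" ?Y \<omega> "\<lambda>j. x $ j"
  proof unfold_locales
    fix r r' j j' :: nat assume r: "r < 5" "r' < 5" and j: "j < n" "j' < n"
    show "pidx \<omega>1 \<omega> (L * s + r) j = pidx \<omega>1 \<omega> (L * s + r') j' \<longleftrightarrow> r = r' \<and> buckets \<omega> r j = buckets \<omega> r j'"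
    proof
      assume e: "pidx \<omega>1 \<omega> (L * s + r) j = pidx \<omega>1 \<omega> (L * s + r') j'"
      have "L * s + r = L * s + r'" by (rule pidx_row[OF _ _ j e]) (use r in \<open>simp_all add: Dg_def\<close>)
      then have "r = r'" by simp
      then show "r = r' \<and> buckets \<omega> r j = buckets \<omega> r j'" using e rel r by simp
    next
      assume e: "r = r' \<and> buckets \<omega> r j = buckets \<omega> r j'"
      show "pidx \<omega>1 \<omega> (L * s + r) j = pidx \<omega>1 \<omega> (L * s + r') j'"
        unfolding conjunct1[OF e, symmetric] rel[OF r(1)] conjunct2[OF e] ..
    qed
  next
    fix r j :: nat assume "r < 5" "j < n"
    then show "sg \<omega>1 \<omega> (L * s + r) j = snd (\<omega> j r)" by (simp add: sg_def)
  next
    fix r e :: nat assume r: "r < 5" "e < n"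
    then have q: "L * s + r < Dg" by (simp add: Dg_def)
    show "pair_value x (pidx \<omega>1 \<omega> (L * s + r) e) = (\<Sum>j | j < n \<and> buckets \<omega> r j = buckets \<omega> r e. hsign \<omega> r j * x $ j)"
      unfolding pair_value_eq[OF x q r(2)] using rel[OF r(1)] by (simp add: sg_def)
  qed
  have Zv: "Zv i l = sketch_est (\<lambda>j. x $ j) b n s (\<omega>1 l) i" if "i < N" "l < L" for i l
    unfolding Zv_def sketch_est_def using sketch_row_pair_value[OF x that] by (intro sum.cong) auto
  have est: "est i = ?E i" if "i < N" for i
    unfolding est_def by (rule approx_median_cong) (use Zv[OF that] L in \<open>auto simp: mult.commute\<close>)
  have E0: "0 \<le> ?E i" for i
    by (rule approx_median_nonneg) (auto simp: sketch_est_def intro!: sum_nonneg)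
  have fr: "fresh init_state" by (simp add: fresh_def init_state_def)
  show ?thesis
  proof (rule runs_Seq[OF runs_mono[OF runs_phase1[OF fr] order_refl] order_refl])
    fix s1 assume s1: "fresh s1 \<and> (\<forall>i<N. rmem s1 1 (int i) = est i)"
    have f1: "fresh s1" using s1 by simp
    have e1: "\<forall>i<N. rmem s1 1 (int i) = ?E i" using s1 est by simp
    show "runs I W (Seq phase2 phase3) s1 ((8 * N + 5 + (K * (4 * height N + 7) + 2)) + (598 * k + 4))
     (\<lambda>s'. \<exists>A D es. topset ?E N K A \<and> peel n (\<lambda>j. x $ j) \<omega> (\<Union>i\<in>A. block b i) D es \<and>
        (\<forall>e\<in>(\<Union>i\<in>A. block b i) - D. card (isolated (buckets \<omega>) ((\<Union>i\<in>A. block b i) - D) e) < 3) \<and>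
        outp s' = (\<lambda>j. if 0 \<le> j \<and> nat j \<in> D then es (nat j) else 0))"
    proof (rule runs_Seq[OF runs_mono[OF runs_phase2[OF f1 e1 E0] order_refl] order_refl])
      fix s2 assume "fresh s2 \<and> (\<exists>\<sigma>. topset ?E N K (\<sigma> ` {..<K}) \<and> inj_on \<sigma> {..<K} \<and> (\<forall>p<K. imem s2 11 (int p) = int (\<sigma> p)))"
      then obtain \<sigma> where f2: "fresh s2" and top: "topset ?E N K (\<sigma> ` {..<K})" and \<sigma>: "inj_on \<sigma> {..<K}" "\<forall>p<K. imem s2 11 (int p) = int (\<sigma> p)"
        by blast
      have sub: "\<sigma> ` {..<K} \<subseteq> {..<N}" using top by (simp add: topset_def)
      show "runs I W phase3 s2 (598 * k + 4)
       (\<lambda>s'. \<exists>A D es. topset ?E N K A \<and> peel n (\<lambda>j. x $ j) \<omega> (\<Union>i\<in>A. block b i) D es \<and>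
        (\<forall>e\<in>(\<Union>i\<in>A. block b i) - D. card (isolated (buckets \<omega>) ((\<Union>i\<in>A. block b i) - D) e) < 3) \<and>
        outp s' = (\<lambda>j. if 0 \<le> j \<and> nat j \<in> D then es (nat j) else 0))"
        by (rule runs_mono[OF runs_phase3[OF f2 \<sigma>(2,1) sub] order_refl]) (use top in blast)
    qed
  qed
qed

end

section \<open>Probability that a random matrix allows recovery\<close>

lemma card_blocks:
  assumes "A \<subseteq> {..<N}" "card A = K"
  shows "(\<Union>i\<in>A. block b i) \<subseteq> {..<n}" "card (\<Union>i\<in>A. block b i) = k"
proof -
  show "(\<Union>i\<in>A. block b i) \<subseteq> {..<n}"
  proof
    fix j assume "j \<in> (\<Union>i\<in>A. block b i)"
    then have "j div b < N" using assms(1) dims(3) by (auto simp: block_iff)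
    then show "j \<in> {..<n}" using dims by (simp add: div_less_iff_less_mult)
  qed
  have "finite A" using finite_subset[OF assms(1)] by simp
  then have "card (\<Union>i\<in>A. block b i) = (\<Sum>i\<in>A. card (block b i))"
  proof (rule card_UN_disjoint)
    show "\<forall>i\<in>A. finite (block b i)" by (simp add: block_def)
    show "\<forall>i\<in>A. \<forall>j\<in>A. i \<noteq> j \<longrightarrow> block b i \<inter> block b j = {}" by (auto simp: block_iff[OF dims(3)])
  qed
  then show "card (\<Union>i\<in>A. block b i) = k" using assms(2) dims by (simp add: block_def)
qed

abbreviation hash_pmf where
  "hash_pmf \<equiv> pair_pmf (Pi_pmf {..<L} undefined (\<lambda>_. sketch_pmf N n s B1)) (hashes B {..<n})"

lemma in_range_hash_pmf: "(\<omega>1, \<omega>) \<in> set_pmf hash_pmf \<Longrightarrow> in_range \<omega>1 \<omega>"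
proof -
  assume a: "(\<omega>1, \<omega>) \<in> set_pmf hash_pmf"
  then have 1: "\<omega>1 \<in> set_pmf (Pi_pmf {..<L} undefined (\<lambda>_. sketch_pmf N n s B1))" and 2: "\<omega> \<in> set_pmf (hashes B {..<n})" by auto
  have "fst (\<omega>1 l) i < B1" if "l < L" "i < N" for l i
  proof -
    have "\<omega>1 l \<in> set_pmf (sketch_pmf N n s B1)" using 1 that by (auto simp: set_Pi_pmf PiE_dflt_def)
    then have "fst (\<omega>1 l) \<in> set_pmf (block_hashes N B1)" by (auto simp: sketch_pmf_def)
    then have "fst (\<omega>1 l) i \<in> set_pmf (pmf_of_set {..<B1})" using that by (auto simp: set_Pi_pmf PiE_dflt_def)
    then show ?thesis using B1 by (simp add: set_pmf_of_set lessThan_empty_iff)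
  qed
  then show ?thesis using hashes_bucket_less[OF B finite_lessThan 2] by (simp add: in_range_def)
qed

lemma finite_sketches: "finite (set_pmf (Pi_pmf {..<L} undefined (\<lambda>_. sketch_pmf N n s B1)))"
  by (rule finite_set_Pi_pmf) (auto simp: sketch_pmf_def finite_block_hashes[OF B1] finite_sign_hashes)

text \<open>The quantifier over \<open>A\<close> needs only uniqueness of the top set; its existence
  is supplied by the execution.\<close>

definition recovery_good :: "(nat \<Rightarrow> real) \<Rightarrow> real \<Rightarrow> real \<Rightarrow> (nat \<Rightarrow> (nat \<Rightarrow> nat) \<times> (nat \<Rightarrow> nat \<Rightarrow> bool)) \<times> (nat \<Rightarrow> nat \<Rightarrow> nat \<times> bool) \<Rightarrow> bool" where
  "recovery_good x \<epsilon> R z \<longleftrightarrow> (\<forall>A. topset (\<lambda>i. approx_median H 64 (\<lambda>l. sketch_est x b n s (fst z l) i)) N K A \<longrightarrow>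
     (\<Sum>i\<in>{..<N} - A. energy x b i) \<le> (1 + \<epsilon> / 2) * R \<and> set_query_good n x (\<Union>i\<in>A. block b i) (\<epsilon>\<^sup>2 / 4) (snd z))"

text \<open>For fixed sketch hashes \<open>\<omega>1\<close> the selected set is determined, and the
  query hashes are independent of it, so \<open>prob_set_query\<close> applies conditionally.
  Estimates of precision \<open>\<epsilon> / 16\<close> yield the tail factor
  \<open>1 + 8 * \<epsilon> / 16\<close>; this also turns the \<open>2 ^ 10\<close> of
  \<open>prob_sketch\<close> into \<open>2 ^ 18\<close> and \<open>2 ^ 14\<close>.\<close>

lemma prob_recovery:
  assumes \<epsilon>: "0 < \<epsilon>" "\<epsilon> < 1" and Q: "Q \<subseteq> {..<N}" "card Q \<le> K" and R: "R = (\<Sum>i\<in>{..<N} - Q. energy x b i)"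
    and s: "2 ^ 18 \<le> \<epsilon>\<^sup>2 * real s" and B1: "2 ^ 14 * real K \<le> \<epsilon> * real B1" and Bk: "2 ^ 48 * real k \<le> \<epsilon>\<^sup>2 * real B"
    and \<kappa>: "\<kappa> \<ge> 1" "\<kappa> ^ 8 = real k"
  shows "measure_pmf.prob hash_pmf {z. \<not> recovery_good x \<epsilon> R z} \<le> real N / 2 ^ L + 1 / (4 * \<kappa>)"
proof -
  let ?E = "\<lambda>\<omega>1 i. approx_median H 64 (\<lambda>l. sketch_est x b n s (\<omega>1 l) i)"
  let ?p = "Pi_pmf {..<L} undefined (\<lambda>_. sketch_pmf N n s B1)" and ?q = "hashes B {..<n}"
  let ?e = "\<epsilon> / 16"
  let ?bad1 = "\<lambda>\<omega>1. \<exists>i<N. \<not> est_ok ?e s (energy x b i) (?e * R / real K) (?E \<omega>1 i)"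
  let ?bad2 = "\<lambda>\<omega>1 \<omega>. \<exists>A. topset (?E \<omega>1) N K A \<and> \<not> set_query_good n x (\<Union>i\<in>A. block b i) (\<epsilon>\<^sup>2 / 4) \<omega>"
  have e: "0 < ?e" "?e \<le> 1" "?e \<le> 1 / 16" using \<epsilon> by auto
  have fin: "finite (set_pmf ?p)" "finite (set_pmf ?q)" using finite_sketches finite_hashes[OF B, of "{..<n}"] by auto
  have k0: "0 < k" using dims by simp
  have b1: "measure_pmf.prob ?p {\<omega>1. ?bad1 \<omega>1} \<le> real N / 2 ^ L"
  proof -
    have "measure_pmf.prob ?p {\<omega>1. ?bad1 \<omega>1} \<le> (\<Sum>i\<in>{..<N}. measure_pmf.prob ?p {\<omega>1. \<not> est_ok ?e s (energy x b i) (?e * R / real K) (?E \<omega>1 i)})"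
      by (rule prob_union_bound) auto
    also have "\<dots> \<le> (\<Sum>i\<in>{..<N}. 1 / 2 ^ L)"
    proof (rule sum_mono)
      fix i assume i: "i \<in> {..<N}"
      show "measure_pmf.prob ?p {\<omega>1. \<not> est_ok ?e s (energy x b i) (?e * R / real K) (?E \<omega>1 i)} \<le> 1 / 2 ^ L"
      proof (rule prob_median[OF _ L], rule prob_sketch[OF dims(3,1) _ dims(4) Q e(1,2) R])
        show "2 ^ 10 \<le> ?e\<^sup>2 * real s" using s by (simp add: power_divide)
        show "2 ^ 10 * real K \<le> ?e * real B1" using B1 by simp
      qed (use i in simp)
    qed
    finally show ?thesis by simp
  qed
  have b2: "measure_pmf.prob ?q {\<omega>. ?bad2 \<omega>1 \<omega>} \<le> 1 / (4 * \<kappa>)" for \<omega>1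
  proof (cases "\<exists>A. topset (?E \<omega>1) N K A")
    case True
    then obtain A where A: "topset (?E \<omega>1) N K A" by blast
    have A': "A \<subseteq> {..<N}" "card A = K" using A by (auto simp: topset_def)
    note cb = card_blocks[OF A']
    have "measure_pmf.prob ?q {\<omega>. ?bad2 \<omega>1 \<omega>} \<le> measure_pmf.prob ?q {\<omega>. \<not> set_query_good n x (\<Union>i\<in>A. block b i) (\<epsilon>\<^sup>2 / 4) \<omega>}"
    proof (rule prob_mono)
      fix \<omega> assume "?bad2 \<omega>1 \<omega>"
      then obtain A2 where A2: "topset (?E \<omega>1) N K A2" "\<not> set_query_good n x (\<Union>i\<in>A2. block b i) (\<epsilon>\<^sup>2 / 4) \<omega>" by blast
      have "A2 = A" by (rule topset_unique[OF A2(1) A])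
      then show "\<not> set_query_good n x (\<Union>i\<in>A. block b i) (\<epsilon>\<^sup>2 / 4) \<omega>" using A2(2) by simp
    qed
    also have "\<dots> \<le> 1 / (4 * \<kappa>)"
      by (rule prob_set_query[OF cb(1) _ \<kappa>(1) _ \<epsilon>]) (use cb(2) k0 \<kappa> Bk in simp_all)
    finally show ?thesis .
  next
    case False
    then have none: "{\<omega>. ?bad2 \<omega>1 \<omega>} = {}" by simp
    show ?thesis unfolding none using \<kappa>(1) by simp
  qed
  have p1: "measure_pmf.prob hash_pmf {z. ?bad1 (fst z)} \<le> real N / 2 ^ L"
  proof -
    have "measure_pmf.prob hash_pmf {z. ?bad1 (fst z)} = measure_pmf.prob (map_pmf fst hash_pmf) {\<omega>1. ?bad1 \<omega>1}"
      by (simp only: measure_map_pmf vimage_def mem_Collect_eq)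
    then show ?thesis using b1 by (simp only: map_fst_pair_pmf)
  qed
  have p2: "measure_pmf.prob hash_pmf {z. ?bad2 (fst z) (snd z)} \<le> 1 / (4 * \<kappa>)"
  proof -
    have "measure_pmf.prob hash_pmf {z. ?bad2 (fst z) (snd z)} = expect ?p (\<lambda>\<omega>1. expect ?q (\<lambda>\<omega>. of_bool (?bad2 \<omega>1 \<omega>)))"
      by (simp only: prob_eq_expect expect_pair[OF fin] fst_conv snd_conv)
    also have "\<dots> \<le> expect ?p (\<lambda>_. 1 / (4 * \<kappa>))"
      by (rule expect_mono[OF fin(1)]) (use b2 in \<open>simp only: prob_eq_expect\<close>)
    finally show ?thesis by simp
  qed
  have "measure_pmf.prob hash_pmf {z. \<not> recovery_good x \<epsilon> R z} \<le>
      measure_pmf.prob hash_pmf {z. ?bad1 (fst z)} + measure_pmf.prob hash_pmf {z. ?bad2 (fst z) (snd z)}"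
  proof (rule prob_disj, rule disjCI)
    fix z assume ng: "\<not> recovery_good x \<epsilon> R z" and "\<not> ?bad2 (fst z) (snd z)"
    then obtain A where A: "topset (?E (fst z)) N K A" "\<not> (\<Sum>i\<in>{..<N} - A. energy x b i) \<le> (1 + \<epsilon> / 2) * R"
      unfolding recovery_good_def by blast
    show "?bad1 (fst z)"
    proof (rule ccontr)
      assume "\<not> ?bad1 (fst z)"
      then have ok: "est_ok ?e s (energy x b i) (?e * R / real K) (?E (fst z) i)" if "i < N" for i using that by blast
      have "(\<Sum>i\<in>{..<N} - A. energy x b i) \<le> (1 + 8 * ?e) * R"
        by (rule topset_energy[where s = "real s", OF A(1) dims(4) _ e(1,3) energy_nonneg Q R]) (use ok s0 in \<open>auto simp: est_ok_def\<close>)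
      then show False using A(2) by simp
    qed
  qed
  then show ?thesis using p1 p2 by linarith
qed

end

section \<open>Parameters and the main theorem\<close>

definition recovery_program :: com where
  "recovery_program = Cond (ILess ParK ParN) (Seq phase1 (Seq phase2 phase3)) (For 0 ParN (Output (Var 0) (Meas (Var 0))))"

lemma l2norm_square: "(l2norm v)\<^sup>2 = (\<Sum>j<dim_vec v. (v $ j)\<^sup>2)"
  unfolding l2norm_def L2_set_def by (simp add: sum_nonneg)

lemma block_err_nonneg: "x \<in> carrier_vec n \<Longrightarrow> 0 \<le> block_err n k b x"
  using block_err_attained[of x n k b] l2norm_nonneg by auto

lemma ln_two_ge_half: "1 / 2 \<le> ln (2 :: real)"
  using exp_half_le2 by (subst ln_ge_iff) auto

lemma le_scaled:
  fixes p q z a C :: real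
  assumes "z \<le> a * p" "a \<le> C" "0 \<le> p" "0 \<le> q" "0 \<le> C" shows "z \<le> C * (p + q)"
proof -
  have "a * p \<le> C * p" by (rule mult_right_mono[OF assms(2,3)])
  moreover have "0 \<le> C * q" by (rule mult_nonneg_nonneg[OF assms(5,4)])
  ultimately show ?thesis using assms(1) unfolding distrib_left by linarith
qed

lemma nat_ceiling_bounds:
  fixes y :: real
  assumes "1 \<le> y" shows "y \<le> real (nat \<lceil>y\<rceil>)" "real (nat \<lceil>y\<rceil>) \<le> 2 * y"
  using assms by linarith+

section \<open>Accuracy, running time and size for given parameters\<close>

context sketch_params begin

abbreviation "run_time \<equiv> N * (L * (s * 3 + 5) + 768 * L + 7) + 2 + (8 * N + 5 + (K * (4 * height N + 7) + 2) + (598 * k + 4)) + 1"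

lemma kn: "k < n" using dims by simp

text \<open>An optimal approximation vanishes outside its blocks \<open>Q\<close>, so the energy of
  \<open>x\<close> there is part of its squared error.\<close>

lemma best_blocks:
  assumes x: "x \<in> carrier_vec n"
  obtains Q where "Q \<subseteq> {..<N}" "card Q \<le> K" "(\<Sum>i\<in>{..<N} - Q. energy (\<lambda>j. x $ j) b i) \<le> (block_err n k b x)\<^sup>2"
proof -
  have nb: "n div b = N" "k div b = K" using dims by simp_all
  obtain z where z: "block_sparse n k b z" "block_err n k b x = l2norm (x - z)" using block_err_attained[OF x] by blast
  obtain Q where Q: "Q \<subseteq> {..<N}" "card Q \<le> K" "{j. j < n \<and> z $ j \<noteq> 0} \<subseteq> (\<Union>i\<in>Q. block b i)"
    using z(1) unfolding block_sparse_def nb by blast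
  have zn: "z \<in> carrier_vec n" using z(1) by (simp add: block_sparse_def)
  have "(\<Sum>i\<in>{..<N} - Q. energy (\<lambda>j. x $ j) b i) = (\<Sum>j | j < n \<and> j div b \<in> {..<N} - Q. (x $ j)\<^sup>2)"
    by (rule sum_by_blocks[symmetric, OF dims(3) _ dims(1)]) simp
  also have "\<dots> = (\<Sum>j | j < n \<and> j div b \<in> {..<N} - Q. ((x - z) $ j)\<^sup>2)"
  proof (rule sum.cong[OF refl])
    fix j assume j: "j \<in> {j. j < n \<and> j div b \<in> {..<N} - Q}"
    then have "j \<notin> (\<Union>i\<in>Q. block b i)" by (auto simp: block_iff[OF dims(3)])
    then have "z $ j = 0" using Q(3) j by blast
    then show "(x $ j)\<^sup>2 = ((x - z) $ j)\<^sup>2" using j zn x by simp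
  qed
  also have "\<dots> \<le> (\<Sum>j<n. ((x - z) $ j)\<^sup>2)" by (rule sum_mono2) auto
  also have "\<dots> = (l2norm (x - z))\<^sup>2" unfolding l2norm_square using x zn by simp
  finally show ?thesis using that Q z(2) by simp
qed

text \<open>Halting and running time hold for every choice of hashes in range; only the accuracy is
  conditional on \<open>recovery_good\<close>. The statement therefore provides one execution for
  both purposes.\<close>

lemma recovers_mat_of:
  fixes W :: real
  assumes rng: "in_range \<omega>1 \<omega>" and x: "x \<in> carrier_vec n" and W: "16 * real (M + n * k + n + k + L + s) \<le> W"
    and \<epsilon>: "0 < \<epsilon>" "\<epsilon> < 1"
  obtains t x' where "recovers recovery_program W n k b \<epsilon> (mat_of \<omega>1 \<omega>) (mat_of \<omega>1 \<omega> *\<^sub>v x) t x'" "t \<le> run_time"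
    "\<And>R. recovery_good (\<lambda>j. x $ j) \<epsilon> R (\<omega>1, \<omega>) \<Longrightarrow> 0 \<le> R \<Longrightarrow> R \<le> (block_err n k b x)\<^sup>2 \<Longrightarrow>
       block_sparse n k b x' \<and> l2norm (x' - x) \<le> (1 + \<epsilon>) * block_err n k b x"
proof -
  let ?A = "mat_of \<omega>1 \<omega>" and ?E = "\<lambda>i. approx_median H 64 (\<lambda>l. sketch_est (\<lambda>j. x $ j) b n s (\<omega>1 l) i)"
  let ?I = "\<lparr>in_n = n, in_k = k, in_b = b, in_eps = \<epsilon>, in_mat = ?A, in_meas = ?A *\<^sub>v x\<rparr>"
  let ?Q = "\<lambda>s'. \<exists>A D es. topset ?E N K A \<and> peel n (\<lambda>j. x $ j) \<omega> (\<Union>i\<in>A. block b i) D es \<and>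
        (\<forall>e\<in>(\<Union>i\<in>A. block b i) - D. card (isolated (buckets \<omega>) ((\<Union>i\<in>A. block b i) - D) e) < 3) \<and>
        outp s' = (\<lambda>j. if 0 \<le> j \<and> nat j \<in> D then es (nat j) else 0)"
  have "real_of_int (16 * int (M + n * k + n + k + L + s)) = 16 * real (M + n * k + n + k + L + s)"
    by (simp only: of_int_mult of_int_numeral of_int_of_nat_eq)
  \<comment> \<open>Executions are built for an integer word bound; rounding down is undone
    afterwards by \<open>exec_word_mono\<close>.\<close>
  then have Wf: "16 * int (M + n * k + n + k + L + s) \<le> \<lfloor>W\<rfloor>" unfolding le_floor_iff using W by (simp only:)
  have "runs ?I \<lfloor>W\<rfloor> recovery_program init_state run_time ?Q"
    unfolding recovery_program_def
  proof (rule runs_Cond, goal_cases)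
    case 2
    show ?case by (rule runs_mono[OF runs_recovery[OF rng _ _ _ _ _ x Wf]]) simp_all
  next
    case 3
    then show ?case using kn by simp
  qed simp
  then obtain t s' where ex: "exec ?I (real_of_int \<lfloor>W\<rfloor>) recovery_program init_state t s'" and t: "t \<le> run_time" and "?Q s'"
    unfolding runs_def by blast
  then obtain A D es where top: "topset ?E N K A" and p: "peel n (\<lambda>j. x $ j) \<omega> (\<Union>i\<in>A. block b i) D es"
        "\<forall>e\<in>(\<Union>i\<in>A. block b i) - D. card (isolated (buckets \<omega>) ((\<Union>i\<in>A. block b i) - D) e) < 3"
      and out: "outp s' = (\<lambda>j. if 0 \<le> j \<and> nat j \<in> D then es (nat j) else 0)" by blast
  let ?x' = "vec n (\<lambda>j. outp s' (int j))" and ?S = "\<Union>i\<in>A. block b i"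
  have ex': "exec ?I W recovery_program init_state t s'" by (rule exec_word_mono[OF ex of_int_floor_le])
  have rec: "recovers recovery_program W n k b \<epsilon> ?A (?A *\<^sub>v x) t ?x'"
    unfolding recovers_def using ex' by blast
  show ?thesis
  proof (rule that[OF rec t])
    fix R assume good: "recovery_good (\<lambda>j. x $ j) \<epsilon> R (\<omega>1, \<omega>)" and R: "0 \<le> R" "R \<le> (block_err n k b x)\<^sup>2"
    let ?T = "\<Sum>j\<in>{..<n} - ?S. (x $ j)\<^sup>2"
    have A: "A \<subseteq> {..<N}" "card A = K" using top by (auto simp: topset_def)
    note S = card_blocks[OF A]
    have g: "(\<Sum>i\<in>{..<N} - A. energy (\<lambda>j. x $ j) b i) \<le> (1 + \<epsilon> / 2) * R" "set_query_good n (\<lambda>j. x $ j) ?S (\<epsilon>\<^sup>2 / 4) \<omega>"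
      using good top unfolding recovery_good_def fst_conv snd_conv by blast+
    have D: "D = ?S" "(\<Sum>e\<in>?S. (es e - x $ e)\<^sup>2) \<le> \<epsilon>\<^sup>2 / 4 * ?T"
      using g(2) p unfolding set_query_good_def by blast+
    have T: "?T \<le> (1 + \<epsilon> / 2) * R"
    proof -
      have "{..<n} - ?S = {j. j < n \<and> j div b \<in> {..<N} - A}"
        using dims by (auto simp: block_iff div_less_iff_less_mult)
      then have "?T = (\<Sum>i\<in>{..<N} - A. energy (\<lambda>j. x $ j) b i)"
        using sum_by_blocks[OF dims(3) _ dims(1), of "{..<N} - A" "\<lambda>j. x $ j"] by simp
      then show ?thesis using g(1) by simp
    qed
    have x'j: "?x' $ j = (if j \<in> ?S then es j else 0)" if "j < n" for j
      using that unfolding out D(1) by simp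
    have nb: "n div b = N" "k div b = K" using dims by simp_all
    have sp: "block_sparse n k b ?x'"
      unfolding block_sparse_def nb
    proof (intro conjI exI[of _ A])
      show "{j. j < n \<and> ?x' $ j \<noteq> 0} \<subseteq> ?S" using x'j by (auto split: if_splits)
    qed (use A in auto)
    have "(l2norm (?x' - x))\<^sup>2 = (\<Sum>j<n. ((?x' - x) $ j)\<^sup>2)" unfolding l2norm_square using x by simp
    also have "\<dots> = (\<Sum>j\<in>?S. ((?x' - x) $ j)\<^sup>2) + (\<Sum>j\<in>{..<n} - ?S. ((?x' - x) $ j)\<^sup>2)"
      using sum.subset_diff[OF S(1), of "\<lambda>j. ((?x' - x) $ j)\<^sup>2"] by simp
    also have "(\<Sum>j\<in>?S. ((?x' - x) $ j)\<^sup>2) = (\<Sum>e\<in>?S. (es e - x $ e)\<^sup>2)"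
    proof (rule sum.cong[OF refl])
      fix j assume j: "j \<in> ?S"
      then have "j < n" using S(1) by auto
      then show "((?x' - x) $ j)\<^sup>2 = (es j - x $ j)\<^sup>2" using x'j[of j] j x by (simp del: index_vec)
    qed
    also have "(\<Sum>j\<in>{..<n} - ?S. ((?x' - x) $ j)\<^sup>2) = ?T"
    proof (rule sum.cong[OF refl])
      fix j assume j: "j \<in> {..<n} - ?S"
      then have "?x' $ j = 0" using x'j[of j] by simp
      then show "((?x' - x) $ j)\<^sup>2 = (x $ j)\<^sup>2" using j x by (simp del: index_vec)
    qed
    \<comment> \<open>The query error is at most \<open>\<epsilon>\<^sup>2 / 4\<close> of the missed
      energy \<open>?T\<close>, which is at most \<open>(1 + \<epsilon> / 2) * R\<close>; both
      factors together stay below \<open>(1 + \<epsilon>)\<^sup>2\<close>.\<close>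
    also have "(\<Sum>e\<in>?S. (es e - x $ e)\<^sup>2) + ?T \<le> (\<epsilon>\<^sup>2 / 4 + 1) * ?T" using D(2) by (simp add: algebra_simps)
    also have "\<dots> \<le> (\<epsilon>\<^sup>2 / 4 + 1) * ((1 + \<epsilon> / 2) * R)" by (rule mult_left_mono[OF T]) simp
    also have "\<dots> = ((\<epsilon>\<^sup>2 / 4 + 1) * (1 + \<epsilon> / 2)) * R" by simp
    also have "\<dots> \<le> (1 + \<epsilon>)\<^sup>2 * (block_err n k b x)\<^sup>2"
    proof (rule mult_mono[OF _ R(2) _ R(1)])
      have "(\<epsilon>\<^sup>2 / 4 + 1) * (1 + \<epsilon> / 2) = 1 + \<epsilon> / 2 + \<epsilon>\<^sup>2 / 4 + \<epsilon> * \<epsilon>\<^sup>2 / 8" by (simp add: algebra_simps)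
      moreover have "(1 + \<epsilon>)\<^sup>2 = 1 + 2 * \<epsilon> + \<epsilon>\<^sup>2" by (simp add: power2_sum)
      moreover have "\<epsilon> * \<epsilon>\<^sup>2 \<le> 1 * \<epsilon>\<^sup>2" using \<epsilon> by (intro mult_right_mono) auto
      moreover have "0 \<le> \<epsilon>\<^sup>2" by simp
      ultimately show "(\<epsilon>\<^sup>2 / 4 + 1) * (1 + \<epsilon> / 2) \<le> (1 + \<epsilon>)\<^sup>2" using \<epsilon> by linarith
    qed simp
    finally have "(l2norm (?x' - x))\<^sup>2 \<le> ((1 + \<epsilon>) * block_err n k b x)\<^sup>2" by (simp add: power_mult_distrib)
    then have "l2norm (?x' - x) \<le> (1 + \<epsilon>) * block_err n k b x"
      by (rule power2_le_imp_le) (use block_err_nonneg[OF x] \<epsilon> in simp)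
    then show "block_sparse n k b ?x' \<and> l2norm (?x' - x) \<le> (1 + \<epsilon>) * block_err n k b x" using sp by simp
  qed
qed

text \<open>Here \<open>u\<close> is the reciprocal of \<epsilon>. The energy sketches need about
  \<open>K * u ^ 3 * ln n\<close> pairs, below the permitted \<open>K * u ^ 5 * ln n\<close>, and
  the query rows about \<open>k * u\<^sup>2\<close>. In the running time the tournament costs
  \<open>K * ln n\<close>, absorbed by the \<open>N * ln n\<close> of the sketches.\<close>

lemma size_bounds:
  fixes u y z :: real
  assumes u: "1 \<le> u" and y: "y = ln (real n)" and Lb: "real L \<le> 128 * y" and sb: "real s \<le> 2 ^ 19 * u ^ 2"
    and B1b: "real B1 \<le> 2 ^ 15 * (real K * u)" and Bb: "real B \<le> 2 ^ 49 * (real k * u ^ 2)"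
  shows "real rows \<le> 2 ^ 60 * (u ^ 2 * real k + real K * u ^ 5 * y)"
    and "z = real n + real k + u \<Longrightarrow> 16 * real (M + n * k + n + k + L + s) \<le> z ^ 40"
    and "real run_time \<le> 2 ^ 37 * (real k + real N * u ^ 2 * y)"
proof -
  have N2: "2 \<le> N" using dims by linarith
  have Nn: "N \<le> n" "K \<le> k" using dims by simp_all
  have n2: "2 \<le> real n" using N2 Nn by linarith
  have "1 \<le> k" "1 \<le> K" using dims by simp_all
  then have k1: "1 \<le> real k" "1 \<le> real K" by linarith+
  have "ln 2 \<le> y" unfolding y using n2 by (subst ln_le_cancel_iff) auto
  then have y2: "ln 2 \<le> y" "1 / 2 \<le> y" using ln_two_ge_half by linarith+
  have u25: "1 \<le> u ^ 2" "u ^ 2 \<le> u ^ 5" "u ^ 3 \<le> u ^ 5" using u by (auto intro: power_increasing one_le_power)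
  have Ls: "real L * real s \<le> 2 ^ 26 * (u ^ 2 * y)"
  proof -
    have "real L * real s \<le> (128 * y) * (2 ^ 19 * u ^ 2)" by (rule mult_mono[OF Lb sb]) (use y2 in auto)
    also have "\<dots> = 2 ^ 26 * (u ^ 2 * y)" by (simp add: algebra_simps)
    finally show ?thesis .
  qed
  have LsB: "real L * real s * real B1 \<le> 2 ^ 41 * (real K * u ^ 3 * y)"
  proof -
    have "real L * real s * real B1 \<le> (2 ^ 26 * (u ^ 2 * y)) * (2 ^ 15 * (real K * u))" by (rule mult_mono[OF Ls B1b]) (use y2 in auto)
    also have "\<dots> = 2 ^ 41 * (real K * u ^ 3 * y)" by (simp add: power2_eq_square power3_eq_cube)
    finally show ?thesis .
  qed
  have M: "real M \<le> 2 ^ 41 * (real K * u ^ 3 * y) + 2 ^ 52 * (real k * u ^ 2)"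
    using LsB Bb unfolding M_def by (simp add: algebra_simps) 
  have X: "u ^ 2 * y \<le> real K * u ^ 5 * y" "real K * u ^ 3 * y \<le> real K * u ^ 5 * y"
  proof -
    have "1 * u ^ 2 \<le> real K * u ^ 5" using k1 u25 by (intro mult_mono) auto
    then show "u ^ 2 * y \<le> real K * u ^ 5 * y" using y2 by (intro mult_right_mono) auto
    show "real K * u ^ 3 * y \<le> real K * u ^ 5 * y" using u25 y2 by (intro mult_right_mono mult_left_mono) auto
  qed
  have Y: "1 \<le> u ^ 2 * real k" using mult_mono[of 1 "u ^ 2" 1 "real k"] u25 k1 by simp
  have "rows \<le> 2 * M + Dg + s" unfolding rows_def using div_times_less_eq_dividend[of "2 * M" Dg] by simp
  also have "\<dots> \<le> 2 * M + 2 * (L * s) + 5"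
  proof -
    have "1 * s \<le> L * s" unfolding L by (intro mult_le_mono1) simp
    then show ?thesis by (simp add: Dg_def)
  qed
  finally have "real rows \<le> real (2 * M + 2 * (L * s) + 5)" by (simp only: of_nat_le_iff)
  also have "\<dots> = 2 * real M + 2 * (real L * real s) + 5" by simp
  finally have r: "real rows \<le> 2 * real M + 2 * (real L * real s) + 5" .
  define XX where "XX = real K * u ^ 5 * y"
  define YY where "YY = u ^ 2 * real k"
  have XX0: "0 \<le> XX" unfolding XX_def using u y2 by simp
  have M': "real M \<le> 2 ^ 41 * XX + 2 ^ 52 * YY" using M X(2) unfolding XX_def YY_def by (simp add: mult.commute)
  have Ls': "real L * real s \<le> 2 ^ 26 * XX" using Ls X(1) unfolding XX_def by simp
  have Y': "1 \<le> YY" using Y unfolding YY_def .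
  have "real rows \<le> 2 ^ 60 * (YY + XX)"
    using r M' Ls' Y' XX0 by simp
  then show "real rows \<le> 2 ^ 60 * (u ^ 2 * real k + real K * u ^ 5 * y)" unfolding XX_def YY_def .
  show "16 * real (M + n * k + n + k + L + s) \<le> z ^ 40" if z: "z = real n + real k + u"
  proof -
    have z4: "4 \<le> z" using z n2 k1 u by linarith
    have le: "real n \<le> z" "real k \<le> z" "u \<le> z" "real K \<le> z" "y \<le> z"
    proof -
      have "y \<le> real n" unfolding y using ln_bound[of "real n"] n2 by simp
      then show "y \<le> z" "real n \<le> z" "real k \<le> z" "u \<le> z" "real K \<le> z" using z k1 u n2 Nn by linarith+
    qed
    have z0: "0 \<le> z" "1 \<le> z" using z4 by linarith+
    have pw: "z ^ 1 \<le> z ^ 5" "z ^ 2 \<le> z ^ 5" "z ^ 3 \<le> z ^ 5" by (rule power_increasing[OF _ z0(2)], simp)+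
    have "real K * u ^ 3 * y \<le> z * z ^ 3 * z" using le k1 u y2 z0 by (intro mult_mono power_mono) auto
    moreover have "z * z ^ 3 * z = z ^ 5" by (simp add: numeral_eq_Suc)
    moreover have "real k * u ^ 2 \<le> z * z ^ 2" using le k1 u z0 by (intro mult_mono power_mono) auto
    moreover have "z * z ^ 2 = z ^ 3" by (simp add: numeral_eq_Suc)
    ultimately have M5: "real M \<le> 2 ^ 41 * z ^ 5 + 2 ^ 52 * z ^ 5" using M pw by simp
    have "real n * real k \<le> z * z" using le z0 by (intro mult_mono) auto
    then have nk: "real n * real k \<le> z ^ 5" using pw(2) by (simp add: power2_eq_square)
    have "u ^ 2 \<le> z ^ 2" using le u by (intro power_mono) auto
    then have s5: "real s \<le> 2 ^ 19 * z ^ 5" using sb pw(2) by simp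
    have L5: "real L \<le> 128 * z ^ 5" using Lb le(5) pw(1) by simp
    have n5: "real n \<le> z ^ 5" "real k \<le> z ^ 5" using le pw(1) by simp_all
    have "16 * real (M + n * k + n + k + L + s) = 16 * (real M + real n * real k + real n + real k + real L + real s)" by simp
    also have "\<dots> \<le> 2 ^ 58 * z ^ 5" using M5 nk s5 L5 n5 z0(1) by simp
    \<comment> \<open>The word bound is a pure power without a leading constant; since
      \<open>z \<ge> 4\<close> the constant is absorbed into 29 further factors of
      \<open>z\<close>.\<close>
    also have "(2 ^ 58 :: real) = 4 ^ 29" by simp
    also have "4 ^ 29 * z ^ 5 \<le> z ^ 29 * z ^ 5" using z4 by (intro mult_right_mono power_mono) auto
    also have "\<dots> = z ^ 34" by (simp flip: power_add)
    also have "\<dots> \<le> z ^ 40" by (rule power_increasing[OF _ z0(2)]) simp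
    finally show ?thesis .
  qed
  have h: "real (height N) \<le> 4 * y"
  proof -
    have "2 ^ height N \<le> 2 * N" using height_le[of N] N2 by simp
    then have "real (2 ^ height N) \<le> real (2 * N)" by (simp only: of_nat_le_iff)
    then have "(2::real) ^ height N \<le> 2 * real N" by simp
    then have "ln ((2::real) ^ height N) \<le> ln (2 * real N)" using N2 by (subst ln_le_cancel_iff) auto
    then have "real (height N) * ln 2 \<le> ln 2 + ln (real N)" using N2 by (simp add: ln_realpow ln_mult)
    moreover have "ln (real N) \<le> y" unfolding y using N2 Nn by (subst ln_le_cancel_iff) auto
    moreover have "real (height N) * (1 / 2) \<le> real (height N) * ln 2" using ln_two_ge_half by (intro mult_left_mono) auto
    ultimately show ?thesis using y2 by linarith
  qed
  define Z where "Z = real N * u ^ 2 * y"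
  have Ny: "real N * y \<le> Z"
  proof -
    have "real N * 1 * y \<le> real N * u ^ 2 * y" using u25 y2 by (intro mult_right_mono mult_left_mono) auto
    then show ?thesis by (simp add: Z_def)
  qed
  have Nr: "real N \<le> 2 * Z"
  proof -
    have "real N * (1 / 2) \<le> real N * y" using y2 by (intro mult_left_mono) auto
    then show ?thesis using Ny by linarith
  qed
  have t1: "real (N * (L * (s * 3 + 5) + 768 * L + 7)) \<le> 2 ^ 36 * Z"
  proof -
    have "L * 1 \<le> L * s" "1 * 1 \<le> L * s" using s0 L by (intro mult_le_mono; simp)+
    moreover have "L * (s * 3 + 5) = 3 * (L * s) + 5 * L" by (simp add: algebra_simps)
    ultimately have "L * (s * 3 + 5) + 768 * L + 7 \<le> 783 * (L * s)" by linarith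
    then have "N * (L * (s * 3 + 5) + 768 * L + 7) \<le> N * (783 * (L * s))" by (rule mult_le_mono2)
    then have "real (N * (L * (s * 3 + 5) + 768 * L + 7)) \<le> real (N * (783 * (L * s)))" by (simp only: of_nat_le_iff)
    also have "\<dots> = 783 * (real N * (real L * real s))" by simp
    also have "\<dots> \<le> 783 * (real N * (2 ^ 26 * (u ^ 2 * y)))" using Ls by (intro mult_left_mono) auto
    also have "\<dots> = 783 * 2 ^ 26 * Z" by (simp add: Z_def)
    also have "\<dots> \<le> 2 ^ 36 * Z" using Nr by (intro mult_right_mono) auto
    finally show ?thesis .
  qed
  have t2: "real (K * (4 * height N + 7)) \<le> 30 * Z"
  proof -
    have "real (K * (4 * height N + 7)) = real K * (4 * real (height N) + 7)" by simp
    also have "\<dots> \<le> real N * (30 * y)" using h y2 dims by (intro mult_mono) auto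
    finally show ?thesis using Ny by linarith
  qed
  have "real run_time = real (N * (L * (s * 3 + 5) + 768 * L + 7)) + real (K * (4 * height N + 7)) + 8 * real N + 598 * real k + 14"
    by (simp only: of_nat_add of_nat_mult of_nat_numeral of_nat_1)
  also have "\<dots> \<le> 2 ^ 36 * Z + 30 * Z + 16 * Z + 612 * real k" using t1 t2 Nr k1 by linarith
  also have "\<dots> \<le> 2 ^ 37 * (real k + Z)" using Nr by simp
  finally show "real run_time \<le> 2 ^ 37 * (real k + real N * u ^ 2 * y)" unfolding Z_def .
qed

end

text \<open>\<open>L\<close> is restricted to the values \<open>64 * 8 ^ H\<close>. The least
  suitable one exceeds its unsuitable predecessor by a factor 8, so it is still logarithmic. The
  demand \<open>4 * n\<^sup>2\<close> makes the union bound over the blocks cost at most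
  \<open>1 / (4 * n)\<close>.\<close>

lemma obtain_height:
  fixes n :: nat
  assumes "2 \<le> n"
  obtains H where "4 * (real n)\<^sup>2 \<le> 2 ^ (64 * 8 ^ H)" "real (64 * 8 ^ H) \<le> 128 * ln (real n)"
proof -
  have ex: "4 * (real n)\<^sup>2 \<le> 2 ^ (64 * 8 ^ n)"
  proof -
    have a: "n \<le> 8 ^ n" using less_exp[of n] power_mono[of 2 "8::nat" n] by simp
    have "real n \<le> 2 ^ n" using of_nat_less_two_power[of n] by (simp add: less_imp_le)
    then have "4 * (real n)\<^sup>2 \<le> 2 ^ 2 * (2 ^ n)\<^sup>2" by (intro mult_mono power_mono) auto
    also have "\<dots> = 2 ^ (2 + 2 * n)" by (simp add: power_add power_mult mult.commute flip: power_mult)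
    also have "\<dots> \<le> 2 ^ (64 * 8 ^ n)"
    proof (rule power_increasing)
      show "2 + 2 * n \<le> 64 * 8 ^ n" using a assms by linarith
    qed simp
    finally show ?thesis .
  qed
  define H where "H = (LEAST H. 4 * (real n)\<^sup>2 \<le> 2 ^ (64 * 8 ^ H))"
  have H: "4 * (real n)\<^sup>2 \<le> 2 ^ (64 * 8 ^ H)" unfolding H_def by (rule LeastI[of _ n]) (rule ex)
  have l2: "ln 2 \<le> ln (real n)" using assms by (subst ln_le_cancel_iff) auto
  have "real (64 * 8 ^ H) \<le> 128 * ln (real n)"
  proof (cases H)
    case 0
    then show ?thesis using l2 ln_two_ge_half by simp
  next
    case (Suc h)
    have "\<not> 4 * (real n)\<^sup>2 \<le> 2 ^ (64 * 8 ^ h)" using not_less_Least[of h "\<lambda>H. 4 * (real n)\<^sup>2 \<le> 2 ^ (64 * 8 ^ H)"] Suc unfolding H_def[symmetric] by simp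
    then have "2 ^ (64 * 8 ^ h) \<le> 4 * (real n)\<^sup>2" by simp
    then have "ln ((2::real) ^ (64 * 8 ^ h)) \<le> ln (2 ^ 2 * (real n)\<^sup>2)" using assms by (subst ln_le_cancel_iff) auto
    also have "\<dots> = ln (2 ^ 2) + ln ((real n)\<^sup>2)" using assms by (subst ln_mult) auto
    also have "ln ((2::real) ^ 2) = 2 * ln 2" by (subst ln_realpow) simp_all
    also have "ln ((real n)\<^sup>2) = 2 * ln (real n)" using assms by (subst ln_realpow) simp_all
    also have "ln ((2::real) ^ (64 * 8 ^ h)) = real (64 * 8 ^ h) * ln 2" by (subst ln_realpow) simp_all
    finally have "real (64 * 8 ^ h) * ln 2 \<le> 4 * ln (real n)" using l2 by linarith
    moreover have "real (64 * 8 ^ h) * (1 / 2) \<le> real (64 * 8 ^ h) * ln 2" using ln_two_ge_half by (intro mult_left_mono) auto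
    ultimately have "real (64 * 8 ^ h) \<le> 8 * ln (real n)" by linarith
    then show ?thesis using l2 ln_two_ge_half by (simp add: Suc)
  qed
  then show ?thesis using that H by blast
qed

lemma recovery_few_blocks:
  fixes n b k :: nat and \<epsilon> :: real
  assumes nb: "n = N * b" "k = K * b" "0 < b" "0 < K" "K < N" and \<epsilon>: "0 < \<epsilon>" "\<epsilon> < 1"
  shows "\<exists>(m :: nat) (D :: real mat pmf).
        real m \<le> 2 ^ 60 * (1 / \<epsilon> ^ 2 * real k + real k / (\<epsilon> ^ 5 * real b) * ln (real n)) \<and>
        (\<forall>A \<in> set_pmf D. A \<in> carrier_mat m n \<and> binary_mat A) \<and>
        (\<forall>x \<in> carrier_vec n.
          (\<forall>A \<in> set_pmf D. \<exists>t x'.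
             recovers recovery_program ((real n + real k + 1 / \<epsilon>) ^ 40) n k b \<epsilon> A (A *\<^sub>v x) t x' \<and>
             real t \<le> 2 ^ 37 * (real k + real n / (\<epsilon> ^ 2 * real b) * ln (real n))) \<and>
          measure_pmf.prob D
            {A. \<exists>t x'.
               recovers recovery_program ((real n + real k + 1 / \<epsilon>) ^ 40) n k b \<epsilon> A (A *\<^sub>v x) t x' \<and>
               block_sparse n k b x' \<and>
               l2norm (x' - x) \<le> (1 + \<epsilon>) * block_err n k b x}
            \<ge> 1 - 1 / real k powr (1 / 8))"
proof -
  define u where "u = 1 / \<epsilon>"
  have u: "1 \<le> u" "0 < u" "\<epsilon> * u = 1" unfolding u_def using \<epsilon> by auto
  have "1 \<le> k" "1 \<le> K" using nb by simp_all
  then have k1: "1 \<le> real k" "1 \<le> real K" by linarith+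
  have Nn: "N \<le> n" "k < n" using nb by simp_all
  have n2: "2 \<le> n" using nb Nn by linarith
  obtain H where H: "4 * (real n)\<^sup>2 \<le> 2 ^ (64 * 8 ^ H)" "real (64 * 8 ^ H) \<le> 128 * ln (real n)"
    by (rule obtain_height[OF n2])
  define L :: nat where "L = 64 * 8 ^ H"
  \<comment> \<open>The real values satisfy the premises of \<open>prob_recovery\<close> exactly;
    being at least 1, they at most double when rounded up.\<close>
  define s where "s = nat \<lceil>2 ^ 18 * u ^ 2\<rceil>"
  define B1 where "B1 = nat \<lceil>2 ^ 14 * (real K * u)\<rceil>"
  define B where "B = nat \<lceil>2 ^ 48 * (real k * u ^ 2)\<rceil>"
  have u2: "1 \<le> u ^ 2" using u by (intro one_le_power)
  have Ku: "1 \<le> real K * u" "1 \<le> real k * u ^ 2" using mult_mono[of 1 "real K" 1 u] mult_mono[of 1 "real k" 1 "u ^ 2"] k1 u u2 by simp_all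
  have sb: "2 ^ 18 * u ^ 2 \<le> real s" "real s \<le> 2 ^ 19 * u ^ 2"
    unfolding s_def using nat_ceiling_bounds[of "2 ^ 18 * u ^ 2"] u2 by simp_all
  have B1b: "2 ^ 14 * (real K * u) \<le> real B1" "real B1 \<le> 2 ^ 15 * (real K * u)"
    unfolding B1_def using nat_ceiling_bounds[of "2 ^ 14 * (real K * u)"] Ku by simp_all
  have Bb: "2 ^ 48 * (real k * u ^ 2) \<le> real B" "real B \<le> 2 ^ 49 * (real k * u ^ 2)"
    unfolding B_def using nat_ceiling_bounds[of "2 ^ 48 * (real k * u ^ 2)"] Ku by simp_all
  have "0 < real s" by (rule less_le_trans[OF _ sb(1)], intro mult_pos_pos zero_less_power) (use u in auto)
  moreover have "0 < real B1" by (rule less_le_trans[OF _ B1b(1)], intro mult_pos_pos zero_less_power) (use k1 u in auto)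
  moreover have "0 < real B" by (rule less_le_trans[OF _ Bb(1)], intro mult_pos_pos zero_less_power) (use k1 u in auto)
  ultimately have pos: "0 < s" "0 < B1" "0 < B" by (simp_all only: of_nat_0_less_iff)
  interpret sketch_params n k b N K s L H B1 B by unfold_locales (use nb pos L_def in auto)
  let ?z = "real n + real k + 1 / \<epsilon>"
  let ?D = "map_pmf (\<lambda>z. mat_of (fst z) (snd z)) hash_pmf"
  note sz = size_bounds[OF u(1) refl _ sb(2) B1b(2) Bb(2), folded L_def]
  have Lb: "real L \<le> 128 * ln (real n)" using H(2) by (simp only: L_def)
  have e5: "real k / (\<epsilon> ^ 5 * real b) = real K * u ^ 5" "real n / (\<epsilon> ^ 2 * real b) = real N * u ^ 2"
    "1 / \<epsilon> ^ 2 = u ^ 2" unfolding u_def nb(1,2) using nb(3) \<epsilon> by (simp_all add: field_simps)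
  have ek: "\<epsilon>\<^sup>2 * u\<^sup>2 = 1" using u(3) by (simp flip: power_mult_distrib)
  have W: "16 * real (M + n * k + n + k + L + s) \<le> ?z ^ 40" by (rule sz(2)[OF Lb]) (simp add: u_def)
  have time: "real run_time \<le> 2 ^ 37 * (real k + real n / (\<epsilon> ^ 2 * real b) * ln (real n))"
    unfolding e5 by (rule sz(3)[OF Lb])
  \<comment> \<open>The eighth root demanded by \<open>prob_set_query\<close>; it is the origin of
    the exponent \<open>1 / 8\<close>. Query and median failures contribute
    \<open>1 / (4 * \<kappa>)\<close> each.\<close>
  define \<kappa> where "\<kappa> = root 8 (real k)"
  have \<kappa>: "1 \<le> \<kappa>" "\<kappa> ^ 8 = real k" "real k powr (1 / 8) = \<kappa>"
    unfolding \<kappa>_def using k1 root_powr_inverse[of 8 "real k"] real_root_pow_pos2[of 8 "real k"] real_root_ge_1_iff[of 8 "real k"] by simp_all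
  have \<kappa>n: "\<kappa> \<le> real n" using self_le_power[OF \<kappa>(1), of 8] \<kappa>(2) Nn by simp
  show ?thesis
  proof (rule exI[of _ rows], rule exI[of _ ?D], intro conjI ballI)
    show "real rows \<le> 2 ^ 60 * (1 / \<epsilon> ^ 2 * real k + real k / (\<epsilon> ^ 5 * real b) * ln (real n))"
      unfolding e5 by (rule sz(1)[OF Lb])
    show "A \<in> carrier_mat rows n" "binary_mat A" if "A \<in> set_pmf ?D" for A
      using that carrier_mat_of binary_mat_of by auto
    fix x :: "real vec" assume x: "x \<in> carrier_vec n"
    have rc: "\<exists>t x'. recovers recovery_program (?z ^ 40) n k b \<epsilon> (mat_of (fst z) (snd z)) (mat_of (fst z) (snd z) *\<^sub>v x) t x' \<and> t \<le> run_time \<and>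
       (\<forall>R. recovery_good (\<lambda>j. x $ j) \<epsilon> R z \<longrightarrow> 0 \<le> R \<longrightarrow> R \<le> (block_err n k b x)\<^sup>2 \<longrightarrow>
       block_sparse n k b x' \<and> l2norm (x' - x) \<le> (1 + \<epsilon>) * block_err n k b x)" if z: "z \<in> set_pmf hash_pmf" for z
    proof -
      have rng: "in_range (fst z) (snd z)" using in_range_hash_pmf[of "fst z" "snd z"] z by simp
      obtain t x' where "recovers recovery_program (?z ^ 40) n k b \<epsilon> (mat_of (fst z) (snd z)) (mat_of (fst z) (snd z) *\<^sub>v x) t x'" "t \<le> run_time"
        "\<And>R. recovery_good (\<lambda>j. x $ j) \<epsilon> R (fst z, snd z) \<Longrightarrow> 0 \<le> R \<Longrightarrow> R \<le> (block_err n k b x)\<^sup>2 \<Longrightarrow>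
         block_sparse n k b x' \<and> l2norm (x' - x) \<le> (1 + \<epsilon>) * block_err n k b x"
        by (rule recovers_mat_of[OF rng x W \<epsilon>]) blast
      then show ?thesis unfolding prod.collapse by blast
    qed
    show "\<exists>t x'. recovers recovery_program (?z ^ 40) n k b \<epsilon> A (A *\<^sub>v x) t x' \<and>
             real t \<le> 2 ^ 37 * (real k + real n / (\<epsilon> ^ 2 * real b) * ln (real n))" if A: "A \<in> set_pmf ?D" for A
    proof -
      obtain z where z: "z \<in> set_pmf hash_pmf" "A = mat_of (fst z) (snd z)" using A by auto
      obtain t x' where t: "recovers recovery_program (?z ^ 40) n k b \<epsilon> A (A *\<^sub>v x) t x'" "t \<le> run_time"
        using rc[OF z(1)] unfolding z(2) by blast
      have "real t \<le> real run_time" using t(2) by (simp only: of_nat_le_iff)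
      from order_trans[OF this time] have "real t \<le> 2 ^ 37 * (real k + real n / (\<epsilon> ^ 2 * real b) * ln (real n))" .
      then show ?thesis using t(1) by blast
    qed
    obtain Q where Q: "Q \<subseteq> {..<N}" "card Q \<le> K" "(\<Sum>i\<in>{..<N} - Q. energy (\<lambda>j. x $ j) b i) \<le> (block_err n k b x)\<^sup>2"
      by (rule best_blocks[OF x])
    let ?R = "\<Sum>i\<in>{..<N} - Q. energy (\<lambda>j. x $ j) b i"
    have R0: "0 \<le> ?R" by (intro sum_nonneg energy_nonneg)
    let ?ok = "\<lambda>A. \<exists>t x'. recovers recovery_program (?z ^ 40) n k b \<epsilon> A (A *\<^sub>v x) t x' \<and>
               block_sparse n k b x' \<and> l2norm (x' - x) \<le> (1 + \<epsilon>) * block_err n k b x"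
    let ?f = "\<lambda>z. mat_of (fst z) (snd z)"
    have "measure_pmf.prob hash_pmf {z. \<not> ?ok (?f z)} \<le> measure_pmf.prob hash_pmf {z. \<not> recovery_good (\<lambda>j. x $ j) \<epsilon> ?R z}"
    proof (rule prob_mono)
      fix z assume z: "z \<in> set_pmf hash_pmf" and no: "\<not> ?ok (?f z)"
      show "\<not> recovery_good (\<lambda>j. x $ j) \<epsilon> ?R z"
      proof
        assume "recovery_good (\<lambda>j. x $ j) \<epsilon> ?R z"
        then have "?ok (?f z)" using rc[OF z] R0 Q(3) by blast
        then show False using no by simp
      qed
    qed
    also have "\<dots> \<le> real N / 2 ^ L + 1 / (4 * \<kappa>)"
    proof (rule prob_recovery[OF \<epsilon> Q(1,2) refl _ _ _ \<kappa>(1,2)])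
      have "\<epsilon>\<^sup>2 * (2 ^ 18 * u\<^sup>2) \<le> \<epsilon>\<^sup>2 * real s" using sb(1) by (intro mult_left_mono) auto
      then show "2 ^ 18 \<le> \<epsilon>\<^sup>2 * real s" using ek by (simp only: mult.left_commute[of "\<epsilon>\<^sup>2"])
      have le1: "\<epsilon> * (2 ^ 14 * (real K * u)) \<le> \<epsilon> * real B1" using B1b(1) \<epsilon> by (intro mult_left_mono) auto
      have eq1: "\<epsilon> * (2 ^ 14 * (real K * u)) = 2 ^ 14 * (real K * (\<epsilon> * u))" by (simp only: mult_ac)
      show "2 ^ 14 * real K \<le> \<epsilon> * real B1" using le1 unfolding eq1 u(3) mult_1_right .
      have le2: "\<epsilon>\<^sup>2 * (2 ^ 48 * (real k * u\<^sup>2)) \<le> \<epsilon>\<^sup>2 * real B" using Bb(1) by (intro mult_left_mono) auto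
      have eq2: "\<epsilon>\<^sup>2 * (2 ^ 48 * (real k * u\<^sup>2)) = 2 ^ 48 * (real k * (\<epsilon>\<^sup>2 * u\<^sup>2))" by (simp only: mult_ac)
      show "2 ^ 48 * real k \<le> \<epsilon>\<^sup>2 * real B" using le2 unfolding eq2 ek mult_1_right .
    qed
    also have "real N / 2 ^ L \<le> 1 / (4 * \<kappa>)"
    proof -
      have n0: "0 < real n" using n2 by simp
      have "real N / 2 ^ L \<le> real n / (4 * (real n)\<^sup>2)" using Nn H(1) n0 by (intro frac_le) (auto simp: L_def)
      also have "\<dots> = 1 / (4 * real n)" using n0 by (simp add: power2_eq_square)
      also have "\<dots> \<le> 1 / (4 * \<kappa>)" using \<kappa>n \<kappa>(1) by (intro divide_left_mono) auto
      finally show ?thesis .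
    qed
    finally have "measure_pmf.prob hash_pmf {z. \<not> ?ok (?f z)} \<le> 1 / (4 * \<kappa>) + 1 / (4 * \<kappa>)" by simp
    also have "\<dots> \<le> 1 / \<kappa>" using \<kappa>(1) by (simp add: field_simps)
    finally have fail: "measure_pmf.prob hash_pmf {z. \<not> ?ok (?f z)} \<le> 1 / \<kappa>" .
    have "measure_pmf.prob ?D {A. ?ok A} = measure_pmf.prob hash_pmf {z. ?ok (?f z)}"
      by (simp only: measure_map_pmf vimage_def mem_Collect_eq)
    also have "\<dots> = 1 - measure_pmf.prob hash_pmf {z. \<not> ?ok (?f z)}"
      using measure_pmf.prob_neg[of hash_pmf "\<lambda>z. ?ok (?f z)"] by simp
    finally show "1 - 1 / real k powr (1 / 8) \<le> measure_pmf.prob ?D {A. ?ok A}" unfolding \<kappa>(3) using fail by linarith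
  qed
qed

text \<open>For \<open>n \<le> k\<close> every vector is block sparse and equals its best
  approximation. The identity is a binary matrix, and copying the measurements takes time linear in
  \<open>n\<close>, hence in \<open>k\<close>.\<close>

lemma recovery_all_blocks:
  fixes n b k :: nat and \<epsilon> :: real
  assumes n: "0 < n" "n \<le> k" and b: "0 < b" "b dvd n" and \<epsilon>: "0 < \<epsilon>" "\<epsilon> < 1" and x: "x \<in> carrier_vec n"
  shows "\<exists>t x'. recovers recovery_program ((real n + real k + 1 / \<epsilon>) ^ 40) n k b \<epsilon> (1\<^sub>m n) (1\<^sub>m n *\<^sub>v x) t x' \<and>
     real t \<le> 6 * real k \<and> block_sparse n k b x' \<and> l2norm (x' - x) \<le> (1 + \<epsilon>) * block_err n k b x"
proof -
  let ?W = "(real n + real k + 1 / \<epsilon>) ^ 40"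
  let ?I = "\<lparr>in_n = n, in_k = k, in_b = b, in_eps = \<epsilon>, in_mat = 1\<^sub>m n, in_meas = 1\<^sub>m n *\<^sub>v x\<rparr>"
  have mx: "1\<^sub>m n *\<^sub>v x = x" "dim_vec x = n" using x by simp_all
  have "1 \<le> 1 / \<epsilon>" using \<epsilon> by simp
  then have z: "real n \<le> real n + real k + 1 / \<epsilon>" "1 \<le> real n + real k + 1 / \<epsilon>" by linarith+
  have "real n \<le> ?W" using z(1) self_le_power[OF z(2), of 40] by simp
  then have Wn: "int n \<le> \<lfloor>?W\<rfloor>" by (simp add: le_floor_iff)
  let ?Inv = "\<lambda>i s. \<forall>j<i. outp s (int j) = x $ j"
  have loop: "runs ?I \<lfloor>?W\<rfloor> (For 0 ParN (Output (Var 0) (Meas (Var 0)))) init_state (n * 3 + 2) (?Inv n)"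
  proof (rule runs_For[where Inv = ?Inv and n = n and T = 1])
    fix i and s :: state assume i: "i < n" "?Inv i s" "imem s 0 0 = int i"
    show "runs ?I \<lfloor>?W\<rfloor> (Output (Var 0) (Meas (Var 0))) s 1 (\<lambda>s'. imem s' 0 0 = int i \<and> ?Inv (Suc i) (setv 0 (int (Suc i)) s'))"
      by (rule runs_Output) (use i Wn mx in \<open>auto simp: less_Suc_eq\<close>)
  qed (use Wn in auto)
  have "runs ?I \<lfloor>?W\<rfloor> recovery_program init_state (n * 3 + 3) (?Inv n)"
    unfolding recovery_program_def
  proof (rule runs_Cond, goal_cases)
    case 3
    show ?case by (rule runs_mono[OF loop]) simp_all
  qed (use n in auto)
  then obtain t s where ts: "exec ?I (real_of_int \<lfloor>?W\<rfloor>) recovery_program init_state t s" "t \<le> n * 3 + 3" "?Inv n s"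
    unfolding runs_def by blast
  have x': "vec n (\<lambda>j. outp s (int j)) = x" using ts(3) mx(2) by (intro eq_vecI) auto
  have rec: "recovers recovery_program ?W n k b \<epsilon> (1\<^sub>m n) (1\<^sub>m n *\<^sub>v x) t x"
    unfolding recovers_def using exec_word_mono[OF ts(1) of_int_floor_le] x' by metis
  have sp: "block_sparse n k b x"
    unfolding block_sparse_def
  proof (intro conjI exI[of _ "{..<n div b}"])
    show "card {..<n div b} \<le> k div b" using n by (simp add: div_le_mono)
    show "{j. j < n \<and> x $ j \<noteq> 0} \<subseteq> (\<Union>i\<in>{..<n div b}. block b i)"
      using b by (auto simp: block_iff div_less_iff_less_mult)
  qed (use x in auto)
  have "l2norm (x - x) = 0" unfolding l2norm_def L2_set_def by simp
  then have "l2norm (x - x) \<le> (1 + \<epsilon>) * block_err n k b x" using block_err_nonneg[OF x] \<epsilon> by simp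
  moreover have "real t \<le> 6 * real k" using ts(2) n by simp
  ultimately show ?thesis using rec sp by blast
qed

theorem theorem4p6:
  shows "\<exists>(P :: com) (q :: nat) (C\<^sub>1 :: real) (C\<^sub>2 :: real) (c :: real).
    C\<^sub>1 > 0 \<and> C\<^sub>2 > 0 \<and> c > 0 \<and>
    (\<forall>(n :: nat) (b :: nat) (k :: nat) (\<epsilon> :: real).
      n > 0 \<and> b > 0 \<and> k > 0 \<and> b dvd n \<and> b dvd k \<and> 0 < \<epsilon> \<and> \<epsilon> < 1 \<longrightarrow>
      (\<exists>(m :: nat) (D :: real mat pmf).
        real m \<le> C\<^sub>1 * (1 / \<epsilon> ^ 2 * real k + real k / (\<epsilon> ^ 5 * real b) * ln (real n)) \<and>
        (\<forall>A \<in> set_pmf D. A \<in> carrier_mat m n \<and> binary_mat A) \<and>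
        (\<forall>x \<in> carrier_vec n.
          (\<forall>A \<in> set_pmf D. \<exists>t x'.
             recovers P ((real n + real k + 1 / \<epsilon>) ^ q) n k b \<epsilon> A (A *\<^sub>v x) t x' \<and>
             real t \<le> C\<^sub>2 * (real k + real n / (\<epsilon> ^ 2 * real b) * ln (real n))) \<and>
          measure_pmf.prob D
            {A. \<exists>t x'.
               recovers P ((real n + real k + 1 / \<epsilon>) ^ q) n k b \<epsilon> A (A *\<^sub>v x) t x' \<and>
               block_sparse n k b x' \<and>
               l2norm (x' - x) \<le> (1 + \<epsilon>) * block_err n k b x}
            \<ge> 1 - 1 / real k powr c)))"
proof (rule exI[of _ recovery_program], rule exI[of _ 40], rule exI[of _ "2 ^ 60"], rule exI[of _ "2 ^ 37"], rule exI[of _ "1 / 8"],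
    intro conjI allI impI, simp, simp, simp)
  \<comment> \<open>The exponent 40 and the constants \<open>2 ^ 60\<close> and
    \<open>2 ^ 37\<close> are those of \<open>size_bounds\<close>; they also cover the case of the
    identity matrix.\<close>
  fix n b k :: nat and \<epsilon> :: real
  assume a: "n > 0 \<and> b > 0 \<and> k > 0 \<and> b dvd n \<and> b dvd k \<and> 0 < \<epsilon> \<and> \<epsilon> < 1"
  then have "b dvd n" "b dvd k" by simp_all
  then obtain N K where "n = b * N" "k = b * K" by (elim dvdE)
  then have NK: "n = N * b" "k = K * b" by (simp_all only: mult.commute)
  show "\<exists>(m :: nat) (D :: real mat pmf).
        real m \<le> 2 ^ 60 * (1 / \<epsilon> ^ 2 * real k + real k / (\<epsilon> ^ 5 * real b) * ln (real n)) \<and>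
        (\<forall>A \<in> set_pmf D. A \<in> carrier_mat m n \<and> binary_mat A) \<and>
        (\<forall>x \<in> carrier_vec n.
          (\<forall>A \<in> set_pmf D. \<exists>t x'.
             recovers recovery_program ((real n + real k + 1 / \<epsilon>) ^ 40) n k b \<epsilon> A (A *\<^sub>v x) t x' \<and>
             real t \<le> 2 ^ 37 * (real k + real n / (\<epsilon> ^ 2 * real b) * ln (real n))) \<and>
          measure_pmf.prob D
            {A. \<exists>t x'.
               recovers recovery_program ((real n + real k + 1 / \<epsilon>) ^ 40) n k b \<epsilon> A (A *\<^sub>v x) t x' \<and>
               block_sparse n k b x' \<and>
               l2norm (x' - x) \<le> (1 + \<epsilon>) * block_err n k b x}
            \<ge> 1 - 1 / real k powr (1 / 8))"
  proof (cases "K < N")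
    case True
    show ?thesis by (rule recovery_few_blocks[OF NK]) (use a NK True in auto)
  next
    case False
    then have nk: "n \<le> k" using NK by simp
    have ln0: "0 \<le> ln (real n)" using a by simp
    have k0: "0 \<le> real k" "0 < \<epsilon>" using a by auto
    show ?thesis
    proof (rule exI[of _ n], rule exI[of _ "return_pmf (1\<^sub>m n)"], intro conjI ballI)
      have "1 \<le> 1 / \<epsilon> ^ 2" using a by (simp add: power_le_one)
      then have l1: "1 * real n \<le> 1 / \<epsilon> ^ 2 * real k" using nk by (intro mult_mono) auto
      have l2: "0 \<le> real k / (\<epsilon> ^ 5 * real b) * ln (real n)" using ln0 k0 by (intro mult_nonneg_nonneg divide_nonneg_nonneg) auto
      show "real n \<le> 2 ^ 60 * (1 / \<epsilon> ^ 2 * real k + real k / (\<epsilon> ^ 5 * real b) * ln (real n))"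
      proof (rule le_scaled[where a = 1])
        show "real n \<le> 1 * (1 / \<epsilon> ^ 2 * real k)" using l1 unfolding mult_1_left .
        show "0 \<le> 1 / \<epsilon> ^ 2 * real k" by simp
      qed (use l2 in simp_all)
      show "A \<in> carrier_mat n n" "binary_mat A" if "A \<in> set_pmf (return_pmf (1\<^sub>m n))" for A :: "real mat"
        using that unfolding binary_mat_def elements_mat_def by auto
      fix x :: "real vec" assume x: "x \<in> carrier_vec n"
      have "\<exists>t x'. recovers recovery_program ((real n + real k + 1 / \<epsilon>) ^ 40) n k b \<epsilon> (1\<^sub>m n) (1\<^sub>m n *\<^sub>v x) t x' \<and>
         real t \<le> 6 * real k \<and> block_sparse n k b x' \<and> l2norm (x' - x) \<le> (1 + \<epsilon>) * block_err n k b x"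
        by (rule recovery_all_blocks) (use a nk x in auto)
      then obtain t x' where tx: "recovers recovery_program ((real n + real k + 1 / \<epsilon>) ^ 40) n k b \<epsilon> (1\<^sub>m n) (1\<^sub>m n *\<^sub>v x) t x'"
         "real t \<le> 6 * real k" "block_sparse n k b x'" "l2norm (x' - x) \<le> (1 + \<epsilon>) * block_err n k b x"
        by (elim exE conjE) (rule that)
      have l3: "0 \<le> real n / (\<epsilon> ^ 2 * real b) * ln (real n)" using ln0 k0 by (intro mult_nonneg_nonneg divide_nonneg_nonneg) auto
      have "real t \<le> 2 ^ 37 * (real k + real n / (\<epsilon> ^ 2 * real b) * ln (real n))"
        by (rule le_scaled[OF tx(2) _ k0(1) l3]) simp_all
      then show "\<exists>t x'. recovers recovery_program ((real n + real k + 1 / \<epsilon>) ^ 40) n k b \<epsilon> A (A *\<^sub>v x) t x' \<and>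
             real t \<le> 2 ^ 37 * (real k + real n / (\<epsilon> ^ 2 * real b) * ln (real n))" if "A \<in> set_pmf (return_pmf (1\<^sub>m n))" for A
        using that tx(1) by auto
      let ?ok = "{A. \<exists>t x'. recovers recovery_program ((real n + real k + 1 / \<epsilon>) ^ 40) n k b \<epsilon> A (A *\<^sub>v x) t x' \<and>
               block_sparse n k b x' \<and> l2norm (x' - x) \<le> (1 + \<epsilon>) * block_err n k b x}"
      have "1\<^sub>m n \<in> ?ok" using tx by blast
      then have "measure_pmf.prob (return_pmf (1\<^sub>m n)) ?ok = 1" by (simp only: measure_return_pmf indicator_simps)
      then show "1 - 1 / real k powr (1 / 8) \<le> measure_pmf.prob (return_pmf (1\<^sub>m n)) ?ok" by simp
    qed
  qed
qed

end
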